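(* Let $A=kQ_A/I_A$ be a finite dimensional monomial algebra and let $B=kQ_B/I_B$ be the algebra obtained from $A$ by gluing a source arrow $\alpha:e_1\to e_2$ and a sink arrow $\beta:e_{n-1}\to e_n$ from the same block. Let $v$ be a walk in $Q_A$ starting at $e_2$ and ending at $e_{n-1}$ which does not contain $\alpha$ or $\beta$, let $v^*$ be the corresponding walk in $Q_B$ and let $g^*\in\mathrm{Hom}(\pi_1(Q_B,I_B,f_2),k^+)$ be the dual of $\gamma^*v^*$. Then the following diagram is commutative: $$\begin{array}{ccccc}\mathrm{Hom}(\pi_1(Q_B,I_B,f_2),k^+)&\xrightarrow{\ \pi_1\ }&\mathrm{Hom}(\pi_1(Q_B,I_B,f_2),k^+)/\langle g^*\rangle&\xrightarrow{\ \sigma\ }&\mathrm{Hom}(\pi_1(Q_A,I_A,e_2),k^+)\\ {\scriptstyle\theta_B}\downarrow&&{\scriptstyle\tilde\theta_B}\downarrow&&\downarrow{\scriptstyle\theta_A}\\ \mathrm{HH}^1(B)&\xrightarrow{\ \pi_2\ }&\mathrm{HH}^1(B)/\langle\gamma^*\|\gamma^*\rangle&\xrightarrow{\ \psi\ }&\mathrm{HH}^1(A)\end{array}$$ where $\sigma$ and $\psi$ are isomorphisms and the horizontal maps $\pi_1$ and $\pi_2$ are the canonical projections.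
   Context: Let $k$ be a field, $k^+$ its additive group. Paths and walks are composed from right to left: $p=a_r\cdots a_1$ has $s(p)=s(a_1)$, $t(p)=t(a_r)$; vertices are identified with trivial paths and with the corresponding idempotents. A finite dimensional monomial algebra is a finite dimensional algebra $A=kQ_A/I_A$, where $Q_A$ is a finite quiver (vertex set $(Q_A)_0$, arrow set $(Q_A)_1$) and $I_A$ is an admissible ideal generated by a set $Z_A$ of paths of length $\ge 2$ which is minimal (no proper subpath of an element of $Z_A$ lies in $Z_A$). $\mathcal{B}_A$ is the set of paths of $Q_A$ (including trivial ones) containing no element of $Z_A$ as a subpath; it gives a $k$-basis of $A$. Blocks of $A$ correspond to connected components of $Q_A$. Gluing two arrows. $Q_A$ has vertices $e_1,\dots,e_n$ ($n\ge 4$) and arrows $\alpha,\beta,\gamma_1,\dots,\gamma_m$ ($m\ge 0$) with $\alpha:e_1\to e_2$, $\beta:e_{n-1}\to e_n$, and $e_1,e_2,e_{n-1},e_n$ pairwise different. The algebra $B$ obtained by gluing $\alpha$ and $\beta$ is the subalgebra of $A$ generated by $f_1:=e_1+e_{n-1}$, $f_2:=e_2+e_n$, $f_i:=e_i$ ($3\le i\le n-2$), $\gamma^*:=\alpha+\beta$, $\gamma_j^*:=\gamma_j$ ($1\le j\le m$). Then $B\simeq kQ_B/I_B$, where $Q_B$ is obtained from $Q_A$ by identifying $\alpha$ with $\beta$ (so $e_1$ with $e_{n-1}$ and $e_2$ with $e_n$). Write $a\mapsto a^*$ for the induced map on arrows ($\alpha^*=\beta^*=\gamma^*$), $e_i^*=f_i$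 for $3\le i\le n-2$, $e_1^*=e_{n-1}^*=f_1$, $e_2^*=e_n^*=f_2$, and $p\mapsto p^*$ for the induced map on paths and walks. $I_B$ is the ideal generated by the images of the paths in $Z_A$ together with $Z_{new}=\{\lambda^*\eta^*,\xi^*\mu^*,\xi^*\gamma^*\eta^*\mid t(\eta)=e_1,t(\mu)=e_2\,(\mu\ne\alpha),s(\lambda)=e_{n-1}\,(\lambda\neq\beta),s(\xi)=e_n\}\cup\{\lambda^*\eta^*,\xi^*\mu^*,\xi^*\gamma^*\eta^*\mid t(\eta)=e_{n-1},t(\mu)=e_n\,(\mu\neq\beta),s(\lambda)=e_1\,(\lambda\neq\alpha),s(\xi)=e_2\}$ ($\eta,\mu,\lambda,\xi\in(Q_A)_1$). Thus $B$ is monomial; $Z_B$, $\mathcal{B}_B$ are defined as for $A$. Source/sink arrows. $\alpha$ is a source arrow if $s(\alpha)$ is a source vertex and, except $\alpha$, no arrow starts at $s(\alpha)$ and no arrow ends at $t(\alpha)$. $\beta$ is a sink arrow if $t(\beta)$ is a sink vertex and, except $\beta$, no arrow starts at $s(\beta)$ and no arrow ends at $t(\beta)$. Hochschild cohomology. For sets $X,Y$ of paths, $k(X\|Y)$ is the vector space with basis the pairs $\epsilon\|\gamma$ of parallel paths (same start, same end), $\epsilon\in X,\gamma\in Y$. For a monomial algebra with data $(Q,Z,\mathcal{B})$ consider $k(Q_0\|\mathcal{B})\xrightarrow{\delta^0}k(Q_1\|\mathcal{B})\xrightarrow{\delta^1}k(Z\|\mathcal{B})$, where $\delta^0(e\|\gamma)=\sum_{s(a)=e,\,a\gamma\in\mathcal{B}}a\|a\gamma-\sum_{t(a)=e,\,\gamma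 a\in\mathcal{B}}a\|\gamma a$ and $\delta^1(a\|\gamma)=\sum_{r\in Z}r\|r^{a\|\gamma}$, with $r^{a\|\gamma}$ the sum of all paths in $\mathcal{B}$ obtained by replacing one appearance of $a$ in $r$ by $\gamma$ (one summand for each appearance). Then $\mathrm{HH}^1=\mathrm{Ker}(\delta^1)/\mathrm{Im}(\delta^0)$, with Lie bracket induced by $[a\|\gamma,b\|\epsilon]=b\|\epsilon^{a\|\gamma}-a\|\gamma^{b\|\epsilon}$. The element $a\|\gamma$ corresponds to the derivation sending $a$ to $\gamma$ and all other arrows and all vertices to $0$. The class of $\gamma^*\|\gamma^*$ in $\mathrm{HH}^1(B)$ is again denoted $\gamma^*\|\gamma^*$. Fundamental groups. A walk is a composable sequence of arrows and formal inverses of arrows. Since $I_A$ and $I_B$ are monomial, $\pi_1(Q,I,x)$ is the group of closed walks at $x$ modulo cancellation of subwalks $aa^{-1}$, $a^{-1}a$; it is free. The maps. Choose a minimal generating set $\{v_1,\dots,v_t\}$ of $\pi_1(Q_A,I_A,e_2)$; its elements are represented by closed walks not containing $\alpha^{\pm1}$ or $\beta^{\pm1}$. Then $\{v_1^*,\dots,v_t^*,\gamma^*v^*\}$ is a minimal generating set of $\pi_1(Q_B,I_B,f_2)$. Let $\{g_1,\dots,g_t\}$ and $\{g_1^*,\dots,g_t^*,g^*\}$ be the corresponding dual bases of $\mathrm{Hom}(\pi_1(Q_A,I_A,e_2),k^+)$ and $\mathrm{Hom}(\pi_1(Q_B,I_B,f_2),k^+)$; in particular $g^*(\gamma^*v^*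 )=1$ and $g^*(v_i^* )=0$. The map $\sigma$ sends the class of $g_i^*$ to $g_i$. Parade data: $w_1^*=v^*$, $w_2^*=f_2$ (trivial walk), and for each $3\le i\le n-2$, $w_i^*$ is a walk in $Q_B$ from $f_2$ to $f_i$ not containing $\gamma^*$ or $(\gamma^* )^{-1}$; in $Q_A$: $w_1=\alpha^{-1}$, $w_2=e_2$, $w_i$ ($3\le i\le n-2$) is the walk in $Q_A$ from $e_2$ to $e_i$ corresponding to $w_i^*$, $w_{n-1}=v$, $w_n=\beta v$. For $h\in\mathrm{Hom}(\pi_1(Q_A,I_A,e_2),k^+)$, $\theta_A(h)$ is the class in $\mathrm{HH}^1(A)$ of the derivation sending each arrow $\delta:e_i\to e_j$ to $h(w_j^{-1}\delta w_i)\,\delta$; similarly, for $h^*\in\mathrm{Hom}(\pi_1(Q_B,I_B,f_2),k^+)$, $\theta_B(h^* )$ is the class of the derivation sending each arrow $\delta^*:f_i\to f_j$ to $h^*((w_j^* )^{-1}\delta^*w_i^* )\,\delta^*$ (arrows outside the connected component of the base point are sent to $0$). The map $\tilde\theta_B$ is induced by $\theta_B$ on the quotients (one has $\theta_B(g^* )=\gamma^*\|\gamma^*$). The map $\psi$ is the inverse of the Lie algebra isomorphism $\mathrm{HH}^1(A)\to\mathrm{HH}^1(B)/\langle\gamma^*\|\gamma^*\rangle$ induced by $a\|p\mapsto a^*\|p^*$. *)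

theory Defs
  imports
    "HOL-Algebra.Algebraic_Closure_Type"
    "HOL-Algebra.QuotRing"
    "HOL-Algebra.Generated_Groups"
    "HOL-Library.Poly_Mapping"
    "Graph_Theory.Arc_Walk"
begin

section \<open>Paths and monomial relations\<close>

text \<open>
  A quiver is a (multi)digraph.  A path is a pair of its starting vertex and the list of its arrows
  in the order in which they are traversed: \<open>a\<^sub>r \<cdots> a\<^sub>1\<close> is \<open>(s(a\<^sub>1), [a\<^sub>1, \<dots>, a\<^sub>r])\<close>, and the
  trivial path at \<open>e\<close> is \<open>(e, [])\<close>.
\<close>

type_synonym ('v, 'a) path = "'v \<times> 'a list"

definition path_target :: "('v, 'a) pre_digraph \<Rightarrow> ('v, 'a) path \<Rightarrow> 'v" where
  "path_target Q p = last (pre_digraph.awalk_verts Q (fst p) (snd p))"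

definition paths :: "('v, 'a) pre_digraph \<Rightarrow> ('v, 'a) path set" where
  "paths Q = {p. \<exists>y. pre_digraph.awalk Q (fst p) (snd p) y}"

text \<open>\<open>path_comp q p\<close> is \<open>q p\<close>, that is, \<open>p\<close> followed by \<open>q\<close>.\<close>

definition path_comp :: "('v, 'a) path \<Rightarrow> ('v, 'a) path \<Rightarrow> ('v, 'a) path" where
  "path_comp q p = (fst p, snd p @ snd q)"

definition arrow_path :: "('v, 'a) pre_digraph \<Rightarrow> 'a \<Rightarrow> ('v, 'a) path" where
  "arrow_path Q a = (tail Q a, [a])"

definition trivial_paths :: "('v, 'a) pre_digraph \<Rightarrow> ('v, 'a) path set" where
  "trivial_paths Q = (\<lambda>x. (x, [])) ` verts Q"

definition arrow_paths :: "('v, 'a) pre_digraph \<Rightarrow> ('v, 'a) path set" where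
  "arrow_paths Q = arrow_path Q ` arcs Q"

definition subpath :: "('v, 'a) pre_digraph \<Rightarrow> ('v, 'a) path \<Rightarrow> ('v, 'a) path \<Rightarrow> bool" where
  "subpath Q q p \<longleftrightarrow>
    (\<exists>us ws. snd p = us @ snd q @ ws \<and> fst q = path_target Q (fst p, us))"

text \<open>The paths lying in the ideal of the path algebra generated by a set \<open>G\<close> of paths.\<close>

definition ideal_paths ::
  "('v, 'a) pre_digraph \<Rightarrow> ('v, 'a) path set \<Rightarrow> ('v, 'a) path set" where
  "ideal_paths Q G = {p \<in> paths Q. \<exists>z\<in>G. subpath Q z p}"

text \<open>The basis \<open>\<B>\<close> of the algebra \<open>kQ/\<langle>G\<rangle>\<close>.\<close>

definition basis_paths ::
  "('v, 'a) pre_digraph \<Rightarrow> ('v, 'a) path set \<Rightarrow> ('v, 'a) path set" where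
  "basis_paths Q G = paths Q - ideal_paths Q G"

text \<open>The minimal set of paths generating the same ideal as \<open>G\<close>.\<close>

definition minimal_relations ::
  "('v, 'a) pre_digraph \<Rightarrow> ('v, 'a) path set \<Rightarrow> ('v, 'a) path set" where
  "minimal_relations Q G =
    {p \<in> ideal_paths Q G. \<forall>q\<in>ideal_paths Q G. subpath Q q p \<longrightarrow> q = p}"

text \<open>
  Presentation data of a finite dimensional monomial algebra \<open>kQ/\<langle>Z\<rangle>\<close>.  Admissibility of the ideal
  amounts to the length bound on \<open>Z\<close> (the ideal lies in the square of the arrow ideal) together with
  the last condition (it contains a power of the arrow ideal).
\<close>

definition monomial_presentation ::
  "('v, 'a) pre_digraph \<Rightarrow> ('v, 'a) path set \<Rightarrow> bool" where
  "monomial_presentation Q Z \<longleftrightarrow>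
    fin_digraph Q \<and> Z \<subseteq> paths Q \<and>
    (\<forall>z\<in>Z. 2 \<le> length (snd z)) \<and>
    (\<forall>z\<in>Z. \<forall>z'\<in>Z. subpath Q z' z \<longrightarrow> z' = z) \<and>
    (\<exists>N. \<forall>p\<in>paths Q. N \<le> length (snd p) \<longrightarrow> p \<in> ideal_paths Q Z)"

definition source_arrow :: "('v, 'a) pre_digraph \<Rightarrow> 'a \<Rightarrow> bool" where
  "source_arrow Q a \<longleftrightarrow>
    a \<in> arcs Q \<and> (\<forall>b\<in>arcs Q. head Q b \<noteq> tail Q a) \<and>
    (\<forall>b\<in>arcs Q. b \<noteq> a \<longrightarrow> tail Q b \<noteq> tail Q a \<and> head Q b \<noteq> head Q a)"

definition sink_arrow :: "('v, 'a) pre_digraph \<Rightarrow> 'a \<Rightarrow> bool" where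
  "sink_arrow Q a \<longleftrightarrow>
    a \<in> arcs Q \<and> (\<forall>b\<in>arcs Q. tail Q b \<noteq> head Q a) \<and>
    (\<forall>b\<in>arcs Q. b \<noteq> a \<longrightarrow> tail Q b \<noteq> tail Q a \<and> head Q b \<noteq> head Q a)"


section \<open>Gluing two arrows\<close>

text \<open>
  The glued quiver identifies the arrow \<open>\<beta>\<close> with \<open>\<alpha>\<close>.  The representatives of the identified objects
  are chosen on the side of \<open>\<alpha>\<close>: in \<open>glue_quiver Q \<alpha> \<beta>\<close> the arrow \<open>\<gamma>\<^sup>*\<close> is \<open>\<alpha>\<close>, the vertex \<open>f\<^sub>1\<close> is
  \<open>tail Q \<alpha>\<close>, the vertex \<open>f\<^sub>2\<close> is \<open>head Q \<alpha>\<close>, and all other arrows and vertices keep their names.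
\<close>

definition glue_vert :: "('v, 'a) pre_digraph \<Rightarrow> 'a \<Rightarrow> 'a \<Rightarrow> 'v \<Rightarrow> 'v" where
  "glue_vert Q \<alpha> \<beta> x =
    (if x = tail Q \<beta> then tail Q \<alpha> else if x = head Q \<beta> then head Q \<alpha> else x)"

definition glue_arrow :: "'a \<Rightarrow> 'a \<Rightarrow> 'a \<Rightarrow> 'a" where
  "glue_arrow \<alpha> \<beta> a = (if a = \<beta> then \<alpha> else a)"

definition glue_quiver :: "('v, 'a) pre_digraph \<Rightarrow> 'a \<Rightarrow> 'a \<Rightarrow> ('v, 'a) pre_digraph" where
  "glue_quiver Q \<alpha> \<beta> =
    \<lparr> verts = glue_vert Q \<alpha> \<beta> ` verts Q,
      arcs = glue_arrow \<alpha> \<beta> ` arcs Q,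
      tail = (\<lambda>a. glue_vert Q \<alpha> \<beta> (tail Q a)),
      head = (\<lambda>a. glue_vert Q \<alpha> \<beta> (head Q a)) \<rparr>"

lemma glue_quiver_endpoints:
  assumes "distinct [tail Q \<alpha>, head Q \<alpha>, tail Q \<beta>, head Q \<beta>]"
  shows "tail (glue_quiver Q \<alpha> \<beta>) (glue_arrow \<alpha> \<beta> a) = glue_vert Q \<alpha> \<beta> (tail Q a)"
    and "head (glue_quiver Q \<alpha> \<beta>) (glue_arrow \<alpha> \<beta> a) = glue_vert Q \<alpha> \<beta> (head Q a)"
  using assms by (auto simp: glue_quiver_def glue_arrow_def glue_vert_def)

lemma fin_digraph_glue_quiver:
  assumes "fin_digraph Q" and "\<alpha> \<in> arcs Q"
    and "distinct [tail Q \<alpha>, head Q \<alpha>, tail Q \<beta>, head Q \<beta>]"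
  shows "fin_digraph (glue_quiver Q \<alpha> \<beta>)"
proof -
  interpret fin_digraph Q by fact
  show ?thesis
    by unfold_locales
      (use assms(2) in \<open>auto simp: glue_quiver_def glue_arrow_def\<close>)
qed

definition glue_path ::
  "('v, 'a) pre_digraph \<Rightarrow> 'a \<Rightarrow> 'a \<Rightarrow> ('v, 'a) path \<Rightarrow> ('v, 'a) path" where
  "glue_path Q \<alpha> \<beta> p = (glue_vert Q \<alpha> \<beta> (fst p), map (glue_arrow \<alpha> \<beta>) (snd p))"

text \<open>
  \<open>cross_relations Q \<alpha> \<beta> c d\<close> are the paths \<open>\<lambda>\<^sup>*\<eta>\<^sup>*\<close>, \<open>\<xi>\<^sup>*\<mu>\<^sup>*\<close>, \<open>\<xi>\<^sup>*\<gamma>\<^sup>*\<eta>\<^sup>*\<close> that enter the glued part along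
  \<open>c\<close> and leave it along \<open>d\<close> (here \<open>l\<close> stands for \<open>\<lambda>\<close>).  The sequences to which \<open>glue_path\<close> is
  applied are not paths of \<open>Q\<close>, but their images are paths of the glued quiver.
\<close>

definition cross_relations ::
  "('v, 'a) pre_digraph \<Rightarrow> 'a \<Rightarrow> 'a \<Rightarrow> 'a \<Rightarrow> 'a \<Rightarrow> ('v, 'a) path set" where
  "cross_relations Q \<alpha> \<beta> c d =
    {glue_path Q \<alpha> \<beta> (tail Q \<eta>, [\<eta>, l]) | \<eta> l.
       \<eta> \<in> arcs Q \<and> l \<in> arcs Q \<and> head Q \<eta> = tail Q c \<and> tail Q l = tail Q d \<and> l \<noteq> d} \<union>
    {glue_path Q \<alpha> \<beta> (tail Q \<mu>, [\<mu>, \<xi>]) | \<mu> \<xi>.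
       \<mu> \<in> arcs Q \<and> \<xi> \<in> arcs Q \<and> head Q \<mu> = head Q c \<and> \<mu> \<noteq> c \<and> tail Q \<xi> = head Q d} \<union>
    {glue_path Q \<alpha> \<beta> (tail Q \<eta>, [\<eta>, \<alpha>, \<xi>]) | \<eta> \<xi>.
       \<eta> \<in> arcs Q \<and> \<xi> \<in> arcs Q \<and> head Q \<eta> = tail Q c \<and> tail Q \<xi> = head Q d}"

definition new_relations ::
  "('v, 'a) pre_digraph \<Rightarrow> 'a \<Rightarrow> 'a \<Rightarrow> ('v, 'a) path set" where
  "new_relations Q \<alpha> \<beta> = cross_relations Q \<alpha> \<beta> \<alpha> \<beta> \<union> cross_relations Q \<alpha> \<beta> \<beta> \<alpha>"

text \<open>
  The minimal set of relations \<open>Z\<^sub>B\<close> of the glued algebra.  The minimalisation is needed: if for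
  instance \<open>\<xi>\<alpha>\<close> is a relation in \<open>Z\<close>, then \<open>\<xi>\<^sup>*\<gamma>\<^sup>*\<eta>\<^sup>*\<close> is redundant.
\<close>

definition glue_relations ::
  "('v, 'a) pre_digraph \<Rightarrow> ('v, 'a) path set \<Rightarrow> 'a \<Rightarrow> 'a \<Rightarrow> ('v, 'a) path set" where
  "glue_relations Q Z \<alpha> \<beta> =
    minimal_relations (glue_quiver Q \<alpha> \<beta>) (glue_path Q \<alpha> \<beta> ` Z \<union> new_relations Q \<alpha> \<beta>)"


section \<open>Linear maps, quotients and Lie brackets\<close>

text \<open>
  Vector spaces are carrier-based modules over the field type \<open>'k\<close>.  A Lie algebra is regarded as a
  nonassociative algebra, so the multiplication of the record is the Lie bracket; the component
  \<open>one\<close> of the record has no meaning here and is set to zero.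
\<close>

definition linear_maps ::
  "('k, 'm) module \<Rightarrow> ('k, 'n) module \<Rightarrow> ('m \<Rightarrow> 'n) set" where
  "linear_maps M N =
    {f \<in> carrier M \<rightarrow> carrier N.
      (\<forall>x\<in>carrier M. \<forall>y\<in>carrier M. f (x \<oplus>\<^bsub>M\<^esub> y) = f x \<oplus>\<^bsub>N\<^esub> f y) \<and>
      (\<forall>c. \<forall>x\<in>carrier M. f (c \<odot>\<^bsub>M\<^esub> x) = c \<odot>\<^bsub>N\<^esub> f x)}"

definition linear_isos ::
  "('k, 'm) module \<Rightarrow> ('k, 'n) module \<Rightarrow> ('m \<Rightarrow> 'n) set" where
  "linear_isos M N = {f \<in> linear_maps M N. bij_betw f (carrier M) (carrier N)}"

definition lie_isos ::
  "('k, 'm) module \<Rightarrow> ('k, 'n) module \<Rightarrow> ('m \<Rightarrow> 'n) set" where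
  "lie_isos M N =
    {f \<in> linear_isos M N. \<forall>x\<in>carrier M. \<forall>y\<in>carrier M. f (x \<otimes>\<^bsub>M\<^esub> y) = f x \<otimes>\<^bsub>N\<^esub> f y}"

definition line :: "('k, 'm) module \<Rightarrow> 'm \<Rightarrow> 'm set" where
  "line M x = {c \<odot>\<^bsub>M\<^esub> x | c. True}"

text \<open>The analogue of \<^const>\<open>FactRing\<close>; the canonical projection is \<open>\<lambda>x. N +>\<^bsub>M\<^esub> x\<close>.\<close>

definition quotient_module :: "('k, 'm) module \<Rightarrow> 'm set \<Rightarrow> ('k, 'm set) module" where
  "quotient_module M N =
    \<lparr> carrier = a_rcosets\<^bsub>M\<^esub> N, monoid.mult = rcoset_mult M N, one = N, zero = N, add = set_add M,
      module.smult = (\<lambda>c A. \<Union>x\<in>A. N +>\<^bsub>M\<^esub> (c \<odot>\<^bsub>M\<^esub> x)) \<rparr>"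


section \<open>Hochschild cohomology in degree one\<close>

text \<open>
  \<open>k(S \<parallel> T)\<close> consists of the finitely supported functions on pairs of parallel paths; the basis
  element \<open>\<epsilon> \<parallel> \<gamma>\<close> is \<open>basis_pair \<epsilon> \<gamma>\<close>.
\<close>

type_synonym ('k, 'v, 'a) cochain = "(('v, 'a) path \<times> ('v, 'a) path) \<Rightarrow>\<^sub>0 'k"

definition basis_pair :: "('v, 'a) path \<Rightarrow> ('v, 'a) path \<Rightarrow> ('k::field, 'v, 'a) cochain" where
  "basis_pair p q = Poly_Mapping.single (p, q) 1"

definition parallel_span ::
  "('v, 'a) pre_digraph \<Rightarrow> ('v, 'a) path set \<Rightarrow> ('v, 'a) path set
    \<Rightarrow> ('k::field, 'v, 'a) cochain set" where
  "parallel_span Q S T =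
    {x. Poly_Mapping.keys x \<subseteq>
      {(p, q). p \<in> S \<and> q \<in> T \<and> fst p = fst q \<and> path_target Q p = path_target Q q}}"

definition cochain_scale :: "'k::field \<Rightarrow> ('b \<Rightarrow>\<^sub>0 'k) \<Rightarrow> ('b \<Rightarrow>\<^sub>0 'k)" where
  "cochain_scale c x = Poly_Mapping.map ((*) c) x"

definition linear_extension ::
  "('b \<Rightarrow> ('c \<Rightarrow>\<^sub>0 'k::field)) \<Rightarrow> ('b \<Rightarrow>\<^sub>0 'k) \<Rightarrow> ('c \<Rightarrow>\<^sub>0 'k)" where
  "linear_extension f x =
    (\<Sum>i\<in>Poly_Mapping.keys x. cochain_scale (Poly_Mapping.lookup x i) (f i))"

definition replace_arrow :: "('v, 'a) path \<Rightarrow> nat \<Rightarrow> ('v, 'a) path \<Rightarrow> ('v, 'a) path" where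
  "replace_arrow p i \<gamma> = (fst p, take i (snd p) @ snd \<gamma> @ drop (Suc i) (snd p))"

text \<open>
  \<open>replacement_sum B q (a, \<gamma>) p\<close> is \<open>q \<parallel> p\<^bsup>a\<parallel>\<gamma>\<^esup>\<close>, where \<open>a\<close> is an arrow, regarded as a path of
  length one.
\<close>

definition replacement_sum ::
  "('v, 'a) path set \<Rightarrow> ('v, 'a) path \<Rightarrow> ('v, 'a) path \<times> ('v, 'a) path \<Rightarrow> ('v, 'a) path
    \<Rightarrow> ('k::field, 'v, 'a) cochain" where
  "replacement_sum B q a\<gamma> p =
    (\<Sum>i | i < length (snd p) \<and> [snd p ! i] = snd (fst a\<gamma>) \<and> replace_arrow p i (snd a\<gamma>) \<in> B.
      basis_pair q (replace_arrow p i (snd a\<gamma>)))"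

definition delta0 ::
  "('v, 'a) pre_digraph \<Rightarrow> ('v, 'a) path set \<Rightarrow> ('k::field, 'v, 'a) cochain
    \<Rightarrow> ('k, 'v, 'a) cochain" where
  "delta0 Q Z = linear_extension (\<lambda>(e, \<gamma>).
     (\<Sum>a | a \<in> arrow_paths Q \<and> fst a = fst e \<and> path_comp a \<gamma> \<in> basis_paths Q Z.
        basis_pair a (path_comp a \<gamma>)) -
     (\<Sum>a | a \<in> arrow_paths Q \<and> path_target Q a = fst e \<and> path_comp \<gamma> a \<in> basis_paths Q Z.
        basis_pair a (path_comp \<gamma> a)))"

definition delta1 ::
  "('v, 'a) pre_digraph \<Rightarrow> ('v, 'a) path set \<Rightarrow> ('k::field, 'v, 'a) cochain
    \<Rightarrow> ('k, 'v, 'a) cochain" where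
  "delta1 Q Z = linear_extension (\<lambda>a\<gamma>. \<Sum>r\<in>Z. replacement_sum (basis_paths Q Z) r a\<gamma> r)"

definition cochain_bracket ::
  "('v, 'a) path set \<Rightarrow> ('k::field, 'v, 'a) cochain \<Rightarrow> ('k, 'v, 'a) cochain
    \<Rightarrow> ('k, 'v, 'a) cochain" where
  "cochain_bracket B x y =
    linear_extension (\<lambda>a\<gamma>. linear_extension (\<lambda>b\<epsilon>.
      replacement_sum B (fst b\<epsilon>) a\<gamma> (snd b\<epsilon>) - replacement_sum B (fst a\<gamma>) b\<epsilon> (snd a\<gamma>)) y) x"

definition cocycles ::
  "('v, 'a) pre_digraph \<Rightarrow> ('v, 'a) path set
    \<Rightarrow> ('k::field, ('k, 'v, 'a) cochain) module" where
  "cocycles Q Z =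
    \<lparr> carrier = {x \<in> parallel_span Q (arrow_paths Q) (basis_paths Q Z). delta1 Q Z x = 0},
      monoid.mult = cochain_bracket (basis_paths Q Z), one = 0, zero = 0, add = (+),
      module.smult = cochain_scale \<rparr>"

definition coboundaries ::
  "('v, 'a) pre_digraph \<Rightarrow> ('v, 'a) path set \<Rightarrow> ('k::field, 'v, 'a) cochain set" where
  "coboundaries Q Z = delta0 Q Z ` parallel_span Q (trivial_paths Q) (basis_paths Q Z)"

definition HH1 ::
  "('v, 'a) pre_digraph \<Rightarrow> ('v, 'a) path set
    \<Rightarrow> ('k::field, ('k, 'v, 'a) cochain set) module" where
  "HH1 Q Z = quotient_module (cocycles Q Z) (coboundaries Q Z)"

definition HH1_class ::
  "('v, 'a) pre_digraph \<Rightarrow> ('v, 'a) path set \<Rightarrow> ('k::field, 'v, 'a) cochain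
    \<Rightarrow> ('k, 'v, 'a) cochain set" where
  "HH1_class Q Z x = coboundaries Q Z +>\<^bsub>cocycles Q Z\<^esub> x"

text \<open>The linear map \<open>a \<parallel> p \<mapsto> a\<^sup>* \<parallel> p\<^sup>*\<close>.\<close>

definition glue_cochain ::
  "('v, 'a) pre_digraph \<Rightarrow> 'a \<Rightarrow> 'a \<Rightarrow> ('k::field, 'v, 'a) cochain
    \<Rightarrow> ('k, 'v, 'a) cochain" where
  "glue_cochain Q \<alpha> \<beta> =
    linear_extension (\<lambda>(a, p). basis_pair (glue_path Q \<alpha> \<beta> a) (glue_path Q \<alpha> \<beta> p))"


section \<open>Walks and the fundamental group\<close>

text \<open>
  A walk is a path of the double quiver, in which \<open>(a, True)\<close> stands for the arrow \<open>a\<close> and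
  \<open>(a, False)\<close> for its formal inverse.
\<close>

type_synonym ('v, 'a) walk = "('v, 'a \<times> bool) path"

definition double_quiver :: "('v, 'a) pre_digraph \<Rightarrow> ('v, 'a \<times> bool) pre_digraph" where
  "double_quiver Q =
    \<lparr> verts = verts Q, arcs = arcs Q \<times> UNIV,
      tail = (\<lambda>(a, b). if b then tail Q a else head Q a),
      head = (\<lambda>(a, b). if b then head Q a else tail Q a) \<rparr>"

definition walks :: "('v, 'a) pre_digraph \<Rightarrow> 'v \<Rightarrow> 'v \<Rightarrow> ('v, 'a) walk set" where
  "walks Q x y =
    {w \<in> paths (double_quiver Q). fst w = x \<and> path_target (double_quiver Q) w = y}"

definition same_block :: "('v, 'a) pre_digraph \<Rightarrow> 'v \<Rightarrow> 'v \<Rightarrow> bool" where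
  "same_block Q x y \<longleftrightarrow> walks Q x y \<noteq> {}"

definition avoids :: "('v, 'a) walk \<Rightarrow> 'a \<Rightarrow> bool" where
  "avoids w a \<longleftrightarrow> a \<notin> fst ` set (snd w)"

definition arrow_walk :: "('v, 'a) pre_digraph \<Rightarrow> 'a \<Rightarrow> ('v, 'a) walk" where
  "arrow_walk Q a = (tail Q a, [(a, True)])"

definition inverse_walk :: "('v, 'a) pre_digraph \<Rightarrow> ('v, 'a) walk \<Rightarrow> ('v, 'a) walk" where
  "inverse_walk Q w =
    (path_target (double_quiver Q) w, rev (map (\<lambda>(a, b). (a, \<not> b)) (snd w)))"

definition glue_walk ::
  "('v, 'a) pre_digraph \<Rightarrow> 'a \<Rightarrow> 'a \<Rightarrow> ('v, 'a) walk \<Rightarrow> ('v, 'a) walk" where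
  "glue_walk Q \<alpha> \<beta> w =
    (glue_vert Q \<alpha> \<beta> (fst w), map (\<lambda>(a, b). (glue_arrow \<alpha> \<beta> a, b)) (snd w))"

definition cancellation :: "('v, 'a) pre_digraph \<Rightarrow> 'v \<Rightarrow> ('v, 'a) walk rel" where
  "cancellation Q x =
    {(w, w') \<in> walks Q x x \<times> walks Q x x.
      \<exists>us a b ws. snd w = us @ [(a, b), (a, \<not> b)] @ ws \<and> snd w' = us @ ws}"

definition homotopy :: "('v, 'a) pre_digraph \<Rightarrow> 'v \<Rightarrow> ('v, 'a) walk rel" where
  "homotopy Q x =
    (cancellation Q x \<union> (cancellation Q x)\<inverse>)\<^sup>* \<inter> (walks Q x x \<times> walks Q x x)"

definition walk_class ::
  "('v, 'a) pre_digraph \<Rightarrow> 'v \<Rightarrow> ('v, 'a) walk \<Rightarrow> ('v, 'a) walk set" where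
  "walk_class Q x w = homotopy Q x `` {w}"

text \<open>The group \<open>\<pi>\<^sub>1(Q, I, x)\<close> for a monomial ideal \<open>I\<close>, which does not depend on \<open>I\<close>.\<close>

definition fundamental_group ::
  "('v, 'a) pre_digraph \<Rightarrow> 'v \<Rightarrow> ('v, 'a) walk set monoid" where
  "fundamental_group Q x =
    \<lparr> carrier = walks Q x x // homotopy Q x,
      monoid.mult = (\<lambda>A B. \<Union>p\<in>A. \<Union>q\<in>B. walk_class Q x (path_comp p q)),
      one = walk_class Q x (x, []) \<rparr>"

text \<open>
  \<open>Hom(G, k\<^sup>+)\<close> as a vector space with zero Lie bracket.  Homomorphisms are extensional, that is,
  determined by their values on the carrier of \<open>G\<close>.
\<close>

definition Hom_add :: "('g, 'b) monoid_scheme \<Rightarrow> ('k::field, 'g \<Rightarrow> 'k) module" where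
  "Hom_add G =
    \<lparr> carrier = hom G (add_monoid (ring_of_type_algebra :: 'k ring)) \<inter> extensional (carrier G),
      monoid.mult = (\<lambda>f g. \<lambda>x\<in>carrier G. 0), one = (\<lambda>x\<in>carrier G. 0), zero = (\<lambda>x\<in>carrier G. 0),
      add = (\<lambda>f g. \<lambda>x\<in>carrier G. f x + g x),
      module.smult = (\<lambda>c f. \<lambda>x\<in>carrier G. c * f x) \<rparr>"

text \<open>
  Minimality refers to the number of generators.  For a free group such generating sets are exactly
  the free bases, whereas a generating set that is minimal with respect to inclusion need not have a
  dual basis (for instance \<open>{2, 3}\<close> in the group of integers).
\<close>

definition minimal_generators :: "('g, 'b) monoid_scheme \<Rightarrow> 'g list \<Rightarrow> bool" where
  "minimal_generators G xs \<longleftrightarrow>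
    set xs \<subseteq> carrier G \<and> generate G (set xs) = carrier G \<and>
    (\<forall>S. S \<subseteq> carrier G \<and> finite S \<and> generate G S = carrier G \<longrightarrow> length xs \<le> card S)"

definition is_dual_basis ::
  "('g, 'b) monoid_scheme \<Rightarrow> 'g list \<Rightarrow> ('g \<Rightarrow> 'k::field) list \<Rightarrow> bool" where
  "is_dual_basis G xs gs \<longleftrightarrow>
    length gs = length xs \<and> set gs \<subseteq> carrier (Hom_add G) \<and>
    (\<forall>i<length xs. \<forall>j<length xs. (gs ! i) (xs ! j) = (if i = j then 1 else 0)) \<and>
    (\<forall>h\<in>carrier (Hom_add G).
       h = (\<Oplus>\<^bsub>Hom_add G\<^esub>i\<in>{..<length xs}. h (xs ! i) \<odot>\<^bsub>Hom_add G\<^esub> (gs ! i)))"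

definition dual_basis ::
  "('g, 'b) monoid_scheme \<Rightarrow> 'g list \<Rightarrow> ('g \<Rightarrow> 'k::field) list" where
  "dual_basis G xs = (THE gs. is_dual_basis G xs gs)"


section \<open>The maps from the fundamental group to Hochschild cohomology\<close>

text \<open>
  For parade data \<open>w\<close> based at \<open>x\<close>, \<open>theta Q Z x w h\<close> is the class of the derivation that multiplies
  every arrow \<open>\<delta>\<close> of the block of \<open>x\<close> by \<open>h (w\<^sub>j\<^sup>-\<^sup>1 \<delta> w\<^sub>i)\<close> and kills all other arrows, as the
  derivation \<open>\<delta> \<mapsto> c \<delta>\<close> corresponds to \<open>c (\<delta> \<parallel> \<delta>)\<close>.
\<close>

definition theta ::
  "('v, 'a) pre_digraph \<Rightarrow> ('v, 'a) path set \<Rightarrow> 'v \<Rightarrow> ('v \<Rightarrow> ('v, 'a) walk)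
    \<Rightarrow> (('v, 'a) walk set \<Rightarrow> 'k::field) \<Rightarrow> ('k, 'v, 'a) cochain set" where
  "theta Q Z x w h =
    HH1_class Q Z (\<Sum>d | d \<in> arcs Q \<and> same_block Q x (tail Q d).
      cochain_scale
        (h (walk_class Q x (path_comp (inverse_walk Q (w (head Q d)))
          (path_comp (arrow_walk Q d) (w (tail Q d))))))
        (basis_pair (arrow_path Q d) (arrow_path Q d)))"

text \<open>The parade data of \<open>Q\<close> based at \<open>head Q \<alpha>\<close>, and that of the glued quiver.\<close>

definition parade ::
  "('v, 'a) pre_digraph \<Rightarrow> 'a \<Rightarrow> 'a \<Rightarrow> ('v, 'a) walk \<Rightarrow> ('v \<Rightarrow> ('v, 'a) walk)
    \<Rightarrow> 'v \<Rightarrow> ('v, 'a) walk" where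
  "parade Q \<alpha> \<beta> v w x =
    (if x = tail Q \<alpha> then inverse_walk Q (arrow_walk Q \<alpha>)
     else if x = head Q \<alpha> then (head Q \<alpha>, [])
     else if x = tail Q \<beta> then v
     else if x = head Q \<beta> then path_comp (arrow_walk Q \<beta>) v
     else w x)"

definition glued_parade ::
  "('v, 'a) pre_digraph \<Rightarrow> 'a \<Rightarrow> ('v, 'a) walk \<Rightarrow> ('v \<Rightarrow> ('v, 'a) walk)
    \<Rightarrow> 'v \<Rightarrow> ('v, 'a) walk" where
  "glued_parade Q \<alpha> v' w' x =
    (if x = tail Q \<alpha> then v' else if x = head Q \<alpha> then (head Q \<alpha>, []) else w' x)"

end

theory Submission
  imports Defs "Jordan_Normal_Form.Determinant"
begin

text \<open>
  A path of \<open>Q\<close> lies in the ideal if and only if its image does, and because of the new relations a nonzero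
  path of the glued quiver passing through \<open>\<gamma>\<^sup>*\<close> lifts.  Hence \<open>a \<parallel> p \<mapsto> a\<^sup>* \<parallel> p\<^sup>*\<close> hits every pair \<open>a\<^sup>* \<parallel> q\<close> except
  those with \<open>a\<^sup>* = \<gamma>\<^sup>*\<close> and \<open>q\<close> the image of a path from \<open>e\<^sub>1\<close> to \<open>e\<^sub>n\<close>, and these are inner.  In \<open>A\<close> both \<open>\<alpha> \<parallel> \<alpha>\<close> and
  \<open>\<beta> \<parallel> \<beta>\<close> are inner, as \<open>e\<^sub>1\<close> is a source and \<open>e\<^sub>n\<close> is a sink; both are sent to \<open>\<gamma>\<^sup>* \<parallel> \<gamma>\<^sup>*\<close>.  Up to that line, coboundaries
  correspond to coboundaries, which gives the Lie isomorphism.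

  On the topological side \<open>\<sigma>\<close> is restriction along the map of fundamental groups induced by gluing, whose
  image together with \<open>\<gamma>\<^sup>* v\<^sup>*\<close> generates.  Dual bases exist because the arrows outside a spanning tree of
  the block provide both generators and coordinate functionals, so that a smallest generating set has at
  most that many elements.  For the chosen parade data the loops attached to \<open>\<alpha>\<close> and \<open>\<beta>\<close> are trivial,
  and those attached to every other arrow correspond under gluing.  Therefore the two derivations
  compared by the diagram differ by a multiple of \<open>\<gamma>\<^sup>* \<parallel> \<gamma>\<^sup>*\<close>.
\<close>

section \<open>Linear extensions\<close>

text \<open>Sums of pairs of paths are unwieldy for brackets. A cochain is therefore treated as its
  derivation of kQ with values in A, which is determined on arrows: cocycles kill the relations, the
  bracket is the commutator, and \<open>delta0\<close> gives inner derivations. Leibniz rules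
  checked on arrows then show that products descend to cohomology. The obstacle is that gluing is
  not a chain map. It fails to commute with \<open>delta0\<close> at the trivial paths at e1 and
  e_n, because each of f1 and f2 has two trivial lifts; the images of those two coboundaries are the
  diagonal pair of the glued arrow up to sign, which is why the line is divided out. In the other
  direction, a closed path of the glued quiver may lift to a path that is not closed; its coboundary
  involves only the pairs that gluing misses. The middle vertical map is built from \<theta>A,
  restriction and the Lie isomorphism, so the right square is formal. The content is that \<theta>B
  induces the same map. For B no count of generators is made: explicit functionals are dual to a
  generating list, and generation makes dual functionals unique.\<close>

lemma lookup_cochain_scale [simp]:
  "Poly_Mapping.lookup (cochain_scale c x) k = c * Poly_Mapping.lookup x k"
  by (simp add: cochain_scale_def Poly_Mapping.map.rep_eq when_def)

lemma cochain_scale_add: "cochain_scale c (x + y) = cochain_scale c x + cochain_scale c y"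
  by (rule poly_mapping_eqI) (simp add: lookup_add algebra_simps)

lemma cochain_scale_diff: "cochain_scale c (x - y) = cochain_scale c x - cochain_scale c y"
  by (rule poly_mapping_eqI) (simp add: lookup_minus algebra_simps)

lemma cochain_scale_add_left: "cochain_scale (c + d) x = cochain_scale c x + cochain_scale d x"
  by (rule poly_mapping_eqI) (simp add: lookup_add algebra_simps)

lemma cochain_scale_assoc: "cochain_scale c (cochain_scale d x) = cochain_scale (c * d) x"
  by (rule poly_mapping_eqI) (simp add: algebra_simps)

lemma cochain_scale_simps [simp]:
  "cochain_scale 0 x = 0" "cochain_scale 1 x = x" "cochain_scale c 0 = 0"
  "cochain_scale (- 1) x = - x"
  by (rule poly_mapping_eqI, simp)+

lemma cochain_scale_sum: "cochain_scale c (sum f A) = (\<Sum>i\<in>A. cochain_scale c (f i))"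
  by (induction A rule: infinite_finite_induct) (simp_all add: cochain_scale_add)

lemma keys_cochain_scale: "Poly_Mapping.keys (cochain_scale c x) \<subseteq> Poly_Mapping.keys x"
  by (auto simp: in_keys_iff)

definition is_linear :: "(('b \<Rightarrow>\<^sub>0 'k::field) \<Rightarrow> ('c \<Rightarrow>\<^sub>0 'k)) \<Rightarrow> bool" where
  "is_linear f \<longleftrightarrow> (\<forall>x y. f (x + y) = f x + f y) \<and> (\<forall>c x. f (cochain_scale c x) = cochain_scale c (f x))"

lemma is_linearI:
  assumes "\<And>x y. f (x + y) = f x + f y" "\<And>c x. f (cochain_scale c x) = cochain_scale c (f x)"
  shows "is_linear f"
  using assms by (simp add: is_linear_def)

lemma
  assumes "is_linear f"
  shows linear_add: "f (x + y) = f x + f y"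
    and linear_scale: "f (cochain_scale c x) = cochain_scale c (f x)"
  using assms by (auto simp: is_linear_def)

lemma linear_zero: "is_linear f \<Longrightarrow> f 0 = 0"
  using linear_scale[of f 0 0] by simp

lemma linear_uminus: "is_linear f \<Longrightarrow> f (- x) = - f x"
  using linear_scale[of f "- 1" x] by simp

lemma linear_diff: "is_linear f \<Longrightarrow> f (x - y) = f x - f y"
  using linear_add[of f x "- y"] linear_uminus[of f y] by simp

lemma linear_sum: "is_linear f \<Longrightarrow> f (sum g A) = (\<Sum>i\<in>A. f (g i))"
  by (induction A rule: infinite_finite_induct) (simp_all add: linear_zero linear_add)

lemma is_linear_id: "is_linear (\<lambda>x. x)"
  and is_linear_zero: "is_linear (\<lambda>x. 0)"
  by (auto intro: is_linearI)

lemma is_linear_comp: "is_linear f \<Longrightarrow> is_linear g \<Longrightarrow> is_linear (\<lambda>x. f (g x))"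
  by (simp add: is_linear_def)

lemma is_linear_plus: "is_linear f \<Longrightarrow> is_linear g \<Longrightarrow> is_linear (\<lambda>x. f x + g x)"
  by (simp add: is_linear_def algebra_simps cochain_scale_add)

lemma is_linear_minus: "is_linear f \<Longrightarrow> is_linear g \<Longrightarrow> is_linear (\<lambda>x. f x - g x)"
  by (simp add: is_linear_def algebra_simps cochain_scale_diff)

lemma is_linear_sum: "(\<And>i. i \<in> A \<Longrightarrow> is_linear (f i)) \<Longrightarrow> is_linear (\<lambda>x. \<Sum>i\<in>A. f i x)"
  by (induction A rule: infinite_finite_induct) (auto intro: is_linear_plus is_linear_zero)

lemma is_linear_cochain_scale: "is_linear (cochain_scale c)"
  by (auto intro!: is_linearI simp: cochain_scale_add cochain_scale_assoc mult.commute)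

lemma is_linear_scaled: "is_linear f \<Longrightarrow> is_linear (\<lambda>x. cochain_scale c (f x))"
  by (rule is_linear_comp[OF is_linear_cochain_scale])

lemma linear_extension_superset:
  assumes "finite A" "Poly_Mapping.keys x \<subseteq> A"
  shows "linear_extension f x = (\<Sum>i\<in>A. cochain_scale (Poly_Mapping.lookup x i) (f i))"
  unfolding linear_extension_def using assms
  by (intro sum.mono_neutral_left) (auto simp: in_keys_iff)

lemma is_linear_extension:
  fixes f :: "'b \<Rightarrow> ('c \<Rightarrow>\<^sub>0 'k::field)"
  shows "is_linear (linear_extension f)"
proof (rule is_linearI)
  fix x y :: "'b \<Rightarrow>\<^sub>0 'k"
  define A where "A = Poly_Mapping.keys x \<union> Poly_Mapping.keys y"
  have "finite A" "Poly_Mapping.keys x \<subseteq> A" "Poly_Mapping.keys y \<subseteq> A" "Poly_Mapping.keys (x + y) \<subseteq> A"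
    using keys_add[of x y] by (auto simp: A_def)
  then show "linear_extension f (x + y) = linear_extension f x + linear_extension f y"
    by (simp add: linear_extension_superset[of A] lookup_add cochain_scale_add_left sum.distrib)
next
  fix c and x :: "'b \<Rightarrow>\<^sub>0 'k"
  show "linear_extension f (cochain_scale c x) = cochain_scale c (linear_extension f x)"
    by (simp add: linear_extension_superset[of "Poly_Mapping.keys x"] keys_cochain_scale
        cochain_scale_sum cochain_scale_assoc)
qed

lemmas linear_extension_rules =
  linear_add[OF is_linear_extension] linear_diff[OF is_linear_extension]
  linear_scale[OF is_linear_extension] linear_sum[OF is_linear_extension]
  linear_zero[OF is_linear_extension] linear_uminus[OF is_linear_extension]

lemma linear_extension_single [simp]:
  "linear_extension f (Poly_Mapping.single k c) = cochain_scale c (f k)"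
  by (simp add: linear_extension_superset[of "{k}"])

lemma linear_extension_basis_pair [simp]: "linear_extension f (basis_pair p q) = f (p, q)"
  by (simp add: basis_pair_def)

lemma cochain_expansion:
  "x = (\<Sum>k\<in>Poly_Mapping.keys x. cochain_scale (Poly_Mapping.lookup x k) (Poly_Mapping.single k 1))"
proof (rule poly_mapping_eqI)
  fix l
  have "Poly_Mapping.lookup x l = (\<Sum>k\<in>Poly_Mapping.keys x. Poly_Mapping.lookup x k * (if k = l then 1 else 0))"
    by (simp add: if_distrib in_keys_iff cong: if_cong)
  then show "Poly_Mapping.lookup x l = Poly_Mapping.lookup (\<Sum>k\<in>Poly_Mapping.keys x.
      cochain_scale (Poly_Mapping.lookup x k) (Poly_Mapping.single k 1)) l"
    by (simp add: lookup_sum lookup_single when_def)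
qed

lemma linear_eq_extension:
  assumes "is_linear f"
  shows "f x = linear_extension (\<lambda>k. f (Poly_Mapping.single k 1)) x"
  unfolding linear_extension_def
  by (subst cochain_expansion[of x]) (simp add: linear_sum[OF assms] linear_scale[OF assms])

text \<open>Only basis vectors in the support of \<open>x\<close> are compared. The maps are defined
  on all finitely supported functions, whereas the identities below hold only for pairs of parallel
  paths.\<close>

lemma linear_eqI:
  assumes "is_linear f" "is_linear g"
    and "\<And>k. k \<in> Poly_Mapping.keys x \<Longrightarrow> f (Poly_Mapping.single k 1) = g (Poly_Mapping.single k 1)"
  shows "f x = g x"
  unfolding linear_eq_extension[OF assms(1), of x] linear_eq_extension[OF assms(2), of x]
  unfolding linear_extension_def using assms(3) by simp

lemma is_linear_extension_param:
  assumes "\<And>k. is_linear (\<lambda>y. f k y)"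
  shows "is_linear (\<lambda>y. linear_extension (\<lambda>k. f k y) x)"
  unfolding linear_extension_def by (intro is_linear_sum is_linear_scaled assms)

lemma keys_linear_extension:
  "Poly_Mapping.keys (linear_extension f x) \<subseteq> (\<Union>k\<in>Poly_Mapping.keys x. Poly_Mapping.keys (f k))"
  unfolding linear_extension_def
  by (rule order_trans[OF keys_sum]) (use keys_cochain_scale in fast)

text \<open>Besides support conditions, \<open>S\<close> is later the set of cochains that lift
  modulo coboundaries or modulo wide cochains, so only closure under linear combinations is
  assumed.\<close>

lemma linear_closed:
  assumes "is_linear f"
    and "0 \<in> S" "\<And>a b. a \<in> S \<Longrightarrow> b \<in> S \<Longrightarrow> a + b \<in> S" "\<And>c a. a \<in> S \<Longrightarrow> cochain_scale c a \<in> S"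
    and "\<And>k. k \<in> Poly_Mapping.keys x \<Longrightarrow> f (Poly_Mapping.single k 1) \<in> S"
  shows "f x \<in> S"
proof -
  have "sum g A \<in> S" if "\<And>i. i \<in> A \<Longrightarrow> g i \<in> S" for g :: "'a \<Rightarrow> _" and A
    using that by (induction A rule: infinite_finite_induct) (auto intro: assms)
  then show ?thesis
    unfolding linear_eq_extension[OF assms(1), of x] linear_extension_def by (simp add: assms)
qed

definition support_span :: "'b set \<Rightarrow> ('b \<Rightarrow>\<^sub>0 'k::field) set" where
  "support_span S = {x. Poly_Mapping.keys x \<subseteq> S}"

lemma support_span_rules:
  "0 \<in> support_span S"
  "x \<in> support_span S \<Longrightarrow> y \<in> support_span S \<Longrightarrow> x + y \<in> support_span S"
  "x \<in> support_span S \<Longrightarrow> y \<in> support_span S \<Longrightarrow> x - y \<in> support_span S"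
  "x \<in> support_span S \<Longrightarrow> - x \<in> support_span S"
  "x \<in> support_span S \<Longrightarrow> cochain_scale c x \<in> support_span S"
  using keys_add[of x y] keys_diff[of x y] keys_cochain_scale[of c x] by (auto simp: support_span_def)

lemma support_span_sum: "(\<And>i. i \<in> A \<Longrightarrow> f i \<in> support_span S) \<Longrightarrow> sum f A \<in> support_span S"
  by (induction A rule: infinite_finite_induct) (auto intro: support_span_rules)

lemma single_in_support_span: "k \<in> S \<Longrightarrow> Poly_Mapping.single k c \<in> support_span S"
  by (simp add: support_span_def)

lemma basis_pair_in_support_span: "(p, q) \<in> S \<Longrightarrow> basis_pair p q \<in> support_span S"
  by (simp add: basis_pair_def single_in_support_span)

lemma linear_extension_in_support_span:
  assumes "x \<in> support_span S" "\<And>k. k \<in> S \<Longrightarrow> f k \<in> support_span T"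
  shows "linear_extension f x \<in> support_span T"
  using assms keys_linear_extension[of f x] unfolding support_span_def by blast

lemma parallel_span_eq:
  "parallel_span Q S T =
    support_span {(p, q). p \<in> S \<and> q \<in> T \<and> fst p = fst q \<and> path_target Q p = path_target Q q}"
  by (simp add: parallel_span_def support_span_def)

section \<open>Derivations of a monomial algebra\<close>

lemma path_target_simps [simp]:
  "path_target Q (x, []) = x"
  "path_target Q (x, a # l) = path_target Q (head Q a, l)"
  by (simp_all add: path_target_def pre_digraph.awalk_verts.simps pre_digraph.awalk_verts_non_Nil)

lemma path_target_append: "path_target Q (x, l @ m) = path_target Q (path_target Q (x, l), m)"
  by (induction l arbitrary: x) simp_all

lemma path_comp_simps [simp]: "fst (path_comp q p) = fst p" "snd (path_comp q p) = snd p @ snd q"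
  by (simp_all add: path_comp_def)

lemma path_comp_assoc: "path_comp (path_comp r q) p = path_comp r (path_comp q p)"
  by (simp add: path_comp_def)

lemma path_target_comp:
  "path_target Q p = fst q \<Longrightarrow> path_target Q (path_comp q p) = path_target Q q"
  by (cases p, cases q) (simp add: path_comp_def path_target_append)

lemma arrow_path_simps [simp]:
  "fst (arrow_path Q b) = tail Q b" "snd (arrow_path Q b) = [b]" "path_target Q (arrow_path Q b) = head Q b"
  by (simp_all add: arrow_path_def)

context wf_digraph
begin

declare awalk_append_iff [simp del]

lemma awalk_target: "awalk x l y \<Longrightarrow> path_target G (x, l) = y"
  by (simp add: path_target_def)

lemma paths_iff: "p \<in> paths G \<longleftrightarrow> awalk (fst p) (snd p) (path_target G p)"
  by (auto simp: paths_def path_target_def)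

lemma awalk_iff: "awalk x l y \<longleftrightarrow> (x, l) \<in> paths G \<and> path_target G (x, l) = y"
  by (auto simp: paths_iff awalk_target)

lemma awalk_append: "awalk x (l @ m) y \<longleftrightarrow> awalk x l (path_target G (x, l)) \<and> awalk (path_target G (x, l)) m y"
  by (simp add: path_target_def awalk_append_iff)

lemma path_comp_iff:
  assumes "path_target G p = fst q"
  shows "path_comp q p \<in> paths G \<longleftrightarrow> p \<in> paths G \<and> q \<in> paths G"
  using assms by (cases p, cases q) (auto simp: paths_iff path_target_comp path_comp_def path_target_append awalk_append)

lemma trivial_in_paths: "(x, []) \<in> paths G \<longleftrightarrow> x \<in> verts G"
  by (simp add: paths_iff awalk_Nil_iff)

lemma arrow_path_in_paths: "b \<in> arcs G \<Longrightarrow> arrow_path G b \<in> paths G"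
  by (simp add: paths_iff arc_implies_awalk)

lemma paths_snoc_cases:
  assumes "p \<in> paths G"
  obtains x where "p = (x, [])" "x \<in> verts G"
  | b q where "b \<in> arcs G" "q \<in> paths G" "path_target G q = tail G b" "p = path_comp (arrow_path G b) q"
proof (cases "snd p" rule: rev_cases)
  case Nil
  then show ?thesis using that(1)[of "fst p"] assms by (cases p) (simp add: trivial_in_paths)
next
  case (snoc l b)
  then have "awalk (fst p) l (path_target G (fst p, l))" "awalk (path_target G (fst p, l)) [b] (path_target G p)"
    using assms by (simp_all add: paths_iff awalk_append)
  then show ?thesis using that(2)[of b "(fst p, l)"] snoc
    by (cases p) (auto simp: paths_iff awalk_Cons_iff path_comp_def arrow_path_def)
qed

text \<open>The last arrow is split off, so that a longer path is \<open>b q\<close> with the arrow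
  on the left; this is the shape used with the Leibniz rule \<open>act_comp\<close>. Walks use the
  same rule in the double quiver.\<close>

lemma paths_induct [consumes 1, case_names trivial step]:
  assumes "p \<in> paths G"
    and "\<And>x. x \<in> verts G \<Longrightarrow> P (x, [])"
    and "\<And>b q. b \<in> arcs G \<Longrightarrow> q \<in> paths G \<Longrightarrow> path_target G q = tail G b \<Longrightarrow> P q
      \<Longrightarrow> P (path_comp (arrow_path G b) q)"
  shows "P p"
  using assms(1)
proof (induction "length (snd p)" arbitrary: p)
  case 0
  then show ?case using assms(2)[of "fst p"] by (cases p) (simp add: trivial_in_paths)
next
  case (Suc n)
  from Suc.prems show ?case
  proof (cases rule: paths_snoc_cases)
    case 1
    then show ?thesis using Suc.hyps(2) by simp
  next
    case (2 b q)
    then show ?thesis using Suc.hyps assms(3)[of b q] by simp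
  qed
qed

lemma path_split:
  assumes "p \<in> paths G" "snd p = l @ m"
  shows "(fst p, l) \<in> paths G" "(path_target G (fst p, l), m) \<in> paths G"
    "path_target G (path_target G (fst p, l), m) = path_target G p"
    "p = path_comp (path_target G (fst p, l), m) (fst p, l)"
  using assms by (cases p; simp add: paths_iff awalk_append path_target_append path_comp_def)+

end

lemma subpath_comp_right: "subpath Q z p \<Longrightarrow> subpath Q z (path_comp q p)"
  unfolding subpath_def by fastforce

lemma subpath_comp_left:
  assumes "subpath Q z q" "path_target Q p = fst q"
  shows "subpath Q z (path_comp q p)"
proof -
  obtain us ws where "snd q = us @ snd z @ ws" "fst z = path_target Q (fst q, us)"
    using assms(1) by (auto simp: subpath_def)
  then have "snd (path_comp q p) = (snd p @ us) @ snd z @ ws \<and>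
      fst z = path_target Q (fst (path_comp q p), snd p @ us)"
    using assms(2) by (cases p) (simp add: path_target_append)
  then show ?thesis unfolding subpath_def by blast
qed

lemma subpath_trans:
  assumes "subpath Q p q" "subpath Q q r"
  shows "subpath Q p r"
proof -
  obtain us ws where 1: "snd q = us @ snd p @ ws" "fst p = path_target Q (fst q, us)"
    using assms(1) by (auto simp: subpath_def)
  obtain us' ws' where 2: "snd r = us' @ snd q @ ws'" "fst q = path_target Q (fst r, us')"
    using assms(2) by (auto simp: subpath_def)
  have "snd r = (us' @ us) @ snd p @ (ws @ ws') \<and> fst p = path_target Q (fst r, us' @ us)"
    using 1 2 by (simp add: path_target_append)
  then show ?thesis unfolding subpath_def by blast
qed

lemma subpath_refl: "subpath Q p p"
  unfolding subpath_def by (rule exI[of _ "[]"], rule exI[of _ "[]"]) simp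

lemma replace_arrow_simps [simp]:
  "fst (replace_arrow p i q) = fst p"
  by (simp add: replace_arrow_def)

lemma replace_arrow_comp_right:
  "i < length (snd p) \<Longrightarrow> replace_arrow (path_comp q p) i r = path_comp q (replace_arrow p i r)"
  by (simp add: replace_arrow_def path_comp_def)

lemma replace_arrow_comp_left:
  "replace_arrow (path_comp q p) (length (snd p) + i) r = path_comp (replace_arrow q i r) p"
  by (simp add: replace_arrow_def path_comp_def)

lemma (in wf_digraph) replace_arrow_path:
  assumes "p \<in> paths G" "i < length (snd p)" "q \<in> paths G"
    and "fst q = tail G (snd p ! i)" "path_target G q = head G (snd p ! i)"
  shows "replace_arrow p i q \<in> paths G" "path_target G (replace_arrow p i q) = path_target G p"
proof -
  define l a m where "l = take i (snd p)" and "a = snd p ! i" and "m = drop (Suc i) (snd p)"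
  have lm: "snd p = l @ a # m"
    using assms(2) by (simp add: l_def m_def a_def id_take_nth_drop)
  have 1: "awalk (fst p) l (tail G a)" "awalk (head G a) m (path_target G p)"
    using assms(1) by (auto simp: paths_iff lm awalk_append awalk_Cons_iff)
  have "awalk (tail G a) (snd q) (head G a)"
    using assms(3-5) by (simp add: paths_iff a_def)
  then have "awalk (fst p) (l @ snd q @ m) (path_target G p)"
    using 1 by (metis awalk_appendI)
  then show "replace_arrow p i q \<in> paths G" "path_target G (replace_arrow p i q) = path_target G p"
    by (auto simp: replace_arrow_def l_def m_def awalk_iff)
qed

section \<open>The algebra in its path basis, and the Leibniz rule\<close>

abbreviation arrow_cochains ::
  "('v, 'a) pre_digraph \<Rightarrow> ('v, 'a) path set \<Rightarrow> ('k::field, 'v, 'a) cochain set" where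
  "arrow_cochains Q Z \<equiv> parallel_span Q (arrow_paths Q) (basis_paths Q Z)"

text \<open>The residue class of a path in A, written in the basis of nonzero paths.\<close>

definition reduced ::
  "('v, 'a) path set \<Rightarrow> ('v, 'a) path \<Rightarrow> (('v, 'a) path \<Rightarrow>\<^sub>0 'k::field)" where
  "reduced B p = (if p \<in> B then Poly_Mapping.single p 1 else 0)"

definition alg_mult ::
  "('v, 'a) pre_digraph \<Rightarrow> ('v, 'a) path set
    \<Rightarrow> (('v, 'a) path \<Rightarrow>\<^sub>0 'k::field) \<Rightarrow> (('v, 'a) path \<Rightarrow>\<^sub>0 'k) \<Rightarrow> (('v, 'a) path \<Rightarrow>\<^sub>0 'k)" where
  "alg_mult Q B x y = linear_extension (\<lambda>q. linear_extension (\<lambda>p.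
     if path_target Q p = fst q then reduced B (path_comp q p) else 0) y) x"

text \<open>
  \<open>act B p x\<close> is the value at the path \<open>p\<close> of the derivation \<open>kQ \<rightarrow> A\<close> that belongs to the cochain \<open>x\<close>.
\<close>

definition act ::
  "('v, 'a) path set \<Rightarrow> ('v, 'a) path \<Rightarrow> ('k::field, 'v, 'a) cochain \<Rightarrow> (('v, 'a) path \<Rightarrow>\<^sub>0 'k)" where
  "act B p = linear_extension (\<lambda>a\<gamma>. \<Sum>i<length (snd p).
     if [snd p ! i] = snd (fst a\<gamma>) then reduced B (replace_arrow p i (snd a\<gamma>)) else 0)"

text \<open>The values of \<open>act\<close> on nonzero paths, extended linearly to A. The Leibniz
  rule in A becomes available once \<open>x\<close> is a cocycle, see
  \<open>derivation_mult\<close>.\<close>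

definition derivation ::
  "('v, 'a) path set \<Rightarrow> ('k::field, 'v, 'a) cochain \<Rightarrow> (('v, 'a) path \<Rightarrow>\<^sub>0 'k)
    \<Rightarrow> (('v, 'a) path \<Rightarrow>\<^sub>0 'k)" where
  "derivation B x = linear_extension (\<lambda>p. act B p x)"

definition tag ::
  "('v, 'a) path \<Rightarrow> (('v, 'a) path \<Rightarrow>\<^sub>0 'k::field) \<Rightarrow> ('k, 'v, 'a) cochain" where
  "tag q = linear_extension (\<lambda>p. basis_pair q p)"

lemma is_linear_act: "is_linear (act B p)"
  unfolding act_def by (rule is_linear_extension)

lemma is_linear_tag: "is_linear (tag q)"
  unfolding tag_def by (rule is_linear_extension)

lemma is_linear_derivation: "is_linear (derivation B x)"
  unfolding derivation_def by (rule is_linear_extension)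

lemma is_linear_derivation_left: "is_linear (\<lambda>x. derivation B x u)"
  unfolding derivation_def by (rule is_linear_extension_param[OF is_linear_act])

lemma is_linear_mult_left: "is_linear (\<lambda>x. alg_mult Q B x y)"
  unfolding alg_mult_def by (rule is_linear_extension)

lemma is_linear_mult_right: "is_linear (alg_mult Q B x)"
  unfolding alg_mult_def[abs_def] by (rule is_linear_extension_param[OF is_linear_extension])

lemmas mult_linear_rules =
  linear_add[OF is_linear_mult_left] linear_add[OF is_linear_mult_right]
  linear_diff[OF is_linear_mult_left] linear_diff[OF is_linear_mult_right]
  linear_scale[OF is_linear_mult_left] linear_scale[OF is_linear_mult_right]
  linear_zero[OF is_linear_mult_left] linear_zero[OF is_linear_mult_right]
  linear_sum[OF is_linear_mult_left] linear_sum[OF is_linear_mult_right]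

lemma lookup_tag: "Poly_Mapping.lookup (tag q v) (q', p) = (if q' = q then Poly_Mapping.lookup v p else 0)"
proof -
  have "(\<Sum>i\<in>Poly_Mapping.keys v. Poly_Mapping.lookup v i * (if q = q' \<and> i = p then 1 else 0)) =
    (if q' = q then Poly_Mapping.lookup v p else 0)"
    by (cases "q = q'") (auto simp: if_distrib in_keys_iff cong: if_cong)
  then show ?thesis
    by (simp add: tag_def linear_extension_def basis_pair_def lookup_sum lookup_single when_def)
qed

text \<open>Replacements that leave the basis become zero after reduction, so filtering them out of
  the index set agrees with reducing every summand. This turns \<open>delta1\<close> and the bracket
  into statements about \<open>act\<close>.\<close>

lemma replacement_sum_eq_tag:
  "replacement_sum B q a\<gamma> p = tag q (act B p (Poly_Mapping.single a\<gamma> 1))"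
proof -
  have "replacement_sum B q a\<gamma> p = (\<Sum>i\<in>{i. i < length (snd p) \<and> [snd p ! i] = snd (fst a\<gamma>) \<and>
      replace_arrow p i (snd a\<gamma>) \<in> B}. tag q (reduced B (replace_arrow p i (snd a\<gamma>))))"
    unfolding replacement_sum_def by (intro sum.cong) (auto simp: reduced_def tag_def)
  also have "\<dots> = (\<Sum>i<length (snd p). tag q
      (if [snd p ! i] = snd (fst a\<gamma>) then reduced B (replace_arrow p i (snd a\<gamma>)) else 0))"
    by (rule sum.mono_neutral_cong_left) (auto simp: reduced_def linear_zero[OF is_linear_tag])
  finally show ?thesis
    by (simp add: act_def linear_sum[OF is_linear_tag])
qed

text \<open>Both \<open>Q\<close> and the glued quiver are instances. Finiteness of \<open>Z\<close>
  keeps the sum in \<open>delta1\<close> from collapsing to the default value 0 of an infinite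
  sum.\<close>

locale monomial_quiver = fin_digraph Q
  for Q :: "('v, 'a) pre_digraph" and Z :: "('v, 'a) path set" +
  assumes finite_relations: "finite Z"
    and relations_subset: "Z \<subseteq> paths Q"
    and relations_length: "z \<in> Z \<Longrightarrow> 2 \<le> length (snd z)"
begin

abbreviation "B \<equiv> basis_paths Q Z"
abbreviation "algebra_span \<equiv> (support_span B :: (('v, 'a) path \<Rightarrow>\<^sub>0 'k::field) set)"

lemma basis_subset_paths: "B \<subseteq> paths Q"
  by (auto simp: basis_paths_def)

lemma basis_comp:
  assumes "path_comp q p \<in> B" "path_target Q p = fst q"
  shows "p \<in> B" "q \<in> B"
  using assms path_comp_iff[OF assms(2)] subpath_comp_left[of Q _ q p] subpath_comp_right[of Q _ p q]
  by (auto simp: basis_paths_def ideal_paths_def)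

lemma short_path_in_basis: "p \<in> paths Q \<Longrightarrow> length (snd p) \<le> 1 \<Longrightarrow> p \<in> B"
  using relations_length by (fastforce simp: basis_paths_def ideal_paths_def subpath_def)

lemma arrow_path_in_basis: "b \<in> arcs Q \<Longrightarrow> arrow_path Q b \<in> B"
  by (simp add: short_path_in_basis arrow_path_in_paths)

lemma reduced_in_span: "reduced B p \<in> algebra_span"
  by (simp add: reduced_def support_span_rules single_in_support_span)

lemma reduced_basis: "p \<in> B \<Longrightarrow> reduced B p = Poly_Mapping.single p 1"
  by (simp add: reduced_def)

lemma mult_single:
  "alg_mult Q B (Poly_Mapping.single q 1) (Poly_Mapping.single p 1) =
    (if path_target Q p = fst q then reduced B (path_comp q p) else 0)"
  by (simp add: alg_mult_def)

text \<open>If a factor lies in the ideal, so does the product, by \<open>basis_comp\<close>; hence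
  the projection from kQ to A is multiplicative on composable paths.\<close>

lemma mult_reduced:
  assumes "path_target Q p = fst q"
  shows "alg_mult Q B (reduced B q) (reduced B p) = reduced B (path_comp q p)"
proof (cases "p \<in> B \<and> q \<in> B")
  case True
  then show ?thesis using assms by (simp add: reduced_basis mult_single)
next
  case False
  then show ?thesis using basis_comp[OF _ assms] by (auto simp: reduced_def mult_linear_rules)
qed

text \<open>Trilinearity reduces this to three basis paths. If both junctions match, the two
  bracketings are the residue class of the same path; otherwise both vanish.\<close>

lemma mult_assoc:
  fixes x :: "('v, 'a) path \<Rightarrow>\<^sub>0 'k::field"
  assumes "x \<in> algebra_span" "y \<in> algebra_span" "z \<in> algebra_span"
  shows "alg_mult Q B (alg_mult Q B x y) z = alg_mult Q B x (alg_mult Q B y z)"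
proof -
  have basis: "alg_mult Q B (alg_mult Q B (Poly_Mapping.single r 1) (Poly_Mapping.single q 1)) (Poly_Mapping.single p 1)
      = alg_mult Q B (Poly_Mapping.single r 1)
          (alg_mult Q B (Poly_Mapping.single q 1) (Poly_Mapping.single p (1::'k)))"
    if "r \<in> B" "q \<in> B" "p \<in> B" for p q r
  proof (cases "path_target Q p = fst q"; cases "path_target Q q = fst r")
    assume "path_target Q p = fst q" "path_target Q q = fst r"
    then show ?thesis
      using that mult_reduced[of p "path_comp r q", where 'b = 'k] mult_reduced[of "path_comp q p" r, where 'b = 'k]
      by (simp add: mult_single path_target_comp reduced_basis path_comp_assoc)
  qed (auto simp: mult_single mult_linear_rules reduced_def path_target_comp)
  show ?thesis
  proof (rule linear_eqI[where f = "\<lambda>x. alg_mult Q B (alg_mult Q B x y) z"])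
    fix r assume "r \<in> Poly_Mapping.keys x"
    then have r: "r \<in> B" using assms(1) by (auto simp: support_span_def)
    let ?r = "Poly_Mapping.single r (1::'k)"
    show "alg_mult Q B (alg_mult Q B ?r y) z = alg_mult Q B ?r (alg_mult Q B y z)"
    proof (rule linear_eqI[where f = "\<lambda>y. alg_mult Q B (alg_mult Q B ?r y) z"])
      fix q assume "q \<in> Poly_Mapping.keys y"
      then have q: "q \<in> B" using assms(2) by (auto simp: support_span_def)
      let ?q = "Poly_Mapping.single q (1::'k)"
      show "alg_mult Q B (alg_mult Q B ?r ?q) z = alg_mult Q B ?r (alg_mult Q B ?q z)"
        by (rule linear_eqI[where f = "alg_mult Q B (alg_mult Q B ?r ?q)"])
          (use assms(3) in \<open>auto simp: support_span_def intro: basis r q is_linear_mult_right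
            is_linear_comp[OF is_linear_mult_right is_linear_mult_right]\<close>)
    qed (intro is_linear_comp[OF is_linear_mult_left] is_linear_comp[OF is_linear_mult_right]
        is_linear_mult_left is_linear_mult_right)+
  qed (intro is_linear_comp[OF is_linear_mult_left] is_linear_mult_left)+
qed

lemma act_in_span: "act B p x \<in> algebra_span"
  unfolding act_def
  by (intro linear_extension_in_support_span[where S = UNIV] support_span_sum)
    (auto simp: support_span_rules reduced_in_span support_span_def[of UNIV])

lemma cochain_keyE:
  assumes "x \<in> arrow_cochains Q Z" "k \<in> Poly_Mapping.keys x"
  obtains b q where "k = (arrow_path Q b, q)" "b \<in> arcs Q" "q \<in> B" "fst q = tail Q b" "path_target Q q = head Q b"
  proof -
  have "k \<in> {(p, q). p \<in> arrow_paths Q \<and> q \<in> B \<and> fst p = fst q \<and> path_target Q p = path_target Q q}"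
    using assms by (auto simp: parallel_span_def)
  then show ?thesis using that by (auto simp: arrow_paths_def)
qed

text \<open>An occurrence of an arrow in \<open>q p\<close> lies either in \<open>p\<close> or in
  \<open>q\<close>, and replacing it by a parallel path keeps the junction composable, so each
  replaced path factors again.\<close>

lemma act_comp:
  fixes x :: "('k::field, 'v, 'a) cochain"
  assumes x: "x \<in> arrow_cochains Q Z" and p: "p \<in> paths Q" and q: "q \<in> paths Q" and pq: "path_target Q p = fst q"
  shows "act B (path_comp q p) x = alg_mult Q B (act B q x) (reduced B p) + alg_mult Q B (reduced B q) (act B p x)"
proof (rule linear_eqI[OF is_linear_act])
  show "is_linear (\<lambda>x. alg_mult Q B (act B q x) (reduced B p) + alg_mult Q B (reduced B q) (act B p x))"
    by (intro is_linear_plus is_linear_comp[OF is_linear_mult_left is_linear_act]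
        is_linear_comp[OF is_linear_mult_right is_linear_act])
next
  fix k assume "k \<in> Poly_Mapping.keys x"
  then obtain b g where k: "k = (arrow_path Q b, g)" "b \<in> arcs Q" "g \<in> B" "fst g = tail Q b" "path_target Q g = head Q b"
    by (rule cochain_keyE[OF x])
  have g: "g \<in> paths Q" using k(3) basis_subset_paths by blast
  define F where "F r i = (if snd r ! i = b then reduced B (replace_arrow r i g) else (0 :: _ \<Rightarrow>\<^sub>0 'k))" for r i
  have act: "act B r (Poly_Mapping.single k 1) = (\<Sum>i<length (snd r). F r i)" for r
    by (simp add: act_def k(1) F_def cong: if_cong)
  have 1: "F (path_comp q p) i = alg_mult Q B (reduced B q) (F p i)" if "i < length (snd p)" for i
    using that replace_arrow_path[OF p that g] k(4,5) pq
    by (auto simp: F_def nth_append mult_linear_rules mult_reduced replace_arrow_comp_right)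
  have 2: "F (path_comp q p) (length (snd p) + i) = alg_mult Q B (F q i) (reduced B p)" if "i < length (snd q)" for i
    using that replace_arrow_path[OF q that g] k(4,5) pq
    by (auto simp: F_def nth_append mult_linear_rules mult_reduced replace_arrow_comp_left)
  have sum_split: "(\<Sum>i<m + n. f i) = (\<Sum>i<n. f (m + i)) + (\<Sum>i<m. f i)" for m n and f :: "nat \<Rightarrow> ('v, 'a) path \<Rightarrow>\<^sub>0 'k"
    by (induction n) (simp_all add: ac_simps)
  show "act B (path_comp q p) (Poly_Mapping.single k (1::'k)) =
      alg_mult Q B (act B q (Poly_Mapping.single k 1)) (reduced B p)
      + alg_mult Q B (reduced B q) (act B p (Poly_Mapping.single k 1))"
    by (simp add: act sum_split 1 2 mult_linear_rules)
qed

lemma act_trivial [simp]: "act B (y, []) x = 0"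
  by (simp add: act_def linear_extension_def)

lemma lookup_act_arrow:
  fixes x :: "('k::field, 'v, 'a) cochain"
  assumes "x \<in> arrow_cochains Q Z" "b \<in> arcs Q"
  shows "Poly_Mapping.lookup (act B (arrow_path Q b) x) p = Poly_Mapping.lookup x (arrow_path Q b, p)"
proof -
  \<comment> \<open>\<open>T\<close> keeps the pairs whose first component is \<open>b\<close>: in a
    path of length one the only replacement yields the second component itself.\<close>
  define T where "T = linear_extension (\<lambda>k :: ('v, 'a) path \<times> ('v, 'a) path. if fst k = arrow_path Q b then Poly_Mapping.single (snd k) (1 :: 'k) else 0)"
  have T: "act B (arrow_path Q b) x = T x"
  proof (rule linear_eqI[OF is_linear_act])
    show "is_linear T" unfolding T_def by (rule is_linear_extension)
    fix k assume "k \<in> Poly_Mapping.keys x"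
    then obtain c g where k: "k = (arrow_path Q c, g)" "c \<in> arcs Q" "g \<in> B" "fst g = tail Q c" "path_target Q g = head Q c"
      by (rule cochain_keyE[OF assms(1)])
    have "replace_arrow (arrow_path Q c) 0 g = g"
      using k(4) by (cases g) (simp add: replace_arrow_def)
    then show "act B (arrow_path Q b) (Poly_Mapping.single k 1) = T (Poly_Mapping.single k 1)"
      using k(3) by (cases "c = b") (auto simp: T_def act_def k(1) reduced_def arrow_path_def cong: if_cong)
  qed
  have "(\<Sum>k\<in>Poly_Mapping.keys x. Poly_Mapping.lookup x k * (if fst k = arrow_path Q b \<and> snd k = p then 1 else 0))
     = (\<Sum>k\<in>Poly_Mapping.keys x. if k = (arrow_path Q b, p) then Poly_Mapping.lookup x k else 0)"
    by (intro sum.cong) auto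
  also have "\<dots> = Poly_Mapping.lookup x (arrow_path Q b, p)"
    by (auto simp: in_keys_iff)
  finally have "(\<Sum>k\<in>Poly_Mapping.keys x. Poly_Mapping.lookup x k * (if fst k = arrow_path Q b \<and> snd k = p then 1 else 0))
     = Poly_Mapping.lookup x (arrow_path Q b, p)" .
  moreover have "Poly_Mapping.lookup (T x) p =
      (\<Sum>k\<in>Poly_Mapping.keys x. Poly_Mapping.lookup x k * (if fst k = arrow_path Q b \<and> snd k = p then 1 else 0))"
    unfolding T_def linear_extension_def lookup_sum
    by (intro sum.cong) (auto simp: lookup_single when_def)
  ultimately show ?thesis unfolding T by simp
qed

text \<open>The coefficients of a cochain are those of its values on arrows, by
  \<open>lookup_act_arrow\<close>; cochains can therefore be compared like derivations, arrow by
  arrow.\<close>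

lemma cochain_eqI:
  assumes "x \<in> arrow_cochains Q Z" "y \<in> arrow_cochains Q Z"
    and "\<And>b. b \<in> arcs Q \<Longrightarrow> act B (arrow_path Q b) x = act B (arrow_path Q b) y"
  shows "x = y"
proof (rule poly_mapping_eqI)
  fix k
  show "Poly_Mapping.lookup x k = Poly_Mapping.lookup y k"
  proof (cases "\<exists>b q. k = (arrow_path Q b, q) \<and> b \<in> arcs Q")
    case True
    then show ?thesis using assms lookup_act_arrow by metis
  next
    case False
    then have "k \<notin> Poly_Mapping.keys x" "k \<notin> Poly_Mapping.keys y"
      using assms(1,2) by (auto elim: cochain_keyE)
    then show ?thesis by (simp add: in_keys_iff)
  qed
qed

end

section \<open>Cocycles as derivations of the algebra, the bracket as their commutator\<close>

lemma is_linear_bracket_left: "is_linear (\<lambda>x. cochain_bracket B x y)"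
  unfolding cochain_bracket_def by (rule is_linear_extension)

lemma is_linear_bracket_right: "is_linear (cochain_bracket B x)"
  unfolding cochain_bracket_def[abs_def] by (rule is_linear_extension_param[OF is_linear_extension])

lemma is_linear_delta0: "is_linear (delta0 Q Z)"
  unfolding delta0_def by (rule is_linear_extension)

lemma is_linear_delta1: "is_linear (delta1 Q Z)"
  unfolding delta1_def by (rule is_linear_extension)

lemma derivation_single [simp]: "derivation B x (Poly_Mapping.single p 1) = act B p x"
  by (simp add: derivation_def)

lemma arrow_path_inj: "arrow_path Q b = arrow_path Q c \<longleftrightarrow> b = c"
  by (auto simp: arrow_path_def)

text \<open>Cochains of degree zero are identified with combinations of nonzero closed paths in A;
  \<open>algebra_loop\<close> goes back.\<close>

definition loop_algebra :: "('k::field, 'v, 'a) cochain \<Rightarrow> (('v, 'a) path \<Rightarrow>\<^sub>0 'k)" where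
  "loop_algebra = linear_extension (\<lambda>k. Poly_Mapping.single (snd k) 1)"

definition algebra_loop :: "(('v, 'a) path \<Rightarrow>\<^sub>0 'k::field) \<Rightarrow> ('k, 'v, 'a) cochain" where
  "algebra_loop = linear_extension (\<lambda>p. basis_pair (fst p, []) p)"

lemma loop_algebra_inverse: "loop_algebra (algebra_loop v) = v"
  unfolding loop_algebra_def algebra_loop_def
  by (rule linear_eqI[OF is_linear_comp[OF is_linear_extension is_linear_extension] is_linear_id]) simp

context monomial_quiver
begin

definition parallels :: "('v, 'a) path \<Rightarrow> ('v, 'a) path set" where
  "parallels p = {q \<in> B. fst q = fst p \<and> path_target Q q = path_target Q p}"

definition loops :: "('v, 'a) path set" where
  "loops = {q \<in> B. path_target Q q = fst q}"

abbreviation loop_cochains :: "('k::field, 'v, 'a) cochain set" where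
  "loop_cochains \<equiv> parallel_span Q (trivial_paths Q) B"

lemma delta1_eq: "delta1 Q Z x = (\<Sum>r\<in>Z. tag r (act B r x))"
proof (rule linear_eqI[OF is_linear_delta1])
  show "is_linear (\<lambda>x. \<Sum>r\<in>Z. tag r (act B r x))"
    by (intro is_linear_sum is_linear_comp[OF is_linear_tag is_linear_act])
qed (simp add: delta1_def replacement_sum_eq_tag)

text \<open>Distinct relations contribute to pairs with distinct first components, so nothing
  cancels in \<open>delta1\<close> and every relation is killed separately.\<close>

lemma cocycles_iff:
  "x \<in> carrier (cocycles Q Z) \<longleftrightarrow> x \<in> arrow_cochains Q Z \<and> (\<forall>r\<in>Z. act B r x = 0)"
proof -
  have "act B r x = 0" if "delta1 Q Z x = 0" "r \<in> Z" for r
  proof (rule poly_mapping_eqI)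
    fix p
    have "Poly_Mapping.lookup (delta1 Q Z x) (r, p) = Poly_Mapping.lookup (act B r x) p"
      using that(2) finite_relations by (simp add: delta1_eq lookup_sum lookup_tag)
    then show "Poly_Mapping.lookup (act B r x) p = Poly_Mapping.lookup 0 p"
      using that(1) by simp
  qed
  moreover have "delta1 Q Z x = 0" if "\<forall>r\<in>Z. act B r x = 0"
    using that by (simp add: delta1_eq linear_zero[OF is_linear_tag])
  ultimately show ?thesis by (auto simp: cocycles_def)
qed

text \<open>Write \<open>p\<close> as \<open>w z u\<close> with a relation \<open>z\<close>. After
  applying the Leibniz rule twice, every term has the value at \<open>z\<close> or the residue class
  of \<open>z\<close> as a factor, and both are zero.\<close>

lemma act_ideal:
  assumes x: "x \<in> carrier (cocycles Q Z)" and p: "p \<in> ideal_paths Q Z"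
  shows "act B p x = 0"
proof -
  obtain z us ws where z: "z \<in> Z" "snd p = us @ snd z @ ws" "fst z = path_target Q (fst p, us)"
    using p by (auto simp: ideal_paths_def subpath_def)
  have xs: "x \<in> arrow_cochains Q Z" and az: "act B z x = 0" using x z(1) by (auto simp: cocycles_iff)
  have pp: "p \<in> paths Q" using p by (simp add: ideal_paths_def)
  define u where "u = (fst p, us)"
  define w where "w = (path_target Q z, ws)"
  have s1: "(fst p, us) \<in> paths Q" "(fst z, snd z @ ws) \<in> paths Q" "p = path_comp (fst z, snd z @ ws) (fst p, us)"
    using path_split[OF pp z(2)] z(3) by simp_all
  have s2: "w \<in> paths Q" "(fst z, snd z @ ws) = path_comp w z"
    using path_split[OF s1(2), of "snd z" ws] by (simp_all add: w_def)
  have zp: "z \<in> paths Q" using z(1) relations_subset by blast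
  have red0: "reduced B z = (0 :: _ \<Rightarrow>\<^sub>0 'b)"
    using z(1) zp subpath_refl by (fastforce simp: reduced_def basis_paths_def ideal_paths_def)
  have wz: "path_target Q z = fst w" "path_target Q u = fst (path_comp w z)"
    by (simp_all add: w_def u_def z(3))
  have "reduced B (path_comp w z) = (0 :: _ \<Rightarrow>\<^sub>0 'b)"
    using mult_reduced[OF wz(1), where 'b = 'b] red0 by (simp add: mult_linear_rules)
  moreover have "act B (path_comp w z) x = 0"
    using act_comp[OF xs zp s2(1) wz(1)] az red0 by (simp add: mult_linear_rules)
  moreover have "p = path_comp (path_comp w z) u" "path_comp w z \<in> paths Q" "u \<in> paths Q"
    using s1 s2 by (simp_all add: u_def)
  ultimately show ?thesis
    using act_comp[OF xs, of u "path_comp w z"] wz(2) by (simp add: mult_linear_rules)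
qed

text \<open>The derivation of kQ given by a cocycle kills the ideal, hence factors through
  A.\<close>

lemma act_derivation:
  assumes "x \<in> carrier (cocycles Q Z)" "p \<in> paths Q"
  shows "act B p x = derivation B x (reduced B p)"
  using assms act_ideal[of x p] by (auto simp: reduced_def basis_paths_def linear_zero[OF is_linear_derivation])

lemma act_in_parallels:
  fixes x :: "('k::field, 'v, 'a) cochain"
  assumes x: "x \<in> arrow_cochains Q Z" and p: "p \<in> paths Q"
  shows "act B p x \<in> support_span (parallels p)"
proof (rule linear_closed[OF is_linear_act])
  fix k assume "k \<in> Poly_Mapping.keys x"
  then obtain b g where k: "k = (arrow_path Q b, g)" "b \<in> arcs Q" "g \<in> B" "fst g = tail Q b" "path_target Q g = head Q b"
    by (rule cochain_keyE[OF x])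
  have g: "g \<in> paths Q" using k(3) basis_subset_paths by blast
  have "(reduced B (replace_arrow p i g) :: _ \<Rightarrow>\<^sub>0 'k) \<in> support_span (parallels p)"
    if "i < length (snd p)" "snd p ! i = b" for i
    using replace_arrow_path[OF p that(1) g] k(4,5) that(2)
    by (auto simp: reduced_def parallels_def intro!: single_in_support_span support_span_rules(1))
  then show "act B p (Poly_Mapping.single k (1::'k)) \<in> support_span (parallels p)"
    by (auto simp: act_def k(1) intro!: support_span_sum support_span_rules(1))
qed (auto intro: support_span_rules)

lemma mult_not_composable:
  fixes u v :: "('v, 'a) path \<Rightarrow>\<^sub>0 'k::field"
  assumes "u \<in> support_span (parallels q)" "v \<in> support_span (parallels p)" "path_target Q p \<noteq> fst q"
  shows "alg_mult Q B u v = 0"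
proof (rule linear_eqI[OF is_linear_mult_left is_linear_zero])
  fix r assume r: "r \<in> Poly_Mapping.keys u"
  show "alg_mult Q B (Poly_Mapping.single r 1) v = 0"
    by (rule linear_eqI[OF is_linear_mult_right is_linear_zero])
      (use assms r in \<open>force simp: mult_single support_span_def parallels_def\<close>)
qed

text \<open>For composable basis paths this is the Leibniz rule of kQ carried over to A. Otherwise
  the values of the derivation keep their endpoints, so the two products on the right vanish as
  well.\<close>

lemma derivation_mult:
  fixes x :: "('k::field, 'v, 'a) cochain"
  assumes x: "x \<in> carrier (cocycles Q Z)" and uv: "u \<in> algebra_span" "v \<in> algebra_span"
  shows "derivation B x (alg_mult Q B u v) = alg_mult Q B (derivation B x u) v + alg_mult Q B u (derivation B x v)"
proof (rule linear_eqI[where f = "\<lambda>u. derivation B x (alg_mult Q B u v)"])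
  fix q assume "q \<in> Poly_Mapping.keys u"
  then have q: "q \<in> B" using uv by (auto simp: support_span_def)
  let ?q = "Poly_Mapping.single q (1::'k)"
  show "derivation B x (alg_mult Q B ?q v) = alg_mult Q B (derivation B x ?q) v + alg_mult Q B ?q (derivation B x v)"
  proof (rule linear_eqI[where f = "\<lambda>v. derivation B x (alg_mult Q B ?q v)"])
    fix p assume "p \<in> Poly_Mapping.keys v"
    then have p: "p \<in> B" using uv by (auto simp: support_span_def)
    let ?p = "Poly_Mapping.single p (1::'k)"
    have pq: "p \<in> paths Q" "q \<in> paths Q" and xs: "x \<in> arrow_cochains Q Z"
      using p q x basis_subset_paths by (auto simp: cocycles_iff)
    show "derivation B x (alg_mult Q B ?q ?p) = alg_mult Q B (derivation B x ?q) ?p + alg_mult Q B ?q (derivation B x ?p)"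
    proof (cases "path_target Q p = fst q")
      case True
      then have "path_comp q p \<in> paths Q" using pq by (simp add: path_comp_iff)
      then show ?thesis
        using True act_comp[OF xs pq True] act_derivation[OF x, of "path_comp q p"] p q
        by (simp add: mult_single reduced_basis)
    next
      case False
      have "?q \<in> support_span (parallels q)" "?p \<in> support_span (parallels p)"
        using p q by (auto simp: parallels_def intro!: single_in_support_span)
      then have "alg_mult Q B (act B q x) ?p = 0" "alg_mult Q B ?q (act B p x) = 0"
        using False act_in_parallels[OF xs] pq mult_not_composable by blast+
      then show ?thesis
        using False by (simp add: mult_single linear_zero[OF is_linear_derivation])
    qed
  qed (intro is_linear_plus is_linear_comp[OF is_linear_derivation] is_linear_comp[OF is_linear_mult_right]
      is_linear_mult_right is_linear_derivation)+
qed (intro is_linear_plus is_linear_comp[OF is_linear_derivation] is_linear_comp[OF is_linear_mult_left]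
      is_linear_mult_left is_linear_derivation)+

lemma derivation_in_span: "derivation B x u \<in> algebra_span"
  unfolding derivation_def
  by (rule linear_extension_in_support_span[of _ UNIV]) (auto simp: act_in_span support_span_def[of UNIV])

lemma derivation_in_loops:
  assumes "x \<in> arrow_cochains Q Z" "u \<in> support_span loops"
  shows "derivation B x u \<in> support_span loops"
  unfolding derivation_def
proof (rule linear_extension_in_support_span[OF assms(2)])
  fix q assume "q \<in> loops"
  then have "q \<in> paths Q" "parallels q \<subseteq> loops"
    using basis_subset_paths by (auto simp: parallels_def loops_def)
  then show "act B q x \<in> support_span loops"
    using act_in_parallels[OF assms(1), of q] by (auto simp: support_span_def)
qed

lemma tag_in_cochains:
  assumes "b \<in> arcs Q" "u \<in> support_span (parallels (arrow_path Q b))"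
  shows "tag (arrow_path Q b) u \<in> arrow_cochains Q Z"
  unfolding parallel_span_eq tag_def using assms
  by (auto intro!: linear_extension_in_support_span basis_pair_in_support_span simp: parallels_def arrow_paths_def)

lemma act_tag:
  assumes "b \<in> arcs Q" "c \<in> arcs Q" "u \<in> support_span (parallels (arrow_path Q c))"
  shows "act B (arrow_path Q b) (tag (arrow_path Q c) u) = (if b = c then u else 0)"
  by (rule poly_mapping_eqI)
    (use assms in \<open>auto simp: lookup_act_arrow[OF tag_in_cochains] lookup_tag arrow_path_inj\<close>)

lemma act_basis_pair:
  assumes "b \<in> arcs Q" "c \<in> arcs Q" "g \<in> parallels (arrow_path Q c)"
  shows "act B (arrow_path Q b) (basis_pair (arrow_path Q c) g) = (if b = c then Poly_Mapping.single g 1 else 0)"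
  using act_tag[OF assms(1,2) single_in_support_span[OF assms(3), of 1]] by (simp add: tag_def)

lemma basis_pair_in_cochains:
  assumes "c \<in> arcs Q" "g \<in> parallels (arrow_path Q c)"
  shows "basis_pair (arrow_path Q c) g \<in> arrow_cochains Q Z"
  using tag_in_cochains[OF assms(1) single_in_support_span[OF assms(2), of 1]] by (simp add: tag_def)

lemma cochain_keyE':
  assumes "x \<in> arrow_cochains Q Z" "k \<in> Poly_Mapping.keys x"
  obtains b q where "k = (arrow_path Q b, q)" "b \<in> arcs Q" "q \<in> parallels (arrow_path Q b)"
  using assms by (elim cochain_keyE) (auto simp: parallels_def)

text \<open>The bracket substitutes each pair into the other. Evaluated on an arrow, the two
  substitutions are the two orders of composing the derivations; by bilinearity single pairs
  suffice.\<close>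

lemma bracket_cochain:
  fixes x y :: "('k::field, 'v, 'a) cochain"
  assumes x: "x \<in> arrow_cochains Q Z" and y: "y \<in> arrow_cochains Q Z"
  shows bracket_in_cochains: "cochain_bracket B x y \<in> arrow_cochains Q Z"
    and act_bracket: "b \<in> arcs Q \<Longrightarrow> act B (arrow_path Q b) (cochain_bracket B x y) =
      derivation B x (act B (arrow_path Q b) y) - derivation B y (act B (arrow_path Q b) x)"
proof -
  have basis: "cochain_bracket B (Poly_Mapping.single k (1::'k)) (Poly_Mapping.single l 1) \<in> arrow_cochains Q Z \<and>
    (\<forall>b\<in>arcs Q. act B (arrow_path Q b) (cochain_bracket B (Poly_Mapping.single k (1::'k)) (Poly_Mapping.single l 1)) =
      derivation B (Poly_Mapping.single k 1) (act B (arrow_path Q b) (Poly_Mapping.single l 1))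
      - derivation B (Poly_Mapping.single l 1) (act B (arrow_path Q b) (Poly_Mapping.single k 1)))"
    if kx: "k \<in> Poly_Mapping.keys x" and ly: "l \<in> Poly_Mapping.keys y" for k l
  proof -
    obtain c g where k: "k = (arrow_path Q c, g)" "c \<in> arcs Q" "g \<in> parallels (arrow_path Q c)"
      using cochain_keyE'[OF x kx] .
    obtain d h where l: "l = (arrow_path Q d, h)" "d \<in> arcs Q" "h \<in> parallels (arrow_path Q d)"
      using cochain_keyE'[OF y ly] .
    let ?k = "Poly_Mapping.single k (1::'k)" and ?l = "Poly_Mapping.single l (1::'k)"
    have ks: "?k \<in> arrow_cochains Q Z" and ls: "?l \<in> arrow_cochains Q Z"
      unfolding k(1) l(1) using k l by (auto intro: basis_pair_in_cochains[unfolded basis_pair_def])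
    have gh: "g \<in> paths Q" "h \<in> paths Q" "parallels g = parallels (arrow_path Q c)" "parallels h = parallels (arrow_path Q d)"
      using k(3) l(3) basis_subset_paths by (auto simp: parallels_def)
    have 1: "cochain_bracket B ?k ?l = tag (arrow_path Q d) (act B h ?k) - tag (arrow_path Q c) (act B g ?l)"
      by (simp add: cochain_bracket_def replacement_sum_eq_tag k(1) l(1))
    have "act B h ?k \<in> support_span (parallels (arrow_path Q d))" "act B g ?l \<in> support_span (parallels (arrow_path Q c))"
      using act_in_parallels[OF ks gh(2)] act_in_parallels[OF ls gh(1)] gh by simp_all
    note 2 = this
    have "act B (arrow_path Q b) ?k = (if b = c then Poly_Mapping.single g 1 else 0)"
      "act B (arrow_path Q b) ?l = (if b = d then Poly_Mapping.single h 1 else 0)" if "b \<in> arcs Q" for b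
      unfolding k(1) l(1)
      by (simp_all add: act_basis_pair[unfolded basis_pair_def, OF that k(2,3)]
          act_basis_pair[unfolded basis_pair_def, OF that l(2,3)])
    then have "\<forall>b\<in>arcs Q. act B (arrow_path Q b) (cochain_bracket B ?k ?l) =
      derivation B ?k (act B (arrow_path Q b) ?l) - derivation B ?l (act B (arrow_path Q b) ?k)"
      unfolding 1 by (auto simp: linear_diff[OF is_linear_act] act_tag k(2) l(2) 2 linear_zero[OF is_linear_derivation])
    moreover have "cochain_bracket B ?k ?l \<in> arrow_cochains Q Z"
      unfolding 1 using tag_in_cochains[OF l(2) 2(1)] tag_in_cochains[OF k(2) 2(2)]
      by (auto simp: parallel_span_eq intro: support_span_rules)
    ultimately show ?thesis by blast
  qed
  have closed: "cochain_bracket B (Poly_Mapping.single k (1::'k)) y \<in> arrow_cochains Q Z" if "k \<in> Poly_Mapping.keys x" for k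
    by (rule linear_closed[OF is_linear_bracket_right])
      (use basis that in \<open>auto simp: parallel_span_eq intro: support_span_rules\<close>)
  show "cochain_bracket B x y \<in> arrow_cochains Q Z"
    by (rule linear_closed[OF is_linear_bracket_left])
      (use closed in \<open>auto simp: parallel_span_eq intro: support_span_rules\<close>)
  assume b: "b \<in> arcs Q"
  show "act B (arrow_path Q b) (cochain_bracket B x y) =
      derivation B x (act B (arrow_path Q b) y) - derivation B y (act B (arrow_path Q b) x)"
  proof (rule linear_eqI[where f = "\<lambda>x. act B (arrow_path Q b) (cochain_bracket B x y)"])
    fix k assume k: "k \<in> Poly_Mapping.keys x"
    let ?k = "Poly_Mapping.single k (1::'k)"
    show "act B (arrow_path Q b) (cochain_bracket B ?k y) =
      derivation B ?k (act B (arrow_path Q b) y) - derivation B y (act B (arrow_path Q b) ?k)"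
    proof (rule linear_eqI[where f = "\<lambda>y. act B (arrow_path Q b) (cochain_bracket B ?k y)"])
    qed (use basis[OF k] b in \<open>auto intro!: is_linear_minus is_linear_comp[OF is_linear_act is_linear_bracket_right]
      is_linear_comp[OF is_linear_derivation is_linear_act] is_linear_derivation_left\<close>)
  qed (auto intro!: is_linear_minus is_linear_comp[OF is_linear_act is_linear_bracket_left]
      is_linear_comp[OF is_linear_derivation is_linear_act] is_linear_derivation_left)
qed

lemma bracket_antisym:
  assumes "x \<in> arrow_cochains Q Z" "y \<in> arrow_cochains Q Z"
  shows "cochain_bracket B y x = - cochain_bracket B x y"
proof (rule cochain_eqI)
  show "- cochain_bracket B x y \<in> arrow_cochains Q Z"
    using bracket_in_cochains[OF assms] by (simp add: parallel_span_eq support_span_rules)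
qed (use assms in \<open>auto simp: act_bracket bracket_in_cochains linear_uminus[OF is_linear_act]\<close>)

lemma cocycle_cochain: "x \<in> carrier (cocycles Q Z) \<Longrightarrow> x \<in> arrow_cochains Q Z"
  by (simp add: cocycles_iff)

text \<open>Applying Leibniz twice produces mixed terms, in which one derivation hits
  \<open>b\<close> and the other hits \<open>q\<close>; they cancel in the commutator. The cocycle
  hypotheses allow the derivations to be applied to products in A.\<close>

lemma act_bracket_path:
  assumes x: "x \<in> carrier (cocycles Q Z)" and y: "y \<in> carrier (cocycles Q Z)" and p: "p \<in> paths Q"
  shows "act B p (cochain_bracket B x y) = derivation B x (act B p y) - derivation B y (act B p x)"
  using p
proof (induction rule: paths_induct)
  case (trivial v)
  then show ?case by (simp add: linear_zero[OF is_linear_derivation])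
next
  case (step b q)
  note xs = cocycle_cochain[OF x] and ys = cocycle_cochain[OF y]
  note comp = act_comp[OF _ step(2) arrow_path_in_paths[OF step(1)], simplified, OF _ step(3)]
  have red: "act B q x = derivation B x (reduced B q)" "act B q y = derivation B y (reduced B q)"
    "act B (arrow_path Q b) x = derivation B x (reduced B (arrow_path Q b))"
    "act B (arrow_path Q b) y = derivation B y (reduced B (arrow_path Q b))"
    using act_derivation[OF x] act_derivation[OF y] step arrow_path_in_paths by auto
  show ?case
    by (simp add: comp[OF bracket_in_cochains[OF xs ys]] comp[OF xs] comp[OF ys] act_bracket[OF xs ys step(1)]
        step.IH linear_add[OF is_linear_derivation] derivation_mult[OF x] derivation_mult[OF y] act_in_span reduced_in_span
        mult_linear_rules) (simp add: red algebra_simps)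
qed

lemma bracket_cocycle:
  assumes x: "x \<in> carrier (cocycles Q Z)" and y: "y \<in> carrier (cocycles Q Z)"
  shows "cochain_bracket B x y \<in> carrier (cocycles Q Z)"
proof -
  have "r \<in> paths Q" "act B r x = 0" "act B r y = 0" if "r \<in> Z" for r
    using that x y relations_subset by (auto simp: cocycles_iff)
  then show ?thesis
    using act_bracket_path[OF x y] bracket_in_cochains x y
    by (auto simp: cocycles_iff linear_zero[OF is_linear_derivation])
qed

section \<open>Coboundaries as inner derivations\<close>

lemma loop_cochain_keyE:
  assumes "u \<in> loop_cochains" "k \<in> Poly_Mapping.keys u"
  obtains p where "k = ((fst p, []), p)" "p \<in> loops"
proof -
  have "k \<in> {(p, q). p \<in> trivial_paths Q \<and> q \<in> B \<and> fst p = fst q \<and> path_target Q p = path_target Q q}"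
    using assms by (auto simp: parallel_span_def)
  then show ?thesis using that by (auto simp: trivial_paths_def loops_def)
qed

lemma loop_algebra_in_loops: "u \<in> loop_cochains \<Longrightarrow> loop_algebra u \<in> support_span loops"
  unfolding loop_algebra_def parallel_span_eq
  by (erule linear_extension_in_support_span) (auto simp: trivial_paths_def loops_def intro!: single_in_support_span)

lemma algebra_loop_in_cochains:
  assumes "v \<in> support_span loops"
  shows "algebra_loop v \<in> loop_cochains"
  unfolding algebra_loop_def parallel_span_eq
proof (rule linear_extension_in_support_span[OF assms])
  fix p assume p: "p \<in> loops"
  then have "p \<in> paths Q" using basis_subset_paths by (auto simp: loops_def)
  then have "fst p \<in> verts Q" unfolding paths_iff by (rule awalk_hd_in_verts)
  then show "basis_pair (fst p, []) p \<in> support_span {(p, q). p \<in> trivial_paths Q \<and> q \<in> B \<and>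
      fst p = fst q \<and> path_target Q p = path_target Q q}"
    using p by (auto simp: trivial_paths_def loops_def intro!: basis_pair_in_support_span)
qed

text \<open>With a cochain of degree zero read as an element \<open>u\<close> of A, the two sums
  defining \<open>delta0\<close> are the products \<open>b u\<close> and \<open>u b\<close>,
  restricted to nonzero paths: \<open>delta0\<close> gives an inner derivation.\<close>

lemma delta0_cochain:
  fixes u :: "('k::field, 'v, 'a) cochain"
  assumes u: "u \<in> loop_cochains"
  shows delta0_in_cochains: "delta0 Q Z u \<in> arrow_cochains Q Z"
    and act_delta0_arrow: "b \<in> arcs Q \<Longrightarrow> act B (arrow_path Q b) (delta0 Q Z u) =
      alg_mult Q B (reduced B (arrow_path Q b)) (loop_algebra u) - alg_mult Q B (loop_algebra u) (reduced B (arrow_path Q b))"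
proof -
  have basis: "delta0 Q Z (Poly_Mapping.single k (1::'k)) \<in> arrow_cochains Q Z \<and>
    (\<forall>b\<in>arcs Q. act B (arrow_path Q b) (delta0 Q Z (Poly_Mapping.single k (1::'k))) =
      alg_mult Q B (reduced B (arrow_path Q b)) (loop_algebra (Poly_Mapping.single k 1))
      - alg_mult Q B (loop_algebra (Poly_Mapping.single k 1)) (reduced B (arrow_path Q b)))"
    if ku: "k \<in> Poly_Mapping.keys u" for k
  proof -
    obtain p where k: "k = ((fst p, []), p)" and p: "p \<in> loops"
      using loop_cochain_keyE[OF u ku] .
    have pB: "p \<in> B" "path_target Q p = fst p" "p \<in> paths Q" using p basis_subset_paths by (auto simp: loops_def)
    define A1 where "A1 = {b \<in> arcs Q. tail Q b = fst p \<and> path_comp (arrow_path Q b) p \<in> B}"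
    define A2 where "A2 = {b \<in> arcs Q. head Q b = fst p \<and> path_comp p (arrow_path Q b) \<in> B}"
    have inj: "inj_on (arrow_path Q) A" for A
      by (auto simp: inj_on_def arrow_path_def)
    have "{a. a \<in> arrow_paths Q \<and> fst a = fst p \<and> path_comp a p \<in> B} = arrow_path Q ` A1"
      "{a. a \<in> arrow_paths Q \<and> path_target Q a = fst p \<and> path_comp p a \<in> B} = arrow_path Q ` A2"
      by (auto simp: A1_def A2_def arrow_paths_def)
    then have d: "delta0 Q Z (Poly_Mapping.single k (1::'k)) =
        (\<Sum>b\<in>A1. basis_pair (arrow_path Q b) (path_comp (arrow_path Q b) p))
        - (\<Sum>b\<in>A2. basis_pair (arrow_path Q b) (path_comp p (arrow_path Q b)))"
      by (simp add: delta0_def k sum.reindex[OF inj] o_def)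
    have A1: "b \<in> A1 \<Longrightarrow> path_comp (arrow_path Q b) p \<in> parallels (arrow_path Q b)"
      and A2: "b \<in> A2 \<Longrightarrow> path_comp p (arrow_path Q b) \<in> parallels (arrow_path Q b)" for b
      using pB by (auto simp: A1_def A2_def parallels_def path_target_comp)
    have fin: "finite A1" "finite A2" "A1 \<subseteq> arcs Q" "A2 \<subseteq> arcs Q" by (auto simp: A1_def A2_def)
    have "delta0 Q Z (Poly_Mapping.single k (1::'k)) \<in> arrow_cochains Q Z"
      unfolding d using basis_pair_in_cochains[OF _ A1] basis_pair_in_cochains[OF _ A2] fin(3,4)
      by (auto simp: parallel_span_eq intro!: support_span_rules support_span_sum)
    moreover have "act B (arrow_path Q b) (delta0 Q Z (Poly_Mapping.single k (1::'k))) =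
      alg_mult Q B (reduced B (arrow_path Q b)) (loop_algebra (Poly_Mapping.single k 1))
      - alg_mult Q B (loop_algebra (Poly_Mapping.single k 1)) (reduced B (arrow_path Q b))" if b: "b \<in> arcs Q" for b
    proof -
      have "(\<Sum>c\<in>A1. act B (arrow_path Q b) (basis_pair (arrow_path Q c) (path_comp (arrow_path Q c) p))) =
          (\<Sum>c\<in>A1. if b = c then Poly_Mapping.single (path_comp (arrow_path Q c) p) (1::'k) else 0)"
        "(\<Sum>c\<in>A2. act B (arrow_path Q b) (basis_pair (arrow_path Q c) (path_comp p (arrow_path Q c)))) =
          (\<Sum>c\<in>A2. if b = c then Poly_Mapping.single (path_comp p (arrow_path Q c)) (1::'k) else 0)"
        using A1 A2 b fin by (auto intro!: sum.cong simp: act_basis_pair subset_iff)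
      then show ?thesis
        using b pB fin(1,2) arrow_path_in_basis[OF b]
        unfolding d by (auto simp: linear_diff[OF is_linear_act] linear_sum[OF is_linear_act] loop_algebra_def k
            reduced_basis mult_single A1_def A2_def reduced_def)
    qed
    ultimately show ?thesis by blast
  qed
  show "delta0 Q Z u \<in> arrow_cochains Q Z"
    by (rule linear_closed[OF is_linear_delta0])
      (use basis in \<open>auto simp: parallel_span_eq intro: support_span_rules\<close>)
  assume b: "b \<in> arcs Q"
  have lin: "is_linear (loop_algebra :: _ \<Rightarrow> _ \<Rightarrow>\<^sub>0 'k)" unfolding loop_algebra_def by (rule is_linear_extension)
  show "act B (arrow_path Q b) (delta0 Q Z u) =
      alg_mult Q B (reduced B (arrow_path Q b)) (loop_algebra u) - alg_mult Q B (loop_algebra u) (reduced B (arrow_path Q b))"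
    by (rule linear_eqI[where f = "\<lambda>u. act B (arrow_path Q b) (delta0 Q Z u)"])
      (use basis b in \<open>auto intro!: is_linear_minus is_linear_comp[OF is_linear_act is_linear_delta0]
        is_linear_comp[OF is_linear_mult_left lin] is_linear_comp[OF is_linear_mult_right lin]\<close>)
qed

lemma loops_span_subset: "support_span loops \<subseteq> algebra_span"
  by (auto simp: loops_def support_span_def)

text \<open>Both sides obey the Leibniz rule; for the commutator this is associativity. At a vertex
  both sides are zero, because a combination of closed paths commutes with every trivial
  path.\<close>

lemma act_delta0:
  fixes u :: "('k::field, 'v, 'a) cochain"
  assumes u: "u \<in> loop_cochains" and p: "p \<in> paths Q"
  shows "act B p (delta0 Q Z u) =
    alg_mult Q B (reduced B p) (loop_algebra u) - alg_mult Q B (loop_algebra u) (reduced B p)"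
  using p
proof (induction rule: paths_induct)
  case (trivial y)
  have y: "(y, []) \<in> B" using trivial by (simp add: short_path_in_basis trivial_in_paths)
  have "alg_mult Q B (reduced B (y, [])) v = alg_mult Q B v (reduced B (y, []))"
    if "v \<in> support_span loops" for v :: "_ \<Rightarrow>\<^sub>0 'k"
    by (rule linear_eqI[OF is_linear_mult_right is_linear_mult_left])
      (use that y in \<open>auto simp: support_span_def loops_def reduced_basis mult_single path_comp_def\<close>)
  then show ?case using loop_algebra_in_loops[OF u] by simp
next
  case (step b q)
  have "loop_algebra u \<in> algebra_span" using loop_algebra_in_loops[OF u] loops_span_subset by blast
  then have "alg_mult Q B (alg_mult Q B (reduced B (arrow_path Q b)) (loop_algebra u)) (reduced B q) =
      alg_mult Q B (reduced B (arrow_path Q b)) (alg_mult Q B (loop_algebra u) (reduced B q))"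
    "alg_mult Q B (alg_mult Q B (loop_algebra u) (reduced B (arrow_path Q b))) (reduced B q) =
      alg_mult Q B (loop_algebra u) (alg_mult Q B (reduced B (arrow_path Q b)) (reduced B q))"
    "alg_mult Q B (alg_mult Q B (reduced B (arrow_path Q b)) (reduced B q)) (loop_algebra u) =
      alg_mult Q B (reduced B (arrow_path Q b)) (alg_mult Q B (reduced B q) (loop_algebra u))"
    by (simp_all add: mult_assoc reduced_in_span)
  moreover have "alg_mult Q B (reduced B (arrow_path Q b)) (reduced B q) = (reduced B (path_comp (arrow_path Q b) q) :: _ \<Rightarrow>\<^sub>0 'k)"
    by (rule mult_reduced) (simp add: step)
  ultimately show ?case
    using act_comp[OF delta0_in_cochains[OF u] step(2) arrow_path_in_paths[OF step(1)]] step
    by (simp add: act_delta0_arrow[OF u] mult_linear_rules)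
qed

lemma coboundary_cocycle:
  assumes "x \<in> coboundaries Q Z"
  shows "x \<in> carrier (cocycles Q Z)"
proof -
  obtain u where u: "u \<in> loop_cochains" "x = delta0 Q Z u" using assms by (auto simp: coboundaries_def)
  have "r \<in> paths Q \<and> reduced B r = (0 :: _ \<Rightarrow>\<^sub>0 'b)" if "r \<in> Z" for r
    using that relations_subset subpath_refl by (fastforce simp: reduced_def basis_paths_def ideal_paths_def)
  then show ?thesis
    using act_delta0[OF u(1)] delta0_in_cochains[OF u(1)] u(2) by (auto simp: cocycles_iff mult_linear_rules)
qed

text \<open>The commutator of a derivation \<open>D\<close> with the inner derivation of
  \<open>l\<close> is the inner derivation of \<open>D l\<close>. As \<open>D\<close> maps closed
  paths to combinations of closed paths, \<open>D l\<close> is again a cochain of degree zero; this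
  is \<open>w\<close>.\<close>

lemma bracket_coboundary:
  assumes x: "x \<in> carrier (cocycles Q Z)" and y: "y \<in> coboundaries Q Z"
  shows "cochain_bracket B x y \<in> coboundaries Q Z" "cochain_bracket B y x \<in> coboundaries Q Z"
proof -
  obtain u where u: "u \<in> loop_cochains" "y = delta0 Q Z u" using y by (auto simp: coboundaries_def)
  have ys: "y \<in> arrow_cochains Q Z" and xs: "x \<in> arrow_cochains Q Z"
    using u delta0_in_cochains x by (auto simp: cocycles_iff)
  define l where "l = loop_algebra u"
  have l: "l \<in> support_span loops" "l \<in> algebra_span"
    using loop_algebra_in_loops[OF u(1)] loops_span_subset by (auto simp: l_def)
  define w where "w = algebra_loop (derivation B x l)"
  have w: "w \<in> loop_cochains" "loop_algebra w = derivation B x l"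
    using derivation_in_loops[OF xs l(1)] by (auto simp: w_def algebra_loop_in_cochains loop_algebra_inverse)
  have dy: "derivation B y v = alg_mult Q B v l - alg_mult Q B l v" if "v \<in> algebra_span" for v
  proof (rule linear_eqI[OF is_linear_derivation])
    fix p assume "p \<in> Poly_Mapping.keys v"
    then have "p \<in> B" "p \<in> paths Q" using that basis_subset_paths by (auto simp: support_span_def)
    then show "derivation B y (Poly_Mapping.single p 1) =
        alg_mult Q B (Poly_Mapping.single p 1) l - alg_mult Q B l (Poly_Mapping.single p 1)"
      using act_delta0[OF u(1), of p] by (simp add: u(2) l_def reduced_basis)
  qed (intro is_linear_minus is_linear_mult_left is_linear_mult_right)
  have "cochain_bracket B x y = delta0 Q Z w"
  proof (rule cochain_eqI[OF bracket_in_cochains[OF xs ys] delta0_in_cochains[OF w(1)]])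
    fix b assume b: "b \<in> arcs Q"
    have "act B (arrow_path Q b) x = derivation B x (reduced B (arrow_path Q b))"
      by (rule act_derivation[OF x arrow_path_in_paths[OF b]])
    then show "act B (arrow_path Q b) (cochain_bracket B x y) = act B (arrow_path Q b) (delta0 Q Z w)"
      using act_bracket[OF xs ys b] act_delta0_arrow[OF u(1) b] act_delta0_arrow[OF w(1) b]
      by (simp add: u(2)[symmetric] l_def[symmetric] w(2) linear_diff[OF is_linear_derivation] derivation_mult[OF x]
          l(2) reduced_in_span dy derivation_in_span)
  qed
  then show 1: "cochain_bracket B x y \<in> coboundaries Q Z" using w(1) by (auto simp: coboundaries_def)
  have "- w \<in> loop_cochains" using w(1) by (simp add: parallel_span_eq support_span_rules)
  then show "cochain_bracket B y x \<in> coboundaries Q Z"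
    using bracket_antisym[OF xs ys] \<open>cochain_bracket B x y = _\<close>
    by (auto simp: coboundaries_def linear_uminus[OF is_linear_delta0, symmetric])
qed

end

section \<open>Quotients of nonassociative algebras\<close>

text \<open>The structure common to cocycles, \<open>HH1\<close> and \<open>Hom_add\<close>, so that
  one quotient construction and one isomorphism theorem serve both rows of the diagram.\<close>

locale nonassoc_algebra = abelian_group M
  for M :: "('k::field, 'm) module" (structure) +
  assumes smult_closed [intro, simp]: "x \<in> carrier M \<Longrightarrow> c \<odot>\<^bsub>M\<^esub> x \<in> carrier M"
    and smult_add_left: "x \<in> carrier M \<Longrightarrow> (c + d) \<odot>\<^bsub>M\<^esub> x = c \<odot>\<^bsub>M\<^esub> x \<oplus> d \<odot>\<^bsub>M\<^esub> x"
    and smult_add_right: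
      "x \<in> carrier M \<Longrightarrow> y \<in> carrier M \<Longrightarrow> c \<odot>\<^bsub>M\<^esub> (x \<oplus> y) = c \<odot>\<^bsub>M\<^esub> x \<oplus> c \<odot>\<^bsub>M\<^esub> y"
    and smult_assoc: "x \<in> carrier M \<Longrightarrow> (c * d) \<odot>\<^bsub>M\<^esub> x = c \<odot>\<^bsub>M\<^esub> (d \<odot>\<^bsub>M\<^esub> x)"
    and smult_one [simp]: "x \<in> carrier M \<Longrightarrow> 1 \<odot>\<^bsub>M\<^esub> x = x"
    and mult_closed [intro, simp]: "x \<in> carrier M \<Longrightarrow> y \<in> carrier M \<Longrightarrow> x \<otimes> y \<in> carrier M"
    and mult_add_left:
      "x \<in> carrier M \<Longrightarrow> y \<in> carrier M \<Longrightarrow> z \<in> carrier M \<Longrightarrow> (x \<oplus> y) \<otimes> z = x \<otimes> z \<oplus> y \<otimes> z"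
    and mult_add_right:
      "x \<in> carrier M \<Longrightarrow> y \<in> carrier M \<Longrightarrow> z \<in> carrier M \<Longrightarrow> x \<otimes> (y \<oplus> z) = x \<otimes> y \<oplus> x \<otimes> z"
    and mult_smult_left:
      "x \<in> carrier M \<Longrightarrow> y \<in> carrier M \<Longrightarrow> (c \<odot>\<^bsub>M\<^esub> x) \<otimes> y = c \<odot>\<^bsub>M\<^esub> (x \<otimes> y)"
    and mult_smult_right:
      "x \<in> carrier M \<Longrightarrow> y \<in> carrier M \<Longrightarrow> x \<otimes> (c \<odot>\<^bsub>M\<^esub> y) = c \<odot>\<^bsub>M\<^esub> (x \<otimes> y)"
begin

lemma smult_zero_left [simp]: "x \<in> carrier M \<Longrightarrow> 0 \<odot>\<^bsub>M\<^esub> x = \<zero>"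
  using smult_add_left[of x 0 0] by (metis add.l_cancel_one add_0 smult_closed)

lemma smult_zero_right [simp]: "c \<odot>\<^bsub>M\<^esub> \<zero> = \<zero>"
  using smult_assoc[of \<zero> c 0] smult_zero_left[of \<zero>] by simp

lemma smult_minus: "x \<in> carrier M \<Longrightarrow> (- c) \<odot>\<^bsub>M\<^esub> x = \<ominus> (c \<odot>\<^bsub>M\<^esub> x)"
  using smult_add_left[of x "- c" c] by (metis add.inv_equality add.left_inverse smult_closed smult_zero_left)

end

locale nonassoc_ideal = nonassoc_algebra M
  for M :: "('k::field, 'm) module" (structure) +
  fixes N :: "'m set"
  assumes ideal_subset: "N \<subseteq> carrier M"
    and ideal_zero: "\<zero> \<in> N"
    and ideal_add: "x \<in> N \<Longrightarrow> y \<in> N \<Longrightarrow> x \<oplus> y \<in> N"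
    and ideal_smult: "x \<in> N \<Longrightarrow> c \<odot>\<^bsub>M\<^esub> x \<in> N"
    and ideal_mult_left: "x \<in> N \<Longrightarrow> y \<in> carrier M \<Longrightarrow> x \<otimes> y \<in> N"
    and ideal_mult_right: "x \<in> N \<Longrightarrow> y \<in> carrier M \<Longrightarrow> y \<otimes> x \<in> N"

text \<open>Negation is scaling by -1, so an ideal is an additive subgroup and the coset calculus of
  HOL-Algebra applies.\<close>

sublocale nonassoc_ideal \<subseteq> abelian_subgroup N M
proof (rule abelian_subgroupI3)
  show "additive_subgroup N M"
  proof (rule additive_subgroup.intro, rule add.subgroupI)
    show "\<ominus> x \<in> N" if "x \<in> N" for x
      using that ideal_smult[of x "- 1"] smult_minus[of x 1] ideal_subset by auto
  qed (use ideal_subset ideal_zero ideal_add in auto)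
qed unfold_locales

context nonassoc_ideal
begin

abbreviation "MN \<equiv> quotient_module M N"

lemma carrier_quotient: "carrier MN = (+>) N ` carrier M"
  by (auto simp: quotient_module_def A_RCOSETS_def')

lemma coset_elem: "x' \<in> N +> x \<longleftrightarrow> (\<exists>n\<in>N. x' = n \<oplus> x)"
  by (auto simp: a_r_coset_def')

lemma coset_eqI: "x \<in> carrier M \<Longrightarrow> x' \<in> N +> x \<Longrightarrow> N +> x' = N +> x"
  using a_repr_independence[of x' N x] a_subgroup by simp

lemma coset_eq:
  assumes x: "x \<in> carrier M" and y: "y \<in> carrier M"
  shows "N +> x = N +> y \<longleftrightarrow> x \<ominus> y \<in> N"
proof -
  have "N +> x = N +> y \<longleftrightarrow> x \<in> N +> y"
    using a_rcos_self[OF x] coset_eqI[OF y, of x] by auto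
  also have "\<dots> \<longleftrightarrow> x \<ominus> y \<in> N"
  proof
    assume "x \<in> N +> y"
    then obtain n where n: "n \<in> N" "x = n \<oplus> y" by (auto simp: coset_elem)
    then have "x \<ominus> y = n" using ideal_subset y by (simp add: subset_iff a_minus_def a_assoc r_neg)
    then show "x \<ominus> y \<in> N" using n by simp
  next
    assume "x \<ominus> y \<in> N"
    moreover have "x = (x \<ominus> y) \<oplus> y" using x y by (simp add: a_minus_def a_assoc l_neg)
    ultimately show "x \<in> N +> y" by (auto simp: coset_elem)
  qed
  finally show ?thesis .
qed

lemma coset_zero: "x \<in> carrier M \<Longrightarrow> N +> x = N \<longleftrightarrow> x \<in> N"
  using a_rcos_self[of x] coset_eqI[OF add.one_closed, of x] a_coset_add_zero[OF ideal_subset] by auto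

lemma quotient_zero: "\<zero>\<^bsub>MN\<^esub> = N"
  by (simp add: quotient_module_def)

lemma quotient_add:
  assumes "x \<in> carrier M" "y \<in> carrier M"
  shows "(N +> x) \<oplus>\<^bsub>MN\<^esub> (N +> y) = N +> (x \<oplus> y)"
  using assms by (simp add: quotient_module_def a_rcos_sum)

text \<open>The record takes a union over all representatives. Their multiples differ by elements of
  \<open>N\<close>, so this is a union of copies of a single coset.\<close>

lemma quotient_smult:
  assumes "x \<in> carrier M"
  shows "c \<odot>\<^bsub>MN\<^esub> (N +> x) = N +> (c \<odot>\<^bsub>M\<^esub> x)"
proof -
  have "N +> (c \<odot>\<^bsub>M\<^esub> x') = N +> (c \<odot>\<^bsub>M\<^esub> x)" if x': "x' \<in> N +> x" for x'
  proof -
    obtain n where n: "n \<in> N" "x' = n \<oplus> x" using x' by (auto simp: coset_elem)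
    have nM: "n \<in> carrier M" using n ideal_subset by blast
    have "c \<odot>\<^bsub>M\<^esub> x' \<in> N +> (c \<odot>\<^bsub>M\<^esub> x)"
      using n nM assms by (auto simp: coset_elem smult_add_right intro: ideal_smult)
    then show ?thesis using coset_eqI assms by simp
  qed
  moreover have "N +> x \<noteq> {}" using a_rcos_self[OF assms] by blast
  ultimately have "(\<Union>x'\<in>N +> x. N +> (c \<odot>\<^bsub>M\<^esub> x')) = N +> (c \<odot>\<^bsub>M\<^esub> x)"
    by (intro SUP_eq_const) blast+
  then show ?thesis by (simp add: quotient_module_def)
qed

lemma quotient_mult:
  assumes x: "x \<in> carrier M" and y: "y \<in> carrier M"
  shows "(N +> x) \<otimes>\<^bsub>MN\<^esub> (N +> y) = N +> (x \<otimes> y)"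
proof -
  have same: "N +> (x' \<otimes> y') = N +> (x \<otimes> y)" if x'y': "x' \<in> N +> x" "y' \<in> N +> y" for x' y'
  proof -
    obtain n m where n: "n \<in> N" "x' = n \<oplus> x" and m: "m \<in> N" "y' = m \<oplus> y"
      using x'y' by (auto simp: coset_elem)
    have M: "n \<in> carrier M" "m \<in> carrier M" using n m ideal_subset by auto
    have y'M: "y' \<in> carrier M" using m M y by simp
    \<comment> \<open>The difference of \<open>x' y'\<close> and \<open>x y\<close> is split as
      \<open>n y' + x m\<close>, so that each term has one factor in \<open>N\<close>.\<close>
    have "x' \<otimes> y' = n \<otimes> y' \<oplus> x \<otimes> y'"
      unfolding n(2) by (rule mult_add_left[OF M(1) x y'M])
    also have "x \<otimes> y' = x \<otimes> m \<oplus> x \<otimes> y"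
      unfolding m(2) by (rule mult_add_right[OF x M(2) y])
    also have "n \<otimes> y' \<oplus> (x \<otimes> m \<oplus> x \<otimes> y) = (n \<otimes> y' \<oplus> x \<otimes> m) \<oplus> x \<otimes> y"
      using M x y y'M by (simp add: a_assoc)
    finally have "x' \<otimes> y' \<in> N +> (x \<otimes> y)"
      using ideal_add[OF ideal_mult_left[OF n(1) y'M] ideal_mult_right[OF m(1) x]]
      unfolding coset_elem by blast
    then show ?thesis using coset_eqI[of "x \<otimes> y"] x y by simp
  qed
  have ne: "N +> x \<noteq> {}" "N +> y \<noteq> {}" using a_rcos_self x y by blast+
  have "(\<Union>y'\<in>N +> y. N +> (x' \<otimes> y')) = N +> (x \<otimes> y)" if "x' \<in> N +> x" for x'
    by (rule SUP_eq_const[OF ne(2)]) (rule same[OF that])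
  then have "(\<Union>x'\<in>N +> x. \<Union>y'\<in>N +> y. N +> (x' \<otimes> y')) = N +> (x \<otimes> y)"
    by (rule SUP_eq_const[OF ne(1)])
  then show ?thesis by (simp add: quotient_module_def rcoset_mult_def)
qed

lemma quotient_nonassoc_algebra: "nonassoc_algebra MN"
proof -
  have "abelian_group MN"
  proof (rule abelian_groupI)
    fix C assume "C \<in> carrier MN"
    then obtain x where x: "x \<in> carrier M" "C = N +> x" by (auto simp: carrier_quotient)
    then have "(N +> \<ominus> x) \<oplus>\<^bsub>MN\<^esub> C = \<zero>\<^bsub>MN\<^esub>" "N +> \<ominus> x \<in> carrier MN"
      by (auto simp: carrier_quotient quotient_add l_neg quotient_zero coset_zero ideal_zero)
    then show "\<exists>D\<in>carrier MN. D \<oplus>\<^bsub>MN\<^esub> C = \<zero>\<^bsub>MN\<^esub>" by blast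
  next
    show "\<zero>\<^bsub>MN\<^esub> \<in> carrier MN"
      unfolding quotient_zero carrier_quotient using coset_zero[of \<zero>] ideal_zero by (intro image_eqI[of _ _ \<zero>]) simp_all
    then have "\<zero>\<^bsub>MN\<^esub> = N +> \<zero>" unfolding quotient_zero using coset_zero[of \<zero>] ideal_zero by simp
    then show "\<zero>\<^bsub>MN\<^esub> \<oplus>\<^bsub>MN\<^esub> C = C" if "C \<in> carrier MN" for C
      using that by (auto simp: carrier_quotient quotient_add)
  qed (auto simp: carrier_quotient quotient_add a_ac)
  then show ?thesis
    unfolding nonassoc_algebra_def nonassoc_algebra_axioms_def carrier_quotient
    by (auto simp: quotient_add quotient_smult quotient_mult smult_add_left smult_add_right smult_assoc
        mult_add_left mult_add_right mult_smult_left mult_smult_right)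
qed

lemma quotient_lift:
  assumes M': "nonassoc_algebra M'" and f: "f \<in> linear_maps M M'" and ker: "\<And>x. x \<in> N \<Longrightarrow> f x = \<zero>\<^bsub>M'\<^esub>"
  obtains g where "g \<in> linear_maps MN M'" "\<And>x. x \<in> carrier M \<Longrightarrow> g (N +> x) = f x"
proof -
  interpret M': nonassoc_algebra M' by fact
  have fc: "x \<in> carrier M \<Longrightarrow> f x \<in> carrier M'"
    and fadd: "x \<in> carrier M \<Longrightarrow> y \<in> carrier M \<Longrightarrow> f (x \<oplus> y) = f x \<oplus>\<^bsub>M'\<^esub> f y"
    and fs: "x \<in> carrier M \<Longrightarrow> f (c \<odot>\<^bsub>M\<^esub> x) = c \<odot>\<^bsub>M'\<^esub> f x" for x y c
    using f by (auto simp: linear_maps_def)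
  have const: "f x' = f x" if "x \<in> carrier M" "x' \<in> N +> x" for x x'
    using that ideal_subset fc ker by (auto simp: coset_elem fadd)
  define g where "g C = f (SOME x. x \<in> C)" for C
  have g: "g (N +> x) = f x" if "x \<in> carrier M" for x
    unfolding g_def using const[OF that] a_rcos_self[OF that] by (metis someI)
  have "g \<in> linear_maps MN M'"
    unfolding linear_maps_def carrier_quotient
    by (auto simp: g quotient_add quotient_smult fadd fs fc)
  then show ?thesis using that g by blast
qed

end

lemma linear_maps_zero:
  assumes "nonassoc_algebra M" "nonassoc_algebra M'" "f \<in> linear_maps M M'"
  shows "f \<zero>\<^bsub>M\<^esub> = \<zero>\<^bsub>M'\<^esub>"
proof -
  interpret M: nonassoc_algebra M by fact
  interpret M': nonassoc_algebra M' by fact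
  have f0: "f \<zero>\<^bsub>M\<^esub> \<in> carrier M'" using assms(3) by (auto simp: linear_maps_def)
  have "f (0 \<odot>\<^bsub>M\<^esub> \<zero>\<^bsub>M\<^esub>) = 0 \<odot>\<^bsub>M'\<^esub> f \<zero>\<^bsub>M\<^esub>"
    using assms(3) M.zero_closed unfolding linear_maps_def by blast
  then show ?thesis
    unfolding M.smult_zero_left[OF M.zero_closed] M'.smult_zero_left[OF f0] .
qed

lemma linear_maps_comp: "f \<in> linear_maps L M \<Longrightarrow> g \<in> linear_maps M N \<Longrightarrow> (\<lambda>x. g (f x)) \<in> linear_maps L N"
  by (simp add: linear_maps_def Pi_def)

lemma kernel_ideal:
  assumes "nonassoc_algebra M" "nonassoc_algebra M'" "f \<in> linear_maps M M'"
    and "\<And>x y. x \<in> carrier M \<Longrightarrow> y \<in> carrier M \<Longrightarrow> f (x \<otimes>\<^bsub>M\<^esub> y) = f x \<otimes>\<^bsub>M'\<^esub> f y"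
  shows "nonassoc_ideal M {x \<in> carrier M. f x = \<zero>\<^bsub>M'\<^esub>}"
proof -
  interpret M: nonassoc_algebra M by fact
  interpret M': nonassoc_algebra M' by fact
  have f: "x \<in> carrier M \<Longrightarrow> f x \<in> carrier M'" for x using assms(3) by (auto simp: linear_maps_def)
  have z: "\<zero>\<^bsub>M'\<^esub> \<otimes>\<^bsub>M'\<^esub> y = \<zero>\<^bsub>M'\<^esub>" "y \<otimes>\<^bsub>M'\<^esub> \<zero>\<^bsub>M'\<^esub> = \<zero>\<^bsub>M'\<^esub>" if "y \<in> carrier M'" for y
    using that M'.mult_smult_left[of "\<zero>\<^bsub>M'\<^esub>" y 0] M'.mult_smult_right[of y "\<zero>\<^bsub>M'\<^esub>" 0] by simp_all
  show ?thesis
    by unfold_locales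
      (use assms f linear_maps_zero[OF assms(1-3)] in \<open>auto simp: linear_maps_def z\<close>)
qed

text \<open>Applied twice below: to the restriction of homomorphisms along gluing, and to the gluing
  of cocycles.\<close>

lemma first_isomorphism:
  assumes "nonassoc_algebra M" "nonassoc_algebra M'" "f \<in> linear_maps M M'"
    and "\<And>x y. x \<in> carrier M \<Longrightarrow> y \<in> carrier M \<Longrightarrow> f (x \<otimes>\<^bsub>M\<^esub> y) = f x \<otimes>\<^bsub>M'\<^esub> f y"
    and surj: "f ` carrier M = carrier M'" and N: "N = {x \<in> carrier M. f x = \<zero>\<^bsub>M'\<^esub>}"
  obtains g where "g \<in> lie_isos (quotient_module M N) M'" "\<And>x. x \<in> carrier M \<Longrightarrow> g (N +>\<^bsub>M\<^esub> x) = f x"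
proof -
  interpret nonassoc_ideal M N unfolding N by (rule kernel_ideal[OF assms(1-4)])
  interpret M': nonassoc_algebra M' by fact
  have ker: "f x = \<zero>\<^bsub>M'\<^esub>" if "x \<in> N" for x using that unfolding N by simp
  obtain g where g: "g \<in> linear_maps (quotient_module M N) M'" "\<And>x. x \<in> carrier M \<Longrightarrow> g (N +>\<^bsub>M\<^esub> x) = f x"
    by (rule quotient_lift[OF assms(2,3) ker]) blast+
  have fc: "x \<in> carrier M \<Longrightarrow> f x \<in> carrier M'"
    and fadd: "x \<in> carrier M \<Longrightarrow> y \<in> carrier M \<Longrightarrow> f (x \<oplus>\<^bsub>M\<^esub> y) = f x \<oplus>\<^bsub>M'\<^esub> f y"
    and fs: "x \<in> carrier M \<Longrightarrow> f (c \<odot>\<^bsub>M\<^esub> x) = c \<odot>\<^bsub>M'\<^esub> f x" for x y c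
    using assms(3) by (auto simp: linear_maps_def)
  have "x \<ominus>\<^bsub>M\<^esub> y \<in> N" if "x \<in> carrier M" "y \<in> carrier M" "f x = f y" for x y
  proof -
    have "x \<ominus>\<^bsub>M\<^esub> y = x \<oplus>\<^bsub>M\<^esub> (- 1) \<odot>\<^bsub>M\<^esub> y"
      using that(2) by (simp add: a_minus_def smult_minus)
    then have "f (x \<ominus>\<^bsub>M\<^esub> y) = f x \<oplus>\<^bsub>M'\<^esub> (- 1) \<odot>\<^bsub>M'\<^esub> f y"
      using that(1,2) by (simp add: fadd fs)
    also have "\<dots> = \<zero>\<^bsub>M'\<^esub>"
      unfolding that(3) using fc[OF that(2)] by (simp add: M'.smult_minus M'.r_neg)
    finally show ?thesis unfolding N using that(1,2) by blast
  qed
  then have "inj_on g (carrier (quotient_module M N))"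
  proof (intro inj_onI)
    fix C D assume *: "C \<in> carrier (quotient_module M N)" "D \<in> carrier (quotient_module M N)" "g C = g D"
    then obtain x y where xy: "x \<in> carrier M" "y \<in> carrier M" "C = N +>\<^bsub>M\<^esub> x" "D = N +>\<^bsub>M\<^esub> y"
      unfolding carrier_quotient by blast
    then have "f x = f y" using *(3) g(2) by simp
    then show "C = D" using xy \<open>\<And>x y. _ \<Longrightarrow> _ \<Longrightarrow> f x = f y \<Longrightarrow> x \<ominus>\<^bsub>M\<^esub> y \<in> N\<close> coset_eq by simp
  qed
  moreover have "g ` carrier (quotient_module M N) = f ` carrier M"
    unfolding carrier_quotient image_image by (rule image_cong[OF refl g(2)])
  ultimately have "g \<in> linear_isos (quotient_module M N) M'"
    using g(1) surj by (simp add: linear_isos_def bij_betw_def)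
  moreover have "g (C \<otimes>\<^bsub>quotient_module M N\<^esub> D) = g C \<otimes>\<^bsub>M'\<^esub> g D"
    if "C \<in> carrier (quotient_module M N)" "D \<in> carrier (quotient_module M N)" for C D
  proof -
    obtain x y where "x \<in> carrier M" "y \<in> carrier M" "C = N +>\<^bsub>M\<^esub> x" "D = N +>\<^bsub>M\<^esub> y"
      using \<open>C \<in> _\<close> \<open>D \<in> _\<close> unfolding carrier_quotient by blast
    then show ?thesis by (simp only: quotient_mult g(2) assms(4) mult_closed)
  qed
  ultimately have "g \<in> lie_isos (quotient_module M N) M'"
    by (simp add: lie_isos_def)
  then show ?thesis using that g(2) by blast
qed

lemma lie_iso_inverse:
  assumes "nonassoc_algebra M" "f \<in> lie_isos M M'"
  obtains g where "g \<in> lie_isos M' M" "\<And>x. x \<in> carrier M \<Longrightarrow> g (f x) = x"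
proof
  interpret nonassoc_algebra M by fact
  let ?g = "inv_into (carrier M) f"
  have bij: "bij_betw f (carrier M) (carrier M')" and f: "f \<in> linear_maps M M'"
    using assms(2) by (auto simp: lie_isos_def linear_isos_def)
  show gf: "?g (f x) = x" if "x \<in> carrier M" for x
    using bij that by (simp add: bij_betw_def)
  have im: "carrier M' = f ` carrier M" using bij by (simp add: bij_betw_def)
  have op: "f x \<oplus>\<^bsub>M'\<^esub> f y = f (x \<oplus>\<^bsub>M\<^esub> y)" "f x \<otimes>\<^bsub>M'\<^esub> f y = f (x \<otimes>\<^bsub>M\<^esub> y)" "c \<odot>\<^bsub>M'\<^esub> f x = f (c \<odot>\<^bsub>M\<^esub> x)"
    if "x \<in> carrier M" "y \<in> carrier M" for x y c
    using that assms(2) by (auto simp: lie_isos_def linear_isos_def linear_maps_def)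
  have "?g \<in> linear_maps M' M"
    unfolding linear_maps_def im by (auto simp: op gf)
  moreover have "bij_betw ?g (carrier M') (carrier M)" by (rule bij_betw_inv_into[OF bij])
  ultimately show "?g \<in> lie_isos M' M"
    unfolding lie_isos_def linear_isos_def im by (auto simp: op gf)
qed

lemma (in nonassoc_algebra) line_ideal:
  assumes x: "x \<in> carrier M" and left: "\<And>y. y \<in> carrier M \<Longrightarrow> x \<otimes> y \<in> line M x"
    and right: "\<And>y. y \<in> carrier M \<Longrightarrow> y \<otimes> x \<in> line M x"
  shows "nonassoc_ideal M (line M x)"
proof unfold_locales
  show "\<zero> \<in> line M x"
    unfolding line_def using smult_zero_left[OF x] by (metis (mono_tags, lifting) mem_Collect_eq)
  fix u v c assume u: "u \<in> line M x"
  show scale: "c \<odot>\<^bsub>M\<^esub> u \<in> line M x" if "u \<in> line M x" for c u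
    using that x unfolding line_def by (auto simp: smult_assoc[symmetric])
  show "u \<oplus> v \<in> line M x" if "v \<in> line M x"
    using u that x by (auto simp: line_def smult_add_left[symmetric])
  show "u \<otimes> v \<in> line M x" "v \<otimes> u \<in> line M x" if v: "v \<in> carrier M"
  proof -
    obtain d where "u = d \<odot>\<^bsub>M\<^esub> x" using u by (auto simp: line_def)
    then show "u \<otimes> v \<in> line M x" "v \<otimes> u \<in> line M x"
      using scale[OF left[OF v], of d] scale[OF right[OF v], of d] v x
      by (simp_all add: mult_smult_left mult_smult_right)
  qed
qed (use x in \<open>auto simp: line_def\<close>)

context monomial_quiver
begin

lemma cocycles_simps [simp]:
  "x \<oplus>\<^bsub>cocycles Q Z\<^esub> y = x + y" "\<zero>\<^bsub>cocycles Q Z\<^esub> = 0"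
  "x \<otimes>\<^bsub>cocycles Q Z\<^esub> y = cochain_bracket B x y" "c \<odot>\<^bsub>cocycles Q Z\<^esub> x = cochain_scale c x"
  by (simp_all add: cocycles_def)

lemma cocycles_closed:
  "0 \<in> carrier (cocycles Q Z)"
  "x \<in> carrier (cocycles Q Z) \<Longrightarrow> y \<in> carrier (cocycles Q Z) \<Longrightarrow> x + y \<in> carrier (cocycles Q Z)"
  "x \<in> carrier (cocycles Q Z) \<Longrightarrow> - x \<in> carrier (cocycles Q Z)"
  "x \<in> carrier (cocycles Q Z) \<Longrightarrow> cochain_scale c x \<in> carrier (cocycles Q Z)"
  by (simp_all add: cocycles_iff parallel_span_eq support_span_rules linear_zero[OF is_linear_act]
      linear_add[OF is_linear_act] linear_uminus[OF is_linear_act] linear_scale[OF is_linear_act])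

lemma cocycles_algebra: "nonassoc_algebra (cocycles Q Z)"
proof -
  have "abelian_group (cocycles Q Z)"
  proof (rule abelian_groupI)
    fix x assume "x \<in> carrier (cocycles Q Z)"
    then show "\<exists>y\<in>carrier (cocycles Q Z). y \<oplus>\<^bsub>cocycles Q Z\<^esub> x = \<zero>\<^bsub>cocycles Q Z\<^esub>"
      by (intro bexI[of _ "- x"]) (simp_all add: cocycles_closed)
  qed (auto simp: cocycles_closed algebra_simps)
  then show ?thesis
    unfolding nonassoc_algebra_def nonassoc_algebra_axioms_def
    by (auto simp: cocycles_closed bracket_cocycle cochain_scale_add cochain_scale_add_left cochain_scale_assoc
        linear_add[OF is_linear_bracket_left] linear_add[OF is_linear_bracket_right]
        linear_scale[OF is_linear_bracket_left] linear_scale[OF is_linear_bracket_right])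
qed

lemma coboundaries_ideal: "nonassoc_ideal (cocycles Q Z) (coboundaries Q Z)"
proof -
  interpret nonassoc_algebra "cocycles Q Z" by (rule cocycles_algebra)
  note lin = linear_add[OF is_linear_delta0, symmetric] linear_scale[OF is_linear_delta0, symmetric]
  show ?thesis
  proof unfold_locales
    show "\<zero>\<^bsub>cocycles Q Z\<^esub> \<in> coboundaries Q Z"
      unfolding coboundaries_def parallel_span_eq
      by (simp, rule image_eqI[of _ _ 0]) (auto simp: linear_zero[OF is_linear_delta0] support_span_rules)
  qed (auto simp: coboundary_cocycle bracket_coboundary,
      auto simp: coboundaries_def lin parallel_span_eq intro!: imageI support_span_rules)
qed

end

section \<open>Paths of the glued quiver\<close>

lemma subpathI: "snd p = us @ snd q @ ws \<Longrightarrow> fst q = path_target Q (fst p, us) \<Longrightarrow> subpath Q q p"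
  unfolding subpath_def by fast

lemma subpathE:
  assumes "subpath Q q p"
  obtains us ws where "snd p = us @ snd q @ ws" "fst q = path_target Q (fst p, us)"
  using assms unfolding subpath_def by fast

lemma ideal_pathsI: "p \<in> paths Q \<Longrightarrow> z \<in> G \<Longrightarrow> subpath Q z p \<Longrightarrow> p \<in> ideal_paths Q G"
  unfolding ideal_paths_def by fast

lemma ideal_pathsE:
  assumes "p \<in> ideal_paths Q G"
  obtains z where "p \<in> paths Q" "z \<in> G" "subpath Q z p"
  using assms unfolding ideal_paths_def by fast

text \<open>A subpath of least length among those in the ideal has no proper subpath in the ideal,
  so it is one of the minimal relations.\<close>

lemma (in wf_digraph) ideal_paths_minimal:
  assumes "G' \<subseteq> paths G"
  shows "ideal_paths G (minimal_relations G G') = ideal_paths G G'"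
proof (intro equalityI subsetI)
  fix p assume "p \<in> ideal_paths G (minimal_relations G G')"
  then show "p \<in> ideal_paths G G'"
    by (auto simp: ideal_paths_def minimal_relations_def intro: subpath_trans)
next
  fix p assume p: "p \<in> ideal_paths G G'"
  obtain z where z: "z \<in> ideal_paths G G'" "subpath G z p"
    and least: "\<And>q. q \<in> ideal_paths G G' \<and> subpath G q p \<Longrightarrow> length (snd z) \<le> length (snd q)"
    using ex_has_least_nat[of "\<lambda>z. z \<in> ideal_paths G G' \<and> subpath G z p" p "\<lambda>z. length (snd z)"]
      p subpath_refl[of G p] by blast
  have "q = z" if q: "q \<in> ideal_paths G G'" "subpath G q z" for q
  proof -
    have "length (snd z) \<le> length (snd q)" using least q(1) subpath_trans[OF q(2) z(2)] by blast
    with q(2) show ?thesis by (auto simp: subpath_def prod_eq_iff)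
  qed
  then have "z \<in> minimal_relations G G'" using z by (auto simp: minimal_relations_def)
  then show "p \<in> ideal_paths G (minimal_relations G G')"
    using z p by (auto simp: ideal_paths_def)
qed

lemma (in fin_digraph) finite_bounded_paths: "finite {p \<in> paths G. length (snd p) \<le> n}"
proof (rule finite_subset)
  show "{p \<in> paths G. length (snd p) \<le> n} \<subseteq> verts G \<times> {l. set l \<subseteq> arcs G \<and> length l \<le> n}"
    by (auto simp: paths_iff awalk_def)
qed (simp add: finite_lists_length_le)

text \<open>Finiteness of \<open>Z\<close> comes from admissibility together with minimality: if a
  relation were longer than \<open>N\<close>, removing its last arrow would leave a path that still
  contains a relation, and this would be a proper subpath of the first one.\<close>

lemma monomial_presentation_quiver:
  assumes "monomial_presentation Q Z"
  shows "monomial_quiver Q Z"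
proof -
  interpret fin_digraph Q using assms by (simp add: monomial_presentation_def)
  obtain N where N: "\<And>p. p \<in> paths Q \<Longrightarrow> N \<le> length (snd p) \<Longrightarrow> p \<in> ideal_paths Q Z"
    using assms unfolding monomial_presentation_def by blast
  have "length (snd z) \<le> N" if z: "z \<in> Z" for z
  proof (rule ccontr)
    assume long: "\<not> length (snd z) \<le> N"
    then obtain l b where l: "snd z = l @ [b]" by (cases "snd z" rule: rev_cases) auto
    have "(fst z, l) \<in> paths Q"
      using path_split(1)[of z l "[b]"] l z assms by (auto simp: monomial_presentation_def)
    then have "(fst z, l) \<in> ideal_paths Q Z" using N long l by simp
    then obtain z' where z': "z' \<in> Z" "subpath Q z' (fst z, l)" by (auto simp: ideal_paths_def)
    then obtain us ws where "l = us @ snd z' @ ws" "fst z' = path_target Q (fst z, us)" by (auto simp: subpath_def)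
    then have "subpath Q z' z" "length (snd z') \<le> length l"
      using l by (auto simp: subpath_def)
    moreover from this(1) have "z' = z" using assms z z'(1) unfolding monomial_presentation_def by blast
    ultimately show False using l by simp
  qed
  then have "Z \<subseteq> {p \<in> paths Q. length (snd p) \<le> N}"
    using assms by (auto simp: monomial_presentation_def)
  then show ?thesis
    using assms finite_bounded_paths[of N] by unfold_locales (auto simp: monomial_presentation_def intro: finite_subset)
qed

lemma (in wf_digraph) consecutive_arrows:
  assumes "p \<in> paths G" "snd p = us @ a # b # ws"
  shows "a \<in> arcs G" "b \<in> arcs G" "head G a = tail G b"
  using assms by (auto simp: paths_iff awalk_append awalk_Cons_iff)

lemma (in wf_digraph) path_hd:
  assumes "p \<in> paths G" "snd p = a # l"
  shows "a \<in> arcs G" "fst p = tail G a"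
  using assms by (auto simp: paths_iff awalk_Cons_iff)

lemma (in wf_digraph) path_last:
  assumes "p \<in> paths G" "snd p = l @ [a]"
  shows "a \<in> arcs G" "path_target G p = head G a"
proof -
  show "a \<in> arcs G" using assms by (auto simp: paths_iff awalk_append awalk_Cons_iff)
  show "path_target G p = head G a" using assms by (cases p) (simp add: path_target_append)
qed

lemma (in wf_digraph) path_nil: "snd p = [] \<Longrightarrow> path_target G p = fst p"
  by (cases p) simp

locale gluing =
  fixes Q :: "('v, 'a) pre_digraph" and Z :: "('v, 'a) path set" and \<alpha> \<beta> :: 'a
  assumes presentation: "monomial_presentation Q Z"
    and source: "source_arrow Q \<alpha>"
    and sink: "sink_arrow Q \<beta>"
    and different: "distinct [tail Q \<alpha>, head Q \<alpha>, tail Q \<beta>, head Q \<beta>]"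
begin

abbreviation "QB \<equiv> glue_quiver Q \<alpha> \<beta>"
abbreviation "ZB \<equiv> glue_relations Q Z \<alpha> \<beta>"
abbreviation "gv \<equiv> glue_vert Q \<alpha> \<beta>"
abbreviation "ga \<equiv> glue_arrow \<alpha> \<beta>"
abbreviation "gp \<equiv> glue_path Q \<alpha> \<beta>"
abbreviation "G \<equiv> gp ` Z \<union> new_relations Q \<alpha> \<beta>"

lemma distinct_vertices [simp]:
  "tail Q \<alpha> \<noteq> head Q \<alpha>" "head Q \<alpha> \<noteq> tail Q \<alpha>" "tail Q \<alpha> \<noteq> tail Q \<beta>" "tail Q \<beta> \<noteq> tail Q \<alpha>"
  "tail Q \<alpha> \<noteq> head Q \<beta>" "head Q \<beta> \<noteq> tail Q \<alpha>" "head Q \<alpha> \<noteq> tail Q \<beta>" "tail Q \<beta> \<noteq> head Q \<alpha>"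
  "head Q \<alpha> \<noteq> head Q \<beta>" "head Q \<beta> \<noteq> head Q \<alpha>" "tail Q \<beta> \<noteq> head Q \<beta>" "head Q \<beta> \<noteq> tail Q \<beta>"
  "\<alpha> \<noteq> \<beta>" "\<beta> \<noteq> \<alpha>"
  using different by auto

lemma special_arrows [simp]: "\<alpha> \<in> arcs Q" "\<beta> \<in> arcs Q"
  using source sink by (auto simp: source_arrow_def sink_arrow_def)

lemma endpoint_simps [simp]:
  assumes "b \<in> arcs Q"
  shows "head Q b \<noteq> tail Q \<alpha>" "tail Q \<alpha> \<noteq> head Q b" "tail Q b \<noteq> head Q \<beta>" "head Q \<beta> \<noteq> tail Q b"
    "tail Q b = tail Q \<alpha> \<longleftrightarrow> b = \<alpha>" "tail Q \<alpha> = tail Q b \<longleftrightarrow> b = \<alpha>"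
    "head Q b = head Q \<alpha> \<longleftrightarrow> b = \<alpha>" "head Q \<alpha> = head Q b \<longleftrightarrow> b = \<alpha>"
    "tail Q b = tail Q \<beta> \<longleftrightarrow> b = \<beta>" "tail Q \<beta> = tail Q b \<longleftrightarrow> b = \<beta>"
    "head Q b = head Q \<beta> \<longleftrightarrow> b = \<beta>" "head Q \<beta> = head Q b \<longleftrightarrow> b = \<beta>"
  using assms source sink by (auto simp: source_arrow_def sink_arrow_def)

lemma glue_vert_simps [simp]:
  "gv (tail Q \<alpha>) = tail Q \<alpha>" "gv (head Q \<alpha>) = head Q \<alpha>" "gv (tail Q \<beta>) = tail Q \<alpha>" "gv (head Q \<beta>) = head Q \<alpha>"
  by (simp_all add: glue_vert_def)

lemma glue_vert_eq:
  "gv x = gv y \<longleftrightarrow> x = y \<or> {x, y} = {tail Q \<alpha>, tail Q \<beta>} \<or> {x, y} = {head Q \<alpha>, head Q \<beta>}"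
  by (auto simp: glue_vert_def doubleton_eq_iff)

lemma glue_vert_eq_tail [simp]: "gv x = tail Q \<alpha> \<longleftrightarrow> x = tail Q \<alpha> \<or> x = tail Q \<beta>"
  "tail Q \<alpha> = gv x \<longleftrightarrow> x = tail Q \<alpha> \<or> x = tail Q \<beta>"
  by (auto simp: glue_vert_def)

lemma glue_vert_eq_head [simp]: "gv x = head Q \<alpha> \<longleftrightarrow> x = head Q \<alpha> \<or> x = head Q \<beta>"
  "head Q \<alpha> = gv x \<longleftrightarrow> x = head Q \<alpha> \<or> x = head Q \<beta>"
  by (auto simp: glue_vert_def)

lemma glue_arrow_eq: "ga a = ga b \<longleftrightarrow> a = b \<or> {a, b} = {\<alpha>, \<beta>}"
  by (auto simp: glue_arrow_def doubleton_eq_iff)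

lemma glue_arrow_simps [simp]: "ga \<alpha> = \<alpha>" "ga \<beta> = \<alpha>" "ga a = \<alpha> \<longleftrightarrow> a = \<alpha> \<or> a = \<beta>"
  by (auto simp: glue_arrow_def)

lemma glue_arrow_id: "b \<noteq> \<beta> \<Longrightarrow> ga b = b"
  by (simp add: glue_arrow_def)

lemma glued_endpoints [simp]:
  "tail QB (ga a) = gv (tail Q a)" "head QB (ga a) = gv (head Q a)"
  "tail QB a = gv (tail Q a)" "head QB a = gv (head Q a)"
  using glue_quiver_endpoints[OF different, of a] by (simp_all add: glue_quiver_def)

lemma glue_vert_arrow [simp]: "gv (tail Q (ga a)) = gv (tail Q a)" "gv (head Q (ga a)) = gv (head Q a)"
  by (auto simp: glue_arrow_def)

lemma glued_verts: "verts QB = gv ` verts Q"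
  by (simp add: glue_quiver_def)

lemma glued_arcs: "a \<in> arcs QB \<longleftrightarrow> a \<in> arcs Q \<and> a \<noteq> \<beta>"
  by (auto simp: glue_quiver_def glue_arrow_def image_iff)

lemma glue_arrow_in_arcs: "a \<in> arcs Q \<Longrightarrow> ga a \<in> arcs QB"
  by (simp add: glue_quiver_def)

sublocale A: monomial_quiver Q Z
  by (rule monomial_presentation_quiver[OF presentation])

sublocale BQ: fin_digraph QB
  by (rule fin_digraph_glue_quiver[OF _ _ different]) (use A.fin_digraph in auto)

lemma glue_path_simps [simp]: "fst (gp p) = gv (fst p)" "snd (gp p) = map ga (snd p)"
  by (simp_all add: glue_path_def)

lemma glue_path_target [simp]: "path_target QB (gp p) = gv (path_target Q p)"
proof -
  have "path_target QB (gv x, map ga l) = gv (path_target Q (x, l))" for x l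
  proof (induction l arbitrary: x)
    case (Cons a l)
    then show ?case by simp
  qed simp
  then show ?thesis by (cases p) (simp add: glue_path_def)
qed

lemma glue_path_in_paths:
  assumes "p \<in> paths Q" shows "gp p \<in> paths QB"
proof -
  have "BQ.awalk (gv x) (map ga l) (gv y)" if "A.awalk x l y" for x l y
    using that
  proof (induction l arbitrary: x)
    case Nil
    then show ?case by (auto simp: BQ.awalk_Nil_iff A.awalk_Nil_iff glued_verts)
  next
    case (Cons a l)
    then show ?case
      by (auto simp: BQ.awalk_Cons_iff A.awalk_Cons_iff glue_arrow_in_arcs)
  qed
  then show ?thesis using assms by (auto simp: A.paths_iff BQ.paths_iff)
qed

lemma glue_path_comp: "gp (path_comp q p) = path_comp (gp q) (gp p)"
  by (simp add: glue_path_def path_comp_def)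

lemma glue_arrow_path: "gp (arrow_path Q b) = arrow_path QB (ga b)"
  by (simp add: glue_path_def arrow_path_def)

lemma glue_replace_arrow: "gp (replace_arrow p i q) = replace_arrow (gp p) i (gp q)"
  by (simp add: glue_path_def replace_arrow_def take_map drop_map)

text \<open>No arrow enters e1 or leaves e_n; only \<alpha> starts at e1 and only \<beta> ends at
  e_n. Of the six families, just the paths survive that enter the glued part at e_(n-1), cross the
  glued arrow and leave from e2.\<close>

lemma new_relations_eq:
  "new_relations Q \<alpha> \<beta> = {gp (tail Q \<eta>, [\<eta>, \<alpha>, \<xi>]) | \<eta> \<xi>.
     \<eta> \<in> arcs Q \<and> \<xi> \<in> arcs Q \<and> head Q \<eta> = tail Q \<beta> \<and> tail Q \<xi> = head Q \<alpha>}"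
  proof -
  have "cross_relations Q \<alpha> \<beta> \<alpha> \<beta> = {}"
    unfolding cross_relations_def by auto
  moreover have "cross_relations Q \<alpha> \<beta> \<beta> \<alpha> = {gp (tail Q \<eta>, [\<eta>, \<alpha>, \<xi>]) | \<eta> \<xi>.
     \<eta> \<in> arcs Q \<and> \<xi> \<in> arcs Q \<and> head Q \<eta> = tail Q \<beta> \<and> tail Q \<xi> = head Q \<alpha>}"
  proof -
    have "{gp (tail Q \<eta>, [\<eta>, l]) | \<eta> l. \<eta> \<in> arcs Q \<and> l \<in> arcs Q \<and> head Q \<eta> = tail Q \<beta> \<and> tail Q l = tail Q \<alpha> \<and> l \<noteq> \<alpha>} = {}"
      "{gp (tail Q \<mu>, [\<mu>, \<xi>]) | \<mu> \<xi>. \<mu> \<in> arcs Q \<and> \<xi> \<in> arcs Q \<and> head Q \<mu> = head Q \<beta> \<and> \<mu> \<noteq> \<beta> \<and> tail Q \<xi> = head Q \<alpha>} = {}"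
      by auto
    then show ?thesis unfolding cross_relations_def by (simp only: Un_empty_left)
  qed
  ultimately show ?thesis unfolding new_relations_def by (simp only: Un_empty_left)
qed

lemma new_relationE:
  assumes "r \<in> new_relations Q \<alpha> \<beta>"
  obtains \<eta> \<xi> where "\<eta> \<in> arcs Q" "\<xi> \<in> arcs Q" "head Q \<eta> = tail Q \<beta>" "tail Q \<xi> = head Q \<alpha>"
    "\<eta> \<noteq> \<alpha>" "\<eta> \<noteq> \<beta>" "\<xi> \<noteq> \<alpha>" "\<xi> \<noteq> \<beta>" "r = (gv (tail Q \<eta>), [\<eta>, \<alpha>, \<xi>])"
  using assms by (fastforce simp: new_relations_eq glue_path_def glue_arrow_def)

lemma glued_relations_paths: "G \<subseteq> paths QB"
proof
  fix r assume "r \<in> G"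
  then show "r \<in> paths QB"
  proof
    assume "r \<in> gp ` Z"
    then show ?thesis using glue_path_in_paths A.relations_subset by auto
  next
    assume "r \<in> new_relations Q \<alpha> \<beta>"
    then show ?thesis
      by (rule new_relationE)
        (auto simp: BQ.paths_iff BQ.awalk_Cons_iff BQ.awalk_Nil_iff glued_arcs glued_verts)
  qed
qed

lemma ideal_paths_glued: "ideal_paths QB ZB = ideal_paths QB G"
  unfolding glue_relations_def by (rule BQ.ideal_paths_minimal[OF glued_relations_paths])

text \<open>A minimal path of the ideal contains a generator and therefore equals it.\<close>

lemma glued_relations_subset: "ZB \<subseteq> G"
proof
  fix p assume p: "p \<in> ZB"
  then obtain z where z: "z \<in> G" "subpath QB z p"
    by (auto simp: glue_relations_def minimal_relations_def ideal_paths_def)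
  then have "z \<in> ideal_paths QB G"
    using glued_relations_paths subpath_refl[of QB z] unfolding ideal_paths_def by blast
  then show "p \<in> G" using p z by (auto simp: glue_relations_def minimal_relations_def)
qed

lemma glued_relation_length: "r \<in> G \<Longrightarrow> 2 \<le> length (snd r)"
  using A.relations_length by (auto elim: new_relationE)

text \<open>New relations have length three, so there are finitely many, and minimalisation only
  selects among the generators.\<close>

sublocale B: monomial_quiver QB ZB
proof unfold_locales
  have "new_relations Q \<alpha> \<beta> \<subseteq> {p \<in> paths QB. length (snd p) \<le> 3}"
    using glued_relations_paths by (auto elim: new_relationE)
  then have "finite (new_relations Q \<alpha> \<beta>)"
    using BQ.finite_bounded_paths[of 3] finite_subset by blast
  then show "finite ZB"
    using glued_relations_subset A.finite_relations finite_subset[of ZB G] by simp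
  show "ZB \<subseteq> paths QB" using glued_relations_subset glued_relations_paths by blast
  show "2 \<le> length (snd z)" if "z \<in> ZB" for z
    using that glued_relations_subset glued_relation_length by blast
qed

section \<open>Nonzero paths of the glued quiver and their lifts\<close>

lemma alpha_first: "p \<in> paths Q \<Longrightarrow> snd p = us @ \<alpha> # ws \<Longrightarrow> us = []"
  using A.consecutive_arrows[of p _ _ \<alpha> ws] by (cases us rule: rev_cases) auto

lemma beta_last: "p \<in> paths Q \<Longrightarrow> snd p = us @ \<beta> # ws \<Longrightarrow> ws = []"
  using A.consecutive_arrows[of p us \<beta>] by (cases ws) auto

text \<open>The lists can differ only by \<alpha> against \<beta> at the same position. There
  \<alpha> is the first arrow of its path and \<beta> the last of the other, so both paths have
  length one; their starting vertices differ as well, which the last assumption rules out.\<close>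

lemma glue_list_inj:
  assumes p: "p \<in> paths Q" and q: "q \<in> paths Q" and eq: "map ga (snd p) = map ga (snd q)"
    and "fst p = fst q \<or> 2 \<le> length (snd p)"
  shows "snd p = snd q"
proof -
  have *: "False" if p: "p \<in> paths Q" and q: "q \<in> paths Q" and len: "length (snd p) = length (snd q)"
    "fst p = fst q \<or> 2 \<le> length (snd p)" and i: "i < length (snd p)" "snd p ! i = \<alpha>" "snd q ! i = \<beta>" for p q i
  proof -
    have "snd p = take i (snd p) @ \<alpha> # drop (Suc i) (snd p)" "snd q = take i (snd q) @ \<beta> # drop (Suc i) (snd q)"
      using i len by (metis id_take_nth_drop)+
    then have "take i (snd p) = []" "drop (Suc i) (snd q) = []"
      using alpha_first[OF p] beta_last[OF q] by blast+
    then have "i = 0" "length (snd q) \<le> Suc i" using i by auto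
    then have "length (snd p) = 1" "length (snd q) = 1" using i(1) len by linarith+
    then have "snd p = [\<alpha>]" "snd q = [\<beta>]" using i \<open>i = 0\<close> by (auto simp: length_Suc_conv)
    then show False
      using len A.path_hd[OF p] A.path_hd[OF q] by auto
  qed
  have len: "length (snd p) = length (snd q)" using eq by (metis length_map)
  show ?thesis
  proof (rule nth_equalityI[OF len])
    fix i assume i: "i < length (snd p)"
    have "ga (snd p ! i) = ga (snd q ! i)" using eq i len by (metis nth_map)
    then show "snd p ! i = snd q ! i"
      using *[OF p q len assms(4) i] *[OF q p len[symmetric]] i len assms(4)
      unfolding glue_arrow_eq doubleton_eq_iff by metis
  qed
qed

lemma glue_path_inj:
  "p \<in> paths Q \<Longrightarrow> q \<in> paths Q \<Longrightarrow> fst p = fst q \<Longrightarrow> gp p = gp q \<Longrightarrow> p = q"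
  using glue_list_inj[of p q] by (metis glue_path_simps(2) prod_eq_iff)

text \<open>For the direction from the glued quiver back to \<open>Q\<close>: the image of a
  relation inside \<open>gp P\<close> lifts to that relation, since its length is at least two. A
  new relation cannot occur in \<open>gp P\<close>, because its middle arrow would come from
  \<alpha> preceded by an arrow or from \<beta> followed by one.\<close>

lemma glue_ideal_iff:
  assumes P: "P \<in> paths Q"
  shows "gp P \<in> ideal_paths QB ZB \<longleftrightarrow> P \<in> ideal_paths Q Z"
proof
  assume "P \<in> ideal_paths Q Z"
  then obtain z where z: "z \<in> Z" "subpath Q z P" by (rule ideal_pathsE)
  from z(2) obtain us ws where uw: "snd P = us @ snd z @ ws" "fst z = path_target Q (fst P, us)"
    by (rule subpathE)
  have "gv (path_target Q (fst P, us)) = path_target QB (gv (fst P), map ga us)"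
    using glue_path_target[of "(fst P, us)"] by (simp add: glue_path_def)
  then have "subpath QB (gp z) (gp P)"
    by (intro subpathI[where us = "map ga us" and ws = "map ga ws"]) (simp_all add: uw)
  then show "gp P \<in> ideal_paths QB ZB"
    unfolding ideal_paths_glued using z(1) glue_path_in_paths[OF P] by (intro ideal_pathsI[of _ _ "gp z"]) simp_all
next
  assume "gp P \<in> ideal_paths QB ZB"
  then obtain g where g: "g \<in> G" "subpath QB g (gp P)"
    unfolding ideal_paths_glued by (rule ideal_pathsE)
  from g(2) obtain us ws where "snd (gp P) = us @ (snd g @ ws)" by (rule subpathE)
  then have "map ga (snd P) = us @ (snd g @ ws)" by simp
  then obtain us' r where r: "snd P = us' @ r" "map ga r = snd g @ ws"
    using map_eq_append_conv[of ga "snd P" us "snd g @ ws"] by metis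
  then obtain zs ws' where l: "snd P = us' @ zs @ ws'" "map ga zs = snd g"
    using map_eq_append_conv[of ga r "snd g" ws] by metis
  from g(1) show "P \<in> ideal_paths Q Z"
  proof
    assume "g \<in> gp ` Z"
    then obtain z where z: "z \<in> Z" "g = gp z" by blast
    have zp: "z \<in> paths Q" using z A.relations_subset by blast
    define x where "x = path_target Q (fst P, us')"
    have "(x, zs @ ws') \<in> paths Q" using A.path_split(2)[OF P l(1)] by (simp add: x_def)
    then have xzs: "(x, zs) \<in> paths Q" using A.path_split(1)[of "(x, zs @ ws')" zs ws'] by simp
    have len: "2 \<le> length (snd z)" using A.relations_length z by blast
    have "snd z = snd (x, zs)"
      by (rule glue_list_inj[OF zp xzs]) (use l z len in auto)
    then have zs: "zs = snd z" by simp
    then have "fst z = x"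
    proof -
      obtain a l where "snd z = a # l" using len by (cases "snd z") auto
      then show ?thesis using A.path_hd(2)[OF zp, of a l] A.path_hd(2)[OF xzs, of a l] zs by simp
    qed
    then have "subpath Q z P" using l(1) zs by (intro subpathI[of _ us' _ ws']) (simp_all add: x_def)
    then show ?thesis using z(1) P by (intro ideal_pathsI)
  next
    assume "g \<in> new_relations Q \<alpha> \<beta>"
    then obtain \<eta> \<xi> where "snd g = [\<eta>, \<alpha>, \<xi>]" by (auto elim: new_relationE)
    then obtain a b c where abc: "zs = [a, b, c]" "ga b = \<alpha>" using l by auto
    have "head Q a = tail Q b" "head Q b = tail Q c" "a \<in> arcs Q" "c \<in> arcs Q"
      using A.consecutive_arrows[OF P, of us' a b "c # ws'"] A.consecutive_arrows[OF P, of "us' @ [a]" b c ws'] l abc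
      by auto
    then show ?thesis using abc(2) by auto
  qed
qed

lemma glue_basis_iff: "P \<in> paths Q \<Longrightarrow> gp P \<in> B.B \<longleftrightarrow> P \<in> A.B"
  using glue_ideal_iff glue_path_in_paths by (auto simp: basis_paths_def)

text \<open>An arrow arriving at f1 ends at the tail of \<beta>, as e1 is a source, and an arrow
  leaving f2 starts at the head of \<alpha>, as e_n is a sink. The three arrows thus form a new
  relation.\<close>

lemma interior_glued_arrow:
  assumes "snd p = us @ [a, \<alpha>, b] @ ws"
  shows "p \<notin> B.B"
proof
  assume "p \<in> B.B"
  then have p: "p \<in> paths QB" "p \<notin> ideal_paths QB G"
    by (auto simp: basis_paths_def ideal_paths_glued)
  have ab: "a \<in> arcs QB" "b \<in> arcs QB" "head QB a = tail QB \<alpha>" "head QB \<alpha> = tail QB b"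
    using BQ.consecutive_arrows[OF p(1), of us a \<alpha> "b # ws"] BQ.consecutive_arrows[OF p(1), of "us @ [a]" \<alpha> b ws] assms
    by auto
  then have "head Q a = tail Q \<beta>" "tail Q b = head Q \<alpha>" by (auto simp: glued_arcs)
  then have "(gv (tail Q a), [a, \<alpha>, b]) \<in> new_relations Q \<alpha> \<beta>"
    unfolding new_relations_eq using ab
    by (intro CollectI exI[of _ a] exI[of _ b]) (auto simp: glued_arcs glue_path_def glue_arrow_id)
  moreover have "gv (tail Q a) = path_target QB (fst p, us)"
    using BQ.path_split(2)[OF p(1) assms] BQ.path_hd(2)[of "(path_target QB (fst p, us), [a, \<alpha>, b] @ ws)" a]
    by simp
  ultimately have "subpath QB (gv (tail Q a), [a, \<alpha>, b]) p" "(gv (tail Q a), [a, \<alpha>, b]) \<in> G"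
    using assms by (auto simp: subpath_def)
  then have "p \<in> ideal_paths QB G"
    using p(1) unfolding ideal_paths_def by blast
  then show False using p(2) by blast
qed

text \<open>The glued arrow is allowed only at the end of the list, where it is read as \<beta>. The
  first arrow of the lift is recorded so that another arrow can be put in front.\<close>

lemma lift_list:
  assumes "BQ.awalk x L y" "L \<noteq> []" "\<alpha> \<notin> set (butlast L)"
  shows "\<exists>L' y'. A.awalk (tail Q (hd L')) L' y' \<and> map ga L' = L \<and> L' \<noteq> [] \<and>
    hd L' = (if hd L = \<alpha> then \<beta> else hd L)"
  using assms
proof (induction L arbitrary: x)
  case (Cons a L)
  have a: "a \<in> arcs Q" "a \<noteq> \<beta>" using Cons.prems by (auto simp: BQ.awalk_Cons_iff glued_arcs)
  show ?case
  proof (cases L)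
    case Nil
    then show ?thesis using a
      by (intro exI[of _ "[if a = \<alpha> then \<beta> else a]"]) (auto simp: A.awalk_Cons_iff A.awalk_Nil_iff glue_arrow_id)
  next
    case (Cons b M)
    have aw: "BQ.awalk (gv (head Q a)) L y" "a \<noteq> \<alpha>" "\<alpha> \<notin> set (butlast L)"
      using Cons.prems Cons by (auto simp: BQ.awalk_Cons_iff)
    obtain L' y' where L': "A.awalk (tail Q (hd L')) L' y'" "map ga L' = L" "L' \<noteq> []"
      "hd L' = (if b = \<alpha> then \<beta> else b)"
    proof -
      have "hd L = b" "L \<noteq> []" using Cons by simp_all
      then show ?thesis using Cons.IH[OF aw(1) _ aw(3)] that by metis
    qed
    have b: "b \<in> arcs Q" "b \<noteq> \<beta>" "gv (head Q a) = gv (tail Q b)"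
      using aw(1) Cons by (auto simp: BQ.awalk_Cons_iff glued_arcs)
    \<comment> \<open>Endpoints that agree after gluing agree already in \<open>Q\<close>: any other
      identification would need an arrow into e1, an arrow out of e_n, or one of the arrows excluded
      here.\<close>
    have "head Q a = tail Q (hd L')"
      using b a aw(2) L'(4) unfolding glue_vert_eq doubleton_eq_iff by auto
    then show ?thesis
      using L' a aw(2) by (intro exI[of _ "a # L'"] exI[of _ y']) (auto simp: A.awalk_Cons_iff glue_arrow_id)
  qed
qed simp

text \<open>In a nonzero path the glued arrow occurs only at the two ends. A first occurrence lifts
  to \<alpha> if something follows it, a last one to \<beta>; for the path consisting of the glued
  arrow alone, \<beta> is chosen.\<close>

lemma lift_basis:
  assumes p: "p \<in> B.B"
  obtains P where "P \<in> A.B" "gp P = p"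
proof -
  have pp: "p \<in> paths QB" using p B.basis_subset_paths by blast
  have "\<exists>P\<in>paths Q. gp P = p"
  proof (cases "snd p")
    case Nil
    then have "fst p \<in> gv ` verts Q"
      using pp BQ.awalk_hd_in_verts unfolding BQ.paths_iff glued_verts by blast
    then obtain x where "x \<in> verts Q" "fst p = gv x" by blast
    then show ?thesis
      using Nil by (intro bexI[of _ "(x, [])"]) (auto simp: A.trivial_in_paths prod_eq_iff)
  next
    case (Cons a L)
    have once: "us = [] \<or> ws = []" if "snd p = us @ \<alpha> # ws" for us ws
      using interior_glued_arrow[of p "butlast us" "last us" "hd ws" "tl ws"] p that
      by (cases us rule: rev_cases; cases ws) auto
    have aw: "BQ.awalk (fst p) (a # L) (path_target QB p)" using pp Cons by (simp add: BQ.paths_iff)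
    have "\<exists>L' y'. A.awalk (tail Q (hd L')) L' y' \<and> map ga L' = a # L \<and> L' \<noteq> []"
    proof (cases "\<alpha> \<in> set (butlast (a # L))")
      case False
      from lift_list[OF aw _ False] show ?thesis by auto
    next
      case True
      then obtain us ws where uw: "butlast (a # L) = us @ \<alpha> # ws" by (meson split_list)
      have "snd p = us @ \<alpha> # ws @ [last (a # L)]"
        using append_butlast_last_id[of "a # L"] uw Cons by simp
      from once[OF this] have "us = []" by simp
      then have aL: "a = \<alpha>" "L \<noteq> []" using uw by (auto split: if_splits)
      have awL: "BQ.awalk (head Q \<alpha>) L (path_target QB p)" using aw aL by (simp add: BQ.awalk_Cons_iff)
      obtain b M where L: "L = b # M" using aL by (cases L) auto
      have b: "b \<in> arcs Q" "tail Q b = head Q \<alpha>" "b \<noteq> \<alpha>"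
        using awL L by (auto simp: BQ.awalk_Cons_iff glued_arcs)
      have "\<alpha> \<notin> set (butlast L)"
      proof
        assume "\<alpha> \<in> set (butlast L)"
        then obtain us ws where "butlast L = us @ \<alpha> # ws" by (meson split_list)
        then have "snd p = (\<alpha> # us) @ \<alpha> # ws @ [last L]"
          using append_butlast_last_id[of L] Cons aL by (metis append_Cons append_assoc)
        from once[OF this] show False by simp
      qed
      then obtain L' y' where L': "A.awalk (tail Q (hd L')) L' y'" "map ga L' = L" "L' \<noteq> []" "hd L' = b"
        using lift_list[OF awL aL(2)] L b by auto
      then show ?thesis
        using b aL by (intro exI[of _ "\<alpha> # L'"] exI[of _ y']) (simp add: A.awalk_Cons_iff)
    qed
    then obtain L' y' where L': "A.awalk (tail Q (hd L')) L' y'" "map ga L' = a # L" "L' \<noteq> []" by metis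
    have "gv (tail Q (hd L')) = fst p"
    proof -
      have "ga (hd L') = a" using L' by (cases L') auto
      then have "gv (tail Q (hd L')) = tail QB a" by (metis glued_endpoints(1))
      then show ?thesis using aw by (simp add: BQ.awalk_Cons_iff del: glued_endpoints)
    qed
    then have "gp (tail Q (hd L'), L') = p" using L' Cons by (simp add: prod_eq_iff)
    then show ?thesis using L'(1) by (auto simp: A.awalk_iff)
  qed
  then show ?thesis using that p glue_basis_iff by blast
qed

lemma path_from_sink: "P \<in> paths Q \<Longrightarrow> fst P = head Q \<beta> \<Longrightarrow> snd P = []"
  using A.path_hd[of P] by (cases "snd P") auto

lemma path_to_source: "P \<in> paths Q \<Longrightarrow> path_target Q P = tail Q \<alpha> \<Longrightarrow> snd P = []"
  using A.path_last[of P] by (cases "snd P" rule: rev_cases) auto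

lemma path_from_beta:
  assumes "P \<in> paths Q" "fst P = tail Q \<beta>" "snd P \<noteq> []"
  shows "P = arrow_path Q \<beta>"
proof -
  obtain a l where al: "snd P = a # l" using assms(3) by (cases "snd P") auto
  then have "a = \<beta>" using A.path_hd[OF assms(1)] assms(2) by auto
  then show ?thesis using beta_last[OF assms(1), of "[]" l] al assms(2) by (simp add: prod_eq_iff)
qed

lemma path_to_alpha:
  assumes "P \<in> paths Q" "path_target Q P = head Q \<alpha>" "snd P \<noteq> []"
  shows "P = arrow_path Q \<alpha>"
proof -
  obtain a l where al: "snd P = l @ [a]" using assms(3) by (cases "snd P" rule: rev_cases) auto
  then have "a = \<alpha>" using A.path_last[OF assms(1)] assms(2) by auto
  then have "snd P = [\<alpha>]" using alpha_first[OF assms(1), of l "[]"] al by simp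
  then show ?thesis using A.path_hd(2)[OF assms(1)] by (simp add: prod_eq_iff)
qed

text \<open>A nontrivial path that ends at the head of \<alpha> is \<alpha>, and one that starts at
  the tail of \<beta> is \<beta>. Hence cochains have only diagonal entries at these two
  arrows.\<close>

lemma parallel_special:
  "A.parallels (arrow_path Q \<alpha>) = {arrow_path Q \<alpha>}" "A.parallels (arrow_path Q \<beta>) = {arrow_path Q \<beta>}"
proof -
  have "P = arrow_path Q \<alpha>" if "P \<in> A.parallels (arrow_path Q \<alpha>)" for P
  proof -
    have "P \<in> paths Q" "path_target Q P = head Q \<alpha>" "fst P = tail Q \<alpha>"
      using that A.basis_subset_paths by (auto simp: A.parallels_def)
    then show ?thesis using path_to_alpha[of P] A.path_nil[of P] by force
  qed
  moreover have "P = arrow_path Q \<beta>" if "P \<in> A.parallels (arrow_path Q \<beta>)" for P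
  proof -
    have "P \<in> paths Q" "path_target Q P = head Q \<beta>" "fst P = tail Q \<beta>"
      using that A.basis_subset_paths by (auto simp: A.parallels_def)
    then show ?thesis using path_from_beta[of P] A.path_nil[of P] by force
  qed
  moreover have "arrow_path Q b \<in> A.parallels (arrow_path Q b)" if "b \<in> arcs Q" for b
    using A.arrow_path_in_basis[OF that] by (simp add: A.parallels_def)
  ultimately show "A.parallels (arrow_path Q \<alpha>) = {arrow_path Q \<alpha>}" "A.parallels (arrow_path Q \<beta>) = {arrow_path Q \<beta>}"
    using special_arrows by blast+
qed

text \<open>
  The images of these paths are parallel to \<open>\<gamma>\<^sup>*\<close>, although the paths themselves are parallel to no arrow.
\<close>

definition wide_paths :: "('v, 'a) path set" where
  "wide_paths = {P \<in> A.B. fst P = tail Q \<alpha> \<and> path_target Q P = head Q \<beta>}"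

text \<open>A lift of \<open>q\<close> has the endpoints of \<open>b\<close> up to the fibres of
  \<open>gv\<close>. For an arrow other than the glued one, a wrong endpoint would be the sink or
  the source; the lift would then be trivial and violate the condition at the other end.\<close>

lemma lift_parallel:
  assumes b: "b \<in> arcs QB" and q: "q \<in> B.parallels (arrow_path QB b)"
  shows "(\<exists>P\<in>A.parallels (arrow_path Q b). q = gp P) \<or> b = \<alpha> \<and> (\<exists>P\<in>wide_paths. q = gp P)"
proof -
  have b': "b \<in> arcs Q" "b \<noteq> \<beta>" using b by (auto simp: glued_arcs)
  obtain P where P: "P \<in> A.B" "gp P = q"
    using q lift_basis[of q] unfolding B.parallels_def by blast
  have Pp: "P \<in> paths Q" using P A.basis_subset_paths by blast
  have ends: "gv (fst P) = gv (tail Q b)" "gv (path_target Q P) = gv (head Q b)"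
    using q P(2) by (auto simp: B.parallels_def)
  show ?thesis
  proof (cases "b = \<alpha>")
    case True
    have src: "fst P = tail Q \<alpha> \<or> fst P = tail Q \<beta>" and tgt: "path_target Q P = head Q \<alpha> \<or> path_target Q P = head Q \<beta>"
      using ends True by simp_all
    have ne: "snd P \<noteq> []" using src tgt A.path_nil[of P] by force
    show ?thesis
    proof (cases "fst P = tail Q \<alpha> \<and> path_target Q P = head Q \<beta>")
      case True
      then have "P \<in> wide_paths" using P(1) by (simp add: wide_paths_def)
      then show ?thesis using \<open>b = \<alpha>\<close> P(2) by blast
    next
      case False
      then have "P = arrow_path Q \<beta> \<or> P = arrow_path Q \<alpha>"
        using src tgt path_from_beta[OF Pp _ ne] path_to_alpha[OF Pp _ ne] by argo
      then have "q = gp (arrow_path Q \<alpha>)" using P(2) by (elim disjE) (simp_all add: glue_arrow_path)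
      then show ?thesis using True parallel_special(1) by simp
    qed
  next
    case False
    have src: "fst P = tail Q b"
    proof (rule ccontr)
      assume "fst P \<noteq> tail Q b"
      then have "fst P = head Q \<beta>" "tail Q b = head Q \<alpha>"
        using ends(1) b' False unfolding glue_vert_eq doubleton_eq_iff by auto
      then have "path_target Q P = head Q \<beta>" using path_from_sink[OF Pp] A.path_nil[of P] by simp
      then show False using ends(2) b' False by auto
    qed
    have "path_target Q P = head Q b"
    proof (rule ccontr)
      assume "path_target Q P \<noteq> head Q b"
      then have "path_target Q P = tail Q \<alpha>"
        using ends(2) b' False unfolding glue_vert_eq doubleton_eq_iff by auto
      then have "fst P = tail Q \<alpha>" using path_to_source[OF Pp] A.path_nil[of P] by simp
      then show False using src b' False by auto
    qed
    then have "P \<in> A.parallels (arrow_path Q b)" using P src by (simp add: A.parallels_def)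
    then show ?thesis using P(2) by blast
  qed
qed

end

section \<open>Cochains of the glued algebra\<close>

definition glue_vector ::
  "('v, 'a) pre_digraph \<Rightarrow> 'a \<Rightarrow> 'a \<Rightarrow> (('v, 'a) path \<Rightarrow>\<^sub>0 'k::field) \<Rightarrow> (('v, 'a) path \<Rightarrow>\<^sub>0 'k)" where
  "glue_vector Q \<alpha> \<beta> = linear_extension (\<lambda>p. Poly_Mapping.single (glue_path Q \<alpha> \<beta> p) 1)"

lemma is_linear_glue_vector: "is_linear (glue_vector Q \<alpha> \<beta>)"
  unfolding glue_vector_def by (rule is_linear_extension)

lemma is_linear_glue_cochain: "is_linear (glue_cochain Q \<alpha> \<beta>)"
  unfolding glue_cochain_def by (rule is_linear_extension)

lemma glue_vector_single [simp]:
  "glue_vector Q \<alpha> \<beta> (Poly_Mapping.single p 1) = Poly_Mapping.single (glue_path Q \<alpha> \<beta> p) 1"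
  by (simp add: glue_vector_def)

lemma glue_cochain_single [simp]:
  "glue_cochain Q \<alpha> \<beta> (Poly_Mapping.single (a, p) 1) = basis_pair (glue_path Q \<alpha> \<beta> a) (glue_path Q \<alpha> \<beta> p)"
  by (simp add: glue_cochain_def)

lemma glue_cochain_basis_pair [simp]:
  "glue_cochain Q \<alpha> \<beta> (basis_pair a p) = basis_pair (glue_path Q \<alpha> \<beta> a) (glue_path Q \<alpha> \<beta> p)"
  by (simp add: glue_cochain_def)

lemma glue_cochain_tag:
  "glue_cochain Q \<alpha> \<beta> (tag q v) = tag (glue_path Q \<alpha> \<beta> q) (glue_vector Q \<alpha> \<beta> v)"
  by (rule linear_eqI[OF is_linear_comp[OF is_linear_glue_cochain is_linear_tag]
        is_linear_comp[OF is_linear_tag is_linear_glue_vector]]) (simp add: tag_def)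

lemma replace_arrow_same: "i < length (snd p) \<Longrightarrow> snd p ! i = b \<Longrightarrow> replace_arrow p i (arrow_path R b) = p"
  using id_take_nth_drop[of i "snd p"] by (simp add: replace_arrow_def arrow_path_def prod_eq_iff)

lemma lookup_relabel:
  assumes "\<And>k. k \<in> Poly_Mapping.keys v \<Longrightarrow> f k = f k0 \<Longrightarrow> k = k0"
  shows "Poly_Mapping.lookup (linear_extension (\<lambda>k. Poly_Mapping.single (f k) 1) v) (f k0) = Poly_Mapping.lookup v k0"
proof -
  have "Poly_Mapping.lookup (linear_extension (\<lambda>k. Poly_Mapping.single (f k) 1) v) (f k0) =
      (\<Sum>k\<in>Poly_Mapping.keys v. if k = k0 then Poly_Mapping.lookup v k else 0)"
    unfolding linear_extension_def lookup_sum
    using assms by (intro sum.cong) (auto simp: lookup_single when_def)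
  then show ?thesis by (auto simp: in_keys_iff)
qed

lemma parallel_span_uminus: "x \<in> parallel_span Q S T \<Longrightarrow> - x \<in> parallel_span Q S T"
  by (simp add: parallel_span_eq support_span_rules)

context monomial_quiver
begin

lemma loop_cochain_basis:
  assumes "p \<in> loops" shows "basis_pair (fst p, []) p \<in> (loop_cochains :: ('k::field, 'v, 'a) cochain set)"
  using algebra_loop_in_cochains[OF single_in_support_span[OF assms, of "1::'k"]] by (simp add: algebra_loop_def)

lemma act_delta0_loop:
  assumes p: "p \<in> loops" and b: "b \<in> arcs Q"
  shows "act B (arrow_path Q b) (delta0 Q Z (basis_pair (fst p, []) p)) =
    (if tail Q b = fst p then reduced B (path_comp (arrow_path Q b) p) else 0)
    - (if head Q b = fst p then reduced B (path_comp p (arrow_path Q b)) else (0 :: _ \<Rightarrow>\<^sub>0 'k::field))"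
proof -
  have pB: "p \<in> B" "path_target Q p = fst p" using p by (auto simp: loops_def)
  show ?thesis
    unfolding act_delta0_arrow[OF loop_cochain_basis[OF p] b] loop_algebra_def linear_extension_basis_pair
      reduced_basis[OF arrow_path_in_basis[OF b]] snd_conv mult_single
    by (simp add: pB eq_commute)
qed

lemma coboundaries_closed:
  "0 \<in> coboundaries Q Z"
  "x \<in> coboundaries Q Z \<Longrightarrow> y \<in> coboundaries Q Z \<Longrightarrow> x + y \<in> coboundaries Q Z"
  "x \<in> coboundaries Q Z \<Longrightarrow> cochain_scale c x \<in> coboundaries Q Z"
  "x \<in> coboundaries Q Z \<Longrightarrow> y \<in> coboundaries Q Z \<Longrightarrow> x - y \<in> coboundaries Q Z"
proof -
  interpret nonassoc_ideal "cocycles Q Z" "coboundaries Q Z" by (rule coboundaries_ideal)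
  show "0 \<in> coboundaries Q Z" using ideal_zero by simp
  show add: "x + y \<in> coboundaries Q Z" if "x \<in> coboundaries Q Z" "y \<in> coboundaries Q Z" for x y
    using ideal_add[OF that] by simp
  show scale: "cochain_scale c x \<in> coboundaries Q Z" if "x \<in> coboundaries Q Z" for c x
    using ideal_smult[OF that, of c] by simp
  show "x - y \<in> coboundaries Q Z" if "x \<in> coboundaries Q Z" "y \<in> coboundaries Q Z"
    using add[OF that(1) scale[OF that(2), of "- 1"]] by simp
qed

end

section \<open>Gluing of cocycles, and compatibility with the bracket\<close>

context gluing
begin

abbreviation gc :: "('k::field, 'v, 'a) cochain \<Rightarrow> ('k, 'v, 'a) cochain" where
  "gc \<equiv> glue_cochain Q \<alpha> \<beta>"

abbreviation gvec :: "(('v, 'a) path \<Rightarrow>\<^sub>0 'k::field) \<Rightarrow> (('v, 'a) path \<Rightarrow>\<^sub>0 'k)" where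
  "gvec \<equiv> glue_vector Q \<alpha> \<beta>"

abbreviation \<gamma>\<gamma> :: "('k::field, 'v, 'a) cochain" where
  "\<gamma>\<gamma> \<equiv> basis_pair (arrow_path QB \<alpha>) (arrow_path QB \<alpha>)"

lemma glue_reduced: "p \<in> paths Q \<Longrightarrow> gvec (reduced A.B p) = reduced B.B (gp p)"
  using glue_basis_iff[of p] by (auto simp: reduced_def linear_zero[OF is_linear_glue_vector])

text \<open>Globally \<alpha> and \<beta> have the same image, so injectivity is available only on
  spans of suitable sets, such as the paths parallel to a fixed one.\<close>

lemma glue_vector_inj:
  assumes v: "v \<in> support_span S" and S: "\<And>p q. p \<in> S \<Longrightarrow> q \<in> S \<Longrightarrow> gp p = gp q \<Longrightarrow> p = q"
    and zero: "gvec v = 0"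
  shows "v = 0"
proof (rule poly_mapping_eqI)
  fix k
  show "Poly_Mapping.lookup v k = Poly_Mapping.lookup 0 k"
  proof (cases "k \<in> Poly_Mapping.keys v")
    case True
    have vS: "Poly_Mapping.keys v \<subseteq> S" using v by (simp add: support_span_def)
    have "Poly_Mapping.lookup (gvec v) (gp k) = Poly_Mapping.lookup v k"
      unfolding glue_vector_def by (rule lookup_relabel, rule S) (use vS True in blast)+
    then show ?thesis using zero by simp
  qed (simp add: in_keys_iff)
qed

lemma parallels_glue_inj: "q \<in> A.parallels p \<Longrightarrow> q' \<in> A.parallels p \<Longrightarrow> gp q = gp q' \<Longrightarrow> q = q'"
  using glue_path_inj[of q q'] A.basis_subset_paths unfolding A.parallels_def by fastforce

lemma glue_parallel:
  assumes "b \<in> arcs Q" "p \<in> A.parallels (arrow_path Q b)"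
  shows "gp p \<in> B.parallels (arrow_path QB (ga b))"
  using assms glue_basis_iff[of p] A.basis_subset_paths by (auto simp: A.parallels_def B.parallels_def)

lemma glue_in_cochains:
  fixes x :: "('k::field, 'v, 'a) cochain"
  assumes x: "x \<in> arrow_cochains Q Z"
  shows "gc x \<in> arrow_cochains QB ZB"
proof (rule linear_closed[OF is_linear_glue_cochain])
  fix k assume "k \<in> Poly_Mapping.keys x"
  then obtain b p where k: "k = (arrow_path Q b, p)" "b \<in> arcs Q" "p \<in> A.parallels (arrow_path Q b)"
    by (rule A.cochain_keyE'[OF x])
  show "gc (Poly_Mapping.single k (1::'k)) \<in> arrow_cochains QB ZB"
    using B.basis_pair_in_cochains[OF glue_arrow_in_arcs[OF k(2)] glue_parallel[OF k(2,3)]]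
    by (simp add: k(1) glue_arrow_path)
qed (auto simp: parallel_span_eq intro: support_span_rules)

text \<open>The glued arrow has two preimages, so its value collects the contributions of \<alpha>
  and of \<beta>.\<close>

lemma act_glue_arrow:
  fixes x :: "('k::field, 'v, 'a) cochain"
  assumes x: "x \<in> arrow_cochains Q Z" and b: "b \<in> arcs QB"
  shows "act B.B (arrow_path QB b) (gc x) = gvec (act A.B (arrow_path Q b) x)
    + (if b = \<alpha> then gvec (act A.B (arrow_path Q \<beta>) x) else 0)"
proof (rule linear_eqI[where f = "\<lambda>x. act B.B (arrow_path QB b) (gc x)"])
  fix k assume "k \<in> Poly_Mapping.keys x"
  then obtain c p where k: "k = (arrow_path Q c, p)" "c \<in> arcs Q" "p \<in> A.parallels (arrow_path Q c)"
    by (rule A.cochain_keyE'[OF x])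
  have b': "b \<in> arcs Q" "b \<noteq> \<beta>" using b by (auto simp: glued_arcs)
  have 1: "act A.B (arrow_path Q d) (Poly_Mapping.single k (1::'k)) = (if d = c then Poly_Mapping.single p 1 else 0)"
    if "d \<in> arcs Q" for d
    unfolding k(1) by (rule A.act_basis_pair[OF that k(2,3), unfolded basis_pair_def])
  have 2: "act B.B (arrow_path QB b) (gc (Poly_Mapping.single k (1::'k))) =
      (if b = ga c then Poly_Mapping.single (gp p) 1 else 0)"
    using B.act_basis_pair[OF b glue_arrow_in_arcs[OF k(2)] glue_parallel[OF k(2,3)]]
    by (simp add: k(1) glue_arrow_path)
  show "act B.B (arrow_path QB b) (gc (Poly_Mapping.single k (1::'k))) =
      gvec (act A.B (arrow_path Q b) (Poly_Mapping.single k 1))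
    + (if b = \<alpha> then gvec (act A.B (arrow_path Q \<beta>) (Poly_Mapping.single k 1)) else 0)"
    unfolding 2 1[OF b'(1)] 1[OF special_arrows(2)] using b'
    by (auto simp: glue_arrow_def linear_zero[OF is_linear_glue_vector])
qed (cases "b = \<alpha>"; simp add: is_linear_plus is_linear_comp[OF is_linear_act is_linear_glue_cochain]
    is_linear_comp[OF is_linear_glue_vector is_linear_act])+

text \<open>An ordinary arrow \<open>b\<close> occurs in \<open>P\<close> and in its image at the
  same positions; \<alpha> and \<beta> can no longer be told apart there.\<close>

lemma act_glue_key:
  assumes b: "b \<in> arcs Q" "b \<noteq> \<alpha>" "b \<noteq> \<beta>" and g: "g \<in> A.parallels (arrow_path Q b)" and P: "P \<in> paths Q"
  shows "act B.B (gp P) (basis_pair (gp (arrow_path Q b)) (gp g)) =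
    gvec (act A.B P (basis_pair (arrow_path Q b) g) :: _ \<Rightarrow>\<^sub>0 'k::field)"
proof -
  have g': "g \<in> paths Q" "fst g = tail Q b" "path_target Q g = head Q b"
    using g A.basis_subset_paths by (auto simp: A.parallels_def)
  have "reduced B.B (replace_arrow (gp P) i (gp g)) = (gvec (reduced A.B (replace_arrow P i g)) :: _ \<Rightarrow>\<^sub>0 'k)"
    if "i < length (snd P)" "snd P ! i = b" for i
  proof -
    have "replace_arrow P i g \<in> paths Q"
      using A.replace_arrow_path(1)[OF P that(1) g'(1)] g' that(2) by simp
    then show ?thesis by (simp add: glue_reduced glue_replace_arrow)
  qed
  moreover have "ga (snd P ! i) = ga b \<longleftrightarrow> snd P ! i = b" for i
    using b by (auto simp: glue_arrow_eq doubleton_eq_iff)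
  ultimately show ?thesis
    by (auto simp: act_def linear_sum[OF is_linear_glue_vector] linear_zero[OF is_linear_glue_vector] intro!: sum.cong)
qed

text \<open>Entries at \<alpha> and \<beta> are diagonal by \<open>parallel_special\<close>.
  Replacing an arrow by itself returns a path of the ideal, so such entries give zero on both sides;
  all others are covered by \<open>act_glue_key\<close>.\<close>

lemma act_glue_ideal:
  fixes x :: "('k::field, 'v, 'a) cochain"
  assumes x: "x \<in> arrow_cochains Q Z" and P: "P \<in> ideal_paths Q Z"
  shows "act B.B (gp P) (gc x) = gvec (act A.B P x)"
proof (rule linear_eqI[where f = "\<lambda>x. act B.B (gp P) (gc x)"])
  fix k assume "k \<in> Poly_Mapping.keys x"
  then obtain b g where k: "k = (arrow_path Q b, g)" "b \<in> arcs Q" "g \<in> A.parallels (arrow_path Q b)"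
    by (rule A.cochain_keyE'[OF x])
  have Pp: "P \<in> paths Q" using P by (simp add: ideal_paths_def)
  have red: "reduced A.B P = (0 :: _ \<Rightarrow>\<^sub>0 'k)" "reduced B.B (gp P) = (0 :: _ \<Rightarrow>\<^sub>0 'k)"
    using P glue_ideal_iff[OF Pp] by (simp_all add: reduced_def basis_paths_def)
  show "act B.B (gp P) (gc (Poly_Mapping.single k (1::'k))) = gvec (act A.B P (Poly_Mapping.single k 1))"
  proof (cases "b = \<alpha> \<or> b = \<beta>")
    case False
    then show ?thesis using act_glue_key[OF k(2) _ _ k(3) Pp, where 'k = 'k] by (simp add: k(1) basis_pair_def)
  next
    case True
    then have g: "g = arrow_path Q b" using k(3) parallel_special by auto
    have "act A.B P (Poly_Mapping.single k (1::'k)) = 0"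
      by (auto simp: act_def k(1) g replace_arrow_same red intro!: sum.neutral)
    moreover have "act B.B (gp P) (basis_pair (gp (arrow_path Q b)) (gp (arrow_path Q b))) = (0 :: _ \<Rightarrow>\<^sub>0 'k)"
      unfolding glue_arrow_path
      by (auto simp: act_def replace_arrow_same[of _ "gp P", simplified] red intro!: sum.neutral)
    ultimately show ?thesis
      by (simp add: k(1) g linear_zero[OF is_linear_glue_vector])
  qed
qed (intro is_linear_comp[OF is_linear_act is_linear_glue_cochain] is_linear_comp[OF is_linear_glue_vector is_linear_act])+

lemma glued_arrow_ends:
  assumes "p \<in> paths QB" "snd p \<noteq> []"
  shows "fst p = gv (tail Q (hd (snd p)))" "path_target QB p = gv (head Q (last (snd p)))"
    "hd (snd p) \<in> arcs QB" "last (snd p) \<in> arcs QB"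
proof -
  obtain a l where "snd p = a # l" using assms(2) by (cases "snd p") auto
  then show "fst p = gv (tail Q (hd (snd p)))" "hd (snd p) \<in> arcs QB" using BQ.path_hd[OF assms(1)] by auto
  obtain a l where "snd p = l @ [a]" using assms(2) by (cases "snd p" rule: rev_cases) auto
  then show "path_target QB p = gv (head Q (last (snd p)))" "last (snd p) \<in> arcs QB" using BQ.path_last[OF assms(1)] by auto
qed

text \<open>Whichever of the three arrows is replaced by a parallel path, a glued arrow remains in
  the interior. For the middle arrow the reason is that every parallel path begins with the glued
  arrow, the only one leaving f1.\<close>

lemma act_new_relation:
  fixes y :: "('k::field, 'v, 'a) cochain"
  assumes y: "y \<in> arrow_cochains QB ZB" and r: "r \<in> new_relations Q \<alpha> \<beta>"
  shows "act B.B r y = 0"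
proof (rule linear_eqI[OF is_linear_act is_linear_zero])
  fix k assume "k \<in> Poly_Mapping.keys y"
  then obtain b g where k: "k = (arrow_path QB b, g)" "b \<in> arcs QB" "g \<in> B.parallels (arrow_path QB b)"
    by (rule B.cochain_keyE'[OF y])
  have g: "g \<in> paths QB" "fst g = gv (tail Q b)" "path_target QB g = gv (head Q b)"
    using k(3) B.basis_subset_paths by (auto simp: B.parallels_def)
  have b: "b \<in> arcs Q" "b \<noteq> \<beta>" using k(2) by (auto simp: glued_arcs)
  obtain \<eta> \<xi> where r: "\<eta> \<in> arcs Q" "\<xi> \<in> arcs Q" "head Q \<eta> = tail Q \<beta>" "tail Q \<xi> = head Q \<alpha>"
    "\<eta> \<noteq> \<alpha>" "\<eta> \<noteq> \<beta>" "\<xi> \<noteq> \<alpha>" "\<xi> \<noteq> \<beta>" "r = (gv (tail Q \<eta>), [\<eta>, \<alpha>, \<xi>])"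
    using new_relationE[OF r] .
  \<comment> \<open>None of the three arrows becomes a loop after gluing, so a parallel path cannot
    be trivial.\<close>
  have ne: "snd g \<noteq> []" if "b = \<eta> \<or> b = \<alpha> \<or> b = \<xi>"
  proof
    assume "snd g = []"
    then have "gv (tail Q b) = gv (head Q b)" using g BQ.path_nil[of g] by simp
    then show False using that r by auto
  qed
  have notin: "replace_arrow r i g \<notin> B.B" if i: "i < 3" "snd r ! i = b" for i
  proof -
    consider "i = 0" "b = \<eta>" | "i = 1" "b = \<alpha>" | "i = 2" "b = \<xi>"
      using i r(9) by (auto simp: less_Suc_eq numeral_3_eq_3 numeral_2_eq_2)
    then show ?thesis
    proof cases
      case 1
      then have "snd (replace_arrow r i g) = butlast (snd g) @ [last (snd g), \<alpha>, \<xi>] @ []"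
        using ne by (simp add: replace_arrow_def r(9))
      then show ?thesis by (rule interior_glued_arrow)
    next
      case 2
      have "tail Q (hd (snd g)) = tail Q \<alpha> \<or> tail Q (hd (snd g)) = tail Q \<beta>"
        using glued_arrow_ends(1)[OF g(1) ne] g(2) 2 by simp
      then have "hd (snd g) = \<alpha>" using glued_arrow_ends(3)[OF g(1) ne] 2 by (auto simp: glued_arcs)
      then obtain l where l: "snd g = \<alpha> # l" using ne 2 by (cases "snd g") auto
      have "snd (replace_arrow r i g) = [] @ [\<eta>, \<alpha>, hd (l @ [\<xi>])] @ tl (l @ [\<xi>])"
        using 2 l by (simp add: replace_arrow_def r(9))
      then show ?thesis by (rule interior_glued_arrow)
    next
      case 3
      then have "snd (replace_arrow r i g) = [] @ [\<eta>, \<alpha>, hd (snd g)] @ tl (snd g)"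
        using ne by (simp add: replace_arrow_def r(9) numeral_2_eq_2)
      then show ?thesis by (rule interior_glued_arrow)
    qed
  qed
  have "length (snd r) = 3" using r(9) by simp
  then show "act B.B r (Poly_Mapping.single k (1::'k)) = 0"
    using notin by (auto simp: act_def k(1) reduced_def intro!: sum.neutral)
qed

text \<open>A relation of \<open>ZB\<close> is the image of one of \<open>Z\<close>, where
  \<open>act_glue_ideal\<close> applies, or a new one, which every cochain kills. Conversely, a
  glued cocycle kills the image of every relation of \<open>Z\<close>, and gluing is injective on
  the paths parallel to it.\<close>

lemma glue_cocycle_iff:
  fixes x :: "('k::field, 'v, 'a) cochain"
  assumes x: "x \<in> arrow_cochains Q Z"
  shows "gc x \<in> carrier (cocycles QB ZB) \<longleftrightarrow> x \<in> carrier (cocycles Q Z)"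
proof
  assume gx: "gc x \<in> carrier (cocycles QB ZB)"
  have "act A.B r x = 0" if r: "r \<in> Z" for r
  proof -
    have rp: "r \<in> paths Q" using r A.relations_subset by blast
    then have ri: "r \<in> ideal_paths Q Z" using r subpath_refl by (rule ideal_pathsI)
    have "gvec (act A.B r x) = act B.B (gp r) (gc x)" by (rule act_glue_ideal[OF x ri, symmetric])
    also have "\<dots> = 0" using ri glue_ideal_iff[OF rp] by (intro B.act_ideal[OF gx]) simp
    finally have zero: "gvec (act A.B r x) = 0" .
    show ?thesis
      by (rule glue_vector_inj[OF A.act_in_parallels[OF x rp] _ zero]) (erule (2) parallels_glue_inj)
  qed
  then show "x \<in> carrier (cocycles Q Z)" using x by (simp add: A.cocycles_iff)
next
  assume cx: "x \<in> carrier (cocycles Q Z)"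
  have "act B.B r (gc x) = 0" if "r \<in> ZB" for r
  proof -
    have "r \<in> G" using that glued_relations_subset by blast
    then show ?thesis
    proof
      assume "r \<in> gp ` Z"
      then obtain z where z: "z \<in> Z" "r = gp z" by blast
      have zi: "z \<in> ideal_paths Q Z" by (rule ideal_pathsI[OF _ z(1) subpath_refl]) (use z A.relations_subset in auto)
      then show ?thesis
        using act_glue_ideal[OF x zi] A.act_ideal[OF cx zi] z by (simp add: linear_zero[OF is_linear_glue_vector])
    next
      assume "r \<in> new_relations Q \<alpha> \<beta>"
      then show ?thesis by (rule act_new_relation[OF glue_in_cochains[OF x]])
    qed
  qed
  then show "gc x \<in> carrier (cocycles QB ZB)" using glue_in_cochains[OF x] by (simp add: B.cocycles_iff)
qed

text \<open>In such a path \<alpha> could only be the first arrow and \<beta> only the last, so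
  \<open>c\<close> would share the tail of \<alpha> or the head of \<beta>.\<close>

lemma parallel_avoids:
  assumes c: "c \<in> arcs Q" "c \<noteq> \<alpha>" "c \<noteq> \<beta>" and h: "h \<in> A.parallels (arrow_path Q c)"
  shows "\<alpha> \<notin> set (snd h)" "\<beta> \<notin> set (snd h)"
proof -
  have h': "h \<in> paths Q" "fst h = tail Q c" "path_target Q h = head Q c"
    using h A.basis_subset_paths by (auto simp: A.parallels_def)
  show "\<alpha> \<notin> set (snd h)"
  proof
    assume "\<alpha> \<in> set (snd h)"
    then obtain us ws where "snd h = us @ \<alpha> # ws" by (meson split_list)
    moreover from this have "us = []" by (rule alpha_first[OF h'(1)])
    ultimately show False using A.path_hd(2)[OF h'(1), of \<alpha> ws] h'(2) c by simp
  qed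
  show "\<beta> \<notin> set (snd h)"
  proof
    assume "\<beta> \<in> set (snd h)"
    then obtain us ws where "snd h = us @ \<beta> # ws" by (meson split_list)
    moreover from this have "ws = []" by (rule beta_last[OF h'(1)])
    ultimately show False using A.path_last(2)[OF h'(1), of us \<beta>] h'(3) c by simp
  qed
qed

text \<open>If one of the two arrows is neither \<alpha> nor \<beta>, acting commutes with gluing.
  If both are special, the pairs are diagonal and their bracket vanishes before and after
  gluing.\<close>

lemma glue_bracket:
  fixes x y :: "('k::field, 'v, 'a) cochain"
  assumes x: "x \<in> arrow_cochains Q Z" and y: "y \<in> arrow_cochains Q Z"
  shows "gc (cochain_bracket A.B x y) = cochain_bracket B.B (gc x) (gc y)"
proof -
  have act: "act B.B (gp h) (basis_pair (gp (arrow_path Q b)) (gp g)) =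
      gvec (act A.B h (basis_pair (arrow_path Q b) g) :: _ \<Rightarrow>\<^sub>0 'k)"
    if "b \<in> arcs Q" "c \<in> arcs Q" "g \<in> A.parallels (arrow_path Q b)" "h \<in> A.parallels (arrow_path Q c)"
      "{b, c} \<inter> - {\<alpha>, \<beta>} \<noteq> {}" for b c g h
  proof (cases "b = \<alpha> \<or> b = \<beta>")
    case False
    moreover have "h \<in> paths Q" using that(4) A.basis_subset_paths by (auto simp: A.parallels_def)
    ultimately show ?thesis using act_glue_key[OF that(1) _ _ that(3)] by blast
  next
    case True
    then have c: "c \<noteq> \<alpha>" "c \<noteq> \<beta>" using that(5) by auto
    \<comment> \<open>The path \<open>h\<close> is parallel to an ordinary arrow and so avoids
      \<alpha> and \<beta>; the special pair acts by zero on both sides.\<close>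
    have *: "snd h ! i \<noteq> \<alpha>" "snd h ! i \<noteq> \<beta>" if "i < length (snd h)" for i
      using parallel_avoids[OF \<open>c \<in> _\<close> c \<open>h \<in> _\<close>] nth_mem[OF that] by metis+
    have "act A.B h (basis_pair (arrow_path Q b) g) = (0 :: _ \<Rightarrow>\<^sub>0 'k)"
      unfolding act_def using * True by (auto intro!: sum.neutral)
    moreover have "act B.B (gp h) (basis_pair (gp (arrow_path Q b)) (gp g)) = (0 :: _ \<Rightarrow>\<^sub>0 'k)"
      unfolding act_def using * True by (auto intro!: sum.neutral)
    ultimately show ?thesis by (simp add: linear_zero[OF is_linear_glue_vector])
  qed
  have br: "cochain_bracket C (basis_pair p g) (basis_pair q h) =
      tag q (act C h (basis_pair p g)) - tag p (act C g (basis_pair q h))"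
    for C :: "('v, 'a) path set" and p q g h and f :: 'k
    unfolding cochain_bracket_def linear_extension_basis_pair by (simp add: replacement_sum_eq_tag basis_pair_def)
  have basis: "gc (cochain_bracket A.B (Poly_Mapping.single k (1::'k)) (Poly_Mapping.single l 1)) =
      cochain_bracket B.B (gc (Poly_Mapping.single k 1)) (gc (Poly_Mapping.single l 1))"
    if kx: "k \<in> Poly_Mapping.keys x" and ly: "l \<in> Poly_Mapping.keys y" for k l
  proof -
    obtain b g where k: "k = (arrow_path Q b, g)" "b \<in> arcs Q" "g \<in> A.parallels (arrow_path Q b)"
      by (rule A.cochain_keyE'[OF x kx])
    obtain c h where l: "l = (arrow_path Q c, h)" "c \<in> arcs Q" "h \<in> A.parallels (arrow_path Q c)"
      by (rule A.cochain_keyE'[OF y ly])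
    have "gc (cochain_bracket A.B (basis_pair (arrow_path Q b) g) (basis_pair (arrow_path Q c) h)) =
        cochain_bracket B.B (basis_pair (gp (arrow_path Q b)) (gp g) :: ('k, 'v, 'a) cochain)
          (basis_pair (gp (arrow_path Q c)) (gp h))"
    proof (cases "{b, c} \<inter> - {\<alpha>, \<beta>} = {}")
      case False
      then have f2: "{c, b} \<inter> - {\<alpha>, \<beta>} \<noteq> {}" by (simp add: insert_commute)
      show ?thesis
        unfolding br linear_diff[OF is_linear_glue_cochain] glue_cochain_tag
          act[OF k(2) l(2) k(3) l(3) False] act[OF l(2) k(2) l(3) k(3) f2] ..
    next
      case True
      then have bc: "b = \<alpha> \<or> b = \<beta>" "c = \<alpha> \<or> c = \<beta>" by auto
      then have gh: "g = arrow_path Q b" "h = arrow_path Q c" using k(3) l(3) parallel_special by auto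
      have act0: "act C (arrow_path R e) (basis_pair (arrow_path R d) (arrow_path R d)) = (0 :: _ \<Rightarrow>\<^sub>0 'k)"
        if "d \<noteq> e" for d e C and R :: "('v, 'a) pre_digraph"
        using that by (auto simp: act_def)
      have "cochain_bracket A.B (basis_pair (arrow_path Q b) g) (basis_pair (arrow_path Q c) h) = (0 :: ('k, 'v, 'a) cochain)"
        unfolding br gh by (cases "b = c") (auto simp: act0 linear_zero[OF is_linear_tag])
      moreover have "gp (arrow_path Q b) = arrow_path QB \<alpha>" "gp (arrow_path Q c) = arrow_path QB \<alpha>"
        using bc by (auto simp: glue_arrow_path)
      ultimately show ?thesis
        unfolding br gh by (simp add: linear_zero[OF is_linear_glue_cochain])
    qed
    then show ?thesis by (simp add: k(1) l(1) basis_pair_def)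
  qed
  show ?thesis
  proof (rule linear_eqI[where f = "\<lambda>x. gc (cochain_bracket A.B x y)"])
    fix k assume k: "k \<in> Poly_Mapping.keys x"
    show "gc (cochain_bracket A.B (Poly_Mapping.single k 1) y) = cochain_bracket B.B (gc (Poly_Mapping.single k 1)) (gc y)"
      by (rule linear_eqI[where f = "\<lambda>y. gc (cochain_bracket A.B (Poly_Mapping.single k 1) y)"])
        (auto intro: basis[OF k] is_linear_comp[OF is_linear_glue_cochain is_linear_bracket_right]
          is_linear_comp[OF is_linear_bracket_right is_linear_glue_cochain])
  qed (auto intro: is_linear_comp[OF is_linear_glue_cochain is_linear_bracket_left]
      is_linear_comp[OF is_linear_bracket_left is_linear_glue_cochain])
qed

section \<open>Coboundaries under gluing\<close>

lemma reduced_interior: "snd p = us @ [a, \<alpha>, b] @ ws \<Longrightarrow> reduced B.B p = 0"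
  using interior_glued_arrow[of p us a b ws] by (simp add: reduced_def)

text \<open>The only arrow at e1 is \<alpha>, which leaves it, and the only arrow at e_n is \<beta>,
  which enters it; hence the opposite signs.\<close>

lemma delta0_source: "delta0 Q Z (basis_pair (tail Q \<alpha>, []) (tail Q \<alpha>, [])) =
    (basis_pair (arrow_path Q \<alpha>) (arrow_path Q \<alpha>) :: ('k::field, 'v, 'a) cochain)"
  and delta0_sink: "delta0 Q Z (basis_pair (head Q \<beta>, []) (head Q \<beta>, [])) =
    (- basis_pair (arrow_path Q \<beta>) (arrow_path Q \<beta>) :: ('k::field, 'v, 'a) cochain)"
  and trivial_loop: "y \<in> verts Q \<Longrightarrow> basis_pair (y, []) (y, []) \<in> (A.loop_cochains :: ('k, 'v, 'a) cochain set)"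
proof -
  show l: "basis_pair (y, []) (y, []) \<in> (A.loop_cochains :: ('k, 'v, 'a) cochain set)" if "y \<in> verts Q" for y
    unfolding parallel_span_eq using that
    by (auto simp: trivial_paths_def A.short_path_in_basis A.trivial_in_paths intro!: basis_pair_in_support_span)
  have act: "act A.B (arrow_path Q b) (delta0 Q Z (basis_pair (y, []) (y, []))) =
      (if tail Q b = y then Poly_Mapping.single (arrow_path Q b) 1 else 0)
      - (if head Q b = y then Poly_Mapping.single (arrow_path Q b) (1::'k) else 0)"
    if "b \<in> arcs Q" "y \<in> verts Q" for b y
  proof -
    have "(y, []) \<in> A.loops" "arrow_path Q b \<in> A.B"
      using that by (simp_all add: A.loops_def A.short_path_in_basis A.trivial_in_paths A.arrow_path_in_basis)
    moreover have "path_comp (arrow_path Q b) (tail Q b, []) = arrow_path Q b"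
      "path_comp (head Q b, []) (arrow_path Q b) = arrow_path Q b"
      by (simp_all add: path_comp_def arrow_path_def)
    ultimately show ?thesis
      using A.act_delta0_loop[of "(y, [])" b, where 'k = 'k] that(1) by (auto simp: A.reduced_basis)
  qed
  note par = parallel_special[THEN equalityD2, THEN subsetD, OF singletonI]
  show "delta0 Q Z (basis_pair (tail Q \<alpha>, []) (tail Q \<alpha>, [])) = (basis_pair (arrow_path Q \<alpha>) (arrow_path Q \<alpha>) :: ('k, 'v, 'a) cochain)"
  proof (rule A.cochain_eqI[OF A.delta0_in_cochains[OF l] A.basis_pair_in_cochains[OF _ par(1)]])
    fix b assume b: "b \<in> arcs Q"
    show "act A.B (arrow_path Q b) (delta0 Q Z (basis_pair (tail Q \<alpha>, []) (tail Q \<alpha>, []))) =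
      act A.B (arrow_path Q b) (basis_pair (arrow_path Q \<alpha>) (arrow_path Q \<alpha>) :: ('k, 'v, 'a) cochain)"
      using b by (simp add: act A.act_basis_pair par(1))
  qed simp_all
  show "delta0 Q Z (basis_pair (head Q \<beta>, []) (head Q \<beta>, [])) = (- basis_pair (arrow_path Q \<beta>) (arrow_path Q \<beta>) :: ('k, 'v, 'a) cochain)"
  proof (rule A.cochain_eqI[OF A.delta0_in_cochains[OF l]])
    show "- basis_pair (arrow_path Q \<beta>) (arrow_path Q \<beta>) \<in> (arrow_cochains Q Z :: ('k, 'v, 'a) cochain set)"
      by (intro parallel_span_uminus A.basis_pair_in_cochains par(2)) simp
    fix b assume b: "b \<in> arcs Q"
    show "act A.B (arrow_path Q b) (delta0 Q Z (basis_pair (head Q \<beta>, []) (head Q \<beta>, []))) =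
      act A.B (arrow_path Q b) (- basis_pair (arrow_path Q \<beta>) (arrow_path Q \<beta>) :: ('k, 'v, 'a) cochain)"
      using b by (simp add: act A.act_basis_pair par(2) linear_uminus[OF is_linear_act])
  qed simp
qed

lemma special_coboundaries:
  "basis_pair (arrow_path Q \<alpha>) (arrow_path Q \<alpha>) \<in> (coboundaries Q Z :: ('k::field, 'v, 'a) cochain set)"
  "basis_pair (arrow_path Q \<beta>) (arrow_path Q \<beta>) \<in> (coboundaries Q Z :: ('k::field, 'v, 'a) cochain set)"
proof -
  show "basis_pair (arrow_path Q \<alpha>) (arrow_path Q \<alpha>) \<in> (coboundaries Q Z :: ('k::field, 'v, 'a) cochain set)"
    unfolding delta0_source[symmetric] coboundaries_def by (intro imageI trivial_loop) simp
  have "basis_pair (arrow_path Q \<beta>) (arrow_path Q \<beta>) =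
      (delta0 Q Z (- basis_pair (head Q \<beta>, []) (head Q \<beta>, [])) :: ('k::field, 'v, 'a) cochain)"
    by (simp add: linear_uminus[OF is_linear_delta0] delta0_sink)
  moreover have "- basis_pair (head Q \<beta>, []) (head Q \<beta>, []) \<in> (A.loop_cochains :: ('k, 'v, 'a) cochain set)"
    by (intro parallel_span_uminus trivial_loop) simp
  ultimately show "basis_pair (arrow_path Q \<beta>) (arrow_path Q \<beta>) \<in> (coboundaries Q Z :: ('k::field, 'v, 'a) cochain set)"
    unfolding coboundaries_def by blast
qed

text \<open>In each fibre of \<open>gv\<close> one vertex is kept, e_(n-1) for f1 and e2 for f2. The
  exceptional case is the glued arrow: it bears the name \<alpha>, but from the kept vertex of f1 it
  is \<beta> that starts.\<close>

lemma glue_tail_eq: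
  assumes "b \<in> arcs QB" "x \<noteq> tail Q \<alpha>" "x \<noteq> head Q \<beta>"
  shows "gv (tail Q b) = gv x \<longleftrightarrow> tail Q b = x \<or> b = \<alpha> \<and> tail Q \<beta> = x"
  using assms by (cases "b = \<alpha>") (auto simp: glue_vert_def glued_arcs)

lemma glue_head_eq:
  assumes "b \<in> arcs QB" "x \<noteq> tail Q \<alpha>" "x \<noteq> head Q \<beta>"
  shows "gv (head Q b) = gv x \<longleftrightarrow> head Q b = x"
  using assms by (cases "b = \<alpha>") (auto simp: glue_vert_def glued_arcs)

text \<open>A closed path at e1 or e_n is trivial, so after excluding two paths the base point has
  its incident arrows in correspondence with those of its image; the glued arrow corresponds to
  \<beta> at e_(n-1) and to \<alpha> at e2.\<close>

lemma glue_delta0: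
  assumes p: "p \<in> A.loops" and not: "p \<noteq> (tail Q \<alpha>, [])" "p \<noteq> (head Q \<beta>, [])"
  shows "gc (delta0 Q Z (basis_pair (fst p, []) p)) =
    (delta0 QB ZB (basis_pair (fst (gp p), []) (gp p)) :: ('k::field, 'v, 'a) cochain)"
proof -
  have p': "p \<in> A.B" "p \<in> paths Q" "path_target Q p = fst p" using p A.basis_subset_paths by (auto simp: A.loops_def)
  have x: "fst p \<noteq> tail Q \<alpha>" "fst p \<noteq> head Q \<beta>"
    using not path_from_sink[OF p'(2)] path_to_source[OF p'(2)] p'(3) by (metis prod.collapse)+
  have gpl: "gp p \<in> B.loops" using p' glue_basis_iff by (simp add: B.loops_def)
  have l: "basis_pair (fst p, []) p \<in> (A.loop_cochains :: ('k, 'v, 'a) cochain set)" by (rule A.loop_cochain_basis[OF p])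
  have lB: "basis_pair (fst (gp p), []) (gp p) \<in> (B.loop_cochains :: ('k, 'v, 'a) cochain set)"
    by (rule B.loop_cochain_basis[OF gpl])
  have actA: "act A.B (arrow_path Q b) (delta0 Q Z (basis_pair (fst p, []) p)) =
      (if tail Q b = fst p then reduced A.B (path_comp (arrow_path Q b) p) else 0)
      - (if head Q b = fst p then reduced A.B (path_comp p (arrow_path Q b)) else (0 :: _ \<Rightarrow>\<^sub>0 'k))"
    if "b \<in> arcs Q" for b
    by (rule A.act_delta0_loop[OF p that])
  have gpB: "gp p \<in> B.B" "path_target QB (gp p) = gv (fst p)" using gpl by (simp_all add: B.loops_def)
  have actB: "act B.B (arrow_path QB b) (delta0 QB ZB (basis_pair (fst (gp p), []) (gp p))) =
      (if gv (tail Q b) = gv (fst p) then reduced B.B (path_comp (arrow_path QB b) (gp p)) else 0)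
      - (if gv (head Q b) = gv (fst p) then reduced B.B (path_comp (gp p) (arrow_path QB b)) else (0 :: _ \<Rightarrow>\<^sub>0 'k))"
    if "b \<in> arcs QB" for b
    using B.act_delta0_loop[OF gpl that, where 'k = 'k] by simp
  have red: "tail Q b = fst p \<Longrightarrow> gvec (reduced A.B (path_comp (arrow_path Q b) p)) =
      (reduced B.B (path_comp (arrow_path QB (ga b)) (gp p)) :: _ \<Rightarrow>\<^sub>0 'k)"
    "head Q b = fst p \<Longrightarrow> gvec (reduced A.B (path_comp p (arrow_path Q b))) =
      (reduced B.B (path_comp (gp p) (arrow_path QB (ga b))) :: _ \<Rightarrow>\<^sub>0 'k)" if "b \<in> arcs Q" for b
    using p' A.arrow_path_in_paths[OF that]
    by (subst glue_reduced; simp add: A.path_comp_iff glue_path_comp glue_arrow_path)+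
  show ?thesis
  proof (rule B.cochain_eqI[OF glue_in_cochains[OF A.delta0_in_cochains[OF l]] B.delta0_in_cochains[OF lB]])
    fix b assume b: "b \<in> arcs QB"
    have b': "b \<in> arcs Q" "b \<noteq> \<beta>" "ga b = b" using b by (auto simp: glued_arcs glue_arrow_id)
    have tl: "gv (tail Q b) = gv (fst p) \<longleftrightarrow> tail Q b = fst p \<or> b = \<alpha> \<and> tail Q \<beta> = fst p"
      using glue_tail_eq[OF b x] .
    have hd: "gv (head Q b) = gv (fst p) \<longleftrightarrow> head Q b = fst p"
      using glue_head_eq[OF b x] .
    have g: "gvec (if P then u else 0) = (if P then gvec u else 0)" for P and u :: "_ \<Rightarrow>\<^sub>0 'k"
      by (simp add: linear_zero[OF is_linear_glue_vector])
    show "act B.B (arrow_path QB b) (gc (delta0 Q Z (basis_pair (fst p, []) p))) =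
      act B.B (arrow_path QB b) (delta0 QB ZB (basis_pair (fst (gp p), []) (gp p)) :: ('k, 'v, 'a) cochain)"
      unfolding act_glue_arrow[OF A.delta0_in_cochains[OF l] b] actA[OF b'(1)] actA[OF special_arrows(2)] actB[OF b]
        linear_diff[OF is_linear_glue_vector] g tl hd
      using red[OF b'(1)] red[OF special_arrows(2)] b' x
      by (cases "b = \<alpha>"; cases "tail Q b = fst p"; cases "head Q b = fst p"; cases "tail Q \<beta> = fst p") simp_all
  qed
qed

text \<open>By \<open>lift_parallel\<close> these are the pairs that gluing misses; all of them sit
  at the glued arrow.\<close>

definition wide_cochains :: "('k::field, 'v, 'a) cochain set" where
  "wide_cochains = support_span {(arrow_path QB \<alpha>, gp P) | P. P \<in> wide_paths}"

lemma wide_path_split: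
  assumes P: "P \<in> wide_paths"
  obtains M m where "snd P = \<alpha> # M @ [m, \<beta>]" "m \<in> arcs Q" "head Q m = tail Q \<beta>"
proof -
  have P': "P \<in> paths Q" "fst P = tail Q \<alpha>" "path_target Q P = head Q \<beta>"
    using P A.basis_subset_paths by (auto simp: wide_paths_def)
  obtain a l where al: "snd P = a # l" using P' A.path_nil[of P] by (cases "snd P") auto
  then have a: "a = \<alpha>" using A.path_hd[OF P'(1) al] P'(2) by simp
  obtain r b where rb: "l = r @ [b]"
    using A.path_last[OF P'(1), of "[]" a] al a P' by (cases l rule: rev_cases) auto
  then have b: "b = \<beta>" using A.path_last[OF P'(1), of "a # r" b] al P'(3) by simp
  obtain M m where "r = M @ [m]"
    using A.consecutive_arrows(3)[OF P'(1), of "[]" a b "[]"] al rb a b by (cases r rule: rev_cases) auto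
  then show ?thesis
    using that[of M m] A.consecutive_arrows[OF P'(1), of "\<alpha> # M" m \<beta> "[]"] al a b rb by simp
qed

text \<open>
  The cochains \<open>\<gamma>\<^sup>* \<parallel> \<gamma>\<^sup>* q \<gamma>\<^sup>*\<close> do not come from the quiver before gluing, but they are inner: the
  loop \<open>\<gamma>\<^sup>* q\<close> at \<open>f\<^sub>2\<close> is annihilated by every arrow starting at \<open>f\<^sub>2\<close>.
\<close>

lemma wide_cochain_coboundary:
  assumes P: "P \<in> wide_paths"
  shows "basis_pair (arrow_path QB \<alpha>) (gp P) \<in> (coboundaries QB ZB :: ('k::field, 'v, 'a) cochain set)"
proof -
  have P': "P \<in> A.B" "P \<in> paths Q" "fst P = tail Q \<alpha>" "path_target Q P = head Q \<beta>"
    using P A.basis_subset_paths by (auto simp: wide_paths_def)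
  obtain M m where M: "snd P = \<alpha> # M @ [m, \<beta>]" by (rule wide_path_split[OF P])
  \<comment> \<open>\<open>q\<close> is the image of \<open>P\<close> without its first arrow: a
    closed path at f2 that still ends with the glued arrow.\<close>
  define q where "q = (head Q \<alpha>, map ga (M @ [m]) @ [\<alpha>])"
  have comp: "path_comp q (arrow_path QB \<alpha>) = gp P"
    using M P'(3) by (simp add: q_def path_comp_def prod_eq_iff)
  have gpP: "gp P \<in> B.B" using P' glue_basis_iff by simp
  have q: "q \<in> B.B" "path_target QB q = head Q \<alpha>"
  proof -
    have 1: "path_target QB (arrow_path QB \<alpha>) = fst q" by (simp add: q_def)
    show "q \<in> B.B" by (rule B.basis_comp(2)[OF _ 1]) (simp only: comp gpP)
    have "path_target QB q = path_target QB (gp P)" using path_target_comp[OF 1] comp by simp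
    then show "path_target QB q = head Q \<alpha>" using P'(4) by simp
  qed
  have loop: "q \<in> B.loops" using q by (simp add: B.loops_def q_def)
  have l: "basis_pair (fst q, []) q \<in> (B.loop_cochains :: ('k, 'v, 'a) cochain set)"
    by (rule B.loop_cochain_basis[OF loop])
  have par: "gp P \<in> B.parallels (arrow_path QB \<alpha>)" using gpP P' by (simp add: B.parallels_def)
  \<comment> \<open>The sign appears because the glued arrow ends at f2, so that its product with
    \<open>q\<close> occurs in the subtracted sum of \<open>delta0\<close>.\<close>
  have "- delta0 QB ZB (basis_pair (fst q, []) q) = (basis_pair (arrow_path QB \<alpha>) (gp P) :: ('k, 'v, 'a) cochain)"
  proof (rule B.cochain_eqI)
    show "- delta0 QB ZB (basis_pair (fst q, []) q) \<in> (arrow_cochains QB ZB :: ('k, 'v, 'a) cochain set)"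
      by (rule parallel_span_uminus[OF B.delta0_in_cochains[OF l]])
    show "basis_pair (arrow_path QB \<alpha>) (gp P) \<in> (arrow_cochains QB ZB :: ('k, 'v, 'a) cochain set)"
      by (rule B.basis_pair_in_cochains[OF _ par]) (simp add: glued_arcs)
    fix b assume b: "b \<in> arcs QB"
    have b': "b \<in> arcs Q" "b \<noteq> \<beta>" using b by (auto simp: glued_arcs)
    have "snd (path_comp (arrow_path QB b) q) = map ga M @ [ga m, \<alpha>, b] @ []" by (simp add: q_def)
    then have "reduced B.B (path_comp (arrow_path QB b) q) = (0 :: _ \<Rightarrow>\<^sub>0 'k)" by (rule reduced_interior)
    moreover have "head Q \<alpha> = gv (head Q b) \<longleftrightarrow> b = \<alpha>" using b' by auto
    moreover have "fst q = head Q \<alpha>" by (simp add: q_def)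
    ultimately have "act B.B (arrow_path QB b) (delta0 QB ZB (basis_pair (fst q, []) q)) =
        (if b = \<alpha> then - Poly_Mapping.single (gp P) 1 else (0 :: _ \<Rightarrow>\<^sub>0 'k))"
      using comp B.reduced_basis[OF gpP, where 'b = 'k] unfolding B.act_delta0_loop[OF loop b] by auto
    note delta = this
    have alpha: "\<alpha> \<in> arcs QB" by (simp add: glued_arcs)
    show "act B.B (arrow_path QB b) (- delta0 QB ZB (basis_pair (fst q, []) q)) =
        act B.B (arrow_path QB b) (basis_pair (arrow_path QB \<alpha>) (gp P) :: ('k, 'v, 'a) cochain)"
      unfolding linear_uminus[OF is_linear_act] delta B.act_basis_pair[OF b alpha par] by simp
  qed
  then have "basis_pair (arrow_path QB \<alpha>) (gp P) = (delta0 QB ZB (- basis_pair (fst q, []) q) :: ('k, 'v, 'a) cochain)"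
    by (simp add: linear_uminus[OF is_linear_delta0])
  moreover have "- basis_pair (fst q, []) q \<in> (B.loop_cochains :: ('k, 'v, 'a) cochain set)"
    by (rule parallel_span_uminus[OF l])
  ultimately show ?thesis unfolding coboundaries_def by blast
qed

text \<open>On generators the constant \<open>c\<close> is 1 for the trivial path at e1, -1 for the
  one at e_n, and 0 for all other closed paths.\<close>

lemma glue_coboundary:
  fixes y :: "('k::field, 'v, 'a) cochain"
  assumes "y \<in> coboundaries Q Z"
  obtains c where "gc y - cochain_scale c \<gamma>\<gamma> \<in> coboundaries QB ZB"
proof -
  obtain u where u: "u \<in> A.loop_cochains" "y = delta0 Q Z u" using assms by (auto simp: coboundaries_def)
  define S where "S = {y :: ('k, 'v, 'a) cochain. \<exists>c. gc y - cochain_scale c \<gamma>\<gamma> \<in> coboundaries QB ZB}"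
  have SI: "y \<in> S" if "gc y - cochain_scale c \<gamma>\<gamma> \<in> coboundaries QB ZB" for y c
    using that by (auto simp: S_def)
  have "delta0 Q Z u \<in> S"
  proof (rule linear_closed[OF is_linear_delta0])
    show "0 \<in> S" by (rule SI[of _ 0]) (simp add: linear_zero[OF is_linear_glue_cochain] B.coboundaries_closed)
    fix a b and c :: 'k assume a: "a \<in> S"
    then obtain d where d: "gc a - cochain_scale d \<gamma>\<gamma> \<in> coboundaries QB ZB" by (auto simp: S_def)
    show "cochain_scale c a \<in> S"
      using B.coboundaries_closed(3)[OF d, of c]
      by (intro SI[of _ "c * d"]) (simp add: linear_scale[OF is_linear_glue_cochain] cochain_scale_diff cochain_scale_assoc)
    assume "b \<in> S"
    then obtain e where e: "gc b - cochain_scale e \<gamma>\<gamma> \<in> coboundaries QB ZB" by (auto simp: S_def)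
    show "a + b \<in> S"
      using B.coboundaries_closed(2)[OF d e]
      by (intro SI[of _ "d + e"]) (simp add: linear_add[OF is_linear_glue_cochain] cochain_scale_add_left algebra_simps)
  next
    fix k assume "k \<in> Poly_Mapping.keys u"
    then obtain p where k: "k = ((fst p, []), p)" and p: "p \<in> A.loops" by (rule A.loop_cochain_keyE[OF u(1)])
    have kb: "Poly_Mapping.single k (1::'k) = basis_pair (fst p, []) p" unfolding k basis_pair_def by simp
    consider "p = (tail Q \<alpha>, [])" | "p = (head Q \<beta>, [])" | "p \<noteq> (tail Q \<alpha>, [])" "p \<noteq> (head Q \<beta>, [])" by blast
    then show "delta0 Q Z (Poly_Mapping.single k 1) \<in> S"
    proof cases
      case 1
      show ?thesis
        by (rule SI[of _ 1]) (simp add: kb 1 delta0_source glue_arrow_path B.coboundaries_closed)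
    next
      case 2
      show ?thesis
        by (rule SI[of _ "- 1"])
          (simp add: kb 2 delta0_sink linear_uminus[OF is_linear_glue_cochain] glue_arrow_path B.coboundaries_closed)
    next
      case 3
      have "gp p \<in> B.loops" using p A.basis_subset_paths glue_basis_iff[of p] by (auto simp: A.loops_def B.loops_def)
      then have "delta0 QB ZB (basis_pair (fst (gp p), []) (gp p)) \<in> (coboundaries QB ZB :: ('k, 'v, 'a) cochain set)"
        unfolding coboundaries_def by (intro imageI B.loop_cochain_basis)
      then show ?thesis
        unfolding kb by (intro SI[of _ 0]) (simp only: glue_delta0[OF p 3] cochain_scale_simps diff_zero)
    qed
  qed
  then show ?thesis using that u(2) by (auto simp: S_def)
qed

lemma cochain_from_glue:
  fixes y :: "('k::field, 'v, 'a) cochain"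
  assumes y: "y \<in> arrow_cochains QB ZB"
  obtains x where "x \<in> arrow_cochains Q Z" "y - gc x \<in> coboundaries QB ZB"
proof -
  define S where "S = {y :: ('k, 'v, 'a) cochain. \<exists>x\<in>arrow_cochains Q Z. y - gc x \<in> coboundaries QB ZB}"
  have SI: "y \<in> S" if "x \<in> arrow_cochains Q Z" "y - gc x \<in> coboundaries QB ZB" for x y
    using that by (auto simp: S_def)
  have zero: "(0 :: ('k, 'v, 'a) cochain) \<in> arrow_cochains Q Z" by (simp add: parallel_span_eq support_span_rules)
  have "y \<in> S"
  proof (rule linear_closed[OF is_linear_id])
    show "0 \<in> S" by (rule SI[OF zero]) (simp add: linear_zero[OF is_linear_glue_cochain] B.coboundaries_closed)
    fix a b and c :: 'k assume a: "a \<in> S"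
    then obtain x where x: "x \<in> arrow_cochains Q Z" "a - gc x \<in> coboundaries QB ZB" by (auto simp: S_def)
    show "cochain_scale c a \<in> S"
      using B.coboundaries_closed(3)[OF x(2), of c] x(1)
      by (intro SI[of "cochain_scale c x"])
        (simp_all add: linear_scale[OF is_linear_glue_cochain] cochain_scale_diff parallel_span_eq support_span_rules)
    assume "b \<in> S"
    then obtain z where z: "z \<in> arrow_cochains Q Z" "b - gc z \<in> coboundaries QB ZB" by (auto simp: S_def)
    show "a + b \<in> S"
      using B.coboundaries_closed(2)[OF x(2) z(2)] x(1) z(1)
      by (intro SI[of "x + z"])
        (simp_all add: linear_add[OF is_linear_glue_cochain] parallel_span_eq support_span_rules algebra_simps)
  next
    fix k assume "k \<in> Poly_Mapping.keys y"
    then obtain b q where k: "k = (arrow_path QB b, q)" and b: "b \<in> arcs QB" and q: "q \<in> B.parallels (arrow_path QB b)"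
      by (rule B.cochain_keyE'[OF y])
    have b': "b \<in> arcs Q" "ga b = b" using b by (auto simp: glued_arcs glue_arrow_id)
    have kb: "Poly_Mapping.single k (1::'k) = basis_pair (arrow_path QB b) q" unfolding k basis_pair_def by simp
    from lift_parallel[OF b q] show "Poly_Mapping.single k (1::'k) \<in> S"
    proof (elim disjE bexE conjE)
      fix P assume P: "P \<in> A.parallels (arrow_path Q b)" "q = gp P"
      show ?thesis
        by (rule SI[OF A.basis_pair_in_cochains[OF b'(1) P(1)]])
          (simp add: kb P(2) glue_arrow_path b'(2) B.coboundaries_closed)
    next
      fix P assume P: "b = \<alpha>" "P \<in> wide_paths" "q = gp P"
      show ?thesis
        using wide_cochain_coboundary[OF P(2), where 'k = 'k]
        by (intro SI[OF zero]) (simp add: kb P(1,3) linear_zero[OF is_linear_glue_cochain])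
    qed
  qed
  then show ?thesis using that by (auto simp: S_def)
qed

lemma wide_tag:
  assumes R: "gp R \<in> B.B \<Longrightarrow> R \<in> wide_paths"
  shows "tag (arrow_path QB \<alpha>) (reduced B.B (gp R)) \<in> (wide_cochains :: ('k::field, 'v, 'a) cochain set)"
    and "(reduced B.B (gp R) :: _ \<Rightarrow>\<^sub>0 'k) \<in> support_span (B.parallels (arrow_path QB \<alpha>))"
proof -
  have tag: "tag (arrow_path QB \<alpha>) (reduced B.B (gp R)) =
      (if gp R \<in> B.B then basis_pair (arrow_path QB \<alpha>) (gp R) else (0 :: ('k, 'v, 'a) cochain))"
    by (simp add: tag_def reduced_def linear_extension_rules)
  show "tag (arrow_path QB \<alpha>) (reduced B.B (gp R)) \<in> (wide_cochains :: ('k, 'v, 'a) cochain set)"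
  proof (cases "gp R \<in> B.B")
    case True
    then have "(arrow_path QB \<alpha>, gp R) \<in> {(arrow_path QB \<alpha>, gp P) | P. P \<in> wide_paths}" using R by blast
    then show ?thesis unfolding tag wide_cochains_def using True by (simp add: basis_pair_in_support_span)
  qed (simp add: tag wide_cochains_def support_span_rules)
  show "(reduced B.B (gp R) :: _ \<Rightarrow>\<^sub>0 'k) \<in> support_span (B.parallels (arrow_path QB \<alpha>))"
  proof (cases "gp R \<in> B.B")
    case True
    then have "gp R \<in> B.parallels (arrow_path QB \<alpha>)" using R by (simp add: B.parallels_def wide_paths_def)
    then show ?thesis using True by (simp add: B.reduced_basis single_in_support_span)
  qed (simp add: reduced_def support_span_rules)
qed

text \<open>The lift joins the two vertices of a fibre, so it starts with \<alpha> or ends with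
  \<beta>. Attaching an arrow at that end moves the glued arrow into the interior and gives zero. At
  the other end only the glued arrow can be attached, and the result is zero or the image of a wide
  path.\<close>

lemma delta0_wide:
  assumes P: "P \<in> A.B" and loop: "gp P \<in> B.loops" and ends: "fst P \<noteq> path_target Q P"
  shows "delta0 QB ZB (basis_pair (fst (gp P), []) (gp P)) \<in> (wide_cochains :: ('k::field, 'v, 'a) cochain set)"
proof -
  have Pp: "P \<in> paths Q" using P A.basis_subset_paths by blast
  have ne: "snd P \<noteq> []" using ends A.path_nil[of P] by auto
  have alpha: "\<alpha> \<in> arcs QB" by (simp add: glued_arcs)
  have l: "basis_pair (fst (gp P), []) (gp P) \<in> (B.loop_cochains :: ('k, 'v, 'a) cochain set)"
    by (rule B.loop_cochain_basis[OF loop])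
  have "gv (fst P) = gv (path_target Q P)" using loop by (auto simp: B.loops_def)
  then consider "fst P = tail Q \<alpha>" "path_target Q P = tail Q \<beta>" | "fst P = head Q \<alpha>" "path_target Q P = head Q \<beta>"
    using ends ne path_from_sink[OF Pp] path_to_source[OF Pp] unfolding glue_vert_eq doubleton_eq_iff by metis
  then show ?thesis
  proof cases
    case 1
    define R where "R = path_comp (arrow_path Q \<beta>) P"
    have Rp: "R \<in> paths Q" using Pp 1 A.arrow_path_in_paths by (simp add: R_def A.path_comp_iff)
    have "gp R \<in> B.B \<Longrightarrow> R \<in> wide_paths"
      using glue_basis_iff[OF Rp] 1 by (simp add: wide_paths_def R_def path_target_comp)
    note wide = wide_tag[OF this, where 'k = 'k]
    obtain a M where aM: "snd P = a # M" using ne by (cases "snd P") auto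
    have a: "a = \<alpha>" using A.path_hd[OF Pp aM] 1(1) by simp
    obtain b N where M: "M = b # N"
      using A.path_last(2)[OF Pp, of "[]" a] aM a 1(2) by (cases M) auto
    have "delta0 QB ZB (basis_pair (fst (gp P), []) (gp P)) = (tag (arrow_path QB \<alpha>) (reduced B.B (gp R)) :: ('k, 'v, 'a) cochain)"
    proof (rule B.cochain_eqI[OF B.delta0_in_cochains[OF l] B.tag_in_cochains[OF alpha wide(2)]])
      fix c assume c: "c \<in> arcs QB"
      have "snd (path_comp (gp P) (arrow_path QB c)) = [] @ [c, \<alpha>, ga b] @ map ga N" by (simp add: aM a M)
      then have "reduced B.B (path_comp (gp P) (arrow_path QB c)) = (0 :: _ \<Rightarrow>\<^sub>0 'k)" by (rule reduced_interior)
      moreover have "gv (tail Q c) = tail Q \<alpha> \<longleftrightarrow> c = \<alpha>" using c by (auto simp: glued_arcs)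
      moreover have "path_comp (arrow_path QB \<alpha>) (gp P) = gp R" by (simp add: R_def glue_path_comp glue_arrow_path)
      ultimately show "act B.B (arrow_path QB c) (delta0 QB ZB (basis_pair (fst (gp P), []) (gp P))) =
          act B.B (arrow_path QB c) (tag (arrow_path QB \<alpha>) (reduced B.B (gp R)) :: ('k, 'v, 'a) cochain)"
        using 1 B.act_delta0_loop[OF loop c, where 'k = 'k]
        by (auto simp: B.act_tag[OF c alpha wide(2)])
    qed
    then show ?thesis using wide(1) by simp
  next
    case 2
    define R where "R = path_comp P (arrow_path Q \<alpha>)"
    have Rp: "R \<in> paths Q" using Pp 2 A.arrow_path_in_paths by (simp add: R_def A.path_comp_iff)
    have "gp R \<in> B.B \<Longrightarrow> R \<in> wide_paths"
      using glue_basis_iff[OF Rp] 2 by (simp add: wide_paths_def R_def path_target_comp)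
    note wide = wide_tag[OF this, where 'k = 'k]
    obtain a M where aM: "snd P = M @ [a]" using ne by (cases "snd P" rule: rev_cases) auto
    have a: "a = \<beta>" using A.path_last[OF Pp aM] 2(2) by simp
    obtain b N where M: "M = N @ [b]"
      using A.path_hd(2)[OF Pp, of a "[]"] aM a 2(1) by (cases M rule: rev_cases) auto
    have "delta0 QB ZB (basis_pair (fst (gp P), []) (gp P)) = (- tag (arrow_path QB \<alpha>) (reduced B.B (gp R)) :: ('k, 'v, 'a) cochain)"
    proof (rule B.cochain_eqI[OF B.delta0_in_cochains[OF l] parallel_span_uminus[OF B.tag_in_cochains[OF alpha wide(2)]]])
      fix c assume c: "c \<in> arcs QB"
      have "snd (path_comp (arrow_path QB c) (gp P)) = map ga N @ [ga b, \<alpha>, c] @ []" by (simp add: aM a M)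
      then have "reduced B.B (path_comp (arrow_path QB c) (gp P)) = (0 :: _ \<Rightarrow>\<^sub>0 'k)" by (rule reduced_interior)
      moreover have "gv (head Q c) = head Q \<alpha> \<longleftrightarrow> c = \<alpha>" using c by (auto simp: glued_arcs)
      moreover have "path_comp (gp P) (arrow_path QB \<alpha>) = gp R" by (simp add: R_def glue_path_comp glue_arrow_path)
      ultimately show "act B.B (arrow_path QB c) (delta0 QB ZB (basis_pair (fst (gp P), []) (gp P))) =
          act B.B (arrow_path QB c) (- tag (arrow_path QB \<alpha>) (reduced B.B (gp R)) :: ('k, 'v, 'a) cochain)"
        using 2 B.act_delta0_loop[OF loop c, where 'k = 'k]
        by (auto simp: linear_uminus[OF is_linear_act] B.act_tag[OF c alpha wide(2)])
    qed
    then show ?thesis using wide(1) by (simp add: wide_cochains_def support_span_rules)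
  qed
qed

lemma coboundary_from_glue:
  fixes y :: "('k::field, 'v, 'a) cochain"
  assumes "y \<in> coboundaries QB ZB"
  obtains x where "x \<in> coboundaries Q Z" "y - gc x \<in> wide_cochains"
proof -
  obtain u where u: "u \<in> B.loop_cochains" "y = delta0 QB ZB u" using assms by (auto simp: coboundaries_def)
  define S where "S = {y :: ('k, 'v, 'a) cochain. \<exists>x\<in>coboundaries Q Z. y - gc x \<in> wide_cochains}"
  have SI: "y \<in> S" if "x \<in> coboundaries Q Z" "y - gc x \<in> wide_cochains" for x y
    using that by (auto simp: S_def)
  have wide: "(0 :: ('k, 'v, 'a) cochain) \<in> wide_cochains"
    "a \<in> wide_cochains \<Longrightarrow> b \<in> wide_cochains \<Longrightarrow> a + b \<in> wide_cochains"
    "a \<in> wide_cochains \<Longrightarrow> cochain_scale c a \<in> wide_cochains" for a b :: "('k, 'v, 'a) cochain" and c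
    by (simp_all add: wide_cochains_def support_span_rules)
  have "delta0 QB ZB u \<in> S"
  proof (rule linear_closed[OF is_linear_delta0])
    show "0 \<in> S"
      by (rule SI[OF A.coboundaries_closed(1)]) (simp add: linear_zero[OF is_linear_glue_cochain] wide)
    fix a b and c :: 'k assume a: "a \<in> S"
    then obtain x where x: "x \<in> coboundaries Q Z" "a - gc x \<in> wide_cochains" by (auto simp: S_def)
    show "cochain_scale c a \<in> S"
      using wide(3)[OF x(2), of c]
      by (intro SI[OF A.coboundaries_closed(3)[OF x(1), of c]]) (simp add: linear_scale[OF is_linear_glue_cochain] cochain_scale_diff)
    assume "b \<in> S"
    then obtain z where z: "z \<in> coboundaries Q Z" "b - gc z \<in> wide_cochains" by (auto simp: S_def)
    show "a + b \<in> S"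
      using wide(2)[OF x(2) z(2)]
      by (intro SI[OF A.coboundaries_closed(2)[OF x(1) z(1)]]) (simp add: linear_add[OF is_linear_glue_cochain] algebra_simps)
  next
    fix k assume "k \<in> Poly_Mapping.keys u"
    then obtain p where k: "k = ((fst p, []), p)" and p: "p \<in> B.loops" by (rule B.loop_cochain_keyE[OF u(1)])
    have kb: "Poly_Mapping.single k (1::'k) = basis_pair (fst p, []) p" unfolding k basis_pair_def by simp
    have "p \<in> B.B" using p by (simp add: B.loops_def)
    then obtain P where P: "P \<in> A.B" "gp P = p" by (rule lift_basis)
    show "delta0 QB ZB (Poly_Mapping.single k 1) \<in> S"
    proof (cases "fst P = path_target Q P")
      case False
      have "delta0 QB ZB (basis_pair (fst p, []) p) \<in> (wide_cochains :: ('k, 'v, 'a) cochain set)"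
        using delta0_wide[OF P(1) _ False] p P(2) by simp
      then show ?thesis
        unfolding kb by (intro SI[OF A.coboundaries_closed(1)]) (simp add: linear_zero[OF is_linear_glue_cochain])
    next
      case True
      \<comment> \<open>Each of f1 and f2 has two trivial lifts. Those at the tail of \<beta> and
        the head of \<alpha> are taken, since \<open>glue_delta0\<close> excludes the other
        two.\<close>
      obtain P' where P': "P' \<in> A.loops" "gp P' = p" "P' \<noteq> (tail Q \<alpha>, [])" "P' \<noteq> (head Q \<beta>, [])"
      proof (cases "P = (tail Q \<alpha>, []) \<or> P = (head Q \<beta>, [])")
        case False
        then show ?thesis using that[of P] P True by (simp add: A.loops_def)
      next
        case True
        then have "gp (tail Q \<beta>, []) = p \<or> gp (head Q \<alpha>, []) = p" using P(2) by (auto simp: glue_path_def)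
        then show ?thesis
          using that[of "(tail Q \<beta>, [])"] that[of "(head Q \<alpha>, [])"]
          by (auto simp: A.loops_def A.short_path_in_basis A.trivial_in_paths)
      qed
      have "delta0 Q Z (basis_pair (fst P', []) P') \<in> (coboundaries Q Z :: ('k, 'v, 'a) cochain set)"
        unfolding coboundaries_def by (intro imageI A.loop_cochain_basis P'(1))
      then show ?thesis
        by (rule SI) (simp add: kb glue_delta0[OF P'(1,3,4)] P'(2) wide(1) glue_path_simps(1)[of P', unfolded P'(2)] del: glue_path_simps)
    qed
  qed
  then show ?thesis using that u(2) by (auto simp: S_def)
qed

text \<open>Subtracting a coboundary of \<open>Q\<close> and a multiple of the diagonal pair of
  \<alpha> makes the glued cochain wide. Wide cochains sit at the glued arrow, so the corrected
  cochain is supported on \<alpha> and \<beta>, where it is diagonal and hence inner.\<close>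

lemma coboundary_if_glued:
  fixes x :: "('k::field, 'v, 'a) cochain"
  assumes x: "x \<in> arrow_cochains Q Z" and cob: "gc x - cochain_scale c \<gamma>\<gamma> \<in> coboundaries QB ZB"
  shows "x \<in> coboundaries Q Z"
proof -
  let ?\<alpha> = "basis_pair (arrow_path Q \<alpha>) (arrow_path Q \<alpha>) :: ('k, 'v, 'a) cochain"
  let ?\<beta> = "basis_pair (arrow_path Q \<beta>) (arrow_path Q \<beta>) :: ('k, 'v, 'a) cochain"
  obtain x0 where x0: "x0 \<in> coboundaries Q Z" "gc x - cochain_scale c \<gamma>\<gamma> - gc x0 \<in> wide_cochains"
    by (rule coboundary_from_glue[OF cob])
  define w where "w = x - cochain_scale c ?\<alpha> - x0"
  have ab: "?\<alpha> \<in> arrow_cochains Q Z" "?\<beta> \<in> arrow_cochains Q Z"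
    by (intro A.basis_pair_in_cochains; simp add: parallel_special)+
  have w: "w \<in> arrow_cochains Q Z"
    using x ab(1) A.coboundary_cocycle[OF x0(1)] A.cocycle_cochain[of x0]
    unfolding w_def parallel_span_eq by (intro support_span_rules) auto
  have gw: "gc w \<in> wide_cochains"
    using x0(2) by (simp add: w_def linear_diff[OF is_linear_glue_cochain] linear_scale[OF is_linear_glue_cochain] glue_arrow_path)
  have zero: "act A.B (arrow_path Q b) w = 0" if b: "b \<in> arcs Q" "b \<noteq> \<alpha>" "b \<noteq> \<beta>" for b
  proof -
    have bB: "b \<in> arcs QB" using b by (simp add: glued_arcs)
    have "act B.B (arrow_path QB b) (gc w) = 0"
    proof (rule poly_mapping_eqI)
      fix p
      have "(arrow_path QB b, p) \<notin> Poly_Mapping.keys (gc w)"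
        using gw b(2) by (auto simp: wide_cochains_def support_span_def arrow_path_inj)
      then show "Poly_Mapping.lookup (act B.B (arrow_path QB b) (gc w)) p = Poly_Mapping.lookup 0 p"
        by (simp add: B.lookup_act_arrow[OF glue_in_cochains[OF w] bB] in_keys_iff)
    qed
    then have z: "gvec (act A.B (arrow_path Q b) w) = 0"
      using act_glue_arrow[OF w bB] b(2) by simp
    show ?thesis
      by (rule glue_vector_inj[OF A.act_in_parallels[OF w A.arrow_path_in_paths[OF b(1)]] _ z])
        (erule (2) parallels_glue_inj)
  qed
  have mult: "\<exists>d. act A.B (arrow_path Q b) w = Poly_Mapping.single (arrow_path Q b) d" if b: "b = \<alpha> \<or> b = \<beta>" for b
  proof -
    have "b \<in> arcs Q" "A.parallels (arrow_path Q b) = {arrow_path Q b}" using b parallel_special by auto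
    then have "Poly_Mapping.keys (act A.B (arrow_path Q b) w) \<subseteq> {arrow_path Q b}"
      using A.act_in_parallels[OF w A.arrow_path_in_paths] by (auto simp: support_span_def)
    then have "act A.B (arrow_path Q b) w =
        Poly_Mapping.single (arrow_path Q b) (Poly_Mapping.lookup (act A.B (arrow_path Q b) w) (arrow_path Q b))"
      by (intro poly_mapping_eqI) (auto simp: lookup_single when_def in_keys_iff)
    then show ?thesis by blast
  qed
  obtain d e where de: "act A.B (arrow_path Q \<alpha>) w = Poly_Mapping.single (arrow_path Q \<alpha>) d"
    "act A.B (arrow_path Q \<beta>) w = Poly_Mapping.single (arrow_path Q \<beta>) e"
    using mult by blast
  have "w = cochain_scale d ?\<alpha> + cochain_scale e ?\<beta>"
  proof (rule A.cochain_eqI[OF w])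
    show "cochain_scale d ?\<alpha> + cochain_scale e ?\<beta> \<in> arrow_cochains Q Z"
      using ab unfolding parallel_span_eq by (intro support_span_rules) auto
    fix b assume b: "b \<in> arcs Q"
    have sc: "cochain_scale r (Poly_Mapping.single p 1) = Poly_Mapping.single p r" for r :: 'k and p :: "('v, 'a) path"
      by (rule poly_mapping_eqI) (simp add: lookup_single when_def)
    have "act A.B (arrow_path Q b) ?\<alpha> = (if b = \<alpha> then Poly_Mapping.single (arrow_path Q \<alpha>) 1 else 0)"
      "act A.B (arrow_path Q b) ?\<beta> = (if b = \<beta> then Poly_Mapping.single (arrow_path Q \<beta>) 1 else 0)"
      by (rule A.act_basis_pair[OF b]; simp add: parallel_special)+
    then show "act A.B (arrow_path Q b) w = act A.B (arrow_path Q b) (cochain_scale d ?\<alpha> + cochain_scale e ?\<beta>)"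
      using zero[OF b] de by (auto simp: linear_add[OF is_linear_act] linear_scale[OF is_linear_act] sc)
  qed
  moreover have "x = w + cochain_scale c ?\<alpha> + x0" by (simp add: w_def)
  ultimately show ?thesis
    using x0(1) special_coboundaries by (simp only:) (intro A.coboundaries_closed)
qed

end

section \<open>The fundamental group of a quiver\<close>

definition inverse_list :: "('a \<times> bool) list \<Rightarrow> ('a \<times> bool) list" where
  "inverse_list l = rev (map (\<lambda>(a, b). (a, \<not> b)) l)"

lemma inverse_list_simps [simp]:
  "inverse_list [] = []" "inverse_list (l @ m) = inverse_list m @ inverse_list l"
  "inverse_list ((a, b) # l) = inverse_list l @ [(a, \<not> b)]" "inverse_list (inverse_list l) = l"
  by (simp_all add: inverse_list_def rev_map comp_def split_def)

text \<open>Free reduction of the bare list, in the cancelling direction only; base points enter in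
  \<open>homotopy_reduces\<close>.\<close>

inductive reduces :: "('a \<times> bool) list \<Rightarrow> ('a \<times> bool) list \<Rightarrow> bool" where
  reduces_refl: "reduces l l"
| reduces_step: "reduces l (us @ (a, b) # (a, \<not> b) # ws) \<Longrightarrow> reduces l (us @ ws)"

lemma reduces_context: "reduces l m \<Longrightarrow> reduces (us @ l @ ws) (us @ m @ ws)"
proof (induction rule: reduces.induct)
  case step: (reduces_step l vs a b xs)
  then have "reduces (us @ l @ ws) ((us @ vs) @ (a, b) # (a, \<not> b) # (xs @ ws))" by simp
  from reduces_step[OF this] show ?case by simp
qed (rule reduces_refl)

lemma reduces_trans: "reduces l m \<Longrightarrow> reduces m n \<Longrightarrow> reduces l n"
  by (rotate_tac, induction rule: reduces.induct) (auto intro: reduces_step)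

lemma reduces_inverse: "reduces (l @ inverse_list l) []"
proof (induction l rule: rev_induct)
  case (snoc e l)
  obtain a b where e: "e = (a, b)" by force
  show ?case
    by (rule reduces_trans[OF _ snoc]) (use reduces_step[OF reduces_refl, of l a b "inverse_list l"] e in simp)
qed (simp add: reduces_refl)

text \<open>The homomorphism from the free group on the arrows to the additive group with value
  \<open>c a\<close> at \<open>a\<close>.\<close>

definition exponent :: "('a \<Rightarrow> 'k::field) \<Rightarrow> ('a \<times> bool) list \<Rightarrow> 'k" where
  "exponent c l = (\<Sum>(a, b)\<leftarrow>l. if b then c a else - c a)"

lemma exponent_simps [simp]:
  "exponent c [] = 0" "exponent c (l @ m) = exponent c l + exponent c m"
  "exponent c ((a, b) # l) = (if b then c a else - c a) + exponent c l"
  by (simp_all add: exponent_def)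

lemma exponent_inverse [simp]: "exponent c (inverse_list l) = - exponent c l"
  by (induction l) auto

lemma exponent_zero: "(\<And>a. a \<in> fst ` set l \<Longrightarrow> c a = 0) \<Longrightarrow> exponent c l = 0"
  by (induction l) auto

lemma exponent_cong: "(\<And>a. a \<in> fst ` set l \<Longrightarrow> c a = d a) \<Longrightarrow> exponent c l = exponent d l"
  by (induction l) auto

lemma double_quiver_simps [simp]:
  "verts (double_quiver Q) = verts Q" "arcs (double_quiver Q) = arcs Q \<times> UNIV"
  "tail (double_quiver Q) (a, b) = (if b then tail Q a else head Q a)"
  "head (double_quiver Q) (a, b) = (if b then head Q a else tail Q a)"
  by (simp_all add: double_quiver_def)

lemma (in wf_digraph) wf_double_quiver: "wf_digraph (double_quiver G)"
  by unfold_locales (auto simp: double_quiver_def)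

lemma inverse_walk_simps [simp]:
  "fst (inverse_walk Q w) = path_target (double_quiver Q) w" "snd (inverse_walk Q w) = inverse_list (snd w)"
  by (simp_all add: inverse_walk_def inverse_list_def)

lemma arrow_walk_simps [simp]: "fst (arrow_walk Q a) = tail Q a" "snd (arrow_walk Q a) = [(a, True)]"
  by (simp_all add: arrow_walk_def)

section \<open>The group of homotopy classes of closed walks\<close>

locale quiver_walks = wf_digraph Q for Q :: "('v, 'a) pre_digraph"
begin

abbreviation "DQ \<equiv> double_quiver Q"

end

sublocale quiver_walks \<subseteq> D: wf_digraph "double_quiver Q"
  by (rule wf_double_quiver)

context quiver_walks
begin

lemma walks_iff: "w \<in> walks Q x y \<longleftrightarrow> fst w = x \<and> D.awalk x (snd w) y"
  by (cases w) (auto simp: walks_def D.paths_iff D.awalk_target)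

lemma walk_target: "w \<in> walks Q x y \<Longrightarrow> path_target DQ w = y"
  by (simp add: walks_def)

lemma walks_comp: "p \<in> walks Q x y \<Longrightarrow> q \<in> walks Q y z \<Longrightarrow> path_comp q p \<in> walks Q x z"
  by (auto simp: walks_iff intro: D.awalk_appendI)

lemma trivial_walk: "x \<in> verts Q \<Longrightarrow> (x, []) \<in> walks Q x x"
  by (simp add: walks_iff D.awalk_Nil_iff)

lemma arrow_walk_in_walks: "d \<in> arcs Q \<Longrightarrow> arrow_walk Q d \<in> walks Q (tail Q d) (head Q d)"
  by (simp add: walks_iff D.awalk_Cons_iff D.awalk_Nil_iff)

lemma awalk_inverse: "D.awalk x l y \<Longrightarrow> D.awalk y (inverse_list l) x"
proof (induction l arbitrary: x)
  case (Cons e l)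
  obtain a b where e: "e = (a, b)" by force
  have "D.awalk y (inverse_list l) (head DQ e)" "e \<in> arcs DQ" "x = tail DQ e"
    using Cons by (auto simp: D.awalk_Cons_iff)
  then show ?case
    unfolding e inverse_list_simps by (elim D.awalk_appendI) (auto simp: D.awalk_Cons_iff D.awalk_Nil_iff)
qed (simp add: D.awalk_Nil_iff)

lemma inverse_in_walks: "w \<in> walks Q x y \<Longrightarrow> inverse_walk Q w \<in> walks Q y x"
  using awalk_inverse by (auto simp: walks_iff walk_target[unfolded walks_iff])

lemma walk_verts: "w \<in> walks Q x y \<Longrightarrow> x \<in> verts Q" "w \<in> walks Q x y \<Longrightarrow> y \<in> verts Q"
  using D.awalk_hd_in_verts[of x "snd w" y] D.awalk_last_in_verts[of x "snd w" y] by (simp_all add: walks_iff)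

lemma reduces_awalk: "reduces l m \<Longrightarrow> D.awalk x l y \<Longrightarrow> D.awalk x m y"
proof (induction rule: reduces.induct)
  case step: (reduces_step l us a b ws)
  let ?z = "path_target DQ (x, us)"
  have 1: "D.awalk x us ?z" "D.awalk ?z ((a, b) # (a, \<not> b) # ws) y"
    using step by (simp_all add: D.awalk_append)
  then have "D.awalk ?z ws y" by (auto simp: D.awalk_Cons_iff split: if_splits)
  then show ?case using 1(1) by (rule D.awalk_appendI[rotated])
qed

lemma homotopy_equiv: "equiv (walks Q x x) (homotopy Q x)"
proof -
  let ?R = "cancellation Q x \<union> (cancellation Q x)\<inverse>"
  have sym: "sym (?R\<^sup>*)" by (rule sym_rtrancl) (auto simp: sym_def)
  show ?thesis
    by (rule equivI)
      (use sym in \<open>auto simp: homotopy_def refl_on_def intro!: symI transI dest: symD intro: rtrancl_trans\<close>)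
qed

lemma homotopy_cancellation: "(p, q) \<in> cancellation Q x \<Longrightarrow> (p, q) \<in> homotopy Q x"
proof -
  assume "(p, q) \<in> cancellation Q x"
  moreover from this have "p \<in> walks Q x x" "q \<in> walks Q x x" by (auto simp: cancellation_def)
  ultimately show ?thesis unfolding homotopy_def by blast
qed

lemma homotopy_reduces:
  assumes "reduces (snd p) m" "p \<in> walks Q x x"
  shows "(p, (x, m)) \<in> homotopy Q x"
  using assms
proof (induction "snd p" m rule: reduces.induct)
  case refl: reduces_refl
  moreover from this have "p = (x, snd p)" by (simp add: walks_iff prod_eq_iff)
  ultimately show ?case using homotopy_equiv[of x] unfolding equiv_def by (metis refl_onD)
next
  case step: (reduces_step us a b ws)
  then have IH: "(p, x, us @ (a, b) # (a, \<not> b) # ws) \<in> homotopy Q x" by simp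
  have w: "(x, us @ (a, b) # (a, \<not> b) # ws) \<in> walks Q x x" using IH by (auto simp: homotopy_def)
  then have "(x, us @ ws) \<in> walks Q x x"
    using reduces_awalk[OF reduces_step[OF reduces_refl]] by (fastforce simp: walks_iff)
  then have "((x, us @ (a, b) # (a, \<not> b) # ws), (x, us @ ws)) \<in> cancellation Q x"
    using w by (fastforce simp: cancellation_def)
  from homotopy_cancellation[OF this] show ?case
    using IH homotopy_equiv[of x] by (meson equiv_def transD)
qed

lemma walk_class_eq_iff:
  "p \<in> walks Q x x \<Longrightarrow> q \<in> walks Q x x \<Longrightarrow> walk_class Q x p = walk_class Q x q \<longleftrightarrow> (p, q) \<in> homotopy Q x"
  unfolding walk_class_def by (rule eq_equiv_class_iff[OF homotopy_equiv])

lemma walk_class_reduces: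
  assumes p: "p \<in> walks Q x x" and q: "fst q = x" "reduces (snd p) (snd q)"
  shows "walk_class Q x p = walk_class Q x q"
proof -
  have "(p, q) \<in> homotopy Q x" using homotopy_reduces[OF q(2) p] q(1) by (metis prod.collapse)
  moreover have "q \<in> walks Q x x" using calculation by (auto simp: homotopy_def)
  ultimately show ?thesis using walk_class_eq_iff[OF p] by blast
qed

text \<open>A cancellation in one factor is a cancellation in the composite; the left factor is
  changed first, then the right one.\<close>

lemma homotopy_comp:
  assumes "(p, p') \<in> homotopy Q x" "(q, q') \<in> homotopy Q x"
  shows "(path_comp p q, path_comp p' q') \<in> homotopy Q x"
proof -
  let ?R = "cancellation Q x \<union> (cancellation Q x)\<inverse>"
  have w: "p \<in> walks Q x x" "p' \<in> walks Q x x" "q \<in> walks Q x x" "q' \<in> walks Q x x"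
    using assms by (auto simp: homotopy_def)
  have can: "(path_comp p q, path_comp p' q) \<in> cancellation Q x" if pp: "(p, p') \<in> cancellation Q x" "q \<in> walks Q x x" for p p' q
  proof -
    obtain us a b ws where 1: "snd p = us @ [(a, b), (a, \<not> b)] @ ws" "snd p' = us @ ws" "p \<in> walks Q x x" "p' \<in> walks Q x x"
      using pp(1) unfolding cancellation_def by blast
    then have "snd (path_comp p q) = (snd q @ us) @ [(a, b), (a, \<not> b)] @ ws" "snd (path_comp p' q) = (snd q @ us) @ ws"
      by simp_all
    then show ?thesis unfolding cancellation_def using 1 pp(2) walks_comp by blast
  qed
  have can': "(path_comp p q, path_comp p q') \<in> cancellation Q x" if pp: "(q, q') \<in> cancellation Q x" "p \<in> walks Q x x" for p q q'
  proof -
    obtain us a b ws where 1: "snd q = us @ [(a, b), (a, \<not> b)] @ ws" "snd q' = us @ ws" "q \<in> walks Q x x" "q' \<in> walks Q x x"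
      using pp(1) unfolding cancellation_def by blast
    then have "snd (path_comp p q) = us @ [(a, b), (a, \<not> b)] @ (ws @ snd p)" "snd (path_comp p q') = us @ (ws @ snd p)"
      by simp_all
    then show ?thesis unfolding cancellation_def using 1 pp(2) walks_comp by blast
  qed
  have "(path_comp p q, path_comp p' q) \<in> ?R\<^sup>*" if "(p, p') \<in> ?R\<^sup>*"
    using that
  proof (induction rule: rtrancl_induct)
    case (step y z)
    have "(path_comp y q, path_comp z q) \<in> ?R" using step(2) can[OF _ w(3)] by blast
    with step(3) show ?case by (rule rtrancl_into_rtrancl)
  qed simp
  moreover have "(path_comp p' q, path_comp p' q') \<in> ?R\<^sup>*" if "(q, q') \<in> ?R\<^sup>*"
    using that
  proof (induction rule: rtrancl_induct)
    case (step y z)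
    have "(path_comp p' y, path_comp p' z) \<in> ?R" using step(2) can'[OF _ w(2)] by blast
    with step(3) show ?case by (rule rtrancl_into_rtrancl)
  qed simp
  ultimately have "(path_comp p q, path_comp p' q') \<in> ?R\<^sup>*"
    using assms by (auto simp: homotopy_def intro: rtrancl_trans)
  then show ?thesis using walks_comp w by (auto simp: homotopy_def)
qed

abbreviation "\<pi>\<^sub>1 \<equiv> fundamental_group Q"

lemma pi1_carrier: "carrier (\<pi>\<^sub>1 x) = walk_class Q x ` walks Q x x"
  by (auto simp: fundamental_group_def quotient_def walk_class_def)

lemma walk_class_self: "p \<in> walks Q x x \<Longrightarrow> p \<in> walk_class Q x p"
  unfolding walk_class_def by (rule equiv_class_self[OF homotopy_equiv])

lemma pi1_mult:
  assumes p: "p \<in> walks Q x x" and q: "q \<in> walks Q x x"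
  shows "walk_class Q x p \<otimes>\<^bsub>\<pi>\<^sub>1 x\<^esub> walk_class Q x q = walk_class Q x (path_comp p q)"
proof -
  have same: "walk_class Q x (path_comp p' q') = walk_class Q x (path_comp p q)"
    if "p' \<in> walk_class Q x p" "q' \<in> walk_class Q x q" for p' q'
  proof -
    have h: "(p, p') \<in> homotopy Q x" "(q, q') \<in> homotopy Q x" using that by (auto simp: walk_class_def)
    then have w: "p' \<in> walks Q x x" "q' \<in> walks Q x x" by (auto simp: homotopy_def)
    show ?thesis
      using walk_class_eq_iff[OF walks_comp[OF q p] walks_comp[OF w(2,1)]] homotopy_comp[OF h] by simp
  qed
  have ne: "walk_class Q x p \<noteq> {}" "walk_class Q x q \<noteq> {}" using walk_class_self p q by blast+
  have "(\<Union>q'\<in>walk_class Q x q. walk_class Q x (path_comp p' q')) = walk_class Q x (path_comp p q)"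
    if "p' \<in> walk_class Q x p" for p'
    by (rule SUP_eq_const[OF ne(2)]) (rule same[OF that])
  then have "(\<Union>p'\<in>walk_class Q x p. \<Union>q'\<in>walk_class Q x q. walk_class Q x (path_comp p' q')) = walk_class Q x (path_comp p q)"
    by (rule SUP_eq_const[OF ne(1)])
  then show ?thesis by (simp add: fundamental_group_def)
qed

lemma pi1_one: "\<one>\<^bsub>\<pi>\<^sub>1 x\<^esub> = walk_class Q x (x, [])"
  by (simp add: fundamental_group_def)

lemma pi1_inverse_left:
  assumes "p \<in> walks Q x x"
  shows "walk_class Q x (inverse_walk Q p) \<otimes>\<^bsub>\<pi>\<^sub>1 x\<^esub> walk_class Q x p = \<one>\<^bsub>\<pi>\<^sub>1 x\<^esub>"
  using walk_class_reduces[of "path_comp (inverse_walk Q p) p" x "(x, [])"] assms reduces_inverse[of "snd p"]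
  by (simp add: pi1_mult inverse_in_walks walks_comp[OF _ inverse_in_walks] pi1_one)

lemma pi1_group:
  assumes x: "x \<in> verts Q"
  shows "group (\<pi>\<^sub>1 x)"
proof (rule groupI)
  show "\<one>\<^bsub>\<pi>\<^sub>1 x\<^esub> \<in> carrier (\<pi>\<^sub>1 x)" by (simp add: pi1_one pi1_carrier trivial_walk[OF x])
next
  fix A assume "A \<in> carrier (\<pi>\<^sub>1 x)"
  then obtain p where p: "p \<in> walks Q x x" "A = walk_class Q x p" by (auto simp: pi1_carrier)
  have "path_comp (x, []) p = p" by (simp add: path_comp_def)
  then show "\<one>\<^bsub>\<pi>\<^sub>1 x\<^esub> \<otimes>\<^bsub>\<pi>\<^sub>1 x\<^esub> A = A" using p by (simp add: pi1_one pi1_mult trivial_walk[OF x])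
  show "\<exists>B\<in>carrier (\<pi>\<^sub>1 x). B \<otimes>\<^bsub>\<pi>\<^sub>1 x\<^esub> A = \<one>\<^bsub>\<pi>\<^sub>1 x\<^esub>"
    using pi1_inverse_left[OF p(1)] inverse_in_walks[OF p(1)] p(2) unfolding pi1_carrier by blast
qed (auto simp: pi1_carrier pi1_mult walks_comp path_comp_assoc)

lemma pi1_inverse:
  assumes "p \<in> walks Q x x"
  shows "inv\<^bsub>\<pi>\<^sub>1 x\<^esub> (walk_class Q x p) = walk_class Q x (inverse_walk Q p)"
proof -
  interpret group "\<pi>\<^sub>1 x" by (rule pi1_group[OF walk_verts(1)[OF assms]])
  show ?thesis
    by (rule inv_equality[OF pi1_inverse_left[OF assms]])
      (use assms inverse_in_walks in \<open>auto simp: pi1_carrier\<close>)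
qed

end

section \<open>Homomorphisms to the additive group\<close>

lemma Hom_add_simps [simp]:
  "\<zero>\<^bsub>Hom_add G\<^esub> = (\<lambda>x\<in>carrier G. 0 :: 'k::field)"
  "f \<oplus>\<^bsub>Hom_add G\<^esub> g = (\<lambda>x\<in>carrier G. f x + g x :: 'k)"
  "c \<odot>\<^bsub>Hom_add G\<^esub> f = (\<lambda>x\<in>carrier G. c * f x :: 'k)"
  "f \<otimes>\<^bsub>Hom_add G\<^esub> g = (\<lambda>x\<in>carrier G. 0 :: 'k)"
  by (simp_all add: Hom_add_def)

lemma Hom_add_iff:
  "h \<in> carrier (Hom_add G :: ('k::field, 'g \<Rightarrow> 'k) module) \<longleftrightarrow>
    (\<forall>x\<in>carrier G. \<forall>y\<in>carrier G. h (x \<otimes>\<^bsub>G\<^esub> y) = h x + h y) \<and> h \<in> extensional (carrier G)"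
  by (auto simp: Hom_add_def hom_def ring_of_type_algebra_def)

lemma Hom_add_undefined:
  "h \<in> carrier (Hom_add G :: ('k::field, 'g \<Rightarrow> 'k) module) \<Longrightarrow> x \<notin> carrier G \<Longrightarrow> h x = undefined"
  unfolding Hom_add_iff by (simp add: extensional_def)

lemma Hom_add_algebra:
  assumes "group G"
  shows "nonassoc_algebra (Hom_add G :: ('k::field, 'g \<Rightarrow> 'k) module)"
proof -
  interpret group G by fact
  have closed: "(\<lambda>x\<in>carrier G. 0) \<in> carrier (Hom_add G :: ('k, 'g \<Rightarrow> 'k) module)"
    "f \<in> carrier (Hom_add G :: ('k, 'g \<Rightarrow> 'k) module) \<Longrightarrow> g \<in> carrier (Hom_add G :: ('k, 'g \<Rightarrow> 'k) module) \<Longrightarrow>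
      (\<lambda>x\<in>carrier G. f x + g x) \<in> carrier (Hom_add G :: ('k, 'g \<Rightarrow> 'k) module)"
    "f \<in> carrier (Hom_add G :: ('k, 'g \<Rightarrow> 'k) module) \<Longrightarrow>
      (\<lambda>x\<in>carrier G. c * f x) \<in> carrier (Hom_add G :: ('k, 'g \<Rightarrow> 'k) module)" for f g c
    unfolding Hom_add_iff by (simp_all add: algebra_simps)
  have "abelian_group (Hom_add G :: ('k, 'g \<Rightarrow> 'k) module)"
  proof (rule abelian_groupI)
    fix f assume f: "f \<in> carrier (Hom_add G :: ('k, 'g \<Rightarrow> 'k) module)"
    show "\<exists>g\<in>carrier (Hom_add G). g \<oplus>\<^bsub>Hom_add G\<^esub> f = \<zero>\<^bsub>Hom_add G :: ('k, 'g \<Rightarrow> 'k) module\<^esub>"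
      by (rule bexI[OF _ closed(3)[OF f, of "- 1"]]) (auto simp: restrict_def)
    show "\<zero>\<^bsub>Hom_add G\<^esub> \<oplus>\<^bsub>Hom_add G\<^esub> f = f"
      using f Hom_add_undefined[OF f] by (auto simp: restrict_def fun_eq_iff)
  qed (use closed in \<open>simp_all add: restrict_def algebra_simps fun_eq_iff\<close>)
  then show ?thesis
    unfolding nonassoc_algebra_def nonassoc_algebra_axioms_def
    using closed
    by (auto simp: restrict_def algebra_simps fun_eq_iff Hom_add_undefined)
qed

lemma Hom_add_one:
  assumes "group G" "h \<in> carrier (Hom_add G :: ('k::field, 'g \<Rightarrow> 'k) module)"
  shows "h \<one>\<^bsub>G\<^esub> = 0"
proof -
  interpret group G by fact
  have "h (\<one>\<^bsub>G\<^esub> \<otimes>\<^bsub>G\<^esub> \<one>\<^bsub>G\<^esub>) = h \<one>\<^bsub>G\<^esub> + h \<one>\<^bsub>G\<^esub>" using assms(2) one_closed unfolding Hom_add_iff by blast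
  then have "h \<one>\<^bsub>G\<^esub> + h \<one>\<^bsub>G\<^esub> = h \<one>\<^bsub>G\<^esub> + 0" by simp
  then show ?thesis by (rule add_left_imp_eq)
qed

lemma Hom_add_mult:
  "h \<in> carrier (Hom_add G :: ('k::field, 'g \<Rightarrow> 'k) module) \<Longrightarrow> x \<in> carrier G \<Longrightarrow> y \<in> carrier G \<Longrightarrow>
    h (x \<otimes>\<^bsub>G\<^esub> y) = h x + h y"
  unfolding Hom_add_iff by blast

lemma Hom_add_inv:
  assumes "group G" "h \<in> carrier (Hom_add G :: ('k::field, 'g \<Rightarrow> 'k) module)" "x \<in> carrier G"
  shows "h (inv\<^bsub>G\<^esub> x) = - h x"
proof -
  interpret group G by fact
  have "h (inv\<^bsub>G\<^esub> x \<otimes>\<^bsub>G\<^esub> x) = h (inv\<^bsub>G\<^esub> x) + h x" by (rule Hom_add_mult[OF assms(2)]) (use assms(3) in auto)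
  then show ?thesis using assms(3) Hom_add_one[OF assms(1,2)] by (simp add: l_inv eq_neg_iff_add_eq_0)
qed

text \<open>The coefficients are the exponent sums of a word for \<open>g\<close>. They do not
  depend on \<open>h\<close>; this uniformity later turns a pairing of loops with functionals into a
  product of matrices.\<close>

lemma Hom_add_combination:
  assumes G: "group G" and xs: "set xs \<subseteq> carrier G" and g: "g \<in> generate G (set xs)"
  shows "\<exists>c. \<forall>h\<in>carrier (Hom_add G :: ('k::field, 'g \<Rightarrow> 'k) module). h g = (\<Sum>i<length xs. c i * h (xs ! i))"
proof -
  interpret group G by fact
  show ?thesis
    using g
  proof (induction rule: generate.induct)
    case one
    show ?case by (rule exI[of _ "\<lambda>_. 0"]) (simp add: Hom_add_one[OF G])
  next
    case (incl h)
    then obtain i where "i < length xs" "h = xs ! i" by (auto simp: in_set_conv_nth)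
    then show ?case by (intro exI[of _ "\<lambda>j. if j = i then 1 else 0"]) (simp add: if_distribR if_distrib cong: if_cong)
  next
    case (inv h)
    then obtain i where "i < length xs" "h = xs ! i" by (auto simp: in_set_conv_nth)
    then show ?case
      using xs by (intro exI[of _ "\<lambda>j. if j = i then - 1 else 0"])
        (auto simp: Hom_add_inv[OF G] if_distribR if_distrib subset_iff cong: if_cong)
  next
    case (eng h1 h2)
    then obtain c d where
      c: "\<forall>h\<in>carrier (Hom_add G :: ('k, 'g \<Rightarrow> 'k) module). h h1 = (\<Sum>i<length xs. c i * h (xs ! i))"
      and d: "\<forall>h\<in>carrier (Hom_add G :: ('k, 'g \<Rightarrow> 'k) module). h h2 = (\<Sum>i<length xs. d i * h (xs ! i))"
      by auto
    have "h1 \<in> carrier G" "h2 \<in> carrier G" using eng generate_incl[OF xs] by auto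
    then show ?case
      using c d by (intro exI[of _ "\<lambda>i. c i + d i"]) (simp add: Hom_add_mult distrib_right sum.distrib)
  qed
qed

lemma Hom_add_eqI:
  assumes G: "group G" and xs: "set xs \<subseteq> carrier G" "generate G (set xs) = carrier G"
    and h: "h \<in> carrier (Hom_add G :: ('k::field, 'g \<Rightarrow> 'k) module)" and h': "h' \<in> carrier (Hom_add G :: ('k, 'g \<Rightarrow> 'k) module)"
    and eq: "\<And>i. i < length xs \<Longrightarrow> h (xs ! i) = h' (xs ! i)"
  shows "h = h'"
proof
  fix g
  show "h g = h' g"
  proof (cases "g \<in> carrier G")
    case True
    then have "g \<in> generate G (set xs)" using xs(2) by simp
    from Hom_add_combination[OF G xs(1) this, where 'k = 'k]
    obtain c where c: "\<forall>h\<in>carrier (Hom_add G :: ('k, 'g \<Rightarrow> 'k) module). h g = (\<Sum>i<length xs. c i * h (xs ! i))"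
      by (elim exE)
    show ?thesis unfolding c[rule_format, OF h] c[rule_format, OF h'] by (intro sum.cong) (simp_all add: eq)
  next
    case False
    then show ?thesis using h h' unfolding Hom_add_iff by (simp add: extensional_def)
  qed
qed

lemma Hom_add_finsum:
  assumes G: "group G" and f: "\<And>i. i \<in> A \<Longrightarrow> f i \<in> carrier (Hom_add G :: ('k::field, 'g \<Rightarrow> 'k) module)"
    and g: "g \<in> carrier G" and A: "finite A"
  shows "(\<Oplus>\<^bsub>Hom_add G\<^esub>i\<in>A. f i) g = (\<Sum>i\<in>A. f i g)"
proof -
  interpret nonassoc_algebra "Hom_add G :: ('k, 'g \<Rightarrow> 'k) module" by (rule Hom_add_algebra[OF G])
  show ?thesis
    using A f by (induction A rule: finite_induct) (use g in \<open>simp_all add: Pi_def finsum_insert\<close>)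
qed

text \<open>The expansion of an arbitrary \<open>h\<close> follows because both sides agree on the
  generators, so duality on a generating list is enough.\<close>

lemma is_dual_basisI:
  fixes gs :: "('g \<Rightarrow> 'k::field) list"
  assumes G: "group G" and xs: "set xs \<subseteq> carrier G" "generate G (set xs) = carrier G"
    and gs: "length gs = length xs" "set gs \<subseteq> carrier (Hom_add G)"
    and dual: "\<And>i j. i < length xs \<Longrightarrow> j < length xs \<Longrightarrow> (gs ! i) (xs ! j) = (if i = j then 1 else 0)"
  shows "is_dual_basis G xs gs"
  unfolding is_dual_basis_def
proof (intro conjI allI impI ballI gs dual)
  interpret nonassoc_algebra "Hom_add G :: ('k, 'g \<Rightarrow> 'k) module" by (rule Hom_add_algebra[OF G])
  fix h assume h: "h \<in> carrier (Hom_add G :: ('k, 'g \<Rightarrow> 'k) module)"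
  have gi: "h (xs ! i) \<odot>\<^bsub>Hom_add G\<^esub> (gs ! i) \<in> carrier (Hom_add G)" if "i \<in> {..<length xs}" for i
    using that gs by (intro smult_closed) (auto simp: subset_iff)
  show "h = (\<Oplus>\<^bsub>Hom_add G\<^esub>i\<in>{..<length xs}. h (xs ! i) \<odot>\<^bsub>Hom_add G\<^esub> (gs ! i))"
  proof (rule Hom_add_eqI[OF G xs h])
    show "(\<Oplus>\<^bsub>Hom_add G\<^esub>i\<in>{..<length xs}. h (xs ! i) \<odot>\<^bsub>Hom_add G\<^esub> (gs ! i)) \<in> carrier (Hom_add G)"
      using gi by (intro finsum_closed) (simp add: Pi_def)
    fix j assume j: "j < length xs"
    then have xj: "xs ! j \<in> carrier G" using xs(1) by (auto simp: subset_iff)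
    have "(\<Oplus>\<^bsub>Hom_add G\<^esub>i\<in>{..<length xs}. h (xs ! i) \<odot>\<^bsub>Hom_add G\<^esub> (gs ! i)) (xs ! j) =
        (\<Sum>i<length xs. (h (xs ! i) \<odot>\<^bsub>Hom_add G\<^esub> (gs ! i)) (xs ! j))"
      by (rule Hom_add_finsum[OF G gi xj]) auto
    also have "\<dots> = (\<Sum>i<length xs. h (xs ! i) * (if i = j then 1 else 0))"
      using xj dual j by (intro sum.cong) auto
    also have "\<dots> = h (xs ! j)" using j by (simp add: if_distrib cong: if_cong)
    finally show "h (xs ! j) = (\<Oplus>\<^bsub>Hom_add G\<^esub>i\<in>{..<length xs}. h (xs ! i) \<odot>\<^bsub>Hom_add G\<^esub> (gs ! i)) (xs ! j)" ..
  qed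
qed

text \<open>Homomorphisms are determined on generators, so the description by \<open>THE\<close>
  denotes any dual list that has been found.\<close>

lemma dual_basis_eq:
  fixes gs :: "('g \<Rightarrow> 'k::field) list"
  assumes G: "group G" and xs: "set xs \<subseteq> carrier G" "generate G (set xs) = carrier G"
    and gs: "is_dual_basis G xs gs"
  shows "dual_basis G xs = gs"
  unfolding dual_basis_def
proof (rule the_equality[where P = "is_dual_basis G xs", OF gs])
  fix hs :: "('g \<Rightarrow> 'k) list" assume hs: "is_dual_basis G xs hs"
  show "hs = gs"
  proof (rule nth_equalityI)
    show "length hs = length gs" using hs gs by (simp add: is_dual_basis_def)
    fix i assume i: "i < length hs"
    show "hs ! i = gs ! i"
      by (rule Hom_add_eqI[OF G xs])
        (use i hs gs in \<open>auto simp: is_dual_basis_def subset_iff\<close>)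
  qed
qed

text \<open>Padding with zeros reduces this to square matrices.\<close>

lemma right_inverse_imp_left_inverse:
  fixes a b :: "nat \<Rightarrow> nat \<Rightarrow> 'k::field"
  assumes "l \<le> r" and ab: "\<And>i j. i < r \<Longrightarrow> j < r \<Longrightarrow> (\<Sum>k<l. a i k * b k j) = (if i = j then 1 else 0)"
    and ij: "i < l" "j < l"
  shows "(\<Sum>k<r. b i k * a k j) = (if i = j then 1 else 0)"
proof -
  define A where "A = mat r r (\<lambda>(i, k). if k < l then a i k else 0)"
  define B where "B = mat r r (\<lambda>(k, j). if k < l then b k j else 0)"
  have AB: "A * B = 1\<^sub>m r"
  proof (rule eq_matI)
    fix i j assume ij: "i < dim_row (1\<^sub>m r :: 'k mat)" "j < dim_col (1\<^sub>m r :: 'k mat)"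
    have "(A * B) $$ (i, j) = (\<Sum>k<r. (if k < l then a i k else 0) * (if k < l then b k j else 0))"
      using ij by (simp add: A_def B_def scalar_prod_def atLeast0LessThan)
    also have "\<dots> = (\<Sum>k<l. a i k * b k j)"
      using assms(1) by (intro sum.mono_neutral_cong_right) auto
    finally show "(A * B) $$ (i, j) = 1\<^sub>m r $$ (i, j)" using ab ij by simp
  qed (simp_all add: A_def B_def)
  have "B * A = 1\<^sub>m r"
    by (rule mat_mult_left_right_inverse[OF _ _ AB]) (simp_all add: A_def B_def)
  moreover have "(B * A) $$ (i, j) = (\<Sum>k<r. b i k * a k j)"
    using ij assms(1) by (simp add: A_def B_def scalar_prod_def atLeast0LessThan)
  ultimately show ?thesis using ij assms(1) by simp
qed

text \<open>
  As \<open>xs\<close> generates, the pairing of \<open>D\<close> with itself factors through the coordinates at \<open>xs\<close>; the bound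
  on the length of \<open>xs\<close> makes the corresponding matrix invertible.
\<close>

lemma dual_basis_exists:
  fixes E :: "'d \<Rightarrow> 'g \<Rightarrow> 'k::field"
  assumes G: "group G" and xs: "set xs \<subseteq> carrier G" "generate G (set xs) = carrier G"
    and D: "finite D" "length xs \<le> card D"
    and l: "\<And>d. d \<in> D \<Longrightarrow> l d \<in> carrier G" and E: "\<And>d. d \<in> D \<Longrightarrow> E d \<in> carrier (Hom_add G)"
    and dual: "\<And>d d'. d \<in> D \<Longrightarrow> d' \<in> D \<Longrightarrow> E d (l d') = (if d = d' then 1 else 0)"
  obtains gs :: "('g \<Rightarrow> 'k) list" where "is_dual_basis G xs gs"
proof -
  obtain e where e: "bij_betw e {..<card D} D"
    using ex_bij_betw_nat_finite[OF D(1)] by (auto simp: atLeast0LessThan)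
  then have eD: "e i \<in> D" if "i < card D" for i using that by (auto simp: bij_betw_def)
  have inj: "e i = e j \<longleftrightarrow> i = j" if "i < card D" "j < card D" for i j
    using e that by (auto simp: bij_betw_def inj_on_def)
  have "\<exists>c. \<forall>h\<in>carrier (Hom_add G :: ('k, 'g \<Rightarrow> 'k) module). h (l (e j)) = (\<Sum>i<length xs. c i * h (xs ! i))" if "j < card D" for j
  proof -
    have "l (e j) \<in> generate G (set xs)" using xs(2) l[OF eD[OF that]] by simp
    then show ?thesis by (rule Hom_add_combination[OF G xs(1)])
  qed
  then have "\<forall>j\<in>{..<card D}. \<exists>c. \<forall>h\<in>carrier (Hom_add G :: ('k, 'g \<Rightarrow> 'k) module). h (l (e j)) = (\<Sum>i<length xs. c i * h (xs ! i))"
    by simp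
  from bchoice[OF this] obtain c where "\<forall>j\<in>{..<card D}. \<forall>h\<in>carrier (Hom_add G :: ('k, 'g \<Rightarrow> 'k) module).
      h (l (e j)) = (\<Sum>i<length xs. c j i * h (xs ! i))" by (elim exE)
  then have c: "h (l (e j)) = (\<Sum>i<length xs. c j i * h (xs ! i))"
    if "j < card D" "h \<in> carrier (Hom_add G :: ('k, 'g \<Rightarrow> 'k) module)" for j h
    using that by blast
  have key: "(\<Sum>k<card D. c k i * E (e k) (xs ! j)) = (if i = j then 1 else 0)" if "i < length xs" "j < length xs" for i j
  proof (rule right_inverse_imp_left_inverse[where a = "\<lambda>k j. E (e k) (xs ! j)" and b = "\<lambda>i k. c k i", OF D(2) _ that])
    fix i j assume ij: "i < card D" "j < card D"
    have "E (e i) (l (e j)) = (\<Sum>k<length xs. c j k * E (e i) (xs ! k))" by (rule c[OF ij(2) E[OF eD[OF ij(1)]]])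
    then show "(\<Sum>k<length xs. E (e i) (xs ! k) * c j k) = (if i = j then 1 else 0)"
      using dual[OF eD[OF ij(1)] eD[OF ij(2)]] inj[OF ij] by (simp add: mult.commute)
  qed
  interpret nonassoc_algebra "Hom_add G :: ('k, 'g \<Rightarrow> 'k) module" by (rule Hom_add_algebra[OF G])
  \<comment> \<open>\<open>c k i\<close> is the coefficient of the element \<open>l (e k)\<close> at
    \<open>xs ! i\<close>; by \<open>key\<close>, these combinations of the functionals
    \<open>E\<close> are dual to \<open>xs\<close>.\<close>
  define f where "f i = (\<Oplus>\<^bsub>Hom_add G\<^esub>k\<in>{..<card D}. c k i \<odot>\<^bsub>Hom_add G\<^esub> E (e k))" for i
  have cl: "c k i \<odot>\<^bsub>Hom_add G\<^esub> E (e k) \<in> carrier (Hom_add G)" if "k \<in> {..<card D}" for k i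
    using E[OF eD] that by (intro smult_closed) simp
  have fc: "f i \<in> carrier (Hom_add G)" for i
    unfolding f_def using cl by (intro finsum_closed) (simp add: Pi_def)
  have "is_dual_basis G xs (map f [0..<length xs])"
  proof (rule is_dual_basisI[OF G xs])
    fix i j assume ij: "i < length xs" "j < length xs"
    then have xj: "xs ! j \<in> carrier G" using xs(1) by (auto simp: subset_iff)
    have "f i (xs ! j) = (\<Sum>k<card D. (c k i \<odot>\<^bsub>Hom_add G\<^esub> E (e k)) (xs ! j))"
      unfolding f_def by (rule Hom_add_finsum[OF G cl xj]) auto
    then show "(map f [0..<length xs] ! i) (xs ! j) = (if i = j then 1 else 0)"
      using ij xj key[OF ij] by simp
  qed (use fc in auto)
  then show ?thesis by (rule that)
qed

section \<open>Exponent sums, parade data and spanning trees\<close>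

context quiver_walks
begin

lemma exponent_homotopy: "(p, q) \<in> homotopy Q x \<Longrightarrow> exponent c (snd p) = exponent c (snd q)"
proof -
  assume "(p, q) \<in> homotopy Q x"
  then have "(p, q) \<in> (cancellation Q x \<union> (cancellation Q x)\<inverse>)\<^sup>*" by (simp add: homotopy_def)
  then show ?thesis
  proof (induction rule: rtrancl_induct)
    case (step y z)
    have "exponent c (snd y) = exponent c (snd z)" using step(2) by (auto simp: cancellation_def)
    with step(3) show ?case by simp
  qed simp
qed

text \<open>Every weighting of the arrows gives a homomorphism on closed walks; by
  \<open>exponent_homotopy\<close> its value does not depend on the representative taken by
  \<open>SOME\<close>.\<close>

definition exponent_hom :: "'v \<Rightarrow> ('a \<Rightarrow> 'k::field) \<Rightarrow> (('v, 'a) walk set \<Rightarrow> 'k)" where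
  "exponent_hom x c = (\<lambda>C\<in>carrier (\<pi>\<^sub>1 x). exponent c (snd (SOME w. w \<in> C)))"

lemma exponent_hom_class:
  assumes "w \<in> walks Q x x"
  shows "exponent_hom x c (walk_class Q x w) = exponent c (snd w)"
proof -
  have "(SOME v. v \<in> walk_class Q x w) \<in> walk_class Q x w" using walk_class_self[OF assms] by (rule someI)
  then have "(w, SOME v. v \<in> walk_class Q x w) \<in> homotopy Q x" by (simp add: walk_class_def)
  then have "exponent c (snd (SOME v. v \<in> walk_class Q x w)) = exponent c (snd w)" by (rule exponent_homotopy[symmetric])
  then show ?thesis using assms by (simp add: exponent_hom_def pi1_carrier)
qed

lemma exponent_hom_in_carrier: "exponent_hom x c \<in> carrier (Hom_add (\<pi>\<^sub>1 x) :: ('k::field, ('v, 'a) walk set \<Rightarrow> 'k) module)"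
proof -
  have "exponent_hom x c (A \<otimes>\<^bsub>\<pi>\<^sub>1 x\<^esub> B) = exponent_hom x c A + exponent_hom x c B"
    if "A \<in> carrier (\<pi>\<^sub>1 x)" "B \<in> carrier (\<pi>\<^sub>1 x)" for A B
    using that unfolding pi1_carrier by (auto simp: pi1_mult exponent_hom_class walks_comp)
  moreover have "exponent_hom x c \<in> extensional (carrier (\<pi>\<^sub>1 x))" by (simp add: exponent_hom_def)
  ultimately show ?thesis unfolding Hom_add_iff by blast
qed

section \<open>Parade data and the loops attached to arrows\<close>

definition is_parade :: "'v \<Rightarrow> ('v \<Rightarrow> ('v, 'a) walk) \<Rightarrow> bool" where
  "is_parade x P \<longleftrightarrow> x \<in> verts Q \<and> P x = (x, []) \<and> (\<forall>y. same_block Q x y \<longrightarrow> P y \<in> walks Q x y)"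

text \<open>For the walks of a spanning tree these are the classical generators of the fundamental
  group; \<open>theta\<close> takes its coefficients from the values of a homomorphism on
  them.\<close>

definition loop_walk :: "('v \<Rightarrow> ('v, 'a) walk) \<Rightarrow> 'a \<Rightarrow> ('v, 'a) walk" where
  "loop_walk P d = path_comp (inverse_walk Q (P (head Q d))) (path_comp (arrow_walk Q d) (P (tail Q d)))"

abbreviation arrow_loop :: "'v \<Rightarrow> ('v \<Rightarrow> ('v, 'a) walk) \<Rightarrow> 'a \<Rightarrow> ('v, 'a) walk set" where
  "arrow_loop x P d \<equiv> walk_class Q x (loop_walk P d)"

definition block_arrows :: "'v \<Rightarrow> 'a set" where
  "block_arrows x = {d \<in> arcs Q. same_block Q x (tail Q d)}"

lemma same_block_walk: "w \<in> walks Q x y \<Longrightarrow> same_block Q x y"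
  by (auto simp: same_block_def)

lemma same_block_arrow: "d \<in> arcs Q \<Longrightarrow> same_block Q x (tail Q d) \<longleftrightarrow> same_block Q x (head Q d)"
  using walks_comp arrow_walk_in_walks inverse_in_walks unfolding same_block_def
  by (metis all_not_in_conv)

lemma snd_loop_walk:
  "snd (loop_walk P d) = snd (P (tail Q d)) @ [(d, True)] @ inverse_list (snd (P (head Q d)))"
  by (simp add: loop_walk_def)

lemma loop_walk_in_walks:
  assumes "is_parade x P" "d \<in> block_arrows x"
  shows "loop_walk P d \<in> walks Q x x"
proof -
  have d: "d \<in> arcs Q" "same_block Q x (tail Q d)" "same_block Q x (head Q d)"
    using assms(2) same_block_arrow by (auto simp: block_arrows_def)
  then have "P (tail Q d) \<in> walks Q x (tail Q d)" "P (head Q d) \<in> walks Q x (head Q d)"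
    using assms(1) by (auto simp: is_parade_def)
  then show ?thesis
    unfolding loop_walk_def using d(1) by (blast intro: walks_comp arrow_walk_in_walks inverse_in_walks)
qed

lemma hom_comp:
  assumes "h \<in> carrier (Hom_add (\<pi>\<^sub>1 x) :: ('k::field, ('v, 'a) walk set \<Rightarrow> 'k) module)"
    and "p \<in> walks Q x x" "q \<in> walks Q x x"
  shows "h (walk_class Q x (path_comp p q)) = h (walk_class Q x p) + h (walk_class Q x q)"
  using Hom_add_mult[OF assms(1), of "walk_class Q x p" "walk_class Q x q"] assms(2,3)
  by (simp add: pi1_mult pi1_carrier)

lemma hom_inverse:
  assumes "h \<in> carrier (Hom_add (\<pi>\<^sub>1 x) :: ('k::field, ('v, 'a) walk set \<Rightarrow> 'k) module)" "p \<in> walks Q x x"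
  shows "h (walk_class Q x (inverse_walk Q p)) = - h (walk_class Q x p)"
  using Hom_add_inv[OF pi1_group[OF walk_verts(1)[OF assms(2)]] assms(1), of "walk_class Q x p"] assms(2)
  by (simp add: pi1_inverse pi1_carrier)

text \<open>Inserting \<open>P z\<close> and its inverse at each vertex \<open>z\<close> on the way
  turns \<open>u\<close> followed by the inverse of \<open>P y\<close> into a telescoping product of
  arrow loops. Generation and the formula for \<open>h\<close> are read off from the same product,
  hence the joint statement.\<close>

lemma parade_decomposition:
  assumes P: "is_parade x P" and u: "u \<in> walks Q x y"
  defines "C \<equiv> \<lambda>u y. walk_class Q x (path_comp (inverse_walk Q (P y)) u)"
  shows "C u y \<in> generate (\<pi>\<^sub>1 x) (arrow_loop x P ` block_arrows x) \<and>
    (\<forall>h\<in>carrier (Hom_add (\<pi>\<^sub>1 x) :: ('k::field, ('v, 'a) walk set \<Rightarrow> 'k) module).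
      h (C u y) = exponent (\<lambda>d. h (arrow_loop x P d)) (snd u))"
proof -
  have x: "x \<in> verts Q" "P x = (x, [])" and Py: "\<And>y. same_block Q x y \<Longrightarrow> P y \<in> walks Q x y"
    using P by (auto simp: is_parade_def)
  interpret group "\<pi>\<^sub>1 x" by (rule pi1_group[OF x(1)])
  have "u \<in> paths DQ" "fst u = x" "path_target DQ u = y" using u by (auto simp: walks_def)
  then show ?thesis
  proof (induction arbitrary: y rule: D.paths_induct)
    case (trivial z)
    then have "z = x" "y = x" by auto
    then have C: "C (z, []) y = \<one>\<^bsub>\<pi>\<^sub>1 x\<^esub>"
      by (simp add: C_def x(2) pi1_one path_comp_def inverse_walk_def)
    show ?case
      unfolding C using Hom_add_one[OF is_group] by (auto intro: generate.one)
  next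
    case (step e q)
    obtain d b where e: "e = (d, b)" by force
    have d: "d \<in> arcs Q" using step e by simp
    let ?y = "path_target DQ q" and ?z = "head DQ e"
    have q: "q \<in> walks Q x ?y" "fst q = x" using step by (simp_all add: walks_def)
    have y: "y = ?z" using step by (simp add: path_target_comp)
    have ey: "?y = tail DQ e" using step by simp
    have blk: "same_block Q x ?y" using q(1) by (rule same_block_walk)
    have blk': "same_block Q x (tail Q d)" "same_block Q x (head Q d)"
      using blk same_block_arrow[OF d] unfolding ey e by (auto split: if_splits)
    have dB: "d \<in> block_arrows x" using d blk' by (simp add: block_arrows_def)
    have lw: "loop_walk P d \<in> walks Q x x" by (rule loop_walk_in_walks[OF P dB])
    \<comment> \<open>An arrow traversed backwards contributes the inverse of its loop.\<close>
    define l where "l = (if b then loop_walk P d else inverse_walk Q (loop_walk P d))"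
    have l: "l \<in> walks Q x x" using lw inverse_in_walks by (simp add: l_def)
    have sl: "snd l = snd (P ?y) @ [e] @ inverse_list (snd (P y))"
      unfolding l_def y ey e by (simp add: snd_loop_walk)
    have Pyq: "path_comp (inverse_walk Q (P ?y)) q \<in> walks Q x x"
      using walks_comp[OF q(1) inverse_in_walks[OF Py[OF blk]]] .
    \<comment> \<open>The parade walk to the current vertex meets its inverse here and
      cancels.\<close>
    have red: "reduces (snd (path_comp l (path_comp (inverse_walk Q (P ?y)) q)))
        (snd (path_comp (inverse_walk Q (P y)) (path_comp (arrow_path DQ e) q)))"
      using reduces_context[OF reduces_inverse[of "inverse_list (snd (P ?y))"], of "snd q" "[e] @ inverse_list (snd (P y))"]
      by (simp add: sl)
    have "walk_class Q x (path_comp l (path_comp (inverse_walk Q (P ?y)) q)) = C (path_comp (arrow_path DQ e) q) y"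
      unfolding C_def by (rule walk_class_reduces[OF walks_comp[OF Pyq l] _ red]) (simp add: q(2))
    then have eq: "C (path_comp (arrow_path DQ e) q) y = walk_class Q x l \<otimes>\<^bsub>\<pi>\<^sub>1 x\<^esub> C q ?y"
      and eqh: "\<And>h. h \<in> carrier (Hom_add (\<pi>\<^sub>1 x) :: ('k, ('v, 'a) walk set \<Rightarrow> 'k) module) \<Longrightarrow>
        h (C (path_comp (arrow_path DQ e) q) y) = h (walk_class Q x l) + h (C q ?y)"
      using pi1_mult[OF l Pyq] hom_comp[OF _ l Pyq] by (simp_all add: C_def)
    have IH: "C q ?y \<in> generate (\<pi>\<^sub>1 x) (arrow_loop x P ` block_arrows x)"
      "\<forall>h\<in>carrier (Hom_add (\<pi>\<^sub>1 x) :: ('k, ('v, 'a) walk set \<Rightarrow> 'k) module).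
        h (C q ?y) = exponent (\<lambda>d. h (arrow_loop x P d)) (snd q)"
      using step.IH[OF q(2) refl] by blast+
    have "walk_class Q x l \<in> generate (\<pi>\<^sub>1 x) (arrow_loop x P ` block_arrows x)"
    proof (cases b)
      case True
      then show ?thesis using dB by (simp add: l_def generate.incl)
    next
      case False
      have "inv\<^bsub>\<pi>\<^sub>1 x\<^esub> (arrow_loop x P d) \<in> generate (\<pi>\<^sub>1 x) (arrow_loop x P ` block_arrows x)"
        using dB by (intro generate.inv) simp
      then show ?thesis using False by (simp add: l_def pi1_inverse[OF lw])
    qed
    moreover have "h (walk_class Q x l) = exponent (\<lambda>d. h (arrow_loop x P d)) [e]"
      if "h \<in> carrier (Hom_add (\<pi>\<^sub>1 x) :: ('k, ('v, 'a) walk set \<Rightarrow> 'k) module)" for h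
      using hom_inverse[OF that lw] by (simp add: l_def e)
    ultimately show ?case
    proof (intro conjI ballI)
      assume "walk_class Q x l \<in> generate (\<pi>\<^sub>1 x) (arrow_loop x P ` block_arrows x)"
      then show "C (path_comp (arrow_path DQ e) q) y \<in> generate (\<pi>\<^sub>1 x) (arrow_loop x P ` block_arrows x)"
        unfolding eq using IH(1) by (rule generate.eng)
    next
      fix h assume h: "h \<in> carrier (Hom_add (\<pi>\<^sub>1 x) :: ('k, ('v, 'a) walk set \<Rightarrow> 'k) module)"
      assume "\<And>h. h \<in> carrier (Hom_add (\<pi>\<^sub>1 x) :: ('k, ('v, 'a) walk set \<Rightarrow> 'k) module) \<Longrightarrow>
        h (walk_class Q x l) = exponent (\<lambda>d. h (arrow_loop x P d)) [e]"
      then show "h (C (path_comp (arrow_path DQ e) q) y) =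
          exponent (\<lambda>d. h (arrow_loop x P d)) (snd (path_comp (arrow_path DQ e) q))"
        using IH(2) h eqh[OF h] by simp
    qed
  qed
qed

lemma inverse_trivial_comp: "fst w = x \<Longrightarrow> path_comp (inverse_walk Q (x, [])) w = w"
  by (simp add: path_comp_def prod_eq_iff)

lemma pi1_generated_by_loops:
  assumes P: "is_parade x P"
  shows "generate (\<pi>\<^sub>1 x) (arrow_loop x P ` block_arrows x) = carrier (\<pi>\<^sub>1 x)"
proof
  interpret group "\<pi>\<^sub>1 x" by (rule pi1_group) (use P in \<open>simp add: is_parade_def\<close>)
  have "arrow_loop x P ` block_arrows x \<subseteq> carrier (\<pi>\<^sub>1 x)"
    using loop_walk_in_walks[OF P] by (auto simp: pi1_carrier)
  then show "generate (\<pi>\<^sub>1 x) (arrow_loop x P ` block_arrows x) \<subseteq> carrier (\<pi>\<^sub>1 x)"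
    by (rule generate_incl)
  show "carrier (\<pi>\<^sub>1 x) \<subseteq> generate (\<pi>\<^sub>1 x) (arrow_loop x P ` block_arrows x)"
  proof
    fix A assume "A \<in> carrier (\<pi>\<^sub>1 x)"
    then obtain w where w: "w \<in> walks Q x x" "A = walk_class Q x w" by (auto simp: pi1_carrier)
    have "P x = (x, [])" "fst w = x" using P w(1) by (auto simp: is_parade_def walks_def)
    then show "A \<in> generate (\<pi>\<^sub>1 x) (arrow_loop x P ` block_arrows x)"
      using parade_decomposition[OF P w(1), THEN conjunct1] w(2) inverse_trivial_comp[of w x] by simp
  qed
qed

text \<open>For a closed walk \<open>P x\<close> is trivial, so the telescoping product represents
  the walk itself.\<close>

lemma hom_eq_exponent:
  assumes P: "is_parade x P" and w: "w \<in> walks Q x x"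
    and h: "h \<in> carrier (Hom_add (\<pi>\<^sub>1 x) :: ('k::field, ('v, 'a) walk set \<Rightarrow> 'k) module)"
  shows "h (walk_class Q x w) = exponent (\<lambda>d. h (arrow_loop x P d)) (snd w)"
proof -
  have "P x = (x, [])" "fst w = x" using P w by (auto simp: is_parade_def walks_def)
  then show ?thesis
    using parade_decomposition[OF P w, where 'k = 'k] h inverse_trivial_comp[of w x] by simp
qed

section \<open>Spanning trees of a block and existence of dual bases\<close>

lemma crossing_arrow:
  "D.awalk x l y \<Longrightarrow> x \<in> V \<Longrightarrow> y \<notin> V \<Longrightarrow> \<exists>e\<in>arcs DQ. tail DQ e \<in> V \<and> head DQ e \<notin> V"
proof (induction l arbitrary: x)
  case Nil
  then show ?case by (simp add: D.awalk_Nil_iff)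
next
  case (Cons e l)
  then show ?case unfolding D.awalk_Cons_iff by blast
qed

text \<open>The last clause makes the loops of tree arrows contractible. The condition on the arrows
  of \<open>P y\<close> makes every arrow outside \<open>T\<close> have exponent zero on all parade
  walks.\<close>

definition is_tree :: "'v \<Rightarrow> 'v set \<Rightarrow> 'a set \<Rightarrow> ('v \<Rightarrow> ('v, 'a) walk) \<Rightarrow> bool" where
  "is_tree x V T P \<longleftrightarrow> x \<in> V \<and> V \<subseteq> Collect (same_block Q x) \<and> T \<subseteq> arcs Q \<and> P x = (x, []) \<and>
    (\<forall>y\<in>V. P y \<in> walks Q x y \<and> fst ` set (snd (P y)) \<subseteq> T) \<and>
    (\<forall>a\<in>T. tail Q a \<in> V \<and> head Q a \<in> V \<and>
      (snd (P (head Q a)) = snd (P (tail Q a)) @ [(a, True)] \<or>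
       snd (P (tail Q a)) = snd (P (head Q a)) @ [(a, False)]))"

text \<open>Connectedness of the block yields an arrow that leaves \<open>V\<close> in one of its
  two directions, and its far end is the new vertex. The arrow is not in \<open>T\<close>, since
  both ends of a tree arrow lie in \<open>V\<close>.\<close>

lemma extend_tree:
  assumes tree: "is_tree x V T P" and V: "V \<noteq> Collect (same_block Q x)"
  obtains z T' P' where "z \<notin> V" "is_tree x (insert z V) T' P'"
proof -
  obtain y where y: "same_block Q x y" "y \<notin> V" using tree V by (auto simp: is_tree_def)
  then obtain w where "D.awalk x (snd w) y" by (auto simp: same_block_def walks_iff)
  moreover have xV: "x \<in> V" using tree by (simp add: is_tree_def)
  ultimately obtain e where e: "e \<in> arcs DQ" "tail DQ e \<in> V" "head DQ e \<notin> V"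
    using crossing_arrow y(2) by blast
  obtain d b where db: "e = (d, b)" by force
  define z where "z = head DQ e"
  define P' where "P' = P(z := (x, snd (P (tail DQ e)) @ [e]))"
  have zx: "z \<noteq> x" "z \<notin> V" using xV e(3) by (auto simp: z_def)
  have d: "d \<in> arcs Q" "d \<notin> T"
    using e tree by (auto simp: db is_tree_def split: if_splits)
  have Pt: "P (tail DQ e) \<in> walks Q x (tail DQ e)" "fst ` set (snd (P (tail DQ e))) \<subseteq> T"
    using tree e(2) by (auto simp: is_tree_def)
  have "D.awalk (tail DQ e) [e] z" using e(1) by (simp add: z_def D.arc_implies_awalk)
  then have Pz: "(x, snd (P (tail DQ e)) @ [e]) \<in> walks Q x z"
    using Pt(1) by (auto simp: walks_iff intro: D.awalk_appendI)
  have P': "P' y = P y" if "y \<in> V" for y using that zx by (auto simp: P'_def)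
  have "is_tree x (insert z V) (insert d T) P'"
    unfolding is_tree_def
  proof (intro conjI ballI)
    show "x \<in> insert z V" using xV by simp
    show "insert z V \<subseteq> Collect (same_block Q x)" using tree same_block_walk[OF Pz] by (auto simp: is_tree_def)
    show "insert d T \<subseteq> arcs Q" using tree d by (auto simp: is_tree_def)
    show "P' x = (x, [])" using tree P'[OF xV] by (simp add: is_tree_def)
    show "P' y \<in> walks Q x y" if "y \<in> insert z V" for y
      using that Pz tree P' by (auto simp: is_tree_def) (simp add: P'_def)
    show "fst ` set (snd (P' y)) \<subseteq> insert d T" if "y \<in> insert z V" for y
    proof (cases "y = z")
      case True
      then have "fst ` set (snd (P' y)) = insert d (fst ` set (snd (P (tail DQ e))))" by (simp add: P'_def db)
      then show ?thesis using Pt(2) by blast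
    next
      case False
      then have y: "y \<in> V" using that by simp
      then have "fst ` set (snd (P y)) \<subseteq> T" using tree by (simp add: is_tree_def)
      then show ?thesis unfolding P'[OF y] by blast
    qed
    fix a assume a: "a \<in> insert d T"
    have ends: "{tail Q d, head Q d} \<subseteq> insert z V" using e db by (auto simp: z_def split: if_splits)
    show "tail Q a \<in> insert z V" "head Q a \<in> insert z V" using a ends tree by (auto simp: is_tree_def)
    show "snd (P' (head Q a)) = snd (P' (tail Q a)) @ [(a, True)] \<or> snd (P' (tail Q a)) = snd (P' (head Q a)) @ [(a, False)]"
    proof (cases "a = d")
      case True
      then show ?thesis using P'[OF e(2)] unfolding db by (cases b) (auto simp: P'_def z_def db)
    next
      case False
      then have "a \<in> T" using a by simp
      then show ?thesis using tree P' by (auto simp: is_tree_def)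
    qed
  qed
  then show ?thesis using that zx(2) by blast
qed

text \<open>The induction on \<open>k\<close> provides a tree that is complete or has at least
  \<open>k\<close> vertices. Taking \<open>k\<close> one larger than the number of vertices leaves
  only the complete one.\<close>

lemma spanning_tree:
  assumes x: "x \<in> verts Q" and fin: "finite (verts Q)"
  obtains T P where "is_tree x (Collect (same_block Q x)) T P"
proof -
  have sub: "Collect (same_block Q x) \<subseteq> verts Q" using walk_verts(2) by (auto simp: same_block_def)
  have "\<exists>V T P. is_tree x V T P \<and> (V = Collect (same_block Q x) \<or> k \<le> card V)" for k
  proof (induction k)
    case 0
    have "is_tree x {x} {} (\<lambda>_. (x, []))"
      using trivial_walk[OF x] same_block_walk by (auto simp: is_tree_def)
    then show ?case by blast
  next
    case (Suc k)
    then obtain V T P where V: "is_tree x V T P" "V = Collect (same_block Q x) \<or> k \<le> card V"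
      by (elim exE conjE)
    show ?case
    proof (cases "V = Collect (same_block Q x)")
      case True
      then show ?thesis using V(1) by blast
    next
      case False
      obtain z T' P' where z: "z \<notin> V" "is_tree x (insert z V) T' P'" by (rule extend_tree[OF V(1) False])
      have "V \<subseteq> Collect (same_block Q x)" using V(1) by (simp add: is_tree_def)
      then have "V \<subseteq> verts Q" using sub by (rule order_trans)
      then have "finite V" using fin by (rule finite_subset)
      then have "Suc k \<le> card (insert z V)" using z(1) V(2) False by simp
      then show ?thesis using z(2) by blast
    qed
  qed
  from this[of "Suc (card (verts Q))"] obtain V T P where V: "is_tree x V T P"
    "V = Collect (same_block Q x) \<or> Suc (card (verts Q)) \<le> card V" by (elim exE conjE)
  have "V \<subseteq> Collect (same_block Q x)" using V(1) by (simp add: is_tree_def)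
  then have "V \<subseteq> verts Q" using sub by (rule order_trans)
  then have "card V \<le> card (verts Q)" by (rule card_mono[OF fin])
  then have "V = Collect (same_block Q x)" using V(2) by simp
  then show ?thesis using V(1) that by simp
qed

text \<open>Loops of tree arrows are trivial, so the loops of the remaining arrows \<open>D\<close>
  generate, and minimality bounds the length of \<open>xs\<close> by the size of \<open>D\<close>.
  Counting a single arrow of \<open>D\<close> with sign gives the functionals dual to these
  loops.\<close>

lemma dual_basis_of_minimal_generators:
  assumes x: "x \<in> verts Q" and fin: "finite (verts Q)" "finite (arcs Q)"
    and gen: "minimal_generators (\<pi>\<^sub>1 x) xs"
  obtains gs :: "(('v, 'a) walk set \<Rightarrow> 'k::field) list" where "is_dual_basis (\<pi>\<^sub>1 x) xs gs"
proof -
  interpret group "\<pi>\<^sub>1 x" by (rule pi1_group[OF x])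
  obtain T P where tree: "is_tree x (Collect (same_block Q x)) T P" by (rule spanning_tree[OF x fin(1)])
  have P: "is_parade x P" using tree x by (auto simp: is_tree_def is_parade_def)
  define D where "D = block_arrows x - T"
  have lw: "loop_walk P d \<in> walks Q x x" if "d \<in> block_arrows x" for d by (rule loop_walk_in_walks[OF P that])
  have incl: "arrow_loop x P ` D \<subseteq> carrier (\<pi>\<^sub>1 x)" using lw by (auto simp: D_def pi1_carrier)
  have "arrow_loop x P d \<in> generate (\<pi>\<^sub>1 x) (arrow_loop x P ` D)" if d: "d \<in> block_arrows x" for d
  proof (cases "d \<in> T")
    case True
    then have "snd (P (head Q d)) = snd (P (tail Q d)) @ [(d, True)] \<or> snd (P (tail Q d)) = snd (P (head Q d)) @ [(d, False)]"
      using tree by (auto simp: is_tree_def)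
    then have "reduces (snd (loop_walk P d)) []"
    proof
      assume "snd (P (head Q d)) = snd (P (tail Q d)) @ [(d, True)]"
      then show ?thesis using reduces_inverse[of "snd (P (tail Q d)) @ [(d, True)]"] by (simp add: snd_loop_walk)
    next
      assume *: "snd (P (tail Q d)) = snd (P (head Q d)) @ [(d, False)]"
      have "reduces (snd (loop_walk P d)) (snd (P (head Q d)) @ inverse_list (snd (P (head Q d))))"
        using reduces_step[OF reduces_refl, of "snd (P (head Q d))" d False "inverse_list (snd (P (head Q d)))"]
        by (simp add: snd_loop_walk *)
      then show ?thesis by (rule reduces_trans[OF _ reduces_inverse])
    qed
    then have "arrow_loop x P d = \<one>\<^bsub>\<pi>\<^sub>1 x\<^esub>" unfolding pi1_one by (intro walk_class_reduces lw d) simp_all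
    then show ?thesis by (simp add: generate.one)
  next
    case False
    then show ?thesis using d by (intro generate.incl) (simp add: D_def)
  qed
  then have "generate (\<pi>\<^sub>1 x) (arrow_loop x P ` block_arrows x) \<subseteq> generate (\<pi>\<^sub>1 x) (arrow_loop x P ` D)"
    by (intro generate_subgroup_incl generate_is_subgroup incl) auto
  then have genD: "generate (\<pi>\<^sub>1 x) (arrow_loop x P ` D) = carrier (\<pi>\<^sub>1 x)"
    using pi1_generated_by_loops[OF P] generate_incl[OF incl] by blast
  have finD: "finite D" using fin(2) by (auto simp: D_def block_arrows_def)
  have xs: "set xs \<subseteq> carrier (\<pi>\<^sub>1 x)" "generate (\<pi>\<^sub>1 x) (set xs) = carrier (\<pi>\<^sub>1 x)"
    and "length xs \<le> card (arrow_loop x P ` D)"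
    using gen incl genD finD unfolding minimal_generators_def by blast+
  then have len: "length xs \<le> card D" using card_image_le[OF finD] by (meson le_trans)
  define E where "E d = exponent_hom x (\<lambda>a. if a = d then 1 else (0::'k))" for d
  have "E d (arrow_loop x P d') = (if d = d' then 1 else 0)" if d: "d \<in> D" "d' \<in> D" for d d'
  proof -
    have "same_block Q x (tail Q d')" "same_block Q x (head Q d')"
      using d(2) same_block_arrow by (auto simp: D_def block_arrows_def)
    then have "fst ` set (snd (P (tail Q d'))) \<subseteq> T" "fst ` set (snd (P (head Q d'))) \<subseteq> T"
      using tree by (auto simp: is_tree_def)
    then have "exponent (\<lambda>a. if a = d then 1 else (0::'k)) (snd (P (tail Q d'))) = 0"
      "exponent (\<lambda>a. if a = d then 1 else (0::'k)) (snd (P (head Q d'))) = 0"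
      using d(1) by (auto intro!: exponent_zero simp: D_def)
    then show ?thesis
      using lw d(2) by (auto simp: E_def exponent_hom_class D_def snd_loop_walk)
  qed
  note dual = this
  have lc: "arrow_loop x P d \<in> carrier (\<pi>\<^sub>1 x)" if "d \<in> D" for d using incl that by blast
  have Ec: "E d \<in> carrier (Hom_add (\<pi>\<^sub>1 x) :: ('k, ('v, 'a) walk set \<Rightarrow> 'k) module)" if "d \<in> D" for d
    unfolding E_def by (rule exponent_hom_in_carrier)
  show ?thesis by (rule dual_basis_exists[OF is_group xs finD len lc Ec dual]) (assumption | erule that)+
qed

end

section \<open>Diagonal derivations\<close>

definition diagonal_cochain ::
  "('v, 'a) pre_digraph \<Rightarrow> 'a set \<Rightarrow> ('a \<Rightarrow> 'k::field) \<Rightarrow> ('k, 'v, 'a) cochain" where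
  "diagonal_cochain Q D c = (\<Sum>d\<in>D. cochain_scale (c d) (basis_pair (arrow_path Q d) (arrow_path Q d)))"

lemma diagonal_cochain_add:
  "diagonal_cochain Q D (\<lambda>d. c d + c' d) = diagonal_cochain Q D c + diagonal_cochain Q D c'"
  by (simp add: diagonal_cochain_def cochain_scale_add_left sum.distrib)

lemma diagonal_cochain_scale:
  "diagonal_cochain Q D (\<lambda>d. r * c d) = cochain_scale r (diagonal_cochain Q D c)"
  by (simp add: diagonal_cochain_def cochain_scale_sum cochain_scale_assoc)

lemma diagonal_cochain_cong:
  "(\<And>d. d \<in> D \<Longrightarrow> c d = c' d) \<Longrightarrow> diagonal_cochain Q D c = diagonal_cochain Q D c'"
  by (simp add: diagonal_cochain_def)

context monomial_quiver
begin

text \<open>Replacing \<open>d\<close> by itself in a relation returns the relation, which is zero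
  in A.\<close>

lemma diagonal_pair_cocycle:
  assumes d: "d \<in> arcs Q"
  shows "basis_pair (arrow_path Q d) (arrow_path Q d) \<in> (carrier (cocycles Q Z) :: ('k::field, 'v, 'a) cochain set)"
proof -
  have "act B r (basis_pair (arrow_path Q d) (arrow_path Q d)) = (0 :: _ \<Rightarrow>\<^sub>0 'k)" if "r \<in> Z" for r
  proof -
    have "r \<in> paths Q" using that relations_subset by blast
    then have "r \<in> ideal_paths Q Z" using that subpath_refl by (rule ideal_pathsI)
    then have "reduced B r = (0 :: _ \<Rightarrow>\<^sub>0 'k)" by (simp add: reduced_def basis_paths_def)
    then show ?thesis
      by (auto simp: act_def replace_arrow_same intro!: sum.neutral)
  qed
  moreover have "arrow_path Q d \<in> parallels (arrow_path Q d)"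
    using arrow_path_in_basis[OF d] by (simp add: parallels_def)
  ultimately show ?thesis using basis_pair_in_cochains[OF d] by (simp add: cocycles_iff)
qed

lemma diagonal_cocycle:
  "D \<subseteq> arcs Q \<Longrightarrow> diagonal_cochain Q D c \<in> (carrier (cocycles Q Z) :: ('k::field, 'v, 'a) cochain set)"
proof (induction D rule: infinite_finite_induct)
  case (insert d D)
  then show ?case
    by (simp add: diagonal_cochain_def cocycles_closed diagonal_pair_cocycle)
qed (simp_all add: diagonal_cochain_def cocycles_closed)

lemma cocycles_minus:
  assumes "x \<in> carrier (cocycles Q Z)" "y \<in> carrier (cocycles Q Z)"
  shows "x \<ominus>\<^bsub>cocycles Q Z\<^esub> y = x - y"
proof -
  interpret nonassoc_algebra "cocycles Q Z" by (rule cocycles_algebra)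
  have "\<ominus>\<^bsub>cocycles Q Z\<^esub> y = - y"
    by (rule add.inv_equality) (use assms cocycles_closed in auto)
  then show ?thesis by (simp add: a_minus_def)
qed

lemma HH1_carrier: "carrier (HH1 Q Z) = HH1_class Q Z ` carrier (cocycles Q Z)"
  and HH1_class_eq: "x \<in> carrier (cocycles Q Z) \<Longrightarrow> y \<in> carrier (cocycles Q Z) \<Longrightarrow>
    HH1_class Q Z x = HH1_class Q Z y \<longleftrightarrow> x - y \<in> coboundaries Q Z"
  and HH1_class_add: "x \<in> carrier (cocycles Q Z) \<Longrightarrow> y \<in> carrier (cocycles Q Z) \<Longrightarrow>
    HH1_class Q Z x \<oplus>\<^bsub>HH1 Q Z\<^esub> HH1_class Q Z y = HH1_class Q Z (x + y)"
  and HH1_class_scale: "x \<in> carrier (cocycles Q Z) \<Longrightarrow>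
    c \<odot>\<^bsub>HH1 Q Z\<^esub> HH1_class Q Z x = HH1_class Q Z (cochain_scale c x)"
  and HH1_class_bracket: "x \<in> carrier (cocycles Q Z) \<Longrightarrow> y \<in> carrier (cocycles Q Z) \<Longrightarrow>
    HH1_class Q Z x \<otimes>\<^bsub>HH1 Q Z\<^esub> HH1_class Q Z y = HH1_class Q Z (cochain_bracket B x y)"
  and HH1_algebra: "nonassoc_algebra (HH1 Q Z)"
proof -
  interpret nonassoc_ideal "cocycles Q Z" "coboundaries Q Z" by (rule coboundaries_ideal)
  show "carrier (HH1 Q Z) = HH1_class Q Z ` carrier (cocycles Q Z)"
    unfolding HH1_def carrier_quotient HH1_class_def[abs_def] ..
  show "x \<in> carrier (cocycles Q Z) \<Longrightarrow> y \<in> carrier (cocycles Q Z) \<Longrightarrow>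
    HH1_class Q Z x = HH1_class Q Z y \<longleftrightarrow> x - y \<in> coboundaries Q Z"
    unfolding HH1_class_def by (simp add: coset_eq cocycles_minus)
  show "x \<in> carrier (cocycles Q Z) \<Longrightarrow> y \<in> carrier (cocycles Q Z) \<Longrightarrow>
    HH1_class Q Z x \<oplus>\<^bsub>HH1 Q Z\<^esub> HH1_class Q Z y = HH1_class Q Z (x + y)"
    unfolding HH1_class_def HH1_def by (simp add: quotient_add)
  show "x \<in> carrier (cocycles Q Z) \<Longrightarrow>
    c \<odot>\<^bsub>HH1 Q Z\<^esub> HH1_class Q Z x = HH1_class Q Z (cochain_scale c x)"
    unfolding HH1_class_def HH1_def by (simp add: quotient_smult)
  show "x \<in> carrier (cocycles Q Z) \<Longrightarrow> y \<in> carrier (cocycles Q Z) \<Longrightarrow>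
    HH1_class Q Z x \<otimes>\<^bsub>HH1 Q Z\<^esub> HH1_class Q Z y = HH1_class Q Z (cochain_bracket B x y)"
    unfolding HH1_class_def HH1_def by (simp add: quotient_mult)
  show "nonassoc_algebra (HH1 Q Z)" unfolding HH1_def by (rule quotient_nonassoc_algebra)
qed

end

locale monomial_walks = monomial_quiver Q Z + quiver_walks Q
  for Q :: "('v, 'a) pre_digraph" and Z :: "('v, 'a) path set"
begin

lemma theta_eq: "theta Q Z x P h = HH1_class Q Z (diagonal_cochain Q (block_arrows x) (\<lambda>d. h (arrow_loop x P d)))"
  unfolding theta_def diagonal_cochain_def block_arrows_def loop_walk_def ..

lemma block_arrows_subset: "block_arrows x \<subseteq> arcs Q"
  by (auto simp: block_arrows_def)

lemma theta_linear:
  assumes P: "is_parade x P"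
  shows "theta Q Z x P \<in> linear_maps (Hom_add (fundamental_group Q x) :: ('k::field, ('v, 'a) walk set \<Rightarrow> 'k) module) (HH1 Q Z)"
proof -
  have loop: "arrow_loop x P d \<in> carrier (fundamental_group Q x)" if "d \<in> block_arrows x" for d
    using loop_walk_in_walks[OF P that] by (simp add: pi1_carrier)
  note diag = diagonal_cocycle[OF block_arrows_subset, where 'k = 'k]
  have add: "diagonal_cochain Q (block_arrows x) (\<lambda>d. (f \<oplus>\<^bsub>Hom_add (fundamental_group Q x)\<^esub> g) (arrow_loop x P d)) =
      diagonal_cochain Q (block_arrows x) (\<lambda>d. f (arrow_loop x P d)) + diagonal_cochain Q (block_arrows x) (\<lambda>d. g (arrow_loop x P d))"
    for f g :: "('v, 'a) walk set \<Rightarrow> 'k"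
    unfolding diagonal_cochain_add[symmetric] by (intro diagonal_cochain_cong) (simp add: loop)
  have scale: "diagonal_cochain Q (block_arrows x) (\<lambda>d. (c \<odot>\<^bsub>Hom_add (fundamental_group Q x)\<^esub> f) (arrow_loop x P d)) =
      cochain_scale c (diagonal_cochain Q (block_arrows x) (\<lambda>d. f (arrow_loop x P d)))"
    for c and f :: "('v, 'a) walk set \<Rightarrow> 'k"
    unfolding diagonal_cochain_scale[symmetric] by (intro diagonal_cochain_cong) (simp add: loop)
  show ?thesis
    unfolding linear_maps_def theta_eq[abs_def] HH1_carrier
    by (intro CollectI conjI ballI allI Pi_I imageI diag)
      (simp_all only: add scale HH1_class_add[OF diag diag] HH1_class_scale[OF diag])
qed

end

section \<open>Gluing and the fundamental group\<close>

context gluing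
begin

sublocale WA: monomial_walks Q Z ..

sublocale WB: monomial_walks QB ZB ..

abbreviation "gw \<equiv> glue_walk Q \<alpha> \<beta>"
abbreviation "\<pi>A \<equiv> fundamental_group Q (head Q \<alpha>)"
abbreviation "\<pi>B \<equiv> fundamental_group QB (head Q \<alpha>)"
abbreviation "classA \<equiv> walk_class Q (head Q \<alpha>)"
abbreviation "classB \<equiv> walk_class QB (head Q \<alpha>)"

section \<open>The map of fundamental groups induced by gluing\<close>

lemma glue_walk_simps [simp]:
  "fst (gw w) = gv (fst w)" "snd (gw w) = map (\<lambda>(a, b). (ga a, b)) (snd w)"
  by (simp_all add: glue_walk_def)

lemma glue_walk_target [simp]: "path_target (double_quiver QB) (gw w) = gv (path_target (double_quiver Q) w)"
proof -
  have "path_target (double_quiver QB) (gv x, map (\<lambda>(a, b). (ga a, b)) l) = gv (path_target (double_quiver Q) (x, l))" for x l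
  proof (induction l arbitrary: x)
    case (Cons e l)
    obtain a b where "e = (a, b)" by force
    then show ?case using Cons by simp
  qed simp
  then show ?thesis by (cases w) (simp add: glue_walk_def)
qed

lemma glue_walk_in_walks:
  assumes "w \<in> walks Q x y" shows "gw w \<in> walks QB (gv x) (gv y)"
proof -
  have "WB.D.awalk (gv x) (map (\<lambda>(a, b). (ga a, b)) l) (gv y)" if "WA.D.awalk x l y" for x l
    using that
  proof (induction l arbitrary: x)
    case Nil
    then show ?case by (auto simp: WB.D.awalk_Nil_iff WA.D.awalk_Nil_iff glued_verts)
  next
    case (Cons e l)
    obtain a b where e: "e = (a, b)" by force
    have "(a, b) \<in> arcs (double_quiver Q)" "x = tail (double_quiver Q) (a, b)" "WA.D.awalk (head (double_quiver Q) (a, b)) l y"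
      using Cons.prems unfolding e WA.D.awalk_Cons_iff by blast+
    then show ?case using Cons.IH[of "head (double_quiver Q) (a, b)"] glue_arrow_in_arcs[of a]
      by (cases b) (simp_all add: e WB.D.awalk_Cons_iff)
  qed
  then show ?thesis using assms by (simp add: WA.walks_iff WB.walks_iff)
qed

lemma glue_walk_comp: "gw (path_comp q p) = path_comp (gw q) (gw p)"
  by (simp add: glue_walk_def path_comp_def)

lemma glue_walk_inverse: "gw (inverse_walk Q p) = inverse_walk QB (gw p)"
  by (simp add: prod_eq_iff inverse_list_def rev_map split_def)

lemma glue_arrow_walk: "gw (arrow_walk Q d) = arrow_walk QB (ga d)"
  by (simp add: prod_eq_iff)

lemma exponent_glue_walk: "exponent c (snd (gw w)) = exponent (\<lambda>a. c (ga a)) (snd w)"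
proof -
  have "exponent c (map (\<lambda>(a, b). (ga a, b)) l) = exponent (\<lambda>a. c (ga a)) l" for l by (induction l) auto
  then show ?thesis by simp
qed

lemma glue_homotopy:
  assumes "(p, q) \<in> homotopy Q (head Q \<alpha>)"
  shows "(gw p, gw q) \<in> homotopy QB (head Q \<alpha>)"
proof -
  let ?x = "head Q \<alpha>"
  have can: "(gw p, gw q) \<in> cancellation QB ?x" if pq: "(p, q) \<in> cancellation Q ?x" for p q
  proof -
    obtain us a b ws where 1: "snd p = us @ [(a, b), (a, \<not> b)] @ ws" "snd q = us @ ws" "p \<in> walks Q ?x ?x" "q \<in> walks Q ?x ?x"
      using pq unfolding cancellation_def by blast
    let ?f = "map (\<lambda>(a, b). (ga a, b))"
    have 2: "snd (gw p) = ?f us @ [(ga a, b), (ga a, \<not> b)] @ ?f ws" "snd (gw q) = ?f us @ ?f ws" using 1 by simp_all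
    have 3: "gw p \<in> walks QB ?x ?x" "gw q \<in> walks QB ?x ?x"
      using glue_walk_in_walks[OF 1(3)] glue_walk_in_walks[OF 1(4)] by simp_all
    show ?thesis
      unfolding cancellation_def mem_Collect_eq prod.case
      by (intro conjI SigmaI 3 exI[of _ "?f us"] exI[of _ "ga a"] exI[of _ b] exI[of _ "?f ws"] CollectI case_prodI) (use 2 3 in auto)
  qed
  have "(p, q) \<in> (cancellation Q ?x \<union> (cancellation Q ?x)\<inverse>)\<^sup>*" using assms by (simp add: homotopy_def)
  then have "(gw p, gw q) \<in> (cancellation QB ?x \<union> (cancellation QB ?x)\<inverse>)\<^sup>*"
  proof (induction rule: rtrancl_induct)
    case (step y z)
    then have "(gw y, gw z) \<in> cancellation QB ?x \<union> (cancellation QB ?x)\<inverse>" using can by blast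
    with step(3) show ?case by (rule rtrancl_into_rtrancl)
  qed simp
  moreover have "p \<in> walks Q ?x ?x" "q \<in> walks Q ?x ?x" using assms by (simp_all add: homotopy_def)
  then have "gw p \<in> walks QB ?x ?x" "gw q \<in> walks QB ?x ?x"
    using glue_walk_in_walks[of p ?x ?x] glue_walk_in_walks[of q ?x ?x] by simp_all
  ultimately show ?thesis by (simp add: homotopy_def)
qed

lemma glue_closed_walk: "p \<in> walks Q (head Q \<alpha>) (head Q \<alpha>) \<Longrightarrow> gw p \<in> walks QB (head Q \<alpha>) (head Q \<alpha>)"
  using glue_walk_in_walks[of p "head Q \<alpha>" "head Q \<alpha>"] by simp

definition glue_class :: "('v, 'a) walk set \<Rightarrow> ('v, 'a) walk set" where
  "glue_class C = classB (gw (SOME p. p \<in> C))"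

lemma glue_class_class:
  assumes p: "p \<in> walks Q (head Q \<alpha>) (head Q \<alpha>)"
  shows "glue_class (classA p) = classB (gw p)"
proof -
  define q where "q = (SOME q. q \<in> classA p)"
  have "q \<in> classA p" unfolding q_def 
    by (rule someI[of "\<lambda>q. q \<in> classA p"]) (rule WA.walk_class_self[OF p])
  then have h: "(p, q) \<in> homotopy Q (head Q \<alpha>)" by (simp add: walk_class_def)
  then have q: "q \<in> walks Q (head Q \<alpha>) (head Q \<alpha>)" by (simp add: homotopy_def)
  have "classB (gw p) = classB (gw q)"
    using WB.walk_class_eq_iff[OF glue_closed_walk[OF p] glue_closed_walk[OF q]] glue_homotopy[OF h] by simp
  then show ?thesis unfolding glue_class_def q_def by (rule sym)
qed

lemma pi1_groups: "group \<pi>A" "group \<pi>B"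
  by (rule WA.pi1_group WB.pi1_group, simp add: glued_verts image_iff, (metis A.head_in_verts glue_vert_simps(2) special_arrows(1))?)+

lemma glue_class_closed: "C \<in> carrier \<pi>A \<Longrightarrow> glue_class C \<in> carrier \<pi>B"
  using glue_closed_walk by (auto simp: WA.pi1_carrier WB.pi1_carrier glue_class_class)

lemma glue_class_mult:
  "C \<in> carrier \<pi>A \<Longrightarrow> D \<in> carrier \<pi>A \<Longrightarrow> glue_class (C \<otimes>\<^bsub>\<pi>A\<^esub> D) = glue_class C \<otimes>\<^bsub>\<pi>B\<^esub> glue_class D"
  using glue_closed_walk
  by (auto simp: WA.pi1_carrier WA.pi1_mult WB.pi1_mult glue_class_class WA.walks_comp glue_walk_comp)

text \<open>The pullback along \<open>glue_class\<close>. Its factorisation through the quotient by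
  the last dual basis element is the map \<sigma>.\<close>

definition restrict_hom :: "(('v, 'a) walk set \<Rightarrow> 'k::field) \<Rightarrow> (('v, 'a) walk set \<Rightarrow> 'k)" where
  "restrict_hom h = (\<lambda>C\<in>carrier \<pi>A. h (glue_class C))"

lemma restrict_hom_linear:
  "restrict_hom \<in> linear_maps (Hom_add \<pi>B :: ('k::field, ('v, 'a) walk set \<Rightarrow> 'k) module) (Hom_add \<pi>A)"
proof -
  have "restrict_hom h \<in> carrier (Hom_add \<pi>A :: ('k, ('v, 'a) walk set \<Rightarrow> 'k) module)"
    if h: "h \<in> carrier (Hom_add \<pi>B :: ('k, ('v, 'a) walk set \<Rightarrow> 'k) module)" for h
  proof -
    interpret PA: group \<pi>A by (rule pi1_groups)
    have "h (glue_class (C \<otimes>\<^bsub>\<pi>A\<^esub> D)) = h (glue_class C) + h (glue_class D)" if "C \<in> carrier \<pi>A" "D \<in> carrier \<pi>A" for C D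
      using Hom_add_mult[OF h glue_class_closed[OF that(1)] glue_class_closed[OF that(2)]] glue_class_mult[OF that] by simp
    then show ?thesis unfolding Hom_add_iff by (simp add: restrict_hom_def)
  qed
  then show ?thesis
    unfolding linear_maps_def using glue_class_closed by (auto simp: restrict_hom_def fun_eq_iff)
qed

end

section \<open>Blocks and parade data under gluing\<close>

locale glued_data = gluing Q Z \<alpha> \<beta>
  for Q :: "('v, 'a) pre_digraph" and Z :: "('v, 'a) path set" and \<alpha> \<beta> :: 'a +
  fixes v :: "('v, 'a) walk" and w w' :: "'v \<Rightarrow> ('v, 'a) walk"
  assumes v: "v \<in> walks Q (head Q \<alpha>) (tail Q \<beta>)" "avoids v \<alpha>" "avoids v \<beta>"
    and w: "x \<in> verts Q \<Longrightarrow> x \<notin> {tail Q \<alpha>, head Q \<alpha>, tail Q \<beta>, head Q \<beta>} \<Longrightarrow> same_block Q (head Q \<alpha>) x \<Longrightarrow>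
      w x \<in> walks Q (head Q \<alpha>) x \<and> gw (w x) = w' x"
begin

abbreviation "PA \<equiv> parade Q \<alpha> \<beta> v w"
abbreviation "PB \<equiv> glued_parade QB \<alpha> (gw v) w'"

lemma parade_simps [simp]:
  "PA (tail Q \<alpha>) = inverse_walk Q (arrow_walk Q \<alpha>)" "PA (head Q \<alpha>) = (head Q \<alpha>, [])"
  "PA (tail Q \<beta>) = v" "PA (head Q \<beta>) = path_comp (arrow_walk Q \<beta>) v"
  "PB (tail Q \<alpha>) = gw v" "PB (head Q \<alpha>) = (head Q \<alpha>, [])"
  by (simp_all add: parade_def glued_parade_def)

lemma base_in_verts: "head Q \<alpha> \<in> verts Q"
  by simp

lemma parade_A: "WA.is_parade (head Q \<alpha>) PA"
  unfolding WA.is_parade_def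
proof (intro conjI allI impI)
  fix y assume y: "same_block Q (head Q \<alpha>) y"
  then have yv: "y \<in> verts Q" using WA.walk_verts(2) by (auto simp: same_block_def)
  consider "y = tail Q \<alpha>" | "y = head Q \<alpha>" | "y = tail Q \<beta>" | "y = head Q \<beta>"
    | "y \<notin> {tail Q \<alpha>, head Q \<alpha>, tail Q \<beta>, head Q \<beta>}" by blast
  then show "PA y \<in> walks Q (head Q \<alpha>) y"
  proof cases
    case 1
    then show ?thesis using WA.inverse_in_walks[OF WA.arrow_walk_in_walks[of \<alpha>]] by simp
  next
    case 2
    then show ?thesis using WA.trivial_walk[OF base_in_verts] by simp
  next
    case 3
    then show ?thesis using v(1) by simp
  next
    case 4
    then show ?thesis using WA.walks_comp[OF v(1) WA.arrow_walk_in_walks[of \<beta>]] by simp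
  next
    case 5
    then show ?thesis using w[OF yv 5 y] by (simp add: parade_def)
  qed
qed simp_all

lemma special_same_block:
  "same_block Q (head Q \<alpha>) (tail Q \<alpha>)" "same_block Q (head Q \<alpha>) (head Q \<alpha>)"
  "same_block Q (head Q \<alpha>) (tail Q \<beta>)" "same_block Q (head Q \<alpha>) (head Q \<beta>)"
proof -
  show *: "same_block Q (head Q \<alpha>) (tail Q \<beta>)" using v(1) by (rule WA.same_block_walk)
  show **: "same_block Q (head Q \<alpha>) (head Q \<alpha>)" using WA.trivial_walk[OF base_in_verts] by (rule WA.same_block_walk)
  show "same_block Q (head Q \<alpha>) (tail Q \<alpha>)" using ** WA.same_block_arrow[of \<alpha>] by simp
  show "same_block Q (head Q \<alpha>) (head Q \<beta>)" using * WA.same_block_arrow[of \<beta>] by simp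
qed

text \<open>Gluing merges no further block into this one: thanks to \<open>v\<close>, all four
  special vertices already lie in the block of the head of \<alpha>. A walk of the glued quiver can
  therefore be followed in \<open>Q\<close> vertex by vertex, up to the fibres of
  \<open>gv\<close>.\<close>

lemma same_block_glue:
  assumes z: "z \<in> verts Q"
  shows "same_block QB (head Q \<alpha>) (gv z) \<longleftrightarrow> same_block Q (head Q \<alpha>) z"
proof
  assume "same_block Q (head Q \<alpha>) z"
  then show "same_block QB (head Q \<alpha>) (gv z)"
    using glue_walk_in_walks[of _ "head Q \<alpha>" z] by (auto simp: same_block_def)
next
  have fibre: "same_block Q (head Q \<alpha>) z" if "same_block Q (head Q \<alpha>) u" "gv z = gv u" for z u
    using that special_same_block unfolding glue_vert_eq doubleton_eq_iff by metis
  assume "same_block QB (head Q \<alpha>) (gv z)"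
  then obtain p where "p \<in> walks QB (head Q \<alpha>) (gv z)" by (auto simp: same_block_def)
  then have "p \<in> paths (double_quiver QB)" "fst p = head Q \<alpha>" "path_target (double_quiver QB) p = gv z"
    by (simp_all add: walks_def)
  then show "same_block Q (head Q \<alpha>) z"
  proof (induction arbitrary: z rule: WB.D.paths_induct)
    case (trivial y)
    then have "gv z = gv (head Q \<alpha>)" by simp
    then show ?case by (rule fibre[OF special_same_block(2)])
  next
    case (step e q)
    obtain d b where e: "e = (d, b)" by force
    have d: "d \<in> arcs Q" using step(1) by (simp add: e glued_arcs)
    define s t where "s = (if b then tail Q d else head Q d)" and "t = (if b then head Q d else tail Q d)"
    have tq: "path_target (double_quiver QB) q = gv s" using step(3) by (simp add: e s_def)
    have "path_target (double_quiver QB) (path_comp (arrow_path (double_quiver QB) e) q) = gv t"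
      using step(3) by (subst path_target_comp) (simp_all add: e t_def)
    then have zt: "gv z = gv t" using step by simp
    have "same_block Q (head Q \<alpha>) s" using step.IH[of s] step.prems(1) tq by simp
    then have "same_block Q (head Q \<alpha>) t" using WA.same_block_arrow[OF d] by (auto simp: s_def t_def split: if_splits)
    then show ?case using zt by (rule fibre)
  qed
qed

lemma parade_B: "WB.is_parade (head Q \<alpha>) PB"
  unfolding WB.is_parade_def
proof (intro conjI allI impI)
  show "head Q \<alpha> \<in> verts QB" unfolding glued_verts by (rule image_eqI[of _ _ "head Q \<alpha>"]) simp_all
  then have base: "head Q \<alpha> \<in> verts QB" .
  fix y assume y: "same_block QB (head Q \<alpha>) y"
  then have "y \<in> verts QB" using WB.walk_verts(2) by (auto simp: same_block_def)
  then obtain z where z: "z \<in> verts Q" "y = gv z" by (auto simp: glued_verts)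
  have blk: "same_block Q (head Q \<alpha>) z" using y same_block_glue[OF z(1)] z(2) by simp
  consider "y = tail Q \<alpha>" | "y = head Q \<alpha>" | "z \<notin> {tail Q \<alpha>, head Q \<alpha>, tail Q \<beta>, head Q \<beta>}"
    using z(2) by auto
  then show "PB y \<in> walks QB (head Q \<alpha>) y"
  proof cases
    case 1
    then show ?thesis using glue_walk_in_walks[OF v(1)] by simp
  next
    case 2
    then show ?thesis using WB.trivial_walk[OF base] by simp
  next
    case 3
    then have "y = z" using z(2) by (simp add: glue_vert_def)
    then show ?thesis
      using w[OF z(1) 3 blk] glue_walk_in_walks[of "w z" "head Q \<alpha>" z] 3 z(2) by (auto simp: glued_parade_def)
  qed
qed simp

lemma block_arrows_glue: "WB.block_arrows (head Q \<alpha>) = insert \<alpha> (WA.block_arrows (head Q \<alpha>) - {\<beta>})"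
  and alpha_in_block: "\<alpha> \<in> WB.block_arrows (head Q \<alpha>)"
proof -
  have "d \<in> WB.block_arrows (head Q \<alpha>) \<longleftrightarrow> d \<in> WA.block_arrows (head Q \<alpha>) \<and> d \<noteq> \<beta>" for d
    using same_block_glue[of "tail Q d"] by (auto simp: WA.block_arrows_def WB.block_arrows_def glued_arcs)
  then have iff: "d \<in> WB.block_arrows (head Q \<alpha>) \<longleftrightarrow> d \<in> WA.block_arrows (head Q \<alpha>) \<and> d \<noteq> \<beta>" for d .
  have \<alpha>: "\<alpha> \<in> WA.block_arrows (head Q \<alpha>)" using special_same_block by (simp add: WA.block_arrows_def)
  show "\<alpha> \<in> WB.block_arrows (head Q \<alpha>)" unfolding iff using \<alpha> by simp
  show "WB.block_arrows (head Q \<alpha>) = insert \<alpha> (WA.block_arrows (head Q \<alpha>) - {\<beta>})"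
    unfolding set_eq_iff iff insert_iff Diff_iff singleton_iff using \<alpha> distinct_vertices(13) by fast
qed

text \<open>At e1 and e_n the parades disagree: there the parade of \<open>Q\<close> runs through
  \<alpha> and \<beta>, whereas the glued one reaches f1 by the image of \<open>v\<close> and f2
  trivially.\<close>

lemma glue_parade:
  assumes "y \<in> verts Q" "same_block Q (head Q \<alpha>) y" "y \<noteq> tail Q \<alpha>" "y \<noteq> head Q \<beta>"
  shows "gw (PA y) = PB (gv y)"
proof -
  consider "y = head Q \<alpha>" | "y = tail Q \<beta>" | "y \<notin> {tail Q \<alpha>, head Q \<alpha>, tail Q \<beta>, head Q \<beta>}" using assms(3,4) by blast
  then show ?thesis
  proof cases
    case 1
    then show ?thesis by (simp add: prod_eq_iff)
  next
    case 2
    then show ?thesis by simp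
  next
    case 3
    then have "gv y = y" by (simp add: glue_vert_def)
    then show ?thesis using w[OF assms(1) 3 assms(2)] 3 by (simp add: parade_def glued_parade_def)
  qed
qed

text \<open>Arrows other than \<alpha> and \<beta> meet neither e1 nor e_n, the two vertices at
  which the parades do not correspond.\<close>

lemma glue_loop:
  assumes d: "d \<in> WA.block_arrows (head Q \<alpha>)" "d \<noteq> \<alpha>" "d \<noteq> \<beta>"
  shows "gw (WA.loop_walk PA d) = WB.loop_walk PB d"
proof -
  have d': "d \<in> arcs Q" "same_block Q (head Q \<alpha>) (tail Q d)" "same_block Q (head Q \<alpha>) (head Q d)"
    using d(1) WA.same_block_arrow by (auto simp: WA.block_arrows_def)
  have "gw (PA (tail Q d)) = PB (gv (tail Q d))" "gw (PA (head Q d)) = PB (gv (head Q d))"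
    using d' d(2,3) by (auto intro!: glue_parade)
  then show ?thesis
    using d(2,3) by (simp add: WA.loop_walk_def WB.loop_walk_def glue_walk_comp glue_walk_inverse glue_arrow_walk glue_arrow_id)
qed

abbreviation "gamma_walk \<equiv> path_comp (arrow_walk QB \<alpha>) (gw v)"

lemma loop_gamma: "WB.loop_walk PB \<alpha> = gamma_walk"
  by (simp add: WB.loop_walk_def path_comp_def prod_eq_iff)

lemma gamma_walk_closed: "gamma_walk \<in> walks QB (head Q \<alpha>) (head Q \<alpha>)"
  using WB.loop_walk_in_walks[OF parade_B alpha_in_block] by (simp add: loop_gamma)

lemma gamma_class_closed: "classB gamma_walk \<in> carrier \<pi>B"
  using gamma_walk_closed by (simp add: WB.pi1_carrier)

text \<open>The parade walks to e1 and e_n end by traversing \<alpha> backwards and \<beta>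
  forwards, so these two arrows behave like tree arrows.\<close>

lemma special_loops: "WA.arrow_loop (head Q \<alpha>) PA \<alpha> = \<one>\<^bsub>\<pi>A\<^esub>" "WA.arrow_loop (head Q \<alpha>) PA \<beta> = \<one>\<^bsub>\<pi>A\<^esub>"
proof -
  have blk: "\<alpha> \<in> WA.block_arrows (head Q \<alpha>)" "\<beta> \<in> WA.block_arrows (head Q \<alpha>)"
    using special_same_block by (simp_all add: WA.block_arrows_def)
  have "reduces (snd (WA.loop_walk PA \<alpha>)) []"
    using reduces_inverse[of "[(\<alpha>, False)]"] by (simp add: WA.snd_loop_walk)
  then show "WA.arrow_loop (head Q \<alpha>) PA \<alpha> = \<one>\<^bsub>\<pi>A\<^esub>"
    unfolding WA.pi1_one by (intro WA.walk_class_reduces WA.loop_walk_in_walks[OF parade_A] blk) simp_all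
  have "reduces (snd (WA.loop_walk PA \<beta>)) []"
    using reduces_inverse[of "snd v @ [(\<beta>, True)]"] by (simp add: WA.snd_loop_walk)
  then show "WA.arrow_loop (head Q \<alpha>) PA \<beta> = \<one>\<^bsub>\<pi>A\<^esub>"
    unfolding WA.pi1_one by (intro WA.walk_class_reduces WA.loop_walk_in_walks[OF parade_A] blk) simp_all
qed

text \<open>The loop of the glued arrow is \<open>gamma_walk\<close>; by \<open>glue_loop\<close>
  every other arrow loop is the image of an arrow loop of \<open>Q\<close>.\<close>

lemma glued_generators:
  assumes S: "S \<subseteq> carrier \<pi>A" "generate \<pi>A S = carrier \<pi>A"
  shows "generate \<pi>B (insert (classB gamma_walk) (glue_class ` S)) = carrier \<pi>B"
proof
  interpret PA: group \<pi>A by (rule pi1_groups)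
  interpret PB: group \<pi>B by (rule pi1_groups)
  let ?S = "insert (classB gamma_walk) (glue_class ` S)"
  have incl: "?S \<subseteq> carrier \<pi>B"
    using S(1) glue_class_closed gamma_class_closed by blast
  then show "generate \<pi>B ?S \<subseteq> carrier \<pi>B" by (rule PB.generate_incl)
  have hom: "group_hom \<pi>A \<pi>B glue_class"
    by unfold_locales (auto simp: hom_def glue_class_closed glue_class_mult)
  have glued: "glue_class C \<in> generate \<pi>B ?S" if "C \<in> carrier \<pi>A" for C
  proof -
    have "glue_class ` generate \<pi>A S = generate \<pi>B (glue_class ` S)"
      by (rule group_hom.generate_img[OF hom S(1), symmetric])
    also have "\<dots> \<subseteq> generate \<pi>B ?S" by (rule PB.mono_generate) blast
    finally show ?thesis using that S(2) by blast
  qed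
  have "WB.arrow_loop (head Q \<alpha>) PB d \<in> generate \<pi>B ?S" if "d \<in> WB.block_arrows (head Q \<alpha>)" for d
  proof (cases "d = \<alpha>")
    case True
    then show ?thesis by (simp add: loop_gamma generate.incl)
  next
    case False
    then have d: "d \<in> WA.block_arrows (head Q \<alpha>)" "d \<noteq> \<beta>" using that by (auto simp: block_arrows_glue)
    note lw = WA.loop_walk_in_walks[OF parade_A d(1)]
    have "WB.arrow_loop (head Q \<alpha>) PB d = glue_class (classA (WA.loop_walk PA d))"
      using glue_loop[OF d(1) False d(2)] glue_class_class[OF lw] by simp
    then show ?thesis using glued lw by (simp add: WA.pi1_carrier)
  qed
  then have "generate \<pi>B (WB.arrow_loop (head Q \<alpha>) PB ` WB.block_arrows (head Q \<alpha>)) \<subseteq> generate \<pi>B ?S"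
    by (intro PB.generate_subgroup_incl PB.generate_is_subgroup incl) auto
  then show "carrier \<pi>B \<subseteq> generate \<pi>B ?S" using WB.pi1_generated_by_loops[OF parade_B] by simp
qed

text \<open>A section of \<open>restrict_hom\<close>. The weights are the values of \<open>h\<close>
  on the arrow loops; the glued arrow gets weight 0 because the loops of \<alpha> and \<beta> are
  both trivial.\<close>

definition extend_hom :: "(('v, 'a) walk set \<Rightarrow> 'k::field) \<Rightarrow> (('v, 'a) walk set \<Rightarrow> 'k)" where
  "extend_hom h = WB.exponent_hom (head Q \<alpha>) (\<lambda>d. if d = \<alpha> then 0 else h (WA.arrow_loop (head Q \<alpha>) PA d))"

text \<open>The signed count of the glued arrow, which turns out to be the last element of the dual
  basis.\<close>

definition gamma_hom :: "('v, 'a) walk set \<Rightarrow> 'k::field" where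
  "gamma_hom = WB.exponent_hom (head Q \<alpha>) (\<lambda>d. if d = \<alpha> then 1 else 0)"

lemma extend_hom_exponent:
  assumes h: "h \<in> carrier (Hom_add \<pi>A :: ('k::field, ('v, 'a) walk set \<Rightarrow> 'k) module)"
  shows "exponent (\<lambda>d. if d = \<alpha> then 0 else h (WA.arrow_loop (head Q \<alpha>) PA d)) (snd (gw p)) =
    exponent (\<lambda>d. h (WA.arrow_loop (head Q \<alpha>) PA d)) (snd p)"
proof -
  have "h \<one>\<^bsub>\<pi>A\<^esub> = 0" by (rule Hom_add_one[OF pi1_groups(1) h])
  then show ?thesis
    unfolding exponent_glue_walk by (intro exponent_cong) (auto simp: special_loops glue_arrow_id)
qed

lemma extend_hom_glue:
  assumes h: "h \<in> carrier (Hom_add \<pi>A :: ('k::field, ('v, 'a) walk set \<Rightarrow> 'k) module)"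
    and C: "C \<in> carrier \<pi>A"
  shows "extend_hom h (glue_class C) = h C"
proof -
  obtain p where p: "p \<in> walks Q (head Q \<alpha>) (head Q \<alpha>)" "C = classA p" using C by (auto simp: WA.pi1_carrier)
  show ?thesis
    unfolding p(2) glue_class_class[OF p(1)] extend_hom_def WB.exponent_hom_class[OF glue_closed_walk[OF p(1)]]
      extend_hom_exponent[OF h] WA.hom_eq_exponent[OF parade_A p(1) h] ..
qed

text \<open>The value is the weighted exponent of \<open>v\<close>, which is the value of
  \<open>h\<close> on \<open>v\<close> followed by the inverse of the parade walk to the tail of
  \<beta>. That parade walk is \<open>v\<close> itself, so the loop contracts.\<close>

lemma extend_hom_gamma:
  assumes h: "h \<in> carrier (Hom_add \<pi>A :: ('k::field, ('v, 'a) walk set \<Rightarrow> 'k) module)"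
  shows "extend_hom h (classB gamma_walk) = 0"
proof -
  let ?u = "path_comp (inverse_walk Q (PA (tail Q \<beta>))) v"
  have "extend_hom h (classB gamma_walk) = exponent (\<lambda>d. h (WA.arrow_loop (head Q \<alpha>) PA d)) (snd v)"
    unfolding extend_hom_def WB.exponent_hom_class[OF gamma_walk_closed] extend_hom_exponent[OF h, symmetric] by simp
  also have "\<dots> = h (classA ?u)"
    using WA.parade_decomposition[OF parade_A v(1), where 'k = 'k] h by simp
  also have "classA ?u = \<one>\<^bsub>\<pi>A\<^esub>"
  proof -
    have u: "?u \<in> walks Q (head Q \<alpha>) (head Q \<alpha>)"
      using WA.walks_comp[OF v(1) WA.inverse_in_walks[OF v(1)]] by simp
    have "reduces (snd ?u) []" using reduces_inverse[of "snd v"] by simp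
    then show ?thesis unfolding WA.pi1_one by (intro WA.walk_class_reduces[OF u]) simp_all
  qed
  also have "h \<one>\<^bsub>\<pi>A\<^esub> = 0" by (rule Hom_add_one[OF pi1_groups(1) h])
  finally show ?thesis .
qed

lemma glue_walk_avoids:
  assumes "avoids p \<alpha>" "avoids p \<beta>"
  shows "\<alpha> \<notin> fst ` set (snd (gw p))"
proof -
  have "fst ` set (snd (gw p)) = ga ` fst ` set (snd p)" by (simp add: image_image split_def)
  then show ?thesis using assms by (auto simp: avoids_def glue_arrow_def split: if_splits)
qed

lemma gamma_hom_gamma: "gamma_hom (classB gamma_walk) = 1"
proof -
  have "\<alpha> \<notin> fst ` set (snd (gw v))" by (rule glue_walk_avoids[OF v(2,3)])
  then have "exponent (\<lambda>d. if d = \<alpha> then 1 else 0 :: 'b) (snd (gw v)) = 0" by (intro exponent_zero) metis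
  then show ?thesis
    unfolding gamma_hom_def WB.exponent_hom_class[OF gamma_walk_closed] by simp
qed

lemma gamma_hom_avoiding:
  assumes "p \<in> walks Q (head Q \<alpha>) (head Q \<alpha>)" "avoids p \<alpha>" "avoids p \<beta>"
  shows "gamma_hom (glue_class (classA p)) = 0"
proof -
  have "\<alpha> \<notin> fst ` set (snd (gw p))" by (rule glue_walk_avoids[OF assms(2,3)])
  then have "exponent (\<lambda>d. if d = \<alpha> then 1 else 0 :: 'b) (snd (gw p)) = 0" by (intro exponent_zero) metis
  then show ?thesis
    unfolding gamma_hom_def glue_class_class[OF assms(1)] WB.exponent_hom_class[OF glue_closed_walk[OF assms(1)]] .
qed

lemma extension_homs:
  "extend_hom h \<in> carrier (Hom_add \<pi>B :: ('k::field, ('v, 'a) walk set \<Rightarrow> 'k) module)"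
  "gamma_hom \<in> carrier (Hom_add \<pi>B :: ('k::field, ('v, 'a) walk set \<Rightarrow> 'k) module)"
  unfolding extend_hom_def gamma_hom_def by (rule WB.exponent_hom_in_carrier)+

end

section \<open>The Lie algebra isomorphism\<close>

context gluing
begin

abbreviation gamma_class :: "('k::field, 'v, 'a) cochain set" where
  "gamma_class \<equiv> HH1_class QB ZB \<gamma>\<gamma>"

abbreviation gamma_line :: "('k::field, 'v, 'a) cochain set set" where
  "gamma_line \<equiv> line (HH1 QB ZB) gamma_class"

lemma gamma_cocycle: "\<gamma>\<gamma> \<in> carrier (cocycles QB ZB)"
  by (rule B.diagonal_pair_cocycle) (use glue_arrow_in_arcs[of \<alpha>] in simp)

lemma glue_cocycle: "x \<in> carrier (cocycles Q Z) \<Longrightarrow> gc x \<in> carrier (cocycles QB ZB)"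
  using glue_cocycle_iff[OF A.cocycle_cochain] by blast

lemma HH1_class_in_gamma_line:
  fixes y :: "('k::field, 'v, 'a) cochain"
  assumes y: "y \<in> carrier (cocycles QB ZB)"
  shows "HH1_class QB ZB y \<in> gamma_line \<longleftrightarrow> (\<exists>c. y - cochain_scale c \<gamma>\<gamma> \<in> coboundaries QB ZB)"
proof -
  have "HH1_class QB ZB y = c \<odot>\<^bsub>HH1 QB ZB\<^esub> gamma_class \<longleftrightarrow> y - cochain_scale c \<gamma>\<gamma> \<in> coboundaries QB ZB" for c
    unfolding B.HH1_class_scale[OF gamma_cocycle]
    by (rule B.HH1_class_eq[OF y B.cocycles_closed(4)[OF gamma_cocycle]])
  then show ?thesis unfolding line_def by simp
qed

lemma glue_coboundary_class:
  fixes y :: "('k::field, 'v, 'a) cochain"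
  assumes y: "y \<in> coboundaries Q Z"
  shows "HH1_class QB ZB (gc y) \<in> gamma_line"
proof -
  obtain c where "gc y - cochain_scale c \<gamma>\<gamma> \<in> coboundaries QB ZB" by (rule glue_coboundary[OF y])
  then show ?thesis
    unfolding HH1_class_in_gamma_line[OF glue_cocycle[OF A.coboundary_cocycle[OF y]]] by blast
qed

lemma HH1_class_from_glue:
  fixes y :: "('k::field, 'v, 'a) cochain"
  assumes y: "y \<in> carrier (cocycles QB ZB)"
  obtains x where "x \<in> carrier (cocycles Q Z)" "HH1_class QB ZB y = HH1_class QB ZB (gc x)"
proof -
  obtain x where x: "x \<in> arrow_cochains Q Z" "y - gc x \<in> coboundaries QB ZB"
    by (rule cochain_from_glue[OF B.cocycle_cochain[OF y]])
  \<comment> \<open>The lift \<open>x\<close> is so far only a cochain. Its image differs from the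
    cocycle \<open>y\<close> by a coboundary, and \<open>glue_cocycle_iff\<close> then makes
    \<open>x\<close> a cocycle.\<close>
  have "y + - (y - gc x) \<in> carrier (cocycles QB ZB)"
    by (intro B.cocycles_closed y B.coboundary_cocycle[OF x(2)])
  then have gx: "gc x \<in> carrier (cocycles QB ZB)" by simp
  then have "x \<in> carrier (cocycles Q Z)" by (simp add: glue_cocycle_iff[OF x(1)])
  moreover have "HH1_class QB ZB y = HH1_class QB ZB (gc x)" using B.HH1_class_eq[OF y gx] x(2) by simp
  ultimately show ?thesis by (rule that)
qed

text \<open>The diagonal pair of the glued arrow is the image of that of \<alpha>, which is inner,
  and every class lifts to \<open>Q\<close>. A bracket with it is therefore the image of a
  coboundary of \<open>Q\<close>, and such images lie on the line.\<close>

lemma gamma_line_ideal: "nonassoc_ideal (HH1 QB ZB) (gamma_line :: ('k::field, 'v, 'a) cochain set set)"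
proof -
  interpret H: nonassoc_algebra "HH1 QB ZB :: ('k, ('k, 'v, 'a) cochain set) module" by (rule B.HH1_algebra)
  let ?a = "basis_pair (arrow_path Q \<alpha>) (arrow_path Q \<alpha>) :: ('k, 'v, 'a) cochain"
  have a: "?a \<in> arrow_cochains Q Z"
    by (rule A.cocycle_cochain[OF A.coboundary_cocycle[OF special_coboundaries(1)]])
  have ga: "gc ?a = \<gamma>\<gamma>" by (simp add: glue_arrow_path glue_arrow_def)
  show ?thesis
  proof (rule H.line_ideal)
    show "gamma_class \<in> carrier (HH1 QB ZB :: ('k, ('k, 'v, 'a) cochain set) module)"
      unfolding B.HH1_carrier by (rule imageI[OF gamma_cocycle])
    fix C assume "C \<in> carrier (HH1 QB ZB :: ('k, ('k, 'v, 'a) cochain set) module)"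
    then obtain y where y: "y \<in> carrier (cocycles QB ZB)" "C = HH1_class QB ZB y"
      unfolding B.HH1_carrier by blast
    obtain x where x: "x \<in> carrier (cocycles Q Z)" "C = HH1_class QB ZB (gc x)"
      using HH1_class_from_glue[OF y(1)] y(2) by metis
    note xc = A.cocycle_cochain[OF x(1)]
    have "gamma_class \<otimes>\<^bsub>HH1 QB ZB\<^esub> C = HH1_class QB ZB (gc (cochain_bracket A.B ?a x))"
      "C \<otimes>\<^bsub>HH1 QB ZB\<^esub> gamma_class = HH1_class QB ZB (gc (cochain_bracket A.B x ?a))"
      unfolding x(2) glue_bracket[OF a xc] glue_bracket[OF xc a] ga
      by (intro B.HH1_class_bracket gamma_cocycle glue_cocycle x)+
    then show "gamma_class \<otimes>\<^bsub>HH1 QB ZB\<^esub> C \<in> gamma_line" "C \<otimes>\<^bsub>HH1 QB ZB\<^esub> gamma_class \<in> gamma_line"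
      using glue_coboundary_class[OF A.bracket_coboundary(1)[OF x(1) special_coboundaries(1)]]
        glue_coboundary_class[OF A.bracket_coboundary(2)[OF x(1) special_coboundaries(1)]] by simp_all
  qed
qed

text \<open>The isomorphism theorem is applied to cocycles of \<open>Q\<close> mapping to the
  quotient by the line. The kernel is found by \<open>glue_coboundary\<close> and
  \<open>coboundary_if_glued\<close>, and surjectivity comes from
  \<open>cochain_from_glue\<close>.\<close>

lemma glued_lie_iso:
  obtains \<phi> where
    "\<phi> \<in> lie_isos (HH1 Q Z :: ('k::field, ('k, 'v, 'a) cochain set) module) (quotient_module (HH1 QB ZB) gamma_line)"
    "\<And>x. x \<in> carrier (cocycles Q Z) \<Longrightarrow>
      \<phi> (HH1_class Q Z x) = gamma_line +>\<^bsub>HH1 QB ZB\<^esub> HH1_class QB ZB (gc x)"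
proof -
  let ?HB = "HH1 QB ZB :: ('k, ('k, 'v, 'a) cochain set) module"
  interpret L: nonassoc_ideal ?HB gamma_line by (rule gamma_line_ideal)
  define F where "F x = gamma_line +>\<^bsub>?HB\<^esub> HH1_class QB ZB (gc x)" for x
  have cl: "HH1_class QB ZB (gc x) \<in> carrier ?HB" if "x \<in> carrier (cocycles Q Z)" for x
    unfolding B.HH1_carrier by (rule imageI[OF glue_cocycle[OF that]])
  have lin: "F \<in> linear_maps (cocycles Q Z) (quotient_module ?HB gamma_line)"
    unfolding linear_maps_def F_def
    by (auto simp: L.carrier_quotient L.quotient_add L.quotient_smult cl B.HH1_class_add B.HH1_class_scale glue_cocycle
      linear_add[OF is_linear_glue_cochain] linear_scale[OF is_linear_glue_cochain])
  have mult: "F (x \<otimes>\<^bsub>cocycles Q Z\<^esub> y) = F x \<otimes>\<^bsub>quotient_module ?HB gamma_line\<^esub> F y"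
    if "x \<in> carrier (cocycles Q Z)" "y \<in> carrier (cocycles Q Z)" for x y
    using that by (simp add: F_def L.quotient_mult cl B.HH1_class_bracket glue_cocycle glue_bracket A.cocycle_cochain)
  have surj: "F ` carrier (cocycles Q Z) = carrier (quotient_module ?HB gamma_line)"
  proof
    show "F ` carrier (cocycles Q Z) \<subseteq> carrier (quotient_module ?HB gamma_line)"
      using lin by (auto simp: linear_maps_def)
    show "carrier (quotient_module ?HB gamma_line) \<subseteq> F ` carrier (cocycles Q Z)"
      unfolding L.carrier_quotient B.HH1_carrier
    proof clarify
      fix y :: "('k, 'v, 'a) cochain" assume "y \<in> carrier (cocycles QB ZB)"
      then obtain x where x: "x \<in> carrier (cocycles Q Z)" "HH1_class QB ZB y = HH1_class QB ZB (gc x)"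
        by (rule HH1_class_from_glue)
      show "gamma_line +>\<^bsub>?HB\<^esub> HH1_class QB ZB y \<in> F ` carrier (cocycles Q Z)"
        by (rule image_eqI[OF _ x(1)]) (simp add: F_def x(2))
    qed
  qed
  have ker: "coboundaries Q Z = {x \<in> carrier (cocycles Q Z). F x = \<zero>\<^bsub>quotient_module ?HB gamma_line\<^esub>}"
  proof -
    have "F x = \<zero>\<^bsub>quotient_module ?HB gamma_line\<^esub> \<longleftrightarrow> x \<in> coboundaries Q Z" if x: "x \<in> carrier (cocycles Q Z)" for x
      unfolding F_def L.quotient_zero L.coset_zero[OF cl[OF x]]
      using glue_coboundary_class coboundary_if_glued[OF A.cocycle_cochain[OF x]] HH1_class_in_gamma_line[OF glue_cocycle[OF x]]
      by blast
    then show ?thesis using A.coboundary_cocycle by blast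
  qed
  obtain g where "g \<in> lie_isos (quotient_module (cocycles Q Z) (coboundaries Q Z)) (quotient_module ?HB gamma_line)"
    "\<And>x. x \<in> carrier (cocycles Q Z) \<Longrightarrow> g (coboundaries Q Z +>\<^bsub>cocycles Q Z\<^esub> x) = F x"
    by (rule first_isomorphism[OF A.cocycles_algebra L.quotient_nonassoc_algebra lin mult surj ker]) blast+
  then show ?thesis
    unfolding F_def HH1_def[symmetric] HH1_class_def[symmetric] by (rule that)
qed

end

section \<open>Dual bases and the commutative diagram\<close>

locale glued_bases = glued_data Q Z \<alpha> \<beta> v w w'
  for Q :: "('v, 'a) pre_digraph" and Z :: "('v, 'a) path set" and \<alpha> \<beta> :: 'a
    and v :: "('v, 'a) walk" and w w' :: "'v \<Rightarrow> ('v, 'a) walk" +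
  fixes vs :: "('v, 'a) walk list"
  assumes vs: "u \<in> set vs \<Longrightarrow> u \<in> walks Q (head Q \<alpha>) (head Q \<alpha>) \<and> avoids u \<alpha> \<and> avoids u \<beta>"
    and generators: "minimal_generators \<pi>A (map classA vs)"
begin

abbreviation "genA \<equiv> map classA vs"
abbreviation "genB \<equiv> map (\<lambda>u. classB (gw u)) vs @ [classB gamma_walk]"

abbreviation HomA :: "('k::field, ('v, 'a) walk set \<Rightarrow> 'k) module" where "HomA \<equiv> Hom_add \<pi>A"
abbreviation HomB :: "('k::field, ('v, 'a) walk set \<Rightarrow> 'k) module" where "HomB \<equiv> Hom_add \<pi>B"

lemma generates_A: "set genA \<subseteq> carrier \<pi>A" "generate \<pi>A (set genA) = carrier \<pi>A"
  using generators unfolding minimal_generators_def by blast+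

lemma nth_genA_closed: "i < length vs \<Longrightarrow> genA ! i \<in> carrier \<pi>A"
  using generates_A(1) nth_mem[of i genA] by (simp only: length_map subset_iff)

lemma gamma_hom_genA:
  assumes i: "i < length vs"
  shows "gamma_hom (glue_class (genA ! i)) = 0"
  unfolding nth_map[OF i] by (rule gamma_hom_avoiding) (use vs[OF nth_mem[OF i]] in blast)+

lemma glue_class_vs: "u \<in> set vs \<Longrightarrow> glue_class (classA u) = classB (gw u)"
  using vs by (intro glue_class_class) blast

lemma generates_B: "set genB \<subseteq> carrier \<pi>B" "generate \<pi>B (set genB) = carrier \<pi>B"
proof -
  have "set genB = insert (classB gamma_walk) (glue_class ` set genA)"
    using glue_class_vs by (simp add: image_image)
  then show "set genB \<subseteq> carrier \<pi>B" "generate \<pi>B (set genB) = carrier \<pi>B"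
    using glued_generators[OF generates_A] gamma_class_closed generates_A(1) glue_class_closed by auto
qed

lemma is_dual_basis_A: "is_dual_basis \<pi>A genA (dual_basis \<pi>A genA :: (('v, 'a) walk set \<Rightarrow> 'k::field) list)"
proof -
  obtain gs :: "(('v, 'a) walk set \<Rightarrow> 'k) list" where gs: "is_dual_basis \<pi>A genA gs"
    by (rule WA.dual_basis_of_minimal_generators[OF base_in_verts A.finite_verts A.finite_arcs generators])
  then show ?thesis unfolding dual_basis_eq[OF pi1_groups(1) generates_A gs] .
qed

lemma length_dual_basis_A: "length (dual_basis \<pi>A genA :: (('v, 'a) walk set \<Rightarrow> 'k::field) list) = length vs"
  using is_dual_basis_A[where 'k = 'k] unfolding is_dual_basis_def length_map by (rule conjunct1)

lemma dual_basis_A_closed: "i < length vs \<Longrightarrow> dual_basis \<pi>A genA ! i \<in> carrier (HomA :: ('k::field, ('v, 'a) walk set \<Rightarrow> 'k) module)"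
  using is_dual_basis_A[where 'k = 'k] nth_mem[of i "dual_basis \<pi>A genA :: (('v, 'a) walk set \<Rightarrow> 'k) list"]
  unfolding is_dual_basis_def length_dual_basis_A by blast

text \<open>Since \<open>genB\<close> generates, only a table of values is needed.
  \<open>gamma_hom\<close> vanishes on the images of \<open>vs\<close> because these walks avoid
  \<alpha> and \<beta>; \<open>extend_hom\<close> restores the values on \<open>vs\<close> and kills
  the last generator.\<close>

lemma is_dual_basis_B: "is_dual_basis \<pi>B genB (map extend_hom (dual_basis \<pi>A genA) @ [gamma_hom :: ('v, 'a) walk set \<Rightarrow> 'k::field])"
proof -
  let ?gA = "dual_basis \<pi>A genA :: (('v, 'a) walk set \<Rightarrow> 'k) list"
  have len: "length ?gA = length vs" and gA: "set ?gA \<subseteq> carrier HomA"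
    and dual: "\<And>i j. i < length vs \<Longrightarrow> j < length vs \<Longrightarrow> (?gA ! i) (genA ! j) = (if i = j then 1 else 0)"
    using is_dual_basis_A[where 'k = 'k] unfolding is_dual_basis_def by simp_all
  show ?thesis
  proof (rule is_dual_basisI[OF pi1_groups(2) generates_B])
    show "set (map extend_hom ?gA @ [gamma_hom]) \<subseteq> carrier HomB" using extension_homs by auto
    fix i j assume ij: "i < length genB" "j < length genB"
    have gj: "genB ! j = glue_class (genA ! j)" "genA ! j \<in> carrier \<pi>A" if "j < length vs"
    proof -
      have u: "vs ! j \<in> set vs" using that by (rule nth_mem)
      show "genB ! j = glue_class (genA ! j)" using that glue_class_vs[OF u] by (simp add: nth_append)
      show "genA ! j \<in> carrier \<pi>A" using that by (rule nth_genA_closed)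
    qed
    have gi: "?gA ! i \<in> carrier HomA" if "i < length vs"
      using nth_mem[of i ?gA] that gA unfolding len by blast
    consider "i < length vs" "j < length vs" | "i < length vs" "j = length vs"
      | "i = length vs" "j < length vs" | "i = length vs" "j = length vs"
      using ij by (simp add: less_Suc_eq) blast
    then show "((map extend_hom ?gA @ [gamma_hom]) ! i) (genB ! j) = (if i = j then 1 else 0)"
    proof cases
      case 1
      then show ?thesis
        using extend_hom_glue[OF gi[OF 1(1)] gj(2)[OF 1(2)]] dual[OF 1] len
        unfolding gj(1)[OF 1(2)] by (simp add: nth_append)
    next
      case 2
      then show ?thesis using extend_hom_gamma[OF gi[OF 2(1)]] len by (simp add: nth_append)
    next
      case 3
      have "gamma_hom (glue_class (genA ! j)) = (0 :: 'k)" by (rule gamma_hom_genA[OF 3(2)])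
      then show ?thesis using 3 len unfolding gj(1)[OF 3(2)] by (simp add: nth_append)
    next
      case 4
      then show ?thesis using len gamma_hom_gamma by (simp add: nth_append)
    qed
  qed (simp add: len)
qed

lemma dual_basis_B: "dual_basis \<pi>B genB = map extend_hom (dual_basis \<pi>A genA) @ [gamma_hom]"
  by (rule dual_basis_eq[OF pi1_groups(2) generates_B is_dual_basis_B])

lemma restrict_hom_closed: "h \<in> carrier HomB \<Longrightarrow> restrict_hom h \<in> carrier HomA"
  using restrict_hom_linear by (auto simp: linear_maps_def)

lemma restrict_extend_hom: "h \<in> carrier HomA \<Longrightarrow> restrict_hom (extend_hom h) = h"
  using extend_hom_glue Hom_add_undefined by (fastforce simp: restrict_hom_def fun_eq_iff)

text \<open>A homomorphism with zero restriction vanishes on all generators but the last, so it is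
  its value there times \<open>gamma_hom\<close>.\<close>

lemma restrict_hom_kernel:
  "line HomB gamma_hom = {h \<in> carrier (HomB :: ('k::field, ('v, 'a) walk set \<Rightarrow> 'k) module). restrict_hom h = \<zero>\<^bsub>HomA\<^esub>}"
proof
  interpret PA: nonassoc_algebra "HomA :: ('k, ('v, 'a) walk set \<Rightarrow> 'k) module" by (rule Hom_add_algebra[OF pi1_groups(1)])
  interpret PB: nonassoc_algebra "HomB :: ('k, ('v, 'a) walk set \<Rightarrow> 'k) module" by (rule Hom_add_algebra[OF pi1_groups(2)])
  have "restrict_hom gamma_hom = \<zero>\<^bsub>HomA :: ('k, ('v, 'a) walk set \<Rightarrow> 'k) module\<^esub>"
  proof (rule Hom_add_eqI[OF pi1_groups(1) generates_A restrict_hom_closed[OF extension_homs(2)] PA.zero_closed])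
    fix i assume "i < length genA"
    then have i: "i < length vs" by simp
    show "restrict_hom gamma_hom (genA ! i) = \<zero>\<^bsub>HomA :: ('k, ('v, 'a) walk set \<Rightarrow> 'k) module\<^esub> (genA ! i)"
      using gamma_hom_genA[OF i, where 'b = 'k] nth_genA_closed[OF i] unfolding restrict_hom_def Hom_add_simps by (simp only: restrict_apply' if_True)
  qed
  moreover have "restrict_hom (c \<odot>\<^bsub>HomB\<^esub> gamma_hom) = c \<odot>\<^bsub>HomA\<^esub> restrict_hom gamma_hom" for c :: 'k
    using restrict_hom_linear[where 'k = 'k] extension_homs(2) unfolding linear_maps_def by blast
  ultimately have "restrict_hom (c \<odot>\<^bsub>HomB\<^esub> gamma_hom) = \<zero>\<^bsub>HomA :: ('k, ('v, 'a) walk set \<Rightarrow> 'k) module\<^esub>" for c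
    using PA.smult_zero_right[of c] by simp
  then show "line HomB gamma_hom \<subseteq> {h \<in> carrier (HomB :: ('k, ('v, 'a) walk set \<Rightarrow> 'k) module). restrict_hom h = \<zero>\<^bsub>HomA\<^esub>}"
    using PB.smult_closed[OF extension_homs(2)] unfolding line_def by blast
  show "{h \<in> carrier (HomB :: ('k, ('v, 'a) walk set \<Rightarrow> 'k) module). restrict_hom h = \<zero>\<^bsub>HomA\<^esub>} \<subseteq> line HomB gamma_hom"
  proof clarify
    fix h :: "('v, 'a) walk set \<Rightarrow> 'k" assume h: "h \<in> carrier HomB" and zero: "restrict_hom h = \<zero>\<^bsub>HomA\<^esub>"
    have "h = h (classB gamma_walk) \<odot>\<^bsub>HomB\<^esub> gamma_hom"
    proof (rule Hom_add_eqI[OF pi1_groups(2) generates_B h PB.smult_closed[OF extension_homs(2)]])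
      fix i assume i: "i < length genB"
      then have cl: "genB ! i \<in> carrier \<pi>B" using generates_B(1) nth_mem by blast
      show "h (genB ! i) = (h (classB gamma_walk) \<odot>\<^bsub>HomB\<^esub> gamma_hom) (genB ! i)"
      proof (cases "i < length vs")
        case True
        then have eq: "genB ! i = glue_class (genA ! i)" using glue_class_vs[OF nth_mem[OF True]] by (simp add: nth_append)
        have "h (glue_class (genA ! i)) = 0"
          using fun_cong[OF zero, of "genA ! i"] nth_genA_closed[OF True]
          unfolding restrict_hom_def Hom_add_simps by (simp only: restrict_apply' if_True)
        then show ?thesis using cl gamma_hom_genA[OF True, where 'b = 'k] unfolding eq by simp
      next
        case False
        then have "i = length vs" using i by simp
        then show ?thesis using cl gamma_hom_gamma[where 'b = 'k] by (simp add: nth_append)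
      qed
    qed
    then show "h \<in> line HomB gamma_hom" unfolding line_def by blast
  qed
qed

lemma restrict_hom_mult:
  "f \<in> carrier HomB \<Longrightarrow> g \<in> carrier HomB \<Longrightarrow> restrict_hom (f \<otimes>\<^bsub>HomB\<^esub> g) = restrict_hom f \<otimes>\<^bsub>HomA\<^esub> restrict_hom g"
  using glue_class_closed by (simp add: restrict_hom_def fun_eq_iff)

lemma sigma_iso:
  obtains \<sigma> where
    "\<sigma> \<in> linear_isos (quotient_module HomB (line HomB gamma_hom)) (HomA :: ('k::field, ('v, 'a) walk set \<Rightarrow> 'k) module)"
    "\<And>h. h \<in> carrier HomB \<Longrightarrow> \<sigma> (line HomB gamma_hom +>\<^bsub>HomB\<^esub> h) = restrict_hom h"
proof -
  have surj: "restrict_hom ` carrier HomB = carrier (HomA :: ('k, ('v, 'a) walk set \<Rightarrow> 'k) module)"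
    using restrict_hom_closed restrict_extend_hom extension_homs(1) by (metis (no_types, lifting) equalityI image_eqI image_subsetI subsetI)
  obtain \<sigma> where \<sigma>: "\<sigma> \<in> lie_isos (quotient_module HomB (line HomB gamma_hom)) (HomA :: ('k, ('v, 'a) walk set \<Rightarrow> 'k) module)"
    "\<And>h. h \<in> carrier HomB \<Longrightarrow> \<sigma> (line HomB gamma_hom +>\<^bsub>HomB\<^esub> h) = restrict_hom h"
    by (rule first_isomorphism[OF Hom_add_algebra[OF pi1_groups(2)] Hom_add_algebra[OF pi1_groups(1)]
          restrict_hom_linear restrict_hom_mult surj restrict_hom_kernel]) blast+
  from \<sigma>(1) have "\<sigma> \<in> linear_isos (quotient_module HomB (line HomB gamma_hom)) HomA"
    unfolding lie_isos_def by (rule CollectE) (rule conjunct1)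
  then show ?thesis using \<sigma>(2) by (rule that)
qed

abbreviation \<theta>A :: "(('v, 'a) walk set \<Rightarrow> 'k::field) \<Rightarrow> ('k, 'v, 'a) cochain set" where
  "\<theta>A \<equiv> theta Q Z (head Q \<alpha>) PA"

abbreviation \<theta>B :: "(('v, 'a) walk set \<Rightarrow> 'k::field) \<Rightarrow> ('k, 'v, 'a) cochain set" where
  "\<theta>B \<equiv> theta QB ZB (head Q \<alpha>) PB"

text \<open>The coefficients at \<alpha> and \<beta> vanish in \<open>Q\<close> because their loops
  are trivial, and those at all other arrows agree by \<open>glue_loop\<close>. The one additional
  term in the glued quiver is a multiple of the diagonal pair of the glued arrow, which the line
  absorbs.\<close>

lemma theta_restrict_hom:
  fixes h :: "('v, 'a) walk set \<Rightarrow> 'k::field"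
  assumes h: "h \<in> carrier HomB"
  obtains x where "x \<in> carrier (cocycles Q Z)" "\<theta>A (restrict_hom h) = HH1_class Q Z x"
    "gamma_line +>\<^bsub>HH1 QB ZB\<^esub> \<theta>B h = gamma_line +>\<^bsub>HH1 QB ZB\<^esub> HH1_class QB ZB (gc x)"
proof -
  let ?HB = "HH1 QB ZB :: ('k, ('k, 'v, 'a) cochain set) module"
  interpret L: nonassoc_ideal ?HB gamma_line by (rule gamma_line_ideal)
  let ?bA = "WA.block_arrows (head Q \<alpha>)" and ?bB = "WB.block_arrows (head Q \<alpha>)"
  let ?lA = "WA.arrow_loop (head Q \<alpha>) PA" and ?lB = "WB.arrow_loop (head Q \<alpha>) PB"
  define x where "x = diagonal_cochain Q ?bA (\<lambda>d. restrict_hom h (?lA d))"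
  define y where "y = diagonal_cochain QB ?bB (\<lambda>d. h (?lB d))"
  define D where "D = ?bA - {\<alpha>, \<beta>}"
  have x: "x \<in> carrier (cocycles Q Z)" unfolding x_def by (rule A.diagonal_cocycle[OF WA.block_arrows_subset])
  have y: "y \<in> carrier (cocycles QB ZB)" unfolding y_def by (rule B.diagonal_cocycle[OF WB.block_arrows_subset])
  have fin: "finite ?bA" using A.finite_arcs WA.block_arrows_subset by (rule rev_finite_subset)
  have one: "restrict_hom h \<one>\<^bsub>\<pi>A\<^esub> = 0" by (rule Hom_add_one[OF pi1_groups(1) restrict_hom_closed[OF h]])
  have loop: "restrict_hom h (?lA d) = h (?lB d)" if "d \<in> D" for d
  proof -
    have d: "d \<in> ?bA" "d \<noteq> \<alpha>" "d \<noteq> \<beta>" using that by (auto simp: D_def)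
    note lw = WA.loop_walk_in_walks[OF parade_A d(1)]
    have "?lA d \<in> carrier \<pi>A" using lw by (simp add: WA.pi1_carrier)
    then show ?thesis
      using glue_class_class[OF lw] glue_loop[OF d] by (simp add: restrict_hom_def)
  qed
  have "gc x = (\<Sum>d\<in>?bA. cochain_scale (restrict_hom h (?lA d)) (basis_pair (arrow_path QB (ga d)) (arrow_path QB (ga d))))"
    unfolding x_def diagonal_cochain_def linear_sum[OF is_linear_glue_cochain] linear_scale[OF is_linear_glue_cochain]
    using WA.block_arrows_subset by (intro sum.cong) (auto simp: glue_arrow_path)
  also have "\<dots> = diagonal_cochain QB D (\<lambda>d. h (?lB d))"
    unfolding diagonal_cochain_def
  proof (rule sum.mono_neutral_cong_right[OF fin])
    show "D \<subseteq> ?bA" by (auto simp: D_def)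
    show "\<forall>d\<in>?bA - D. cochain_scale (restrict_hom h (?lA d)) (basis_pair (arrow_path QB (ga d)) (arrow_path QB (ga d))) = 0"
    proof
      fix d assume "d \<in> ?bA - D"
      then have "d = \<alpha> \<or> d = \<beta>" by (auto simp: D_def)
      then have "?lA d = \<one>\<^bsub>\<pi>A\<^esub>" using special_loops by blast
      then have "restrict_hom h (?lA d) = 0" using one by (simp only:)
      then show "cochain_scale (restrict_hom h (?lA d)) (basis_pair (arrow_path QB (ga d)) (arrow_path QB (ga d))) = 0"
        by (simp only: cochain_scale_simps)
    qed
    fix d assume d: "d \<in> D"
    then have "ga d = d" by (simp add: D_def glue_arrow_def)
    then show "cochain_scale (restrict_hom h (?lA d)) (basis_pair (arrow_path QB (ga d)) (arrow_path QB (ga d))) =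
        cochain_scale (h (?lB d)) (basis_pair (arrow_path QB d) (arrow_path QB d))"
      using loop[OF d] by (simp only:)
  qed
  finally have gx: "gc x = diagonal_cochain QB D (\<lambda>d. h (?lB d))" .
  have "?bB = insert \<alpha> D" unfolding block_arrows_glue D_def by blast
  then have "y = cochain_scale (h (?lB \<alpha>)) \<gamma>\<gamma> + gc x"
    unfolding y_def gx using fin by (simp add: diagonal_cochain_def D_def)
  then have "HH1_class QB ZB y = (h (?lB \<alpha>) \<odot>\<^bsub>?HB\<^esub> gamma_class) \<oplus>\<^bsub>?HB\<^esub> HH1_class QB ZB (gc x)"
    by (simp add: B.HH1_class_add B.HH1_class_scale gamma_cocycle glue_cocycle x B.cocycles_closed)
  moreover have "h (?lB \<alpha>) \<odot>\<^bsub>?HB\<^esub> gamma_class \<in> gamma_line" unfolding line_def by blast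
  ultimately have "HH1_class QB ZB y \<in> gamma_line +>\<^bsub>?HB\<^esub> HH1_class QB ZB (gc x)" unfolding L.coset_elem by blast
  moreover have "HH1_class QB ZB (gc x) \<in> carrier ?HB" unfolding B.HH1_carrier by (rule imageI[OF glue_cocycle[OF x]])
  ultimately have "gamma_line +>\<^bsub>?HB\<^esub> HH1_class QB ZB y = gamma_line +>\<^bsub>?HB\<^esub> HH1_class QB ZB (gc x)"
    by (intro L.coset_eqI)
  then show ?thesis
    using that[OF x] by (simp add: WA.theta_eq WB.theta_eq x_def y_def)
qed

text \<open>The middle map \<open>\<theta>Bq\<close> factors \<phi> after \<open>\<theta>A\<close>
  after restriction through the quotient. \<open>square\<close> shows that \<open>\<theta>B\<close>
  induces the same map, and the right square follows because \<psi> undoes \<phi>.\<close>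

lemma commutative_diagram:
  fixes HA :: "('k::field, ('k, 'v, 'a) cochain set) module"
  defines "HA \<equiv> HH1 Q Z" and "HBq \<equiv> quotient_module (HH1 QB ZB) gamma_line"
    and "HomBq \<equiv> quotient_module HomB (line HomB gamma_hom)"
  shows "\<exists>\<sigma> \<theta>Bq \<phi> \<psi>.
      \<sigma> \<in> linear_isos HomBq HomA \<and> (\<forall>i<length vs. \<sigma> (line HomB gamma_hom +>\<^bsub>HomB\<^esub> (dual_basis \<pi>B genB ! i)) = dual_basis \<pi>A genA ! i) \<and>
      \<theta>Bq \<in> linear_maps HomBq HBq \<and>
      \<phi> \<in> lie_isos HA HBq \<and>
      (\<forall>x\<in>carrier (cocycles Q Z).
         \<phi> (HH1_class Q Z x) = gamma_line +>\<^bsub>HH1 QB ZB\<^esub> HH1_class QB ZB (gc x)) \<and>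
      \<psi> \<in> lie_isos HBq HA \<and>
      (\<forall>c\<in>carrier HA. \<psi> (\<phi> c) = c) \<and>
      (\<forall>h\<in>carrier HomB. \<theta>Bq (line HomB gamma_hom +>\<^bsub>HomB\<^esub> h) = gamma_line +>\<^bsub>HH1 QB ZB\<^esub> \<theta>B h) \<and>
      (\<forall>H\<in>carrier HomBq. \<theta>A (\<sigma> H) = \<psi> (\<theta>Bq H))"
proof -
  let ?HomA = "HomA :: ('k, ('v, 'a) walk set \<Rightarrow> 'k) module" and ?HomB = "HomB :: ('k, ('v, 'a) walk set \<Rightarrow> 'k) module"
  interpret L: nonassoc_ideal "HH1 QB ZB :: ('k, ('k, 'v, 'a) cochain set) module" gamma_line by (rule gamma_line_ideal)
  interpret K: nonassoc_ideal ?HomB "line HomB gamma_hom"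
    unfolding restrict_hom_kernel
    by (intro kernel_ideal Hom_add_algebra pi1_groups restrict_hom_linear restrict_hom_mult)
  have HA: "nonassoc_algebra HA" unfolding HA_def by (rule A.HH1_algebra)
  have HBq: "nonassoc_algebra HBq" unfolding HBq_def by (rule L.quotient_nonassoc_algebra)
  obtain \<sigma> where \<sigma>: "\<sigma> \<in> linear_isos HomBq ?HomA"
    "\<And>h. h \<in> carrier ?HomB \<Longrightarrow> \<sigma> (line HomB gamma_hom +>\<^bsub>?HomB\<^esub> h) = restrict_hom h"
    by (rule sigma_iso[where 'k = 'k, folded HomBq_def]) (rule that)
  obtain \<phi> where \<phi>: "\<phi> \<in> lie_isos HA HBq"
    "\<And>x. x \<in> carrier (cocycles Q Z) \<Longrightarrow> \<phi> (HH1_class Q Z x) = gamma_line +>\<^bsub>HH1 QB ZB\<^esub> HH1_class QB ZB (gc x)"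
    by (rule glued_lie_iso[where 'k = 'k, folded HA_def HBq_def]) (rule that)
  obtain \<psi> where \<psi>: "\<psi> \<in> lie_isos HBq HA" "\<And>c. c \<in> carrier HA \<Longrightarrow> \<psi> (\<phi> c) = c"
    by (rule lie_iso_inverse[OF HA \<phi>(1)]) (rule that)
  have \<theta>A: "\<theta>A \<in> linear_maps ?HomA HA" unfolding HA_def by (rule WA.theta_linear[OF parade_A])
  have \<phi>l: "\<phi> \<in> linear_maps HA HBq" using \<phi>(1) by (simp add: lie_isos_def linear_isos_def)
  have square: "\<phi> (\<theta>A (restrict_hom h)) = gamma_line +>\<^bsub>HH1 QB ZB\<^esub> \<theta>B h" if h: "h \<in> carrier ?HomB" for h
    by (rule theta_restrict_hom[OF h]) (simp only: \<phi>(2))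
  have lin: "(\<lambda>h. \<phi> (\<theta>A (restrict_hom h))) \<in> linear_maps ?HomB HBq"
    by (rule linear_maps_comp[OF linear_maps_comp[OF restrict_hom_linear \<theta>A] \<phi>l])
  have ker: "\<phi> (\<theta>A (restrict_hom h)) = \<zero>\<^bsub>HBq\<^esub>" if "h \<in> line ?HomB gamma_hom" for h
  proof -
    have "restrict_hom h = \<zero>\<^bsub>?HomA\<^esub>" using that unfolding restrict_hom_kernel by blast
    then show ?thesis
      using linear_maps_zero[OF Hom_add_algebra[OF pi1_groups(1)] HA \<theta>A] linear_maps_zero[OF HA HBq \<phi>l] by simp
  qed
  obtain \<theta>Bq where \<theta>Bq: "\<theta>Bq \<in> linear_maps HomBq HBq"
    "\<And>h. h \<in> carrier ?HomB \<Longrightarrow> \<theta>Bq (line HomB gamma_hom +>\<^bsub>?HomB\<^esub> h) = \<phi> (\<theta>A (restrict_hom h))"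
    by (rule K.quotient_lift[OF HBq lin ker, folded HomBq_def]) (assumption, rule that)
  have "\<sigma> (line HomB gamma_hom +>\<^bsub>?HomB\<^esub> (dual_basis \<pi>B genB ! i)) = dual_basis \<pi>A genA ! i" if i: "i < length vs" for i
  proof -
    have "dual_basis \<pi>B genB ! i = extend_hom (dual_basis \<pi>A genA ! i :: _ \<Rightarrow> 'k)"
      using i by (simp add: dual_basis_B nth_append length_dual_basis_A)
    then show ?thesis using \<sigma>(2)[OF extension_homs(1)] restrict_extend_hom[OF dual_basis_A_closed[OF i]] by simp
  qed
  moreover have "\<theta>A (\<sigma> H) = \<psi> (\<theta>Bq H)" if H: "H \<in> carrier HomBq" for H
  proof -
    have "carrier HomBq = (+>\<^bsub>?HomB\<^esub>) (line HomB gamma_hom) ` carrier ?HomB"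
      unfolding HomBq_def by (rule K.carrier_quotient)
    with H have "H \<in> (+>\<^bsub>?HomB\<^esub>) (line HomB gamma_hom) ` carrier ?HomB" by (simp only:)
    then obtain h where h: "H = line HomB gamma_hom +>\<^bsub>?HomB\<^esub> h" "h \<in> carrier ?HomB" by (rule imageE)
    have "\<theta>A (restrict_hom h) \<in> carrier HA"
      using \<theta>A restrict_hom_closed[OF h(2)] by (simp add: linear_maps_def Pi_def)
    then show ?thesis unfolding h(1) \<sigma>(2)[OF h(2)] \<theta>Bq(2)[OF h(2)] by (simp add: \<psi>(2))
  qed
  ultimately show ?thesis
    using \<sigma>(1) \<theta>Bq \<phi> \<psi> square by (intro exI[of _ \<sigma>] exI[of _ \<theta>Bq] exI[of _ \<phi>] exI[of _ \<psi>]) simp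
qed

end

theorem proposition5p4:
  fixes Q :: "('v, 'a) pre_digraph"
    and Z :: "('v, 'a) path set"
    and \<alpha> \<beta> :: 'a
    and v :: "('v, 'a) walk"
    and vs :: "('v, 'a) walk list"
    and w w' :: "'v \<Rightarrow> ('v, 'a) walk"
  defines "QB \<equiv> glue_quiver Q \<alpha> \<beta>"
    and "ZB \<equiv> glue_relations Q Z \<alpha> \<beta>"
    and "f2 \<equiv> glue_vert Q \<alpha> \<beta> (head Q \<alpha>)"
    and "\<gamma> \<equiv> glue_arrow \<alpha> \<beta> \<alpha>"
    and "v' \<equiv> glue_walk Q \<alpha> \<beta> v"
  defines "\<pi>A \<equiv> fundamental_group Q (head Q \<alpha>)"
    and "\<pi>B \<equiv> fundamental_group QB f2"
  defines "genA \<equiv> map (walk_class Q (head Q \<alpha>)) vs"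
    and "genB \<equiv> map (\<lambda>u. walk_class QB f2 (glue_walk Q \<alpha> \<beta> u)) vs
                  @ [walk_class QB f2 (path_comp (arrow_walk QB \<gamma>) v')]"
  defines "gA \<equiv> (dual_basis \<pi>A genA :: (('v, 'a) walk set \<Rightarrow> 'k::field) list)"
    and "gB \<equiv> (dual_basis \<pi>B genB :: (('v, 'a) walk set \<Rightarrow> 'k::field) list)"
  defines "gstar \<equiv> gB ! length vs"
  defines "HomA \<equiv> (Hom_add \<pi>A :: ('k, ('v, 'a) walk set \<Rightarrow> 'k) module)"
    and "HomB \<equiv> (Hom_add \<pi>B :: ('k, ('v, 'a) walk set \<Rightarrow> 'k) module)"
  defines "HA \<equiv> (HH1 Q Z :: ('k, ('k, 'v, 'a) cochain set) module)"
    and "HB \<equiv> (HH1 QB ZB :: ('k, ('k, 'v, 'a) cochain set) module)"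
  defines "\<gamma>\<gamma> \<equiv> HH1_class QB ZB (basis_pair (arrow_path QB \<gamma>) (arrow_path QB \<gamma>))"
  defines "HomBq \<equiv> quotient_module HomB (line HomB gstar)"
    and "HBq \<equiv> quotient_module HB (line HB \<gamma>\<gamma>)"
  defines "p1 \<equiv> (\<lambda>h. line HomB gstar +>\<^bsub>HomB\<^esub> h)"
    and "p2 \<equiv> (\<lambda>c. line HB \<gamma>\<gamma> +>\<^bsub>HB\<^esub> c)"
  defines "\<theta>A \<equiv> theta Q Z (head Q \<alpha>) (parade Q \<alpha> \<beta> v w)"
    and "\<theta>B \<equiv> theta QB ZB f2 (glued_parade QB \<gamma> v' w')"
  assumes monomial: "monomial_presentation Q Z"
    and source: "source_arrow Q \<alpha>"
    and sink: "sink_arrow Q \<beta>"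
    and different: "distinct [tail Q \<alpha>, head Q \<alpha>, tail Q \<beta>, head Q \<beta>]"
    and block: "same_block Q (tail Q \<alpha>) (tail Q \<beta>)"
    and v: "v \<in> walks Q (head Q \<alpha>) (tail Q \<beta>)" "avoids v \<alpha>" "avoids v \<beta>"
    and vs: "\<forall>u\<in>set vs. u \<in> walks Q (head Q \<alpha>) (head Q \<alpha>) \<and> avoids u \<alpha> \<and> avoids u \<beta>"
    and generators: "minimal_generators \<pi>A genA"
    and w': "\<forall>x\<in>verts Q. x \<notin> {tail Q \<alpha>, head Q \<alpha>, tail Q \<beta>, head Q \<beta>} \<and>
               same_block Q (head Q \<alpha>) x \<longrightarrow>
               w' x \<in> walks QB f2 (glue_vert Q \<alpha> \<beta> x) \<and> avoids (w' x) \<gamma>"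
    and w: "\<forall>x\<in>verts Q. x \<notin> {tail Q \<alpha>, head Q \<alpha>, tail Q \<beta>, head Q \<beta>} \<and>
               same_block Q (head Q \<alpha>) x \<longrightarrow>
               w x \<in> walks Q (head Q \<alpha>) x \<and> glue_walk Q \<alpha> \<beta> (w x) = w' x"
  shows "is_dual_basis \<pi>A genA gA \<and> is_dual_basis \<pi>B genB gB \<and>
    \<theta>A \<in> linear_maps HomA HA \<and> \<theta>B \<in> linear_maps HomB HB \<and>
    (\<exists>\<sigma> \<theta>Bq \<phi> \<psi>.
      \<sigma> \<in> linear_isos HomBq HomA \<and> (\<forall>i<length vs. \<sigma> (p1 (gB ! i)) = gA ! i) \<and>
      \<theta>Bq \<in> linear_maps HomBq HBq \<and>
      \<phi> \<in> lie_isos HA HBq \<and>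
      (\<forall>x\<in>carrier (cocycles Q Z).
         \<phi> (HH1_class Q Z x) = p2 (HH1_class QB ZB (glue_cochain Q \<alpha> \<beta> x))) \<and>
      \<psi> \<in> lie_isos HBq HA \<and>
      (\<forall>c\<in>carrier HA. \<psi> (\<phi> c) = c) \<and>
      (\<forall>h\<in>carrier HomB. \<theta>Bq (p1 h) = p2 (\<theta>B h)) \<and>
      (\<forall>H\<in>carrier HomBq. \<theta>A (\<sigma> H) = \<psi> (\<theta>Bq H)))"
proof -
  interpret G: glued_bases Q Z \<alpha> \<beta> v w w' vs
  proof unfold_locales
    fix x
    assume "x \<in> verts Q" "x \<notin> {tail Q \<alpha>, head Q \<alpha>, tail Q \<beta>, head Q \<beta>}" "same_block Q (head Q \<alpha>) x"
    then show "w x \<in> walks Q (head Q \<alpha>) x \<and> glue_walk Q \<alpha> \<beta> (w x) = w' x" using w by blast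
  next
    fix u
    assume "u \<in> set vs"
    then show "u \<in> walks Q (head Q \<alpha>) (head Q \<alpha>) \<and> avoids u \<alpha> \<and> avoids u \<beta>" using vs by blast
  qed (use monomial source sink different v generators in \<open>simp_all only: genA_def \<pi>A_def\<close>)
  \<comment> \<open>In the naming convention of \<open>glue_quiver\<close> the glued arrow is
    \<alpha> and f2 is its head, so the definitions of the statement unfold to the abbreviations of
    the locale.\<close>
  have base: "glue_vert Q \<alpha> \<beta> (head Q \<alpha>) = head Q \<alpha>" "glue_arrow \<alpha> \<beta> \<alpha> = \<alpha>"
    by (rule G.glue_vert_simps) (simp add: glue_arrow_def)
  note data = f2_def \<gamma>_def v'_def QB_def ZB_def base
  have \<pi>: "\<pi>A = G.\<pi>A" "\<pi>B = G.\<pi>B" "genA = G.genA" "genB = G.genB" "HomA = G.HomA" "HomB = G.HomB"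
    unfolding \<pi>A_def \<pi>B_def genA_def genB_def HomA_def HomB_def data by (rule refl)+
  have gA: "gA = dual_basis G.\<pi>A G.genA" and gB: "gB = dual_basis G.\<pi>B G.genB"
    unfolding gA_def gB_def \<pi> by (rule refl)+
  \<comment> \<open>The explicit dual basis lists the extended functionals first, so position
    \<open>length vs\<close> holds \<open>gamma_hom\<close>.\<close>
  have gstar: "gstar = G.gamma_hom"
    unfolding gstar_def gB G.dual_basis_B by (simp only: nth_append length_map G.length_dual_basis_A) simp
  have HB: "HB = HH1 G.QB G.ZB" and \<gamma>\<gamma>: "\<gamma>\<gamma> = G.gamma_class"
    unfolding HB_def \<gamma>\<gamma>_def data by (rule refl)+
  have \<theta>: "\<theta>A = G.\<theta>A" "\<theta>B = G.\<theta>B"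
    unfolding \<theta>A_def \<theta>B_def data by (rule refl)+
  have dual: "is_dual_basis \<pi>A genA gA" "is_dual_basis \<pi>B genB gB"
    unfolding gA gB \<pi> G.dual_basis_B by (rule G.is_dual_basis_A G.is_dual_basis_B)+
  have lin: "\<theta>A \<in> linear_maps HomA HA" "\<theta>B \<in> linear_maps HomB HB"
    unfolding \<theta> \<pi> HA_def HB by (rule G.WA.theta_linear[OF G.parade_A] G.WB.theta_linear[OF G.parade_B])+
  show ?thesis
    by (intro conjI dual lin)
      (unfold p1_def p2_def HomBq_def HBq_def HB \<gamma>\<gamma> gstar gA gB \<theta> HA_def \<pi> data, rule G.commutative_diagram)
qed

end
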